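(* Consider the statistical learning setting described in the context: $\{(y_i(\mathbf X),\mathbf x_i)\}_{i\le n}$ i.i.d. with $y_i(\mathbf X)=\eta(\boldsymbol\Theta^{\star\top}\mathbf x_i,\varepsilon_i)$, and $\{(y_i(\mathbf G),\mathbf g_i)\}_{i\le n}$ with $\mathbf g_i\sim\mathcal N(\boldsymbol\mu_{\mathbf g},\boldsymbol\Sigma_{\mathbf g})$ i.i.d. and $y_i(\mathbf G)=\eta(\boldsymbol\Theta^{\star\top}\mathbf g_i,\varepsilon_i)$. Let $\mathcal S_p$ be a domain of Gaussianity for $\mathbf x$. Suppose the regime, constraint-set, penalty and restricted-subgaussianity assumptions of the context hold, and that the loss and labels satisfy either alternative (I) or alternative (II) of the context. If $\mathcal C_p\subseteq\mathcal S_p$ and $\boldsymbol\theta^\star_j\in\mathcal S_p$ for each $j\le k^\star$, then for every bounded Lipschitz $\psi:\mathbb R\to\mathbb R$, $$\lim_{n\to\infty}\Big|\mathbb E\big[\psi\big(\widehat R^\star_n(\mathbf X,\mathbf y(\mathbf X))\big)\big]-\mathbb E\big[\psi\big(\widehat R_n^\star(\mathbf G,\mathbf y(\mathbf G))\big)\big]\Big|=0 .$$ Hence, for any constants $\rho\in\mathbb R$ and $\delta>0$, $$\limsup_{n\to\infty}\mathbb P\big(\widehat R_n^\star(\mathbf X,\mathbf y(\mathbf X))\ge\rho+\delta\big)\le\limsup_{n\to\infty}\mathbb P\big(\widehat R_n^\star(\mathbf G,\mathbf y(\mathbf G))\ge\rho\big),$$ $$\limsup_{n\to\infty}\mathbb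 P\big(\widehat R_n^\star(\mathbf X,\mathbf y(\mathbf X))\le\rho-\delta\big)\le\limsup_{n\to\infty}\mathbb P\big(\widehat R_n^\star(\mathbf G,\mathbf y(\mathbf G))\le\rho\big),$$ and the same two inequalities hold with every $\limsup_{n\to\infty}$ replaced by $\liminf_{n\to\infty}$. Consequently, for all $\rho\in\mathbb R$, $\widehat R_n^\star(\mathbf X,\mathbf y(\mathbf X))\to\rho$ in probability if and only if $\widehat R_n^\star(\mathbf G,\mathbf y(\mathbf G))\to\rho$ in probability.
   Context: **Setting.** A sequence of problems indexed by $n$, $p=p(n)$; $k,k^\star\ge1$ fixed integers. The set $\mathcal C_p\subseteq\mathbb R^p$, the domain $\mathcal S_p$, the penalty $r$, the matrix $\boldsymbol\Theta^\star$, the laws of $\mathbf x$ and $\varepsilon_i$, and $\boldsymbol\mu_{\mathbf g},\boldsymbol\Sigma_{\mathbf g}$ may depend on $n$; the functions $L,F,\eta$ and all constants do not. $\mathbf x_1,\dots,\mathbf x_n$ are i.i.d. copies of a random vector $\mathbf x\in\mathbb R^p$ (rows of $\mathbf X$); $\mathbf g_1,\dots,\mathbf g_n$ are i.i.d. copies of $\mathbf g\sim\mathcal N(\boldsymbol\mu_{\mathbf g},\boldsymbol\Sigma_{\mathbf g})$ (rows of $\mathbf G$); $\varepsilon_1,\dots,\varepsilon_n$ are i.i.d. real variables independent of $\mathbf X$ and of $\mathbf G$. $\boldsymbol\Theta^\star=(\boldsymbol\theta_1^\star,\dots,\boldsymbol\theta^\star_{k^\star})\in\mathbb R^{p\times k^\star}$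 is deterministic, $F:\mathbb R^k\to\mathbb R$, $L:\mathbb R\times\mathbb R\to\mathbb R_{\ge0}$, $\eta:\mathbb R^{k^\star+1}\to\mathbb R$, and $$L_F(\mathbf v,y)=L(F(\mathbf v),y),\qquad \ell(\mathbf u,\mathbf u^\star;\varepsilon)=L(F(\mathbf u),\eta(\mathbf u^\star,\varepsilon)).$$ For $\boldsymbol\Theta\in\mathbb R^{p\times k}$, $$\widehat R_n(\boldsymbol\Theta;\mathbf X,\mathbf y(\mathbf X))=\frac1n\sum_{i=1}^nL_F(\boldsymbol\Theta^\top\mathbf x_i,y_i(\mathbf X))+r(\boldsymbol\Theta)=\frac1n\sum_{i=1}^n\ell(\boldsymbol\Theta^\top\mathbf x_i,\boldsymbol\Theta^{\star\top}\mathbf x_i;\varepsilon_i)+r(\boldsymbol\Theta),$$ and $\widehat R_n^\star(\mathbf X,\mathbf y(\mathbf X))=\min_{\boldsymbol\Theta\in\mathcal C_p^k}\widehat R_n(\boldsymbol\Theta;\mathbf X,\mathbf y(\mathbf X))$, where $\mathcal C_p^k$ is the set of matrices with all $k$ columns in $\mathcal C_p$; similarly with $\mathbf G$ in place of $\mathbf X$. $\|\cdot\|_{\psi_2}$ is the subgaussian norm. In the assumptions below we write $\mathcal C_{j,p}=\mathcal C_p$ for $1\le j\le k$ and $\mathcal C_{k+l,p}=\{\boldsymbol\theta_l^\star\}$ for $1\le l\le k^\star$ (the matrix $\boldsymbol\Theta^\star$ is not optimized over). **Regime.** $C_0^{-1}\le p(n)/n\le C_0$ for all $n$, some constant $C_0>0$.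 **Constraint sets.** The sets $\mathcal C_{j,p}$, $j\le k+k^\star$, are compact with $\ell_2$ radius bounded by $R$, i.e. contained in the Euclidean ball of radius $R$ centered at $0$ ($R$ a constant). **Penalty.** $r:\mathbb R^{p\times k}\to\mathbb R_{\ge0}$ is continuous and for every $B>0$ there is $K_r(B)>0$ independent of $p$ with $|r(\boldsymbol\Theta)-r(\widetilde{\boldsymbol\Theta})|\le K_r(B)\|\boldsymbol\Theta-\widetilde{\boldsymbol\Theta}\|_F$ whenever $\|\boldsymbol\Theta\|_F,\|\widetilde{\boldsymbol\Theta}\|_F\le B$. **Domain of Gaussianity.** A sequence of symmetric convex sets $\mathcal S_p\subseteq\mathbb R^p$ such that for every bounded Lipschitz $\varphi:\mathbb R\to\mathbb R$, $\lim_{p\to\infty}\sup_{\boldsymbol\theta\in\mathcal S_p}|\mathbb E[\varphi(\boldsymbol\theta^\top\mathbf g)]-\mathbb E[\varphi(\boldsymbol\theta^\top\mathbf x)]|=0$, $\mathbf g\sim\mathcal N(\boldsymbol\mu_{\mathbf g},\boldsymbol\Sigma_{\mathbf g})$. **Restricted subgaussianity.** For a constant $K$ independent of $n,p$, and for the sets $\mathcal C_{j,p}$, $j\le k+k^\star$: $\sup_{\{\boldsymbol\theta\in\mathcal C_{j,p}:\|\boldsymbol\theta\|_2\le1\}}\|\mathbf x^\top\boldsymbol\theta\|_{\psi_2}\le K$, $\sup_{\{\boldsymbol\theta\in\mathcal C_{j,p}:\|\boldsymbol\theta\|_2\le1\}}\|\boldsymbol\Sigma_{\mathbf g}^{1/2}\boldsymbol\theta\|_2\le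 K$, $\|\boldsymbol\mu_{\mathbf g}\|_2\le K$. **Alternative (I).** $\max_i\|\varepsilon_i\|_{\psi_2}\le K$ for a constant $K$, and $\ell$, viewed as a function of $(\mathbf w,\varepsilon)$ with $\mathbf w=(\mathbf u,\mathbf u^\star)\in\mathbb R^{k+k^\star}$, is non-negative and is either Lipschitz, i.e. $|\ell(\mathbf w,\varepsilon)-\ell(\tilde{\mathbf w},\tilde\varepsilon)|\le K(\|\mathbf w-\tilde{\mathbf w}\|_2+|\varepsilon-\tilde\varepsilon|)$, or locally Lipschitz (the same inequality with constant $K_\ell(B)$ on $\{\|(\mathbf w,\varepsilon)\|_2\le B\}$ for every $B>0$) with $-K_0+K_1(\|\mathbf w\|_2^a+|\varepsilon|^a)\le\ell(\mathbf w,\varepsilon)\le K(1+\|\mathbf w\|_2^b+|\varepsilon|^b)$ for some constants $K_0$, $K_1>0$, $K$, $b\ge a>0$. **Alternative (II).** $L_F$ is non-negative and for all $\mathbf v,\tilde{\mathbf v}\in\mathbb R^k$, $y,\tilde y\in\mathbb R$: $|L_F(\mathbf v,y)-L_F(\tilde{\mathbf v},y)|\le K(1+|y|)\|\mathbf v-\tilde{\mathbf v}\|_2$ and $|L_F(\mathbf v,y)-L_F(\mathbf v,\tilde y)|\le K(1+\|\mathbf v\|_2)|y-\tilde y|$. Labels are binary: $y_i\in\{+1,-1\}$ with $\mathbb P(y_i=+1\mid\mathbf x_i)=g(\boldsymbol\Theta^{\star\top}\mathbf x_i)$ (and likewise with $\mathbf g_i$ in the Gaussian model), where $g:\mathbb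 R^{k^\star}\to[0,1]$ satisfies $|g(\mathbf v)-g(\tilde{\mathbf v})|\le K(1+\|\mathbf v\|_2+\|\tilde{\mathbf v}\|_2)\|\mathbf v-\tilde{\mathbf v}\|_2$.
   Formalization: Restricted subgaussianity is imposed on all of C_{j,p}, including {θ*_l}, with vectors of norm above 1 replaced by θ/‖θ‖ rather than discarded; as written the claim fails (C_p={2e_1}, x=z+nBe_1, B~Bernoulli(1/n), loss |u|). *)

theory Defs
  imports "HOL-Probability.Probability"
begin

text \<open>
  The dimension p varies along the sequence of problems, so vectors with p entries are the
  functions on naturals that are extensional on {..<p}; this is the space of the product
  measurable space over {..<p}, and its topology as a set of functions is the Euclidean one.
  The numbers k and k* are fixed and are the cardinalities of finite types. A matrix
  with p rows and k columns is the vector of its columns.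
\<close>

definition Rvec :: "nat \<Rightarrow> (nat \<Rightarrow> real) set" where
  "Rvec p = ({..<p} \<rightarrow>\<^sub>E UNIV)"

definition Rvec_borel :: "nat \<Rightarrow> (nat \<Rightarrow> real) measure" where
  "Rvec_borel p = Pi\<^sub>M {..<p} (\<lambda>_. borel)"

definition dotp :: "nat \<Rightarrow> (nat \<Rightarrow> real) \<Rightarrow> (nat \<Rightarrow> real) \<Rightarrow> real" where
  "dotp p u v = (\<Sum>i<p. u i * v i)"

definition vnorm :: "nat \<Rightarrow> (nat \<Rightarrow> real) \<Rightarrow> real" where
  "vnorm p u = L2_set u {..<p}"

definition vscale :: "nat \<Rightarrow> real \<Rightarrow> (nat \<Rightarrow> real) \<Rightarrow> (nat \<Rightarrow> real)" where
  "vscale p t u = (\<lambda>i\<in>{..<p}. t * u i)"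

definition vadd :: "nat \<Rightarrow> (nat \<Rightarrow> real) \<Rightarrow> (nat \<Rightarrow> real) \<Rightarrow> (nat \<Rightarrow> real)" where
  "vadd p u v = (\<lambda>i\<in>{..<p}. u i + v i)"

definition mat_vec :: "nat \<Rightarrow> (nat \<Rightarrow> nat \<Rightarrow> real) \<Rightarrow> (nat \<Rightarrow> real) \<Rightarrow> (nat \<Rightarrow> real)" where
  "mat_vec p A u = (\<lambda>i\<in>{..<p}. \<Sum>j<p. A i j * u j)"

definition cols_in :: "(nat \<Rightarrow> real) set \<Rightarrow> ((nat \<Rightarrow> real) ^ 'k) set" where
  "cols_in C = {\<Theta>. \<forall>j. \<Theta> $ j \<in> C}"

definition proj :: "nat \<Rightarrow> (nat \<Rightarrow> real) ^ 'k \<Rightarrow> (nat \<Rightarrow> real) \<Rightarrow> real ^ 'k" where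
  "proj p \<Theta> x = (\<chi> j. dotp p (\<Theta> $ j) x)"

definition frob_dist :: "nat \<Rightarrow> (nat \<Rightarrow> real) ^ 'k \<Rightarrow> (nat \<Rightarrow> real) ^ 'k \<Rightarrow> real" where
  "frob_dist p \<Theta> \<Theta>' = L2_set (\<lambda>(j, i). (\<Theta> $ j) i - (\<Theta>' $ j) i) (UNIV \<times> {..<p})"

definition frob_norm :: "nat \<Rightarrow> (nat \<Rightarrow> real) ^ 'k \<Rightarrow> real" where
  "frob_norm p \<Theta> = L2_set (\<lambda>(j, i). (\<Theta> $ j) i) (UNIV \<times> {..<p})"

definition sym_psd :: "nat \<Rightarrow> (nat \<Rightarrow> nat \<Rightarrow> real) \<Rightarrow> bool" where
  "sym_psd p A \<longleftrightarrow> (\<forall>i<p. \<forall>j<p. A i j = A j i) \<and> (\<forall>u\<in>Rvec p. 0 \<le> dotp p u (mat_vec p A u))"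

text \<open>The (unique) symmetric positive semidefinite square root, as a relation.\<close>

definition is_psd_sqrt :: "nat \<Rightarrow> (nat \<Rightarrow> nat \<Rightarrow> real) \<Rightarrow> (nat \<Rightarrow> nat \<Rightarrow> real) \<Rightarrow> bool" where
  "is_psd_sqrt p T \<Sigma> \<longleftrightarrow>
     sym_psd p \<Sigma> \<and> sym_psd p T \<and> (\<forall>i<p. \<forall>j<p. \<Sigma> i j = (\<Sum>l<p. T i l * T l j))"

definition sym_convex :: "nat \<Rightarrow> (nat \<Rightarrow> real) set \<Rightarrow> bool" where
  "sym_convex p S \<longleftrightarrow> S \<subseteq> Rvec p \<and> (\<forall>u\<in>S. vscale p (- 1) u \<in> S) \<and>
     (\<forall>u\<in>S. \<forall>v\<in>S. \<forall>t\<in>{0..1}. vadd p (vscale p (1 - t) u) (vscale p t v) \<in> S)"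

definition bounded_lipschitz :: "(real \<Rightarrow> real) \<Rightarrow> bool" where
  "bounded_lipschitz \<phi> \<longleftrightarrow> bounded (range \<phi>) \<and> (\<exists>C. C-lipschitz_on UNIV \<phi>)"

text \<open>Takes the value top if the variable is not subgaussian.\<close>

definition psi2_norm :: "'a measure \<Rightarrow> ('a \<Rightarrow> real) \<Rightarrow> ennreal" where
  "psi2_norm M Z =
     Inf {ennreal t | t. 0 < t \<and> (\<integral>\<^sup>+\<omega>. ennreal (exp ((Z \<omega>)\<^sup>2 / t\<^sup>2)) \<partial>M) \<le> 2}"

definition normal_law :: "real \<Rightarrow> real \<Rightarrow> real measure" where
  "normal_law m v =
     (if v = 0 then return borel m else density lborel (\<lambda>z. ennreal (normal_density m (sqrt v) z)))"

text \<open>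
  The multivariate normal distribution, possibly degenerate: every linear functional is normal
  with the corresponding mean and variance.
\<close>

definition gaussian_vector ::
  "'a measure \<Rightarrow> nat \<Rightarrow> (nat \<Rightarrow> real) \<Rightarrow> (nat \<Rightarrow> nat \<Rightarrow> real) \<Rightarrow> ('a \<Rightarrow> nat \<Rightarrow> real) \<Rightarrow> bool" where
  "gaussian_vector M p \<mu> \<Sigma> g \<longleftrightarrow>
     g \<in> M \<rightarrow>\<^sub>M Rvec_borel p \<and>
     (\<forall>\<theta>\<in>Rvec p. distr M borel (\<lambda>\<omega>. dotp p \<theta> (g \<omega>)) =
        normal_law (dotp p \<theta> \<mu>) (dotp p \<theta> (mat_vec p \<Sigma> \<theta>)))"

definition iid :: "'a measure \<Rightarrow> 'b measure \<Rightarrow> nat \<Rightarrow> (nat \<Rightarrow> 'a \<Rightarrow> 'b) \<Rightarrow> bool" where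
  "iid M N n Z \<longleftrightarrow> prob_space.indep_vars M (\<lambda>_. N) Z {..<n} \<and>
     (\<forall>i<n. \<forall>j<n. distr M N (Z i) = distr M N (Z j))"

definition iid_copies ::
  "'a measure \<Rightarrow> 'b measure \<Rightarrow> nat \<Rightarrow> ('a \<Rightarrow> 'b) \<Rightarrow> (nat \<Rightarrow> 'a \<Rightarrow> 'b) \<Rightarrow> bool" where
  "iid_copies M N n z Z \<longleftrightarrow> z \<in> M \<rightarrow>\<^sub>M N \<and> iid M N n Z \<and>
     (\<forall>i<n. distr M N (Z i) = distr M N z)"

definition indep_families ::
  "'a measure \<Rightarrow> nat \<Rightarrow> 'b measure \<Rightarrow> (nat \<Rightarrow> 'a \<Rightarrow> 'b) \<Rightarrow> 'c measure \<Rightarrow> (nat \<Rightarrow> 'a \<Rightarrow> 'c) \<Rightarrow> bool" where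
  "indep_families M n N Z N' Z' \<longleftrightarrow>
     prob_space.indep_set M
       (sets (vimage_algebra (space M) (\<lambda>\<omega>. \<lambda>i\<in>{..<n}. Z i \<omega>) (Pi\<^sub>M {..<n} (\<lambda>_. N))))
       (sets (vimage_algebra (space M) (\<lambda>\<omega>. \<lambda>i\<in>{..<n}. Z' i \<omega>) (Pi\<^sub>M {..<n} (\<lambda>_. N'))))"

definition converges_in_prob :: "(nat \<Rightarrow> 'a measure) \<Rightarrow> (nat \<Rightarrow> 'a \<Rightarrow> real) \<Rightarrow> real \<Rightarrow> bool" where
  "converges_in_prob M Z \<rho> \<longleftrightarrow>
     (\<forall>e>0. (\<lambda>n. measure (M n) {\<omega> \<in> space (M n). e < \<bar>Z n \<omega> - \<rho>\<bar>}) \<longlonglongrightarrow> 0)"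

definition label ::
  "nat \<Rightarrow> ((real ^ 's) \<times> real \<Rightarrow> real) \<Rightarrow> (nat \<Rightarrow> real) ^ 's \<Rightarrow> (nat \<Rightarrow> real) \<Rightarrow> real \<Rightarrow> real" where
  "label p \<eta> \<Theta>s x e = \<eta> (proj p \<Theta>s x, e)"

definition loss_F :: "(real \<Rightarrow> real \<Rightarrow> real) \<Rightarrow> (real ^ 'k \<Rightarrow> real) \<Rightarrow> real ^ 'k \<Rightarrow> real \<Rightarrow> real" where
  "loss_F L F v y = L (F v) y"

text \<open>
  The norm on the argument ((u, u*), e) is the Euclidean norm in dimension k + k* + 1, because
  the product type carries the Euclidean combination of the norms of its factors.
\<close>

definition loss_ell ::
  "(real \<Rightarrow> real \<Rightarrow> real) \<Rightarrow> (real ^ 'k \<Rightarrow> real) \<Rightarrow> ((real ^ 's) \<times> real \<Rightarrow> real) \<Rightarrow>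
   ((real ^ 'k) \<times> (real ^ 's)) \<times> real \<Rightarrow> real" where
  "loss_ell L F \<eta> = (\<lambda>((u, us), e). L (F u) (\<eta> (us, e)))"

definition emp_risk ::
  "nat \<Rightarrow> nat \<Rightarrow> (real ^ 'k \<Rightarrow> real \<Rightarrow> real) \<Rightarrow> ((nat \<Rightarrow> real) ^ 'k \<Rightarrow> real) \<Rightarrow>
   (nat \<Rightarrow> nat \<Rightarrow> real) \<Rightarrow> (nat \<Rightarrow> real) \<Rightarrow> (nat \<Rightarrow> real) ^ 'k \<Rightarrow> real" where
  "emp_risk n p LF r x y \<Theta> = (1 / real n) * (\<Sum>i<n. LF (proj p \<Theta> (x i)) (y i)) + r \<Theta>"

text \<open>
  The infimum is a minimum whenever C is compact and nonempty and the loss and the penalty are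
  continuous in the matrix.
\<close>

definition min_emp_risk ::
  "nat \<Rightarrow> nat \<Rightarrow> (real ^ 'k \<Rightarrow> real \<Rightarrow> real) \<Rightarrow> ((nat \<Rightarrow> real) ^ 'k \<Rightarrow> real) \<Rightarrow>
   (nat \<Rightarrow> real) set \<Rightarrow> (nat \<Rightarrow> nat \<Rightarrow> real) \<Rightarrow> (nat \<Rightarrow> real) \<Rightarrow> real" where
  "min_emp_risk n p LF r C x y = (INF \<Theta>\<in>cols_in C. emp_risk n p LF r x y \<Theta>)"

definition opt_risk ::
  "nat \<Rightarrow> nat \<Rightarrow> (real \<Rightarrow> real \<Rightarrow> real) \<Rightarrow> (real ^ 'k \<Rightarrow> real) \<Rightarrow> ((real ^ 's) \<times> real \<Rightarrow> real) \<Rightarrow>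
   ((nat \<Rightarrow> real) ^ 'k \<Rightarrow> real) \<Rightarrow> (nat \<Rightarrow> real) set \<Rightarrow> (nat \<Rightarrow> real) ^ 's \<Rightarrow>
   (nat \<Rightarrow> 'a \<Rightarrow> nat \<Rightarrow> real) \<Rightarrow> (nat \<Rightarrow> 'a \<Rightarrow> real) \<Rightarrow> 'a \<Rightarrow> real" where
  "opt_risk n p L F \<eta> r C \<Theta>s X e \<omega> =
     min_emp_risk n p (loss_F L F) r C (\<lambda>i. X i \<omega>) (\<lambda>i. label p \<eta> \<Theta>s (X i \<omega>) (e i \<omega>))"

definition proportional_regime :: "(nat \<Rightarrow> nat) \<Rightarrow> bool" where
  "proportional_regime p \<longleftrightarrow>
     (\<exists>C0>0. \<forall>n\<ge>1. inverse C0 \<le> real (p n) / real n \<and> real (p n) / real n \<le> C0)"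

definition constraint_family ::
  "(nat \<Rightarrow> real) set \<Rightarrow> (nat \<Rightarrow> real) ^ 's \<Rightarrow> (nat \<Rightarrow> real) set set" where
  "constraint_family C \<Theta>s = insert C (range (\<lambda>l. {\<Theta>s $ l}))"

definition constraint_sets ::
  "(nat \<Rightarrow> nat) \<Rightarrow> (nat \<Rightarrow> (nat \<Rightarrow> real) set) \<Rightarrow> (nat \<Rightarrow> (nat \<Rightarrow> real) ^ 's) \<Rightarrow> bool" where
  "constraint_sets p C \<Theta>s \<longleftrightarrow>
     (\<exists>R. \<forall>n. \<forall>D\<in>constraint_family (C n) (\<Theta>s n).
        D \<noteq> {} \<and> D \<subseteq> Rvec (p n) \<and> compact D \<and> (\<forall>\<theta>\<in>D. vnorm (p n) \<theta> \<le> R))"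

definition penalty :: "(nat \<Rightarrow> nat) \<Rightarrow> (nat \<Rightarrow> (nat \<Rightarrow> real) ^ 'k \<Rightarrow> real) \<Rightarrow> bool" where
  "penalty p r \<longleftrightarrow>
     (\<forall>n. \<forall>\<Theta>\<in>cols_in (Rvec (p n)). 0 \<le> r n \<Theta>) \<and>
     (\<forall>n. continuous_on (cols_in (Rvec (p n))) (r n)) \<and>
     (\<forall>B>0. \<exists>Kr>0. \<forall>n. \<forall>\<Theta>\<in>cols_in (Rvec (p n)). \<forall>\<Theta>'\<in>cols_in (Rvec (p n)).
        frob_norm (p n) \<Theta> \<le> B \<longrightarrow> frob_norm (p n) \<Theta>' \<le> B \<longrightarrow>
        \<bar>r n \<Theta> - r n \<Theta>'\<bar> \<le> Kr * frob_dist (p n) \<Theta> \<Theta>')"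

definition domain_of_gaussianity ::
  "(nat \<Rightarrow> 'a measure) \<Rightarrow> (nat \<Rightarrow> nat) \<Rightarrow> (nat \<Rightarrow> 'a \<Rightarrow> nat \<Rightarrow> real) \<Rightarrow> (nat \<Rightarrow> 'a \<Rightarrow> nat \<Rightarrow> real) \<Rightarrow>
   (nat \<Rightarrow> (nat \<Rightarrow> real) set) \<Rightarrow> bool" where
  "domain_of_gaussianity M p x g S \<longleftrightarrow>
     (\<forall>n. sym_convex (p n) (S n)) \<and>
     (\<forall>\<phi>. bounded_lipschitz \<phi> \<longrightarrow>
        (\<lambda>n. SUP \<theta>\<in>S n. \<bar>(\<integral>\<omega>. \<phi> (dotp (p n) \<theta> (g n \<omega>)) \<partial>M n) -
                           (\<integral>\<omega>. \<phi> (dotp (p n) \<theta> (x n \<omega>)) \<partial>M n)\<bar>) \<longlonglongrightarrow> 0)"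

text \<open>
  Restricted subgaussianity bounds linear functionals on the vectors of C of norm at most 1. Here a
  vector of norm at most 1 is kept and a longer one is replaced by its normalization. Discarding the
  longer vectors instead would impose nothing on them, and the universality theorem would fail: take
  n = p, the singleton C consisting of twice the first basis vector e, S the segment between
  this vector and its negative, k = k* = 1, true parameter 0, no penalty, loss equal to
  the absolute value of the projection, g standard normal, and x a standard normal vector plus
  n B e for an independent Bernoulli variable B of mean 1/n. The hypotheses on C are then void,
  and the minimal risks for x and g differ asymptotically by twice a Poisson variable of mean 1.
  The two readings agree if C lies in the unit ball or is star-shaped about the origin; see
  unit_part_of_unit_ball and unit_part_of_star_shaped.
\<close>

definition unit_part :: "nat \<Rightarrow> (nat \<Rightarrow> real) set \<Rightarrow> (nat \<Rightarrow> real) set" where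
  "unit_part p C = (\<lambda>\<theta>. vscale p (1 / max 1 (vnorm p \<theta>)) \<theta>) ` C"

definition restricted_subgaussian ::
  "(nat \<Rightarrow> 'a measure) \<Rightarrow> (nat \<Rightarrow> nat) \<Rightarrow> (nat \<Rightarrow> 'a \<Rightarrow> nat \<Rightarrow> real) \<Rightarrow> (nat \<Rightarrow> nat \<Rightarrow> real) \<Rightarrow>
   (nat \<Rightarrow> nat \<Rightarrow> nat \<Rightarrow> real) \<Rightarrow> (nat \<Rightarrow> (nat \<Rightarrow> real) set) \<Rightarrow> (nat \<Rightarrow> (nat \<Rightarrow> real) ^ 's) \<Rightarrow> bool" where
  "restricted_subgaussian M p x \<mu> \<Sigma>half C \<Theta>s \<longleftrightarrow>
     (\<exists>K. \<forall>n.
        (\<forall>D\<in>constraint_family (C n) (\<Theta>s n).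
           (SUP \<theta>\<in>unit_part (p n) D. psi2_norm (M n) (\<lambda>\<omega>. dotp (p n) (x n \<omega>) \<theta>)) \<le> ennreal K \<and>
           (\<forall>\<theta>\<in>unit_part (p n) D. vnorm (p n) (mat_vec (p n) (\<Sigma>half n) \<theta>) \<le> K)) \<and>
        vnorm (p n) (\<mu> n) \<le> K)"

definition loss_lipschitz :: "(('w::real_normed_vector \<times> real) \<Rightarrow> real) \<Rightarrow> bool" where
  "loss_lipschitz lo \<longleftrightarrow>
     (\<exists>K. \<forall>w e w' e'. \<bar>lo (w, e) - lo (w', e')\<bar> \<le> K * (norm (w - w') + \<bar>e - e'\<bar>))"

definition loss_locally_lipschitz :: "(('w::real_normed_vector \<times> real) \<Rightarrow> real) \<Rightarrow> bool" where
  "loss_locally_lipschitz lo \<longleftrightarrow>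
     (\<forall>B>0. \<exists>K. \<forall>w e w' e'. norm (w, e) \<le> B \<longrightarrow> norm (w', e') \<le> B \<longrightarrow>
        \<bar>lo (w, e) - lo (w', e')\<bar> \<le> K * (norm (w - w') + \<bar>e - e'\<bar>))"

definition loss_growth :: "(('w::real_normed_vector \<times> real) \<Rightarrow> real) \<Rightarrow> bool" where
  "loss_growth lo \<longleftrightarrow>
     (\<exists>K0 K1 K a b. 0 < K1 \<and> 0 < a \<and> a \<le> b \<and>
        (\<forall>w e. - K0 + K1 * (norm w powr a + \<bar>e\<bar> powr a) \<le> lo (w, e) \<and>
               lo (w, e) \<le> K * (1 + norm w powr b + \<bar>e\<bar> powr b)))"

definition alternative_I ::
  "(nat \<Rightarrow> 'a measure) \<Rightarrow> (nat \<Rightarrow> nat \<Rightarrow> 'a \<Rightarrow> real) \<Rightarrow>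
   (((real ^ 'k) \<times> (real ^ 's)) \<times> real \<Rightarrow> real) \<Rightarrow> bool" where
  "alternative_I M \<epsilon> lo \<longleftrightarrow>
     (\<exists>K. \<forall>n. \<forall>i<n. psi2_norm (M n) (\<epsilon> n i) \<le> ennreal K) \<and>
     (\<forall>z. 0 \<le> lo z) \<and>
     (loss_lipschitz lo \<or> (loss_locally_lipschitz lo \<and> loss_growth lo))"

text \<open>
  Binary labels y with P(y = 1 | x) = g(v) almost surely, where v is a function of x;
  the conditioning is on the sigma-algebra generated by the feature vector x.
\<close>

definition binary_label ::
  "'a measure \<Rightarrow> nat \<Rightarrow> ('v \<Rightarrow> real) \<Rightarrow> ('a \<Rightarrow> nat \<Rightarrow> real) \<Rightarrow> ('a \<Rightarrow> 'v) \<Rightarrow> ('a \<Rightarrow> real) \<Rightarrow> bool" where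
  "binary_label M p g x v y \<longleftrightarrow>
     (AE \<omega> in M. y \<omega> = 1 \<or> y \<omega> = - 1) \<and>
     (AE \<omega> in M. real_cond_exp M (vimage_algebra (space M) x (Rvec_borel p))
                   (indicator {\<omega>' \<in> space M. y \<omega>' = 1}) \<omega> = g (v \<omega>))"

definition alternative_II ::
  "(nat \<Rightarrow> 'a measure) \<Rightarrow> (nat \<Rightarrow> nat) \<Rightarrow> ((real ^ 's) \<times> real \<Rightarrow> real) \<Rightarrow> (nat \<Rightarrow> (nat \<Rightarrow> real) ^ 's) \<Rightarrow>
   (nat \<Rightarrow> nat \<Rightarrow> 'a \<Rightarrow> nat \<Rightarrow> real) \<Rightarrow> (nat \<Rightarrow> nat \<Rightarrow> 'a \<Rightarrow> nat \<Rightarrow> real) \<Rightarrow> (nat \<Rightarrow> nat \<Rightarrow> 'a \<Rightarrow> real) \<Rightarrow>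
   (real ^ 'k \<Rightarrow> real \<Rightarrow> real) \<Rightarrow> bool" where
  "alternative_II M p \<eta> \<Theta>s X G \<epsilon> LF \<longleftrightarrow>
     (\<exists>K. (\<forall>v y. 0 \<le> LF v y) \<and>
        (\<forall>v v' y. \<bar>LF v y - LF v' y\<bar> \<le> K * (1 + \<bar>y\<bar>) * norm (v - v')) \<and>
        (\<forall>v y y'. \<bar>LF v y - LF v y'\<bar> \<le> K * (1 + norm v) * \<bar>y - y'\<bar>) \<and>
        (\<forall>n. \<exists>g. (\<forall>v. 0 \<le> g v \<and> g v \<le> 1) \<and>
           (\<forall>v v'. \<bar>g v - g v'\<bar> \<le> K * (1 + norm v + norm v') * norm (v - v')) \<and>
           (\<forall>i<n.
              binary_label (M n) (p n) g (X n i) (\<lambda>\<omega>. proj (p n) (\<Theta>s n) (X n i \<omega>))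
                (\<lambda>\<omega>. label (p n) \<eta> (\<Theta>s n) (X n i \<omega>) (\<epsilon> n i \<omega>)) \<and>
              binary_label (M n) (p n) g (G n i) (\<lambda>\<omega>. proj (p n) (\<Theta>s n) (G n i \<omega>))
                (\<lambda>\<omega>. label (p n) \<eta> (\<Theta>s n) (G n i \<omega>) (\<epsilon> n i \<omega>)))))"

lemma vscale_1: "\<theta> \<in> Rvec p \<Longrightarrow> vscale p 1 \<theta> = \<theta>"
  by (auto simp: vscale_def Rvec_def PiE_def extensional_def fun_eq_iff)

lemma vnorm_vscale: "vnorm p (vscale p t \<theta>) = \<bar>t\<bar> * vnorm p \<theta>"
proof -
  have "vnorm p (vscale p t \<theta>) = L2_set (\<lambda>i. \<bar>t\<bar> * \<theta> i) {..<p}"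
    by (auto simp: vnorm_def vscale_def L2_set_def power_mult_distrib intro!: sum.cong)
  then show ?thesis
    by (simp add: vnorm_def L2_set_right_distrib)
qed

lemma unit_part_of_unit_ball:
  assumes "C \<subseteq> Rvec p" "\<And>\<theta>. \<theta> \<in> C \<Longrightarrow> vnorm p \<theta> \<le> 1"
  shows "unit_part p C = C"
proof -
  have "vscale p (1 / max 1 (vnorm p \<theta>)) \<theta> = \<theta>" if "\<theta> \<in> C" for \<theta>
    using that assms by (auto simp: max_absorb1 vscale_1)
  then show ?thesis
    unfolding unit_part_def by simp
qed

lemma unit_part_of_star_shaped:
  assumes "C \<subseteq> Rvec p" "\<And>\<theta> t. \<theta> \<in> C \<Longrightarrow> 0 \<le> t \<Longrightarrow> t \<le> 1 \<Longrightarrow> vscale p t \<theta> \<in> C"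
  shows "unit_part p C = {\<theta> \<in> C. vnorm p \<theta> \<le> 1}"
proof (intro equalityI subsetI)
  fix \<theta> assume "\<theta> \<in> unit_part p C"
  then obtain \<theta>' where \<theta>': "\<theta>' \<in> C" "\<theta> = vscale p (1 / max 1 (vnorm p \<theta>')) \<theta>'"
    by (auto simp: unit_part_def)
  have "vnorm p \<theta> \<le> 1"
    by (simp add: \<theta>'(2) vnorm_vscale field_simps)
  moreover have "\<theta> \<in> C"
    unfolding \<theta>'(2) by (rule assms(2)[OF \<theta>'(1)]) (auto simp: field_simps)
  ultimately show "\<theta> \<in> {\<theta> \<in> C. vnorm p \<theta> \<le> 1}" by simp
next
  fix \<theta> assume "\<theta> \<in> {\<theta> \<in> C. vnorm p \<theta> \<le> 1}"
  then have "\<theta> \<in> C" "vnorm p \<theta> \<le> 1" "\<theta> = vscale p (1 / max 1 (vnorm p \<theta>)) \<theta>"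
    using assms(1) by (auto simp: max_absorb1 vscale_1)
  then show "\<theta> \<in> unit_part p C"
    unfolding unit_part_def by blast
qed

end

theory Submission
  imports Defs "HOL-Probability.Probability"
begin

text \<open>
  The minimum over the compact constraint set is replaced by a minimum over a net, whose logarithmic
  cardinality is of order n in the proportional regime, and the latter by a soft minimum
  -(1/(n b)) log (sum of exp (-n b R)) of the empirical risk R with truncated losses, at a cost that
  vanishes as b grows. Exchanging the samples of one model for those of the other one at a time, the
  change of a smooth function of the soft minimum is an expectation over the exchanged sample alone
  of log of a Gibbs average of exp (-b loss). Approximating the logarithm by a polynomial
  turns the powers of the Gibbs average into averages over independent replicas of the expectation of
  products of exp (-b loss), taken at several matrices but a single feature vector. Such an expectation
  is a continuous function of finitely many linear functionals of the features, which trigonometric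
  polynomials reduce to cosines of a single linear functional; since the constraint set lies in the
  symmetric convex domain of Gaussianity, a scalar multiple of the combined direction lies in
  the domain, and the expectations agree asymptotically and uniformly. For binary labels the label is
  first integrated out given the features.
\<close>

section \<open>Exchange of samples and soft minima\<close>

text \<open>The infimum runs over exponentially many matrices, while the law of a sample is
  controlled only through linear functionals, one direction at a time; no step may need a joint
  approximation over the whole net. Two devices achieve this. Removing one sample leaves weights, or
  a near-minimizer, that do not depend on it, so its effect is a statement about its own law,
  uniform over all weights. And a polynomial of degree \<open>m\<close> in a Gibbs average involves
  at most \<open>m\<close> matrices at a time, so closeness for every fixed number of replicas
  suffices, whatever the size of the net. One exchange costs a multiple of \<gamma>/(\<beta> n) at
  first order and of 1/n^2 at second order, hence n exchanges cost a multiple of \<gamma>/\<beta>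
  and O(1/n). The constants are chosen accordingly: truncation level A, mesh \<delta>, inverse
  temperature \<beta>, accuracy \<gamma>, degree m with tolerance \<tau>, and n last. Features of
  both models and the noise enter through one kind of bound: the absolute value of a linear
  functional, divided by \<kappa>, has exponential moment at most 10.\<close>

lemma integrable_bounded:
  fixes f :: "'z \<Rightarrow> real"
  assumes "prob_space Q" "f \<in> borel_measurable Q" "\<And>z. z \<in> space Q \<Longrightarrow> \<bar>f z\<bar> \<le> B"
  shows "integrable Q f"
proof -
  interpret prob_space Q by fact
  show ?thesis
    by (rule integrable_const_bound[of _ B]) (use assms in auto)
qed

lemma abs_integral_le:
  fixes f :: "'z \<Rightarrow> real"
  assumes "prob_space Q" "f \<in> borel_measurable Q" "\<And>z. z \<in> space Q \<Longrightarrow> \<bar>f z\<bar> \<le> B"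
  shows "\<bar>\<integral>z. f z \<partial>Q\<bar> \<le> B"
proof -
  interpret prob_space Q by fact
  have i: "integrable Q f" using assms by (rule integrable_bounded)
  have "\<bar>\<integral>z. f z \<partial>Q\<bar> \<le> (\<integral>z. \<bar>f z\<bar> \<partial>Q)" by (rule integral_abs_bound)
  also have "\<dots> \<le> (\<integral>z. B \<partial>Q)"
    using i assms by (intro integral_mono) auto
  finally show ?thesis by (simp add: prob_space)
qed

text \<open>Telescoping over hybrid products whose first \<open>m\<close> coordinates follow
  \<open>Q\<close> and whose others follow \<open>Q'\<close>. The functional \<open>\<Phi> m\<close>
  may change with the hybrid, so the lemma serves both a change of law under one functional and,
  with \<open>Q' = Q\<close>, a change of the functional one sample at a time.\<close>

lemma lindeberg_swap:
  fixes Q Q' :: "'z measure" and \<Phi> :: "nat \<Rightarrow> (nat \<Rightarrow> 'z) \<Rightarrow> real"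
  assumes Q: "prob_space Q" and Q': "prob_space Q'" and sets: "sets Q' = sets Q"
    and meas: "\<And>m. m \<le> n \<Longrightarrow> \<Phi> m \<in> borel_measurable (PiM {..<n} (\<lambda>_. Q))"
    and bdd: "\<And>m w. m \<le> n \<Longrightarrow> w \<in> space (PiM {..<n} (\<lambda>_. Q)) \<Longrightarrow> \<bar>\<Phi> m w\<bar> \<le> B"
    and step: "\<And>m w. m < n \<Longrightarrow> w \<in> space (PiM {..<n} (\<lambda>_. Q)) \<Longrightarrow>
      \<bar>(\<integral>z. \<Phi> (Suc m) (w(m := z)) \<partial>Q) - (\<integral>z. \<Phi> m (w(m := z)) \<partial>Q')\<bar> \<le> c"
  shows "\<bar>(\<integral>w. \<Phi> n w \<partial>PiM {..<n} (\<lambda>_. Q)) - (\<integral>w. \<Phi> 0 w \<partial>PiM {..<n} (\<lambda>_. Q'))\<bar> \<le> real n * c"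
proof -
  interpret Q: prob_space Q by fact
  interpret Q': prob_space Q' by fact
  define h where "h m j = (if j < m then Q else Q')" for m j :: nat
  have sets_h: "sets (h m j) = sets Q" for m j by (simp add: h_def sets)
  have space_h: "space (h m j) = space Q" for m j
    using sets_h by (rule sets_eq_imp_space_eq)
  have ph: "prob_space (h m j)" for m j by (simp add: h_def Q Q')
  have setsP: "sets (PiM J (h m)) = sets (PiM J (\<lambda>_. Q))" for J m
    by (intro sets_PiM_cong refl sets_h)
  have spaceP: "space (PiM J (h m)) = space (PiM J (\<lambda>_. Q))" for J m
    using setsP by (rule sets_eq_imp_space_eq)
  define H where "H m = (\<integral>w. \<Phi> m w \<partial>PiM {..<n} (h m))" for m
  have diff: "\<bar>H (Suc m) - H m\<bar> \<le> c" if m: "m < n" for m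
  proof -
    let ?J = "{..<n} - {m}"
    have ins: "{..<n} = insert m ?J" using m by auto
    interpret P: product_prob_space "h k" for k by (rule product_prob_spaceI) (rule ph)
    have PJ: "prob_space (PiM J (h k))" for J k by (rule prob_space_PiM) (rule ph)
    have int: "integrable (PiM {..<n} (h k)) (\<Phi> l)" if "l \<le> n" for k l
      by (rule integrable_bounded[where B = B])
        (use PJ meas[OF that] bdd[OF that] in \<open>auto simp: spaceP cong: measurable_cong_sets[OF setsP]\<close>)
    have eq: "H' = (\<integral>x. (\<integral>z. \<Phi> l (x(m := z)) \<partial>h k m) \<partial>PiM ?J (h k))"
      if "l \<le> n" "H' = (\<integral>w. \<Phi> l w \<partial>PiM {..<n} (h k))" for k l H'
      unfolding that(2) 
      by (subst ins, rule P.product_integral_insert) (use int[OF that(1), of k] ins in auto)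
    \<comment> \<open>Consecutive hybrids differ only in coordinate \<open>m\<close>; Fubini in that
      coordinate writes both as integrals over the same product of the others.\<close>
    have same: "PiM ?J (h (Suc m)) = PiM ?J (h m)"
      by (rule PiM_cong) (auto simp: h_def)
    let ?P = "PiM ?J (h m)"
    have mm: "(\<lambda>x. \<integral>z. \<Phi> l (x(m := z)) \<partial>R) \<in> borel_measurable ?P"
      if l: "l \<le> n" and R: "prob_space R" "sets R = sets Q" for l R
    proof -
      interpret R: prob_space R by fact
      have s: "sets (?P \<Otimes>\<^sub>M R) = sets (PiM ?J (\<lambda>_. Q) \<Otimes>\<^sub>M Q)"
        by (intro sets_pair_measure_cong setsP R(2))
      have "(\<lambda>(x, z). x(m := z)) \<in> ?P \<Otimes>\<^sub>M R \<rightarrow>\<^sub>M PiM (insert m ?J) (\<lambda>_. Q)"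
        unfolding measurable_cong_sets[OF s refl] by (rule measurable_add_dim)
      then have "(\<lambda>(x, z). \<Phi> l (x(m := z))) \<in> borel_measurable (?P \<Otimes>\<^sub>M R)"
        using measurable_compose[OF _ meas[OF l]] ins[symmetric] by (simp add: case_prod_beta')
      then show ?thesis
        by (rule R.borel_measurable_lebesgue_integral)
    qed
    have sp: "x(m := z) \<in> space (PiM {..<n} (\<lambda>_. Q))" if "x \<in> space ?P" "z \<in> space Q" for x z
      using that m by (auto simp: space_PiM space_h PiE_iff extensional_def)
    have bb: "\<bar>\<integral>z. \<Phi> l (x(m := z)) \<partial>R\<bar> \<le> B" 
      if l: "l \<le> n" and R: "prob_space R" "sets R = sets Q" and x: "x \<in> space ?P" for l R x
    proof (rule abs_integral_le[OF R(1)])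
      have "(\<lambda>z. x(m := z)) \<in> R \<rightarrow>\<^sub>M PiM (insert m ?J) (\<lambda>_. Q)"
        unfolding measurable_cong_sets[OF R(2) refl]
        by (rule measurable_component_update) (use x in \<open>auto simp: spaceP\<close>)
      then show "(\<lambda>z. \<Phi> l (x(m := z))) \<in> borel_measurable R"
        using measurable_compose[OF _ meas[OF l]] ins[symmetric] by simp
      show "\<bar>\<Phi> l (x(m := z))\<bar> \<le> B" if "z \<in> space R" for z
        using bdd[OF l sp[OF x]] that sets_eq_imp_space_eq[OF R(2)] by simp
    qed
    have Sm: "H (Suc m) = (\<integral>x. (\<integral>z. \<Phi> (Suc m) (x(m := z)) \<partial>Q) \<partial>?P)"
      using eq[of "Suc m" "H (Suc m)" "Suc m"] m by (simp add: H_def same h_def[of _ m])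
    have m0: "H m = (\<integral>x. (\<integral>z. \<Phi> m (x(m := z)) \<partial>Q') \<partial>?P)"
      using eq[of "m" "H m" "m"] m by (simp add: H_def h_def[of _ m])
    have "H (Suc m) - H m = (\<integral>x. (\<integral>z. \<Phi> (Suc m) (x(m := z)) \<partial>Q) - (\<integral>z. \<Phi> m (x(m := z)) \<partial>Q') \<partial>?P)"
      unfolding Sm m0
      by (rule Bochner_Integration.integral_diff[symmetric]; 
          rule integrable_bounded[OF PJ, where B=B]) (use m Q Q' in \<open>auto intro!: mm bb sets\<close>)
    also have "\<bar>\<dots>\<bar> \<le> c"
    proof (rule abs_integral_le[OF PJ])
      fix x assume x: "x \<in> space ?P"
      \<comment> \<open>\<open>step\<close> speaks of full points \<open>w\<close>, but overwrites
        their value at \<open>m\<close>; so \<open>x\<close> may be completed by any point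
        \<open>a\<close>.\<close>
      obtain a where a: "a \<in> space Q" using Q.not_empty by auto
      show "\<bar>(\<integral>z. \<Phi> (Suc m) (x(m := z)) \<partial>Q) - (\<integral>z. \<Phi> m (x(m := z)) \<partial>Q')\<bar> \<le> c"
        using step[OF m sp[OF x a]] by simp
    qed (use m Q Q' in \<open>auto intro!: mm sets borel_measurable_diff\<close>)
    finally show ?thesis .
  qed
  have ind: "m \<le> n \<Longrightarrow> \<bar>H m - H 0\<bar> \<le> real m * c" for m
  proof (induction m)
    case (Suc m)
    have "\<bar>H (Suc m) - H 0\<bar> \<le> \<bar>H (Suc m) - H m\<bar> + \<bar>H m - H 0\<bar>" by linarith
    also have "\<dots> \<le> c + real m * c"
      using Suc diff[of m] by auto
    finally show ?case by (simp add: algebra_simps)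
  qed auto
  have "PiM {..<n} (h n) = PiM {..<n} (\<lambda>_. Q)" "h 0 = (\<lambda>_. Q')"
    by (rule PiM_cong) (auto simp: h_def fun_eq_iff)
  then show ?thesis
    using ind[of n] by (simp add: H_def)
qed

text \<open>If truncation lowers the infimum, the truncated one is still at least
  \<open>U + s * A\<close>, with \<open>U\<close> the infimum of \<open>f\<close>; the untruncated
  one is at most \<open>U + s * (a \<theta>0 + 1)\<close>, by testing at \<open>\<theta>0\<close>.
  Since \<open>\<theta>0\<close> nearly minimizes \<open>f\<close> alone, it can be chosen before
  the new sample is drawn, and only the loss at one fixed parameter has to be integrated
  afterwards.\<close>

lemma inf_truncation:
  fixes f a :: "'t \<Rightarrow> real"
  assumes T: "T \<noteq> {}" and f: "\<And>\<theta>. \<theta> \<in> T \<Longrightarrow> 0 \<le> f \<theta>" and a: "\<And>\<theta>. \<theta> \<in> T \<Longrightarrow> 0 \<le> a \<theta>"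
    and A: "0 < A" and s: "0 < s" and \<theta>0: "\<theta>0 \<in> T" "f \<theta>0 \<le> (INF \<theta>\<in>T. f \<theta>) + s"
  shows "\<bar>(INF \<theta>\<in>T. f \<theta> + s * min A (a \<theta>)) - (INF \<theta>\<in>T. f \<theta> + s * a \<theta>)\<bar> \<le> s * (a \<theta>0 + 1)\<^sup>2 / A"
proof -
  let ?U = "INF \<theta>\<in>T. f \<theta>" and ?V = "INF \<theta>\<in>T. f \<theta> + s * a \<theta>"
    and ?W = "INF \<theta>\<in>T. f \<theta> + s * min A (a \<theta>)"
  have bU: "bdd_below (f ` T)" by (rule bdd_belowI2[of _ 0]) (rule f)
  have bV: "bdd_below ((\<lambda>\<theta>. f \<theta> + s * a \<theta>) ` T)"
    by (rule bdd_belowI2[of _ 0]) (use f a s in simp)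
  have bW: "bdd_below ((\<lambda>\<theta>. f \<theta> + s * min A (a \<theta>)) ` T)"
    by (rule bdd_belowI2[of _ 0]) (use f a s A in simp)
  have "?W \<le> ?V"
    by (rule cINF_mono[OF T bW]) (use s in \<open>auto intro!: bexI mult_left_mono\<close>)
  moreover have "min ?V (?U + s * A) \<le> ?W"
  proof (rule cINF_greatest[OF T])
    fix \<theta> assume \<theta>: "\<theta> \<in> T"
    have "?V \<le> f \<theta> + s * a \<theta>" "?U \<le> f \<theta>"
      using cINF_lower[OF bV \<theta>] cINF_lower[OF bU \<theta>] by auto
    then show "min ?V (?U + s * A) \<le> f \<theta> + s * min A (a \<theta>)"
      by (auto simp: min_def)
  qed
  moreover have "?V \<le> ?U + s * (a \<theta>0 + 1)"
    using cINF_lower[OF bV \<theta>0(1)] \<theta>0(2) by (simp add: algebra_simps)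
  \<comment> \<open>Replacing the excess over \<open>A\<close> by a square divided by
    \<open>A\<close> makes second moments sufficient.\<close>
  moreover have "a \<theta>0 + 1 - A \<le> (a \<theta>0 + 1)\<^sup>2 / A"
  proof -
    have "0 \<le> ((a \<theta>0 + 1) - A / 2)\<^sup>2" "0 < A * A" using A by auto
    then have "(a \<theta>0 + 1 - A) * A \<le> (a \<theta>0 + 1)\<^sup>2"
      unfolding power2_eq_square by (simp add: algebra_simps) 
    then show ?thesis using A by (simp add: pos_le_divide_eq)
  qed
  then have "s * (a \<theta>0 + 1 - A) \<le> s * ((a \<theta>0 + 1)\<^sup>2 / A)"
    using s by (intro mult_left_mono) auto
  moreover have "0 \<le> s * (a \<theta>0 + 1)\<^sup>2 / A"
    using s A by simp
  ultimately show ?thesis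
    by (auto simp: min_def abs_le_iff algebra_simps split: if_splits)
qed

text \<open>The samples are truncated one at a time, at a cost O(1/(A n)) each, whatever the size of
  \<open>T\<close>: \<open>\<theta>0\<close> is determined by the other samples, so only the second
  moment of the loss at \<open>\<theta>0\<close> enters, and no supremum over \<open>T\<close> has
  to be integrated.\<close>

lemma truncation_swap:
  fixes l :: "'t \<Rightarrow> 'z \<Rightarrow> real" and \<psi> :: "real \<Rightarrow> real"
  assumes Q: "prob_space Q" and T: "T \<noteq> {}" and A: "0 < A" and n: "0 < n"
    and l: "\<And>\<theta> z. \<theta> \<in> T \<Longrightarrow> 0 \<le> l \<theta> z" and r: "\<And>\<theta>. \<theta> \<in> T \<Longrightarrow> 0 \<le> r \<theta>"
    and meas: "\<And>m. m \<le> n \<Longrightarrow>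
      (\<lambda>w. INF \<theta>\<in>T. (1 / real n) * (\<Sum>j<n. if j < m then min A (l \<theta> (w j)) else l \<theta> (w j)) + r \<theta>)
        \<in> borel_measurable (PiM {..<n} (\<lambda>_. Q))"
    and mom: "\<And>\<theta>. \<theta> \<in> T \<Longrightarrow> l \<theta> \<in> borel_measurable Q"
      "\<And>\<theta>. \<theta> \<in> T \<Longrightarrow> integrable Q (\<lambda>z. (l \<theta> z)\<^sup>2)"
      "\<And>\<theta>. \<theta> \<in> T \<Longrightarrow> (\<integral>z. (l \<theta> z)\<^sup>2 \<partial>Q) \<le> c2"
    and \<psi>: "\<And>x. \<bar>\<psi> x\<bar> \<le> B" and lip: "\<And>x y. \<bar>\<psi> x - \<psi> y\<bar> \<le> L * \<bar>x - y\<bar>" and L: "0 \<le> L"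
  shows "\<bar>(\<integral>w. \<psi> (INF \<theta>\<in>T. (1 / real n) * (\<Sum>j<n. min A (l \<theta> (w j))) + r \<theta>) \<partial>PiM {..<n} (\<lambda>_. Q)) -
           (\<integral>w. \<psi> (INF \<theta>\<in>T. (1 / real n) * (\<Sum>j<n. l \<theta> (w j)) + r \<theta>) \<partial>PiM {..<n} (\<lambda>_. Q))\<bar>
         \<le> 2 * L * (c2 + 1) / A"
proof -
  interpret Q: prob_space Q by fact
  define lm where "lm m j \<theta> z = (if j < m then min A (l \<theta> z) else l \<theta> z)" for m j :: nat and \<theta> z
  define \<Phi> where "\<Phi> m w = \<psi> (INF \<theta>\<in>T. (1 / real n) * (\<Sum>j<n. lm m j \<theta> (w j)) + r \<theta>)" for m and w :: "nat \<Rightarrow> 'z"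
  have \<psi>m: "\<psi> \<in> borel_measurable borel"
    by (intro borel_measurable_continuous_onI lipschitz_on_continuous_on[of L])
      (use lip L in \<open>auto intro!: lipschitz_onI simp: dist_real_def\<close>)
  have \<Phi>m: "\<Phi> m \<in> borel_measurable (PiM {..<n} (\<lambda>_. Q))" if "m \<le> n" for m
    unfolding \<Phi>_def lm_def by (rule measurable_compose[OF meas[OF that] \<psi>m])
  have "\<bar>(\<integral>w. \<Phi> n w \<partial>PiM {..<n} (\<lambda>_. Q)) - (\<integral>w. \<Phi> 0 w \<partial>PiM {..<n} (\<lambda>_. Q))\<bar>
      \<le> real n * (2 * L * (c2 + 1) / (A * real n))"
  proof (rule lindeberg_swap[OF Q Q refl \<Phi>m])
    show "\<bar>\<Phi> m w\<bar> \<le> B" for m w by (simp add: \<Phi>_def \<psi>)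
  next
    fix m w assume m: "m < n" and w: "w \<in> space (PiM {..<n} (\<lambda>_. Q))"
    define f where "f \<theta> = (1 / real n) * (\<Sum>j\<in>{..<n} - {m}. lm m j \<theta> (w j)) + r \<theta>" for \<theta>
    have f0: "0 \<le> f \<theta>" if "\<theta> \<in> T" for \<theta>
    proof -
      have "0 \<le> lm m j \<theta> (w j)" for j using l[OF that] A by (simp add: lm_def)
      then show ?thesis
        using r[OF that] by (auto simp: f_def intro!: add_nonneg_nonneg divide_nonneg_nonneg sum_nonneg)
    qed
    have split: "(\<Sum>j<n. g j) = g m + (\<Sum>j\<in>{..<n} - {m}. g j)" for g :: "nat \<Rightarrow> real"
      using m by (intro sum.remove) auto
    have e1: "\<Phi> (Suc m) (w(m := z)) = \<psi> (INF \<theta>\<in>T. f \<theta> + (1 / real n) * min A (l \<theta> z))" for z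
    proof -
      have "(\<Sum>j\<in>{..<n} - {m}. lm (Suc m) j \<theta> ((w(m := z)) j)) = (\<Sum>j\<in>{..<n} - {m}. lm m j \<theta> (w j))" for \<theta>
        by (rule sum.cong) (auto simp: lm_def)
      then show ?thesis
        unfolding \<Phi>_def f_def split by (simp add: lm_def[of "Suc m" m] algebra_simps add_divide_distrib)
    qed
    have e2: "\<Phi> m (w(m := z)) = \<psi> (INF \<theta>\<in>T. f \<theta> + (1 / real n) * l \<theta> z)" for z
    proof -
      have "(\<Sum>j\<in>{..<n} - {m}. lm m j \<theta> ((w(m := z)) j)) = (\<Sum>j\<in>{..<n} - {m}. lm m j \<theta> (w j))" for \<theta>
        by (rule sum.cong) (auto simp: lm_def)
      then show ?thesis
        unfolding \<Phi>_def f_def split by (simp add: lm_def[of "m" m] algebra_simps add_divide_distrib)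
    qed
    \<comment> \<open>The slack 1/n equals the weight \<open>s\<close> of one sample, as
      \<open>inf_truncation\<close> asks, and allows for an infimum that is not attained.\<close>
    have "\<exists>y\<in>f ` T. y < (INF \<theta>\<in>T. f \<theta>) + 1 / real n"
      by (rule cInf_lessD) (use T n in auto)
    then obtain \<theta>0 where \<theta>0: "\<theta>0 \<in> T" "f \<theta>0 \<le> (INF \<theta>\<in>T. f \<theta>) + 1 / real n"
      by force
    have b: "\<bar>\<Phi> (Suc m) (w(m := z)) - \<Phi> m (w(m := z))\<bar> \<le> 2 * L / (A * real n) * ((l \<theta>0 z)\<^sup>2 + 1)" for z
    proof -
      have "\<bar>\<Phi> (Suc m) (w(m := z)) - \<Phi> m (w(m := z))\<bar> \<le> L * ((1 / real n) * (l \<theta>0 z + 1)\<^sup>2 / A)"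
        unfolding e1 e2
        by (rule order_trans[OF lip], rule mult_left_mono[OF inf_truncation L])
          (use T f0 l A n \<theta>0 in auto)
      also have "\<dots> = L / (A * real n) * (l \<theta>0 z + 1)\<^sup>2" by simp
      also have "\<dots> \<le> L / (A * real n) * (2 * ((l \<theta>0 z)\<^sup>2 + 1))"
      proof (rule mult_left_mono)
        have "0 \<le> (l \<theta>0 z - 1)\<^sup>2" by simp
        then show "(l \<theta>0 z + 1)\<^sup>2 \<le> 2 * ((l \<theta>0 z)\<^sup>2 + 1)"
          unfolding power2_eq_square by (simp add: algebra_simps)
      qed (use L A in auto)
      also have "\<dots> = 2 * L / (A * real n) * ((l \<theta>0 z)\<^sup>2 + 1)"
        by (simp add: algebra_simps add_divide_distrib)
      finally show ?thesis .
    qed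
    have upd: "(\<lambda>z. w(m := z)) \<in> Q \<rightarrow>\<^sub>M PiM {..<n} (\<lambda>_. Q)"
    proof (rule measurable_PiM_single')
      show "(\<lambda>z. (w(m := z)) i) \<in> Q \<rightarrow>\<^sub>M Q" if "i \<in> {..<n}" for i
        using that w by (cases "i = m") (auto simp: space_PiM PiE_iff)
      show "(\<lambda>z. w(m := z)) \<in> space Q \<rightarrow> (\<Pi>\<^sub>E i\<in>{..<n}. space Q)"
        using w m by (auto simp: space_PiM PiE_iff extensional_def)
    qed
    have int: "integrable Q (\<lambda>z. \<Phi> k (w(m := z)))" if "k \<le> n" for k
      by (rule integrable_bounded[OF Q, where B = B])
        (use measurable_compose[OF upd \<Phi>m[OF that]] in \<open>auto simp: \<Phi>_def \<psi>\<close>)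
    have "\<bar>(\<integral>z. \<Phi> (Suc m) (w(m := z)) \<partial>Q) - (\<integral>z. \<Phi> m (w(m := z)) \<partial>Q)\<bar>
        = \<bar>(\<integral>z. \<Phi> (Suc m) (w(m := z)) - \<Phi> m (w(m := z)) \<partial>Q)\<bar>"
      using m int by simp
    also have "\<dots> \<le> (\<integral>z. \<bar>\<Phi> (Suc m) (w(m := z)) - \<Phi> m (w(m := z))\<bar> \<partial>Q)"
      by (rule integral_abs_bound)
    also have "\<dots> \<le> (\<integral>z. 2 * L / (A * real n) * ((l \<theta>0 z)\<^sup>2 + 1) \<partial>Q)"
      by (rule integral_mono) (use m int b mom(2)[OF \<theta>0(1)] in auto)
    also have "\<dots> = 2 * L / (A * real n) * ((\<integral>z. (l \<theta>0 z)\<^sup>2 \<partial>Q) + 1)"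
      using mom(2)[OF \<theta>0(1)] by (simp add: Q.prob_space)
    also have "\<dots> \<le> 2 * L / (A * real n) * (c2 + 1)"
      by (rule mult_left_mono) (use mom(3)[OF \<theta>0(1)] L A in auto)
    finally show "\<bar>(\<integral>z. \<Phi> (Suc m) (w(m := z)) \<partial>Q) - (\<integral>z. \<Phi> m (w(m := z)) \<partial>Q)\<bar>
        \<le> 2 * L * (c2 + 1) / (A * real n)"
      by simp
  qed auto
  moreover have "\<Phi> n w = \<psi> (INF \<theta>\<in>T. (1 / real n) * (\<Sum>j<n. min A (l \<theta> (w j))) + r \<theta>)" for w
    unfolding \<Phi>_def lm_def by (auto intro!: arg_cong[of _ _ \<psi>] INF_cong sum.cong)
  ultimately show ?thesis
    using n by (simp add: \<Phi>_def lm_def)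
qed

text \<open>A sum of exponentials lies between its largest term and \<open>card T\<close> times that
  term; the gap is small once \<open>c\<close> dominates the logarithm of the cardinality.\<close>

lemma softmin_bounds:
  fixes a :: "'t \<Rightarrow> real"
  assumes T: "finite T" "T \<noteq> {}" and c: "0 < c"
  shows "- (1 / c) * ln (\<Sum>\<theta>\<in>T. exp (- c * a \<theta>)) \<le> (INF \<theta>\<in>T. a \<theta>)"
    and "(INF \<theta>\<in>T. a \<theta>) - ln (real (card T)) / c \<le> - (1 / c) * ln (\<Sum>\<theta>\<in>T. exp (- c * a \<theta>))"
proof -
  let ?S = "\<Sum>\<theta>\<in>T. exp (- c * a \<theta>)"
  have S: "0 < ?S" using T by (intro sum_pos) auto
  show "- (1 / c) * ln ?S \<le> (INF \<theta>\<in>T. a \<theta>)"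
  proof (rule cINF_greatest)
    fix \<theta> assume \<theta>: "\<theta> \<in> T"
    have "exp (- c * a \<theta>) \<le> ?S"
      by (rule member_le_sum) (use \<theta> T in auto)
    then have "- c * a \<theta> \<le> ln ?S"
      using S by (simp add: ln_ge_iff)
    then show "- (1 / c) * ln ?S \<le> a \<theta>"
      using c by (simp add: field_simps)
  qed fact
  let ?m = "INF \<theta>\<in>T. a \<theta>"
  have "?S \<le> (\<Sum>\<theta>\<in>T. exp (- c * ?m))"
    using c T by (intro sum_mono) (auto intro!: cINF_lower bdd_below_finite)
  also have "\<dots> = real (card T) * exp (- c * ?m)" by simp
  finally have "ln ?S \<le> ln (real (card T) * exp (- c * ?m))"
    using S by (subst ln_le_cancel_iff) auto
  also have "\<dots> = ln (real (card T)) - c * ?m"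
    using T by (subst ln_mult) (auto simp: card_gt_0_iff)
  finally have "(c * ?m - ln (real (card T))) / c \<le> (- ln ?S) / c"
    using c by (intro divide_right_mono) auto
  then show "?m - ln (real (card T)) / c \<le> - (1 / c) * ln ?S"
    using c by (simp add: diff_divide_distrib)
qed

text \<open>Once sample \<open>m\<close> is set aside, the soft minimum is
  \<open>f0 + D z / real n\<close>, where \<open>D z\<close> is the free energy of the new sample
  \<open>z\<close> under Gibbs weights \<open>u\<close> determined by the others. Since D lies
  between 0 and A, a first-order expansion errs by O(A^2/n^2). The other samples are arbitrary,
  hence so are the weights, and \<open>wt\<close> is required for every probability vector.\<close>

lemma softmin_swap:
  fixes l :: "'t \<Rightarrow> 'z \<Rightarrow> real" and r :: "'t \<Rightarrow> real" and \<psi> \<psi>' :: "real \<Rightarrow> real"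
  assumes Q: "prob_space Q" and Q': "prob_space Q'" and sets: "sets Q' = sets Q"
    and T: "finite T" "T \<noteq> {}" and n: "0 < n" and \<beta>: "0 < \<beta>"
    and l: "\<And>\<theta> z. \<theta> \<in> T \<Longrightarrow> 0 \<le> l \<theta> z" "\<And>\<theta> z. \<theta> \<in> T \<Longrightarrow> l \<theta> z \<le> A"
    and lm[measurable]: "\<And>\<theta>. \<theta> \<in> T \<Longrightarrow> l \<theta> \<in> borel_measurable Q"
    and \<psi>: "\<And>x. (\<psi> has_real_derivative \<psi>' x) (at x)" "\<And>x. \<bar>\<psi> x\<bar> \<le> B"
    and \<psi>': "\<And>x. \<bar>\<psi>' x\<bar> \<le> L" "\<And>x y. \<bar>\<psi>' x - \<psi>' y\<bar> \<le> L2 * \<bar>x - y\<bar>" "0 \<le> L2"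
    and wt: "\<And>u. (\<And>\<theta>. \<theta> \<in> T \<Longrightarrow> 0 \<le> u \<theta>) \<Longrightarrow> (\<Sum>\<theta>\<in>T. u \<theta>) = 1 \<Longrightarrow>
      \<bar>(\<integral>z. ln (\<Sum>\<theta>\<in>T. u \<theta> * exp (- \<beta> * l \<theta> z)) \<partial>Q) - (\<integral>z. ln (\<Sum>\<theta>\<in>T. u \<theta> * exp (- \<beta> * l \<theta> z)) \<partial>Q')\<bar> \<le> \<gamma>"
  defines "S \<equiv> \<lambda>w. - (1 / (real n * \<beta>)) *
      ln (\<Sum>\<theta>\<in>T. exp (- (real n * \<beta>) * ((1 / real n) * (\<Sum>j<n. l \<theta> (w j)) + r \<theta>)))"
  shows "\<bar>(\<integral>w. \<psi> (S w) \<partial>PiM {..<n} (\<lambda>_. Q)) - (\<integral>w. \<psi> (S w) \<partial>PiM {..<n} (\<lambda>_. Q'))\<bar>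
      \<le> L * \<gamma> / \<beta> + 2 * L2 * A\<^sup>2 / real n"
proof -
  interpret Q: prob_space Q by fact
  interpret Q': prob_space Q' by fact
  have A0: "0 \<le> A" using T l by (meson all_not_in_conv order_trans)
  have \<psi>m[measurable]: "\<psi> \<in> borel_measurable borel"
    by (intro borel_measurable_continuous_onI continuous_at_imp_continuous_on ballI DERIV_isCont[OF \<psi>(1)])
  have Sm: "S \<in> borel_measurable (PiM {..<n} (\<lambda>_. Q))"
    unfolding S_def by measurable
  \<comment> \<open>The mean value theorem needs only a Lipschitz derivative; the test functions
    built by \<open>smoothing\<close> come without a second derivative.\<close>
  have taylor: "\<bar>\<psi> (x + d) - \<psi> x - \<psi>' x * d\<bar> \<le> L2 * d\<^sup>2" if d: "0 \<le> d" for x d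
  proof (cases "d = 0")
    case False
    then have "x < x + d" using d by simp
    from MVT2[OF this, of \<psi> \<psi>'] obtain z where z: "x < z" "z < x + d" "\<psi> (x + d) - \<psi> x = d * \<psi>' z"
      using \<psi>(1) by auto
    have "\<psi> (x + d) - \<psi> x - \<psi>' x * d = (\<psi>' z - \<psi>' x) * d"
      unfolding z(3) by (simp add: algebra_simps)
    then have "\<bar>\<psi> (x + d) - \<psi> x - \<psi>' x * d\<bar> = \<bar>(\<psi>' z - \<psi>' x) * d\<bar>"
      by simp
    also have "\<dots> = \<bar>\<psi>' z - \<psi>' x\<bar> * d" using d by (simp add: abs_mult)
    also have "\<dots> \<le> (L2 * \<bar>z - x\<bar>) * d" using \<psi>'(2) d by (intro mult_right_mono) auto
    also have "\<dots> \<le> (L2 * d) * d" using z d \<psi>'(3) by (intro mult_right_mono mult_left_mono) auto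
    finally show ?thesis by (simp add: power2_eq_square)
  qed auto
  have "\<bar>(\<integral>w. \<psi> (S w) \<partial>PiM {..<n} (\<lambda>_. Q)) - (\<integral>w. \<psi> (S w) \<partial>PiM {..<n} (\<lambda>_. Q'))\<bar>
      \<le> real n * (L * \<gamma> / (\<beta> * real n) + 2 * L2 * A\<^sup>2 / (real n)\<^sup>2)"
  proof (rule lindeberg_swap[OF Q Q' sets, where \<Phi> = "\<lambda>_ w. \<psi> (S w)"])
    show "(\<lambda>w. \<psi> (S w)) \<in> borel_measurable (PiM {..<n} (\<lambda>_. Q))"
      by (rule measurable_compose[OF Sm \<psi>m])
    show "\<bar>\<psi> (S w)\<bar> \<le> B" for w by (rule \<psi>)
  next
    fix m w assume m: "m < n" and w: "w \<in> space (PiM {..<n} (\<lambda>_. Q))"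
    \<comment> \<open>Gibbs factor of \<open>\<theta>\<close> without sample \<open>m\<close>: the
      scale \<open>real n * \<beta>\<close> cancels the 1/n of the empirical mean and multiplies the
      penalty by \<open>n\<close>.\<close>
    define e where "e \<theta> = exp (- \<beta> * ((\<Sum>j\<in>{..<n} - {m}. l \<theta> (w j)) + real n * r \<theta>))" for \<theta>
    define Z where "Z = (\<Sum>\<theta>\<in>T. e \<theta>)"
    define u where "u \<theta> = e \<theta> / Z" for \<theta>
    define D where "D z = - (1 / \<beta>) * ln (\<Sum>\<theta>\<in>T. u \<theta> * exp (- \<beta> * l \<theta> z))" for z
    define f0 where "f0 = - (1 / (real n * \<beta>)) * ln Z"
    have Z: "0 < Z" unfolding Z_def e_def using T by (intro sum_pos) auto
    have u: "0 < u \<theta>" for \<theta> using Z by (simp add: u_def e_def)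
    have u1: "(\<Sum>\<theta>\<in>T. u \<theta>) = 1"
      using Z by (simp add: u_def sum_divide_distrib[symmetric] Z_def)
    have E: "0 < (\<Sum>\<theta>\<in>T. u \<theta> * exp (- \<beta> * l \<theta> z))" for z
      using u T by (intro sum_pos) auto
    have eq: "S (w(m := z)) = f0 + D z / real n" for z
    proof -
      have "exp (- (real n * \<beta>) * ((1 / real n) * (\<Sum>j<n. l \<theta> ((w(m := z)) j)) + r \<theta>)) =
          e \<theta> * exp (- \<beta> * l \<theta> z)" for \<theta>
      proof -
        have "(\<Sum>j<n. l \<theta> ((w(m := z)) j)) = l \<theta> z + (\<Sum>j\<in>{..<n} - {m}. l \<theta> ((w(m := z)) j))"
          using m by (subst sum.remove[of _ m]) auto
        also have "(\<Sum>j\<in>{..<n} - {m}. l \<theta> ((w(m := z)) j)) = (\<Sum>j\<in>{..<n} - {m}. l \<theta> (w j))"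
          by (rule sum.cong) auto
        finally show ?thesis
          using n unfolding e_def mult_exp_exp by (simp add: field_simps)
      qed
      then have "S (w(m := z)) = - (1 / (real n * \<beta>)) * ln (\<Sum>\<theta>\<in>T. e \<theta> * exp (- \<beta> * l \<theta> z))"
        by (simp add: S_def)
      also have "(\<Sum>\<theta>\<in>T. e \<theta> * exp (- \<beta> * l \<theta> z)) = Z * (\<Sum>\<theta>\<in>T. u \<theta> * exp (- \<beta> * l \<theta> z))"
        using Z by (simp add: u_def sum_distrib_left)
      also have "ln \<dots> = ln Z + ln (\<Sum>\<theta>\<in>T. u \<theta> * exp (- \<beta> * l \<theta> z))"
        using Z E[of z] by (subst ln_mult) auto
      finally have S: "S (w(m := z)) = - (1 / (real n * \<beta>)) * (ln Z + ln (\<Sum>\<theta>\<in>T. u \<theta> * exp (- \<beta> * l \<theta> z)))" .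
      show ?thesis
        unfolding S f0_def D_def using n \<beta> by (simp add: field_simps)
    qed
    have D0: "0 \<le> D z" for z
    proof -
      have "(\<Sum>\<theta>\<in>T. u \<theta> * exp (- \<beta> * l \<theta> z)) \<le> (\<Sum>\<theta>\<in>T. u \<theta> * 1)"
        using l \<beta> less_imp_le[OF u] by (intro sum_mono mult_left_mono) auto
      then show ?thesis
        using E \<beta> u1 by (simp add: D_def ln_le_zero_iff divide_nonpos_pos)
    qed
    have DA: "D z \<le> A" for z
    proof -
      have "exp (- \<beta> * A) = (\<Sum>\<theta>\<in>T. u \<theta> * exp (- \<beta> * A))"
        by (simp add: sum_distrib_right[symmetric] u1)
      also have "\<dots> \<le> (\<Sum>\<theta>\<in>T. u \<theta> * exp (- \<beta> * l \<theta> z))"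
        using l \<beta> less_imp_le[OF u] by (intro sum_mono mult_left_mono) auto
      finally have "- \<beta> * A \<le> ln (\<Sum>\<theta>\<in>T. u \<theta> * exp (- \<beta> * l \<theta> z))"
        using E by (simp add: ln_ge_iff)
      then show ?thesis using \<beta> by (simp add: D_def field_simps)
    qed
    have Dm[measurable]: "D \<in> borel_measurable Q" unfolding D_def by measurable
    have Dm': "D \<in> borel_measurable Q'" using Dm by (simp cong: measurable_cong_sets[OF sets])
    have DDm: "(\<lambda>z. D z / real n) \<in> borel_measurable Q'" using Dm' by measurable
    have absD: "\<bar>D z\<bar> \<le> A" for z using D0 DA by (simp add: abs_le_iff)
    have Dint: "integrable Q D" "integrable Q' D"
      by (rule integrable_bounded[where B = A]; use Q Q' Dm Dm' absD in simp)+
    have lin: "\<bar>(\<integral>z. \<psi> (f0 + D z / real n) \<partial>R) - (\<psi> f0 + \<psi>' f0 * ((\<integral>z. D z \<partial>R) / real n))\<bar> \<le> L2 * A\<^sup>2 / (real n)\<^sup>2"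
      if R: "prob_space R" and DR[measurable]: "D \<in> borel_measurable R" for R
    proof -
      interpret R: prob_space R by fact
      have i1: "integrable R (\<lambda>z. \<psi> (f0 + D z / real n))"
        by (rule integrable_bounded[OF R, where B = B]) (auto simp: \<psi>)
      have i2: "integrable R D"
        by (rule integrable_bounded[OF R, where B = A]) (auto simp: absD)
      have "(\<integral>z. \<psi> (f0 + D z / real n) \<partial>R) - (\<psi> f0 + \<psi>' f0 * ((\<integral>z. D z \<partial>R) / real n)) =
         (\<integral>z. \<psi> (f0 + D z / real n) - \<psi> f0 - \<psi>' f0 * (D z / real n) \<partial>R)"
        using i1 i2 by (simp add: R.prob_space)
      also have "\<bar>\<dots>\<bar> \<le> L2 * A\<^sup>2 / (real n)\<^sup>2"
      proof (rule abs_integral_le[OF R])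
        fix z
        have "\<bar>\<psi> (f0 + D z / real n) - \<psi> f0 - \<psi>' f0 * (D z / real n)\<bar> \<le> L2 * (D z / real n)\<^sup>2"
          by (rule taylor) (simp add: D0)
        also have "\<dots> \<le> L2 * (A / real n)\<^sup>2"
          using D0 DA \<psi>'(3) by (intro mult_left_mono power_mono divide_right_mono) auto
        finally show "\<bar>\<psi> (f0 + D z / real n) - \<psi> f0 - \<psi>' f0 * (D z / real n)\<bar> \<le> L2 * A\<^sup>2 / (real n)\<^sup>2"
          by (simp add: power_divide)
      qed measurable
      finally show ?thesis .
    qed
    let ?a = "\<integral>z. D z \<partial>Q" and ?b = "\<integral>z. D z \<partial>Q'"
    have "\<bar>?a - ?b\<bar> = \<bar>(\<integral>z. ln (\<Sum>\<theta>\<in>T. u \<theta> * exp (- \<beta> * l \<theta> z)) \<partial>Q) -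
        (\<integral>z. ln (\<Sum>\<theta>\<in>T. u \<theta> * exp (- \<beta> * l \<theta> z)) \<partial>Q')\<bar> / \<beta>"
      unfolding D_def integral_mult_right_zero using \<beta>
      by (simp add: abs_mult[symmetric] abs_minus_commute diff_divide_distrib[symmetric])
    also have "\<dots> \<le> \<gamma> / \<beta>"
      using wt[of u] u u1 \<beta> by (intro divide_right_mono) (auto intro: less_imp_le)
    finally have ab: "\<bar>?a - ?b\<bar> \<le> \<gamma> / \<beta>" .
    have "\<bar>\<psi>' f0 * (?a / real n) - \<psi>' f0 * (?b / real n)\<bar> = \<bar>\<psi>' f0\<bar> * \<bar>?a - ?b\<bar> / real n"
      by (simp add: right_diff_distrib[symmetric] diff_divide_distrib[symmetric] abs_mult)
    also have "\<dots> \<le> L * (\<gamma> / \<beta>) / real n"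
      by (intro divide_right_mono mult_mono ab \<psi>') (use \<psi>'(1)[of 0] in auto)
    finally have "\<bar>\<psi>' f0 * (?a / real n) - \<psi>' f0 * (?b / real n)\<bar> \<le> L * \<gamma> / (\<beta> * real n)"
      by simp
    with lin[OF Q Dm] lin[OF Q' Dm']
    show "\<bar>(\<integral>z. \<psi> (S (w(m := z))) \<partial>Q) - (\<integral>z. \<psi> (S (w(m := z))) \<partial>Q')\<bar>
        \<le> L * \<gamma> / (\<beta> * real n) + 2 * L2 * A\<^sup>2 / (real n)\<^sup>2"
      unfolding eq by linarith
  qed
  also have "\<dots> = L * \<gamma> / \<beta> + 2 * L2 * A\<^sup>2 / real n"
    using n by (simp add: field_simps power2_eq_square)
  finally show ?thesis .
qed

text \<open>\<open>\<phi>\<close> is the average of \<open>\<psi>\<close> over a window of length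
  \<open>h\<close>, written with an antiderivative. Its derivative is a difference quotient of
  \<open>\<psi>\<close>, hence bounded by \<open>L\<close> and Lipschitz with constant
  \<open>2 * L / h\<close>, which is what \<open>softmin_swap\<close> asks of a test
  function.\<close>

lemma smoothing:
  fixes \<psi> :: "real \<Rightarrow> real"
  assumes B: "\<And>x. \<bar>\<psi> x\<bar> \<le> B" and lip: "\<And>x y. \<bar>\<psi> x - \<psi> y\<bar> \<le> L * \<bar>x - y\<bar>" and L: "0 \<le> L" and h: "0 < h"
  obtains \<phi> \<phi>' where "\<And>x. (\<phi> has_real_derivative \<phi>' x) (at x)" "\<And>x. \<bar>\<phi> x\<bar> \<le> B"
    "\<And>x. \<bar>\<phi>' x\<bar> \<le> L" "\<And>x y. \<bar>\<phi>' x - \<phi>' y\<bar> \<le> 2 * L / h * \<bar>x - y\<bar>" "\<And>x. \<bar>\<phi> x - \<psi> x\<bar> \<le> L * h"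
proof -
  have cont: "isCont \<psi> x" for x
  proof -
    have "continuous_on UNIV \<psi>"
      by (rule lipschitz_on_continuous_on[of L]) (use lip L in \<open>auto intro!: lipschitz_onI simp: dist_real_def\<close>)
    then show ?thesis by (simp add: continuous_on_eq_continuous_at)
  qed
  have "\<exists>F. \<forall>x::real. -\<infinity> < ereal x \<longrightarrow> ereal x < \<infinity> \<longrightarrow> (F has_vector_derivative \<psi> x) (at x)"
    by (rule einterval_antiderivative) (use cont in auto)
  then obtain F where F: "\<And>x. (F has_real_derivative \<psi> x) (at x)"
    by (auto simp: has_real_derivative_iff_has_vector_derivative)
  define \<phi> where "\<phi> x = (F (x + h) - F x) / h" for x
  define \<phi>' where "\<phi>' x = (\<psi> (x + h) - \<psi> x) / h" for x
  have mv: "\<exists>z. \<bar>z - x\<bar> \<le> h \<and> \<phi> x = \<psi> z" for x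
  proof -
    obtain z where "x < z" "z < x + h" "F (x + h) - F x = h * \<psi> z"
      using MVT2[of x "x + h" F \<psi>] F h by auto
    then show ?thesis using h by (intro exI[of _ z]) (auto simp: \<phi>_def)
  qed
  show ?thesis
  proof (rule that[of \<phi> \<phi>'])
    show "(\<phi> has_real_derivative \<phi>' x) (at x)" for x
      unfolding \<phi>_def \<phi>'_def using h
      by (auto intro!: derivative_eq_intros DERIV_chain'[OF _ F, of _ 1, simplified] F)
    show "\<bar>\<phi> x\<bar> \<le> B" for x using mv[of x] B by auto
    show "\<bar>\<phi> x - \<psi> x\<bar> \<le> L * h" for x
    proof -
      obtain z where z: "\<bar>z - x\<bar> \<le> h" "\<phi> x = \<psi> z" using mv by blast
      have "\<bar>\<psi> z - \<psi> x\<bar> \<le> L * \<bar>z - x\<bar>" by (rule lip)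
      also have "\<dots> \<le> L * h" using z L by (intro mult_left_mono) auto
      finally show ?thesis by (simp add: z)
    qed
    show "\<bar>\<phi>' x\<bar> \<le> L" for x
      using lip[of "x + h" x] h by (simp add: \<phi>'_def field_simps)
    show "\<bar>\<phi>' x - \<phi>' y\<bar> \<le> 2 * L / h * \<bar>x - y\<bar>" for x y
    proof -
      have "\<bar>\<phi>' x - \<phi>' y\<bar> = \<bar>(\<psi> (x + h) - \<psi> (y + h)) - (\<psi> x - \<psi> y)\<bar> / h"
        using h by (simp add: \<phi>'_def diff_divide_distrib[symmetric] algebra_simps)
      also have "\<dots> \<le> (2 * L * \<bar>x - y\<bar>) / h"
        using lip[of "x + h" "y + h"] lip[of x y] h by (intro divide_right_mono) auto
      finally show ?thesis by simp
    qed
  qed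
qed

text \<open>The degree \<open>m\<close> and the tolerance \<open>\<tau>\<close> precede the laws,
  the index set and the weights, so they cannot depend on \<open>n\<close>. The Gibbs average stays
  in [exp (-\<beta> A), 1], away from the singularity of the logarithm, and one polynomial works
  there for all weights. Its k-th power is an average over k-tuples with weights of total mass 1;
  hence the tolerance is not multiplied by the number of tuples.\<close>

lemma log_average_close:
  fixes A \<beta> \<gamma> :: real
  assumes \<beta>: "0 < \<beta>" and A: "0 \<le> A" and \<gamma>: "0 < \<gamma>"
  shows "\<exists>(m :: nat) \<tau>. 0 < \<tau> \<and> (\<forall>(Q :: 'z measure) Q' (T :: 't set) l u.
      prob_space Q \<longrightarrow> prob_space Q' \<longrightarrow> sets Q' = sets Q \<longrightarrow> finite T \<longrightarrow>
      (\<forall>\<theta>\<in>T. l \<theta> \<in> borel_measurable Q) \<longrightarrow> (\<forall>\<theta>\<in>T. \<forall>z. 0 \<le> l \<theta> z \<and> l \<theta> z \<le> A) \<longrightarrow>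
      (\<forall>k\<le>m. \<forall>s. (\<forall>j<k. s j \<in> T) \<longrightarrow>
        \<bar>(\<integral>z. (\<Prod>j<k. exp (- \<beta> * l (s j) z)) \<partial>Q) - (\<integral>z. (\<Prod>j<k. exp (- \<beta> * l (s j) z)) \<partial>Q')\<bar> \<le> \<tau>) \<longrightarrow>
      (\<forall>\<theta>\<in>T. 0 \<le> u \<theta>) \<longrightarrow> (\<Sum>\<theta>\<in>T. u \<theta>) = 1 \<longrightarrow>
      \<bar>(\<integral>z. ln (\<Sum>\<theta>\<in>T. u \<theta> * exp (- \<beta> * l \<theta> z)) \<partial>Q) -
       (\<integral>z. ln (\<Sum>\<theta>\<in>T. u \<theta> * exp (- \<beta> * l \<theta> z)) \<partial>Q')\<bar> \<le> \<gamma>)"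
proof -
  let ?I = "{exp (- \<beta> * A)..1}"
  have "continuous_on ?I ln"
    by (intro continuous_intros) (auto simp: not_le intro: less_le_trans[OF exp_gt_zero])
  then obtain g where "real_polynomial_function g" and g: "\<And>x. x \<in> ?I \<Longrightarrow> \<bar>ln x - g x\<bar> < \<gamma> / 3"
    using Stone_Weierstrass_real_polynomial_function[of ?I ln "\<gamma> / 3"] \<gamma> by auto
  then obtain a m where gp: "g = (\<lambda>x. \<Sum>i\<le>m. a i * x ^ i)"
    by (auto simp: real_polynomial_function_iff_sum)
  define b where "b = (\<Sum>i\<le>m. \<bar>a i\<bar>)"
  have b: "0 \<le> b" by (simp add: b_def sum_nonneg)
  \<comment> \<open>A polynomial with coefficients of total absolute value \<open>b\<close>
    amplifies the tolerance by at most \<open>b\<close>; the added 1 avoids division by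
    zero.\<close>
  define \<tau> where "\<tau> = \<gamma> / (3 * (b + 1))"
  have \<tau>: "0 < \<tau>" using \<gamma> b by (simp add: \<tau>_def)
  have b\<tau>: "b * \<tau> \<le> \<gamma> / 3"
    using b \<gamma> by (simp add: \<tau>_def field_simps)
  show ?thesis
  proof (intro exI[of _ m] exI[of _ \<tau>] conjI \<tau> allI impI)
    fix Q Q' :: "'z measure" and T :: "'t set" and l and u :: "'t \<Rightarrow> real"
    assume Q: "prob_space Q" and Q': "prob_space Q'" and sets: "sets Q' = sets Q" and T: "finite T"
      and "\<forall>\<theta>\<in>T. l \<theta> \<in> borel_measurable Q" "\<forall>\<theta>\<in>T. \<forall>z. 0 \<le> l \<theta> z \<and> l \<theta> z \<le> A"
      and close: "\<forall>k\<le>m. \<forall>s. (\<forall>j<k. s j \<in> T) \<longrightarrow>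
        \<bar>(\<integral>z. (\<Prod>j<k. exp (- \<beta> * l (s j) z)) \<partial>Q) - (\<integral>z. (\<Prod>j<k. exp (- \<beta> * l (s j) z)) \<partial>Q')\<bar> \<le> \<tau>"
      and "\<forall>\<theta>\<in>T. 0 \<le> u \<theta>" and u1: "(\<Sum>\<theta>\<in>T. u \<theta>) = 1"
    then have lm: "\<And>\<theta>. \<theta> \<in> T \<Longrightarrow> l \<theta> \<in> borel_measurable Q" and l0: "\<And>\<theta> z. \<theta> \<in> T \<Longrightarrow> 0 \<le> l \<theta> z"
      and lA: "\<And>\<theta> z. \<theta> \<in> T \<Longrightarrow> l \<theta> z \<le> A" and u0: "\<And>\<theta>. \<theta> \<in> T \<Longrightarrow> 0 \<le> u \<theta>" by blast+
    interpret Q: prob_space Q by fact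
    interpret Q': prob_space Q' by fact
    define E where "E z = (\<Sum>\<theta>\<in>T. u \<theta> * exp (- \<beta> * l \<theta> z))" for z
    have lm': "l \<theta> \<in> borel_measurable Q'" if "\<theta> \<in> T" for \<theta>
      using lm[OF that] by (simp cong: measurable_cong_sets[OF sets])
    have Em: "E \<in> borel_measurable Q" "E \<in> borel_measurable Q'"
      unfolding E_def using lm lm' by measurable
    have E1: "E z \<le> 1" for z
    proof -
      have "E z \<le> (\<Sum>\<theta>\<in>T. u \<theta> * 1)"
        unfolding E_def using l0 \<beta> u0 by (intro sum_mono mult_left_mono) auto
      then show ?thesis by (simp add: u1)
    qed
    have E2: "exp (- \<beta> * A) \<le> E z" for z
    proof -
      have "(\<Sum>\<theta>\<in>T. u \<theta> * exp (- \<beta> * A)) \<le> E z"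
        unfolding E_def using lA \<beta> u0 by (intro sum_mono mult_left_mono) auto
      then show ?thesis by (simp add: u1 sum_distrib_right[symmetric])
    qed
    have E0: "0 < E z" for z by (rule less_le_trans[OF _ E2]) simp
    have lnE: "\<bar>ln (E z)\<bar> \<le> \<beta> * A" for z
      using E1[of z] E2[of z] E0[of z] ln_ge_iff[of "E z" "- \<beta> * A"] by auto
    have gE: "\<bar>g (E z)\<bar> \<le> b" for z
    proof -
      have "\<bar>g (E z)\<bar> \<le> (\<Sum>i\<le>m. \<bar>a i * E z ^ i\<bar>)" unfolding gp by (rule sum_abs)
      also have "\<dots> \<le> b" unfolding b_def
        using E0[of z] E1[of z]
        by (intro sum_mono) (auto simp: abs_mult power_le_one intro!: mult_right_le_one_le)
      finally show ?thesis .
    qed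
    have gEm: "(\<lambda>z. g (E z)) \<in> borel_measurable Q" "(\<lambda>z. g (E z)) \<in> borel_measurable Q'"
      unfolding gp using Em by measurable
    have lnEm: "(\<lambda>z. ln (E z)) \<in> borel_measurable Q" "(\<lambda>z. ln (E z)) \<in> borel_measurable Q'"
      using Em by measurable
    have app: "\<bar>(\<integral>z. ln (E z) \<partial>R) - (\<integral>z. g (E z) \<partial>R)\<bar> \<le> \<gamma> / 3"
      if R: "prob_space R" and m1: "(\<lambda>z. ln (E z)) \<in> borel_measurable R" and m2: "(\<lambda>z. g (E z)) \<in> borel_measurable R" for R
    proof -
      have "(\<integral>z. ln (E z) \<partial>R) - (\<integral>z. g (E z) \<partial>R) = (\<integral>z. ln (E z) - g (E z) \<partial>R)"
        by (rule Bochner_Integration.integral_diff[symmetric])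
          (auto intro!: integrable_bounded[OF R m1] integrable_bounded[OF R m2] lnE gE)
      also have "\<bar>\<dots>\<bar> \<le> \<gamma> / 3"
        by (rule abs_integral_le[OF R]) (use m1 m2 g[of "E _"] E1 E2 in \<open>auto intro: less_imp_le\<close>)
      finally show ?thesis .
    qed
    have pow: "(\<integral>z. E z ^ k \<partial>R) = (\<Sum>s\<in>{..<k} \<rightarrow>\<^sub>E T. (\<Prod>j<k. u (s j)) * (\<integral>z. (\<Prod>j<k. exp (- \<beta> * l (s j) z)) \<partial>R))"
      if R: "prob_space R" and m1: "\<And>\<theta>. \<theta> \<in> T \<Longrightarrow> l \<theta> \<in> borel_measurable R" for R k
    proof -
      have "E z ^ k = (\<Sum>s\<in>{..<k} \<rightarrow>\<^sub>E T. (\<Prod>j<k. u (s j)) * (\<Prod>j<k. exp (- \<beta> * l (s j) z)))" for z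
        using prod_sum_PiE[of "{..<k}" "\<lambda>_. T" "\<lambda>_ \<theta>. u \<theta> * exp (- \<beta> * l \<theta> z)"] T
        by (simp add: E_def prod.distrib)
      moreover have "integrable R (\<lambda>z. (\<Prod>j<k. exp (- \<beta> * l (s j) z)))" if s: "s \<in> {..<k} \<rightarrow>\<^sub>E T" for s
      proof (rule integrable_bounded[OF R, where B = 1])
        show "(\<lambda>z. (\<Prod>j<k. exp (- \<beta> * l (s j) z))) \<in> borel_measurable R"
          using s m1 by (intro borel_measurable_prod) (auto simp: PiE_iff)
        fix z
        have "(\<Prod>j<k. exp (- \<beta> * l (s j) z)) \<le> (\<Prod>j<k. 1)"
          using s l0 \<beta> by (intro prod_mono) (auto simp: PiE_iff)
        then show "\<bar>\<Prod>j<k. exp (- \<beta> * l (s j) z)\<bar> \<le> 1"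
          by (simp add: abs_prod)
      qed
      ultimately show ?thesis
        by (simp add: Bochner_Integration.integral_sum)
    qed
    have Epow: "\<bar>(\<integral>z. E z ^ k \<partial>Q) - (\<integral>z. E z ^ k \<partial>Q')\<bar> \<le> \<tau>" if k: "k \<le> m" for k
    proof -
      have "\<bar>(\<integral>z. E z ^ k \<partial>Q) - (\<integral>z. E z ^ k \<partial>Q')\<bar> =
        \<bar>\<Sum>s\<in>{..<k} \<rightarrow>\<^sub>E T. (\<Prod>j<k. u (s j)) * ((\<integral>z. (\<Prod>j<k. exp (- \<beta> * l (s j) z)) \<partial>Q)
           - (\<integral>z. (\<Prod>j<k. exp (- \<beta> * l (s j) z)) \<partial>Q'))\<bar>"
        using pow[OF Q, of k] pow[OF Q', of k] lm lm' by (simp add: sum_subtractf right_diff_distrib)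
      also have "\<dots> \<le> (\<Sum>s\<in>{..<k} \<rightarrow>\<^sub>E T. (\<Prod>j<k. u (s j)) * \<tau>)"
      proof (rule order_trans[OF sum_abs], rule sum_mono)
        fix s assume s: "s \<in> {..<k} \<rightarrow>\<^sub>E T"
        then have "0 \<le> (\<Prod>j<k. u (s j))" using u0 by (intro prod_nonneg) (auto simp: PiE_iff)
        then show "\<bar>(\<Prod>j<k. u (s j)) * ((\<integral>z. (\<Prod>j<k. exp (- \<beta> * l (s j) z)) \<partial>Q)
           - (\<integral>z. (\<Prod>j<k. exp (- \<beta> * l (s j) z)) \<partial>Q'))\<bar> \<le> (\<Prod>j<k. u (s j)) * \<tau>"
          using close[rule_format, OF k, of s] s by (simp add: abs_mult PiE_iff mult_left_mono)
      qed
      also have "\<dots> = \<tau>"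
        using prod_sum_PiE[of "{..<k}" "\<lambda>_. T" "\<lambda>_ \<theta>. u \<theta>"] T
        by (simp add: sum_distrib_right[symmetric] u1)
      finally show ?thesis .
    qed
    have "integrable R (\<lambda>z. E z ^ k)" if "prob_space R" "E \<in> borel_measurable R" for R k
      by (rule integrable_bounded[OF that(1), where B = 1])
        (use that(2) E0 E1 in \<open>auto simp: power_le_one less_imp_le\<close>)
    then have "(\<integral>z. g (E z) \<partial>Q) = (\<Sum>i\<le>m. a i * (\<integral>z. E z ^ i \<partial>Q))"
      "(\<integral>z. g (E z) \<partial>Q') = (\<Sum>i\<le>m. a i * (\<integral>z. E z ^ i \<partial>Q'))"
      using Q Q' Em by (simp_all add: gp)
    then have "\<bar>(\<integral>z. g (E z) \<partial>Q) - (\<integral>z. g (E z) \<partial>Q')\<bar> =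
        \<bar>\<Sum>i\<le>m. a i * ((\<integral>z. E z ^ i \<partial>Q) - (\<integral>z. E z ^ i \<partial>Q'))\<bar>"
      by (simp add: sum_subtractf right_diff_distrib)
    also have "\<dots> \<le> (\<Sum>i\<le>m. \<bar>a i\<bar> * \<tau>)"
      by (rule order_trans[OF sum_abs], rule sum_mono) (auto simp: abs_mult intro!: mult_left_mono Epow)
    also have "\<dots> \<le> \<gamma> / 3"
      using b\<tau> by (simp add: b_def sum_distrib_right)
    finally show "\<bar>(\<integral>z. ln (\<Sum>\<theta>\<in>T. u \<theta> * exp (- \<beta> * l \<theta> z)) \<partial>Q) -
       (\<integral>z. ln (\<Sum>\<theta>\<in>T. u \<theta> * exp (- \<beta> * l \<theta> z)) \<partial>Q')\<bar> \<le> \<gamma>"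
      using app[OF Q lnEm(1) gEm(1)] app[OF Q' lnEm(2) gEm(2)] unfolding E_def[symmetric] by linarith
  qed
qed

section \<open>Packing in symmetric convex bodies\<close>

lemma abs_dotp_le: "\<bar>dotp p u v\<bar> \<le> vnorm p u * vnorm p v"
proof -
  have "\<bar>dotp p u v\<bar> \<le> (\<Sum>i<p. \<bar>u i\<bar> * \<bar>v i\<bar>)"
    unfolding dotp_def by (rule order_trans[OF sum_abs]) (simp add: abs_mult)
  also have "\<dots> \<le> vnorm p u * vnorm p v"
    unfolding vnorm_def by (rule L2_set_mult_ineq)
  finally show ?thesis .
qed

lemma vnorm_nonneg[simp]: "0 \<le> vnorm p u"
  by (simp add: vnorm_def L2_set_nonneg)

lemma abs_coord_le_vnorm: "i < p \<Longrightarrow> \<bar>u i\<bar> \<le> vnorm p u"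
  unfolding vnorm_def using member_le_L2_set[of "{..<p}" i "\<lambda>i. \<bar>u i\<bar>"]
  by (simp add: L2_set_def)

lemma vnorm_le_sum: "vnorm p u \<le> (\<Sum>i<p. \<bar>u i\<bar>)"
  unfolding vnorm_def by (rule L2_set_le_sum_abs)

lemma measurable_component_Rvec[measurable]: "i < p \<Longrightarrow> (\<lambda>v. v i) \<in> borel_measurable (Rvec_borel p)"
  unfolding Rvec_borel_def by measurable

lemma measurable_dotp[measurable]: "dotp p \<theta> \<in> borel_measurable (Rvec_borel p)"
  unfolding dotp_def[abs_def] by (intro borel_measurable_sum) measurable

lemma measurable_vnorm[measurable]: "vnorm p \<in> borel_measurable (Rvec_borel p)"
  unfolding vnorm_def[abs_def] L2_set_def by measurable

abbreviation lebp :: "nat \<Rightarrow> (nat \<Rightarrow> real) measure" where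
  "lebp p \<equiv> PiM {..<p} (\<lambda>_. lborel)"

lemma space_lebp: "space (lebp p) = Rvec p"
  by (simp add: Rvec_def space_PiM)

text \<open>\<open>affp p t c v \<in> K\<close> says that \<open>v\<close> lies in the translated
  dilate t + cK; nets and separation in the gauge of a convex body are expressed in this way without
  introducing a norm.\<close>

definition affp :: "nat \<Rightarrow> (nat \<Rightarrow> real) \<Rightarrow> real \<Rightarrow> (nat \<Rightarrow> real) \<Rightarrow> nat \<Rightarrow> real" where
  "affp p t c v = (\<lambda>i\<in>{..<p}. (v i - t i) / c)"

lemma affp_Rvec[simp]: "affp p t c v \<in> Rvec p"
  by (auto simp: affp_def Rvec_def)

lemma measurable_affp: "affp p t c \<in> lebp p \<rightarrow>\<^sub>M lebp p"
  unfolding affp_def[abs_def] by (rule measurable_restrict) measurable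

lemma emeasure_lborel_affine_vimage:
  fixes t c :: real
  assumes "0 < c" "A \<in> sets borel"
  shows "ennreal (1 / c) * emeasure lborel ((\<lambda>x. (x - t) / c) -` A) = emeasure lborel A"
proof -
  have "emeasure lborel A = emeasure (density (distr lborel borel (\<lambda>x. - t / c + (1 / c) * x)) (\<lambda>_. ennreal \<bar>1 / c\<bar>)) A"
    using lborel_real_affine[of "1 / c" "- t / c"] assms by simp
  also have "\<dots> = ennreal (1 / c) * emeasure (distr lborel borel (\<lambda>x. - t / c + (1 / c) * x)) A"
    using assms by (simp add: emeasure_density_const)
  also have "(\<lambda>x. - t / c + (1 / c) * x) = (\<lambda>x. (x - t) / c)"
    by (auto simp: fun_eq_iff diff_divide_distrib)
  also have "emeasure (distr lborel borel (\<lambda>x. (x - t) / c)) A = emeasure lborel ((\<lambda>x. (x - t) / c) -` A)"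
    using assms by (subst emeasure_distr) auto
  finally show ?thesis by simp
qed

text \<open>Both sides are measures in \<open>A\<close>, and they are compared on boxes, where the
  product measure factorizes and the one-dimensional scaling applies.\<close>

lemma emeasure_lebp_affine:
  assumes c: "0 < c" and A: "A \<in> sets (lebp p)"
  shows "ennreal (1 / c) ^ p * emeasure (lebp p) (affp p t c -` A \<inter> Rvec p) = emeasure (lebp p) A"
proof -
  interpret P: product_sigma_finite "\<lambda>_::nat. lborel :: real measure" ..
  interpret F: finite_product_sigma_finite "\<lambda>_::nat. lborel :: real measure" "{..<p}" by standard auto
  have "density (distr (lebp p) (lebp p) (affp p t c)) (\<lambda>_. ennreal (1 / c) ^ p) = lebp p"
  proof (rule P.PiM_eqI)
    fix A :: "nat \<Rightarrow> real set" assume A: "\<And>i. i \<in> {..<p} \<Longrightarrow> A i \<in> sets lborel"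
    have s: "Pi\<^sub>E {..<p} A \<in> sets (lebp p)" using A by (intro sets_PiM_I_finite) auto
    have v: "affp p t c -` (Pi\<^sub>E {..<p} A) \<inter> space (lebp p) = (\<Pi>\<^sub>E i\<in>{..<p}. (\<lambda>x. (x - t i) / c) -` A i)"
      by (auto simp: affp_def space_PiM PiE_iff)
    have m: "(\<lambda>x. (x - t i) / c) -` A i \<in> sets borel" if "i < p" for i
      using measurable_sets[of "\<lambda>x. (x - t i) / c" borel borel "A i"] A[of i] that by auto
    have "emeasure (density (distr (lebp p) (lebp p) (affp p t c)) (\<lambda>_. ennreal (1 / c) ^ p)) (Pi\<^sub>E {..<p} A) =
      ennreal (1 / c) ^ p * (\<Prod>i<p. emeasure lborel ((\<lambda>x. (x - t i) / c) -` A i))"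
    proof -
      have "emeasure (lebp p) (\<Pi>\<^sub>E i\<in>{..<p}. (\<lambda>x. (x - t i) / c) -` A i) = (\<Prod>i<p. emeasure lborel ((\<lambda>x. (x - t i) / c) -` A i))"
        by (rule P.emeasure_PiM) (use m in auto)
      then show ?thesis
        using s by (simp add: emeasure_density_const emeasure_distr measurable_affp v)
    qed
    also have "\<dots> = (\<Prod>i<p. ennreal (1 / c) * emeasure lborel ((\<lambda>x. (x - t i) / c) -` A i))"
      by (simp add: prod.distrib)
    also have "\<dots> = (\<Prod>i<p. emeasure lborel (A i))"
      by (intro prod.cong refl emeasure_lborel_affine_vimage c) (use A in auto)
    finally show "emeasure (density (distr (lebp p) (lebp p) (affp p t c)) (\<lambda>_. ennreal (1 / c) ^ p)) (Pi\<^sub>E {..<p} A)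
      = (\<Prod>i<p. emeasure lborel (A i))" .
  qed auto
  then have "emeasure (lebp p) A = emeasure (density (distr (lebp p) (lebp p) (affp p t c)) (\<lambda>_. ennreal (1 / c) ^ p)) A"
    by simp
  also have "\<dots> = ennreal (1 / c) ^ p * emeasure (lebp p) (affp p t c -` A \<inter> Rvec p)"
    using A by (simp add: emeasure_density_const emeasure_distr measurable_affp space_lebp)
  finally show ?thesis by simp
qed

lemma sym_convex_comb:
  assumes K: "sym_convex p K" and "u \<in> K" "v \<in> K" "0 \<le> a" "0 \<le> b" "a + b = 1"
  shows "(\<lambda>i\<in>{..<p}. a * u i + b * v i) \<in> K"
proof -
  have "vadd p (vscale p (1 - b) u) (vscale p b v) \<in> K"
    using assms unfolding sym_convex_def by auto
  also have "vadd p (vscale p (1 - b) u) (vscale p b v) = (\<lambda>i\<in>{..<p}. a * u i + b * v i)"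
  proof -
    have "a = 1 - b" using assms(6) by simp
    then show ?thesis by (auto simp: vadd_def vscale_def fun_eq_iff)
  qed
  finally show ?thesis .
qed

lemma sym_convex_neg:
  assumes K: "sym_convex p K" and "u \<in> K"
  shows "(\<lambda>i\<in>{..<p}. - u i) \<in> K"
  using assms unfolding sym_convex_def vscale_def by auto

text \<open>Volume comparison: the bodies \<theta> + (\<delta>/2)K around the points of
  \<open>P\<close> are disjoint and lie in (\<kappa> + \<delta>/2)K. The volume of \<open>K\<close>
  cancels.\<close>

lemma packing_bound:
  assumes K: "sym_convex p K" "K \<in> sets (lebp p)"
    and pos: "emeasure (lebp p) K \<noteq> 0" and fin: "emeasure (lebp p) K \<noteq> \<infinity>"
    and \<delta>: "0 < \<delta>" and \<kappa>: "0 < \<kappa>"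
    and P: "finite P" "P \<subseteq> Rvec p" "\<And>\<theta>. \<theta> \<in> P \<Longrightarrow> affp p (\<lambda>_. 0) \<kappa> \<theta> \<in> K"
    and sep: "\<And>\<theta> \<theta>'. \<theta> \<in> P \<Longrightarrow> \<theta>' \<in> P \<Longrightarrow> \<theta> \<noteq> \<theta>' \<Longrightarrow> affp p \<theta>' \<delta> \<theta> \<notin> K"
  shows "real (card P) \<le> (1 + 2 * \<kappa> / \<delta>) ^ p"
proof -
  define B where "B \<theta> = affp p \<theta> (\<delta> / 2) -` K \<inter> Rvec p" for \<theta>
  define D where "D = affp p (\<lambda>_. 0) (\<kappa> + \<delta> / 2) -` K \<inter> Rvec p"
  let ?v = "emeasure (lebp p) K"
  have Bs: "B \<theta> \<in> sets (lebp p)" for \<theta>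
    unfolding B_def using measurable_sets[OF measurable_affp K(2)] by (simp add: space_lebp)
  have Ds: "D \<in> sets (lebp p)"
    unfolding D_def using measurable_sets[OF measurable_affp K(2)] by (simp add: space_lebp)
  have disj: "disjoint_family_on B P"
    unfolding disjoint_family_on_def
  proof (intro ballI impI)
    fix \<theta> \<theta>' assume \<theta>: "\<theta> \<in> P" "\<theta>' \<in> P" "\<theta> \<noteq> \<theta>'"
    have False if v: "v \<in> B \<theta>" "v \<in> B \<theta>'" for v
    proof -
      have n: "(\<lambda>i\<in>{..<p}. - affp p \<theta> (\<delta> / 2) v i) \<in> K" and a: "affp p \<theta>' (\<delta> / 2) v \<in> K"
        using v by (auto intro!: sym_convex_neg[OF K(1)] simp del: restrict_apply simp: B_def)
      \<comment> \<open>A common point \<open>v\<close> would make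
        \<open>affp p \<theta>' \<delta> \<theta>\<close> the midpoint of two points of
        \<open>K\<close>, against the separation.\<close>
      have "(\<lambda>i\<in>{..<p}. (1/2) * affp p \<theta>' (\<delta> / 2) v i + (1/2) * (\<lambda>i\<in>{..<p}. - affp p \<theta> (\<delta> / 2) v i) i) \<in> K"
        by (rule sym_convex_comb[OF K(1) a n]) auto
      also have "(\<lambda>i\<in>{..<p}. (1/2) * affp p \<theta>' (\<delta> / 2) v i + (1/2) * (\<lambda>i\<in>{..<p}. - affp p \<theta> (\<delta> / 2) v i) i) = affp p \<theta>' \<delta> \<theta>"
        using \<delta> by (auto simp: affp_def fun_eq_iff field_simps)
      finally show False using sep[OF \<theta>] by simp
    qed
    then show "B \<theta> \<inter> B \<theta>' = {}" by auto
  qed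
  have sub: "B \<theta> \<subseteq> D" if \<theta>: "\<theta> \<in> P" for \<theta>
  proof
    fix v assume v: "v \<in> B \<theta>"
    \<comment> \<open>Convexity, with weights proportional to \<kappa> and \<delta>/2, puts
      \<kappa>K + (\<delta>/2)K inside (\<kappa> + \<delta>/2)K.\<close>
    have "(\<lambda>i\<in>{..<p}. (\<kappa> / (\<kappa> + \<delta> / 2)) * affp p (\<lambda>_. 0) \<kappa> \<theta> i + ((\<delta> / 2) / (\<kappa> + \<delta> / 2)) * affp p \<theta> (\<delta> / 2) v i) \<in> K"
    proof (rule sym_convex_comb[OF K(1) P(3)[OF \<theta>]])
      show "\<kappa> / (\<kappa> + \<delta> / 2) + (\<delta> / 2) / (\<kappa> + \<delta> / 2) = 1"
        unfolding add_divide_distrib[symmetric] using \<delta> \<kappa> by simp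
    qed (use v \<delta> \<kappa> in \<open>auto simp: B_def\<close>)
    also have "(\<lambda>i\<in>{..<p}. (\<kappa> / (\<kappa> + \<delta> / 2)) * affp p (\<lambda>_. 0) \<kappa> \<theta> i + ((\<delta> / 2) / (\<kappa> + \<delta> / 2)) * affp p \<theta> (\<delta> / 2) v i)
      = affp p (\<lambda>_. 0) (\<kappa> + \<delta> / 2) v"
    proof -
      have "(\<kappa> / s) * ((a - 0) / \<kappa>) + (d / s) * ((b - a) / d) = (b - 0) / s" if "0 < d" for a b s d :: real
        using that \<kappa> by (simp add: add_divide_distrib[symmetric])
      note aux = this
      have half: "0 < \<delta> / 2" using \<delta> by simp
      show ?thesis
      proof
        fix i show "(\<lambda>i\<in>{..<p}. (\<kappa> / (\<kappa> + \<delta> / 2)) * affp p (\<lambda>_. 0) \<kappa> \<theta> i + ((\<delta> / 2) / (\<kappa> + \<delta> / 2)) * affp p \<theta> (\<delta> / 2) v i) i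
          = affp p (\<lambda>_. 0) (\<kappa> + \<delta> / 2) v i"
          unfolding affp_def by (cases "i \<in> {..<p}") (simp_all only: restrict_apply if_True if_False aux[OF half])
      qed
    qed
    finally show "v \<in> D" using v by (auto simp: D_def B_def)
  qed
  have eB: "emeasure (lebp p) (B \<theta>) = ennreal (\<delta> / 2) ^ p * ?v" for \<theta>
  proof -
    have "ennreal (\<delta> / 2) ^ p * ?v = (ennreal (\<delta> / 2) * ennreal (1 / (\<delta> / 2))) ^ p * emeasure (lebp p) (B \<theta>)"
      using emeasure_lebp_affine[of "\<delta> / 2" K p \<theta>] \<delta> K(2)
      by (simp add: B_def power_mult_distrib mult.assoc)
    also have "ennreal (\<delta> / 2) * ennreal (1 / (\<delta> / 2)) = 1"
      using \<delta> by (simp add: ennreal_mult[symmetric])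
    finally show ?thesis by simp
  qed
  have eD: "emeasure (lebp p) D = ennreal (\<kappa> + \<delta> / 2) ^ p * ?v"
  proof -
    have "ennreal (\<kappa> + \<delta> / 2) ^ p * ?v = (ennreal (\<kappa> + \<delta> / 2) * ennreal (1 / (\<kappa> + \<delta> / 2))) ^ p * emeasure (lebp p) D"
      using emeasure_lebp_affine[of "\<kappa> + \<delta> / 2" K p "\<lambda>_. 0"] \<delta> \<kappa> K(2)
      by (simp add: D_def power_mult_distrib mult.assoc)
    also have "ennreal (\<kappa> + \<delta> / 2) * ennreal (1 / (\<kappa> + \<delta> / 2)) = 1"
      using \<delta> \<kappa> by (subst ennreal_mult[symmetric]) (auto simp del: ennreal_plus)
    finally show ?thesis by simp
  qed
  have "of_nat (card P) * (ennreal (\<delta> / 2) ^ p * ?v) = (\<Sum>\<theta>\<in>P. emeasure (lebp p) (B \<theta>))"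
    by (simp add: eB)
  also have "\<dots> = emeasure (lebp p) (\<Union>\<theta>\<in>P. B \<theta>)"
    using disj P(1) Bs by (intro sum_emeasure) auto
  also have "\<dots> \<le> emeasure (lebp p) D"
    using sub Ds by (intro emeasure_mono) auto
  finally have le: "of_nat (card P) * (ennreal (\<delta> / 2) ^ p * ?v) \<le> ennreal (\<kappa> + \<delta> / 2) ^ p * ?v"
    by (simp add: eD)
  obtain v where v: "?v = ennreal v" "0 < v"
    using pos fin by (cases ?v) auto
  have "of_nat (card P) * (ennreal (\<delta> / 2) ^ p * ?v) = ennreal (real (card P) * ((\<delta> / 2) ^ p * v))"
    using \<delta> v by (simp add: ennreal_mult ennreal_power ennreal_of_nat_eq_real_of_nat)
  moreover have "ennreal (\<kappa> + \<delta> / 2) ^ p * ?v = ennreal ((\<kappa> + \<delta> / 2) ^ p * v)"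
  proof -
    have e: "ennreal (\<kappa> + \<delta> / 2) ^ p = ennreal ((\<kappa> + \<delta> / 2) ^ p)"
      using \<delta> \<kappa> by (intro ennreal_power) auto
    show ?thesis unfolding e v(1) using \<delta> \<kappa> v(2) by (intro ennreal_mult[symmetric]) auto
  qed
  ultimately have "real (card P) * ((\<delta> / 2) ^ p * v) \<le> (\<kappa> + \<delta> / 2) ^ p * v"
    using le \<delta> \<kappa> v by (simp add: ennreal_le_iff)
  then have "real (card P) * (\<delta> / 2) ^ p \<le> (\<kappa> + \<delta> / 2) ^ p"
    using v by simp
  then have "real (card P) \<le> ((\<kappa> + \<delta> / 2) / (\<delta> / 2)) ^ p"
    unfolding power_divide[of "\<kappa> + \<delta> / 2"] using \<delta> by (subst pos_le_divide_eq) auto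
  also have "(\<kappa> + \<delta> / 2) / (\<delta> / 2) = 1 + 2 * \<kappa> / \<delta>"
    using \<delta> by (simp add: field_simps)
  finally show ?thesis .
qed

text \<open>A separated set of greatest cardinality is a net, since a point that it misses could be
  added; \<open>packing_bound\<close> ensures that a greatest cardinality exists.\<close>

lemma net_exists:
  assumes K: "sym_convex p K" "K \<in> sets (lebp p)"
    and pos: "emeasure (lebp p) K \<noteq> 0" and fin: "emeasure (lebp p) K \<noteq> \<infinity>"
    and \<delta>: "0 < \<delta>" and \<kappa>: "0 < \<kappa>"
    and C: "C \<subseteq> Rvec p" "\<And>\<theta>. \<theta> \<in> C \<Longrightarrow> affp p (\<lambda>_. 0) \<kappa> \<theta> \<in> K"
  obtains T where "finite T" "T \<subseteq> C" "real (card T) \<le> (1 + 2 * \<kappa> / \<delta>) ^ p"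
    "\<And>\<theta>. \<theta> \<in> C \<Longrightarrow> \<exists>\<theta>'\<in>T. affp p \<theta>' \<delta> \<theta> \<in> K"
proof -
  define good where "good P \<longleftrightarrow> finite P \<and> P \<subseteq> C \<and>
    (\<forall>\<theta>\<in>P. \<forall>\<theta>'\<in>P. \<theta> \<noteq> \<theta>' \<longrightarrow> affp p \<theta>' \<delta> \<theta> \<notin> K)" for P
  have bound: "real (card P) \<le> (1 + 2 * \<kappa> / \<delta>) ^ p" if "good P" for P
    by (rule packing_bound[OF K pos fin \<delta> \<kappa>]) (use that C in \<open>auto simp: good_def\<close>)
  have "good {}" by (simp add: good_def)
  moreover have "\<forall>P. good P \<longrightarrow> card P < Suc (nat \<lfloor>(1 + 2 * \<kappa> / \<delta>) ^ p\<rfloor>)"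
    using bound by (auto simp: less_Suc_eq_le le_nat_floor)
  ultimately obtain T where T: "good T" and max: "\<And>P. good P \<Longrightarrow> card P \<le> card T"
    using ex_has_greatest_nat[of good "{}" card] by blast
  show ?thesis
  proof (rule that[of T])
    fix \<theta> assume \<theta>: "\<theta> \<in> C"
    show "\<exists>\<theta>'\<in>T. affp p \<theta>' \<delta> \<theta> \<in> K"
    proof (rule ccontr)
      assume no: "\<not> ?thesis"
      \<comment> \<open>A missed point that belonged to \<open>T\<close> would be covered by itself,
        because 0 lies in \<open>K\<close> as the midpoint of \<open>k\<close> and its
        negative.\<close>
      have ns: "\<theta> \<notin> T \<or> (\<exists>\<theta>'\<in>T. affp p \<theta> \<delta> \<theta>' \<in> K)"
      proof (cases "K = {}")
        case True
        then show ?thesis using pos by simp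
      next
        case False
        then obtain k where k: "k \<in> K" by auto
        have "(\<lambda>i\<in>{..<p}. (1/2) * k i + (1/2) * (\<lambda>i\<in>{..<p}. - k i) i) \<in> K"
          using k by (intro sym_convex_comb[OF K(1)] sym_convex_neg[OF K(1)]) auto
        also have "(\<lambda>i\<in>{..<p}. (1/2) * k i + (1/2) * (\<lambda>i\<in>{..<p}. - k i) i) = affp p \<theta> \<delta> \<theta>"
          by (auto simp: affp_def)
        finally show ?thesis by blast
      qed
      have sy: "affp p \<theta> \<delta> \<theta>' \<notin> K" if "\<theta>' \<in> T" for \<theta>'
      proof
        assume "affp p \<theta> \<delta> \<theta>' \<in> K"
        then have "(\<lambda>i\<in>{..<p}. - affp p \<theta> \<delta> \<theta>' i) \<in> K" by (rule sym_convex_neg[OF K(1)])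
        also have "(\<lambda>i\<in>{..<p}. - affp p \<theta> \<delta> \<theta>' i) = affp p \<theta>' \<delta> \<theta>"
          by (auto simp: affp_def fun_eq_iff minus_divide_left)
        finally show False using no that by blast
      qed
      with ns have "\<theta> \<notin> T" by blast
      moreover have "good (insert \<theta> T)"
        using T \<theta> no sy by (auto simp: good_def)
      ultimately show False
        using max[of "insert \<theta> T"] T by (simp add: good_def)
    qed
  qed (use T bound in \<open>auto simp: good_def\<close>)
qed

section \<open>Convex body of directions with bounded truncated exponential moments\<close>

lemma vnorm_comb:
  assumes "0 \<le> a" "0 \<le> b"
  shows "vnorm p (\<lambda>i\<in>{..<p}. a * u i + b * v i) \<le> a * vnorm p u + b * vnorm p v"
proof -
  have "vnorm p (\<lambda>i\<in>{..<p}. a * u i + b * v i) = L2_set (\<lambda>i. a * u i + b * v i) {..<p}"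
    by (auto simp: vnorm_def L2_set_def)
  also have "\<dots> \<le> L2_set (\<lambda>i. a * u i) {..<p} + L2_set (\<lambda>i. b * v i) {..<p}"
    by (rule L2_set_triangle_ineq)
  also have "\<dots> = a * vnorm p u + b * vnorm p v"
    using assms by (simp add: vnorm_def L2_set_right_distrib)
  finally show ?thesis .
qed

lemma dotp_comb: "dotp p (\<lambda>i\<in>{..<p}. a * u i + b * v i) x = a * dotp p u x + b * dotp p v x"
  by (simp add: dotp_def sum_distrib_left sum.distrib algebra_simps)

text \<open>
  Subgaussianity is available only in directions of the constraint set, so two of its points that
  are close in the Euclidean norm need not have close projections. Nets are therefore taken in the
  gauge of the convex body of all directions with controlled truncated exponential moments.
  The truncation at M ensures that the body contains a small ball; the packing bound only needs its
  volume to be positive and finite.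
\<close>

definition trunc_mgf :: "nat \<Rightarrow> 'z measure \<Rightarrow> ('z \<Rightarrow> nat \<Rightarrow> real) \<Rightarrow> real \<Rightarrow> (nat \<Rightarrow> real) \<Rightarrow> real" where
  "trunc_mgf p R X M \<theta> = (\<integral>z. exp (of_bool (vnorm p (X z) \<le> M) * \<bar>dotp p \<theta> (X z)\<bar>) \<partial>R)"

lemma trunc_exp_bounded:
  assumes "0 \<le> M"
  shows "of_bool (vnorm p x \<le> M) * \<bar>dotp p \<theta> x\<bar> \<le> M * vnorm p \<theta>"
proof (cases "vnorm p x \<le> M")
  case True
  have "\<bar>dotp p \<theta> x\<bar> \<le> vnorm p \<theta> * vnorm p x" by (rule abs_dotp_le)
  also have "\<dots> \<le> vnorm p \<theta> * M" using True by (intro mult_left_mono) auto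
  finally show ?thesis using True by (simp add: mult.commute)
qed (use assms in simp)

lemma trunc_mgf_integrable:
  assumes R: "prob_space R" and X[measurable]: "X \<in> R \<rightarrow>\<^sub>M Rvec_borel p" and M: "0 \<le> M"
  shows "integrable R (\<lambda>z. exp (of_bool (vnorm p (X z) \<le> M) * \<bar>dotp p \<theta> (X z)\<bar>))"
  by (rule integrable_bounded[OF R, where B = "exp (M * vnorm p \<theta>)"])
    (use trunc_exp_bounded[OF M] in auto)

text \<open>Both laws are imposed together so that one net serves both models. The unit ball keeps
  the volume finite and makes closeness in the gauge imply Euclidean closeness, by which the penalty
  is compared.\<close>

definition subexp_body :: "nat \<Rightarrow> 'z measure \<Rightarrow> 'z measure \<Rightarrow> ('z \<Rightarrow> nat \<Rightarrow> real) \<Rightarrow> real \<Rightarrow> (nat \<Rightarrow> real) set" where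
  "subexp_body p R R' X M = {\<theta> \<in> Rvec p. vnorm p \<theta> \<le> 1 \<and> trunc_mgf p R X M \<theta> \<le> 10 \<and> trunc_mgf p R' X M \<theta> \<le> 10}"

lemma trunc_mgf_comb:
  assumes R: "prob_space R" and X: "X \<in> R \<rightarrow>\<^sub>M Rvec_borel p" and M: "0 \<le> M"
    and ab: "0 \<le> a" "0 \<le> b" "a + b = 1"
  shows "trunc_mgf p R X M (\<lambda>i\<in>{..<p}. a * u i + b * v i) \<le> a * trunc_mgf p R X M u + b * trunc_mgf p R X M v"
proof -
  note int = trunc_mgf_integrable[OF R X M]
  have "trunc_mgf p R X M (\<lambda>i\<in>{..<p}. a * u i + b * v i) \<le>
    (\<integral>z. a * exp (of_bool (vnorm p (X z) \<le> M) * \<bar>dotp p u (X z)\<bar>) + b * exp (of_bool (vnorm p (X z) \<le> M) * \<bar>dotp p v (X z)\<bar>) \<partial>R)"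
    unfolding trunc_mgf_def
  proof (rule integral_mono)
    fix z
    let ?b = "of_bool (vnorm p (X z) \<le> M) :: real"
    have "?b * \<bar>dotp p (\<lambda>i\<in>{..<p}. a * u i + b * v i) (X z)\<bar> \<le> ?b * (a * \<bar>dotp p u (X z)\<bar> + b * \<bar>dotp p v (X z)\<bar>)"
      unfolding dotp_comb using ab
      by (intro mult_left_mono order_trans[OF abs_triangle_ineq]) (auto simp: abs_mult)
    also have "\<dots> = a * (?b * \<bar>dotp p u (X z)\<bar>) + b * (?b * \<bar>dotp p v (X z)\<bar>)"
      by (simp add: algebra_simps)
    finally have "exp (?b * \<bar>dotp p (\<lambda>i\<in>{..<p}. a * u i + b * v i) (X z)\<bar>)
       \<le> exp (a * (?b * \<bar>dotp p u (X z)\<bar>) + b * (?b * \<bar>dotp p v (X z)\<bar>))" by simp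
    also have "\<dots> \<le> a * exp (?b * \<bar>dotp p u (X z)\<bar>) + b * exp (?b * \<bar>dotp p v (X z)\<bar>)"
      using convex_onD[OF exp_convex, of b "?b * \<bar>dotp p u (X z)\<bar>" "?b * \<bar>dotp p v (X z)\<bar>"] ab
      by (simp add: eq_diff_eq[symmetric])
    finally show "exp (?b * \<bar>dotp p (\<lambda>i\<in>{..<p}. a * u i + b * v i) (X z)\<bar>) \<le> \<dots>" .
  qed (auto intro!: int)
  also have "\<dots> = a * trunc_mgf p R X M u + b * trunc_mgf p R X M v"
    unfolding trunc_mgf_def using int by simp
  finally show ?thesis .
qed

lemma subexp_body_convex:
  assumes R: "prob_space R" and X: "X \<in> R \<rightarrow>\<^sub>M Rvec_borel p"
    and R': "prob_space R'" and X': "X \<in> R' \<rightarrow>\<^sub>M Rvec_borel p" and M: "0 \<le> M"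
  shows "sym_convex p (subexp_body p R R' X M)"
  unfolding sym_convex_def
proof (intro conjI ballI)
  show "subexp_body p R R' X M \<subseteq> Rvec p" by (auto simp: subexp_body_def)
next
  fix u assume u: "u \<in> subexp_body p R R' X M"
  have "\<bar>dotp p (vscale p (-1) u) x\<bar> = \<bar>dotp p u x\<bar>" for x
    by (simp add: dotp_def vscale_def sum_negf)
  then show "vscale p (-1) u \<in> subexp_body p R R' X M"
    using u by (auto simp: subexp_body_def vnorm_vscale trunc_mgf_def) (auto simp: Rvec_def vscale_def)
next
  fix u v t assume u: "u \<in> subexp_body p R R' X M" and v: "v \<in> subexp_body p R R' X M" and t: "t \<in> {0..1::real}"
  have eq: "vadd p (vscale p (1 - t) u) (vscale p t v) = (\<lambda>i\<in>{..<p}. (1 - t) * u i + t * v i)" (is "_ = ?w")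
    by (auto simp: vadd_def vscale_def)
  have "vnorm p ?w \<le> (1 - t) * vnorm p u + t * vnorm p v" using t by (intro vnorm_comb) auto
  also have "\<dots> \<le> 1" using u v t by (intro convex_bound_le) (auto simp: subexp_body_def)
  finally have 1: "vnorm p ?w \<le> 1" .
  have 2: "trunc_mgf p P X M ?w \<le> 10" if "prob_space P" "X \<in> P \<rightarrow>\<^sub>M Rvec_borel p" "trunc_mgf p P X M u \<le> 10" "trunc_mgf p P X M v \<le> 10" for P
  proof -
    have "trunc_mgf p P X M ?w \<le> (1 - t) * trunc_mgf p P X M u + t * trunc_mgf p P X M v"
      using t by (intro trunc_mgf_comb that M) auto
    also have "\<dots> \<le> 10" using that t by (intro convex_bound_le) auto
    finally show ?thesis .
  qed
  show "vadd p (vscale p (1 - t) u) (vscale p t v) \<in> subexp_body p R R' X M"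
    unfolding eq using 1 2[OF R X] 2[OF R' X'] u v by (auto simp: subexp_body_def Rvec_def)
qed

lemma sets_lebp_Rvec: "sets (lebp p) = sets (Rvec_borel p)"
  unfolding Rvec_borel_def by (intro sets_PiM_cong) auto

lemma trunc_mgf_measurable:
  assumes R: "prob_space R" and X[measurable]: "X \<in> R \<rightarrow>\<^sub>M Rvec_borel p"
  shows "trunc_mgf p R X M \<in> borel_measurable (lebp p)"
proof -
  interpret prob_space R by fact
  have c: "(\<lambda>v. v i) \<in> borel_measurable (lebp p)" if "i < p" for i
    using measurable_component_Rvec[OF that] unfolding measurable_cong_sets[OF sets_lebp_Rvec refl] .
  have "(\<lambda>(\<theta>, z). dotp p \<theta> (X z)) \<in> borel_measurable (lebp p \<Otimes>\<^sub>M R)"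
    unfolding dotp_def case_prod_beta'
  proof (intro borel_measurable_sum borel_measurable_times)
    fix i assume i: "i \<in> {..<p}"
    show "(\<lambda>x. fst x i) \<in> borel_measurable (lebp p \<Otimes>\<^sub>M R)"
      using i by (intro measurable_compose[OF measurable_fst c]) auto
    show "(\<lambda>x. X (snd x) i) \<in> borel_measurable (lebp p \<Otimes>\<^sub>M R)"
      using i by (intro measurable_compose[OF measurable_snd] measurable_compose[OF X]) auto
  qed
  then have [measurable]: "(\<lambda>x. dotp p (fst x) (X (snd x))) \<in> borel_measurable (lebp p \<Otimes>\<^sub>M R)"
    by (simp add: case_prod_beta')
  show ?thesis
    unfolding trunc_mgf_def[abs_def]
    by (rule borel_measurable_lebesgue_integral) (simp add: case_prod_beta', measurable)
qed

lemma subexp_body_measurable: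
  assumes R: "prob_space R" and X: "X \<in> R \<rightarrow>\<^sub>M Rvec_borel p"
    and R': "prob_space R'" and X': "X \<in> R' \<rightarrow>\<^sub>M Rvec_borel p"
  shows "subexp_body p R R' X M \<in> sets (lebp p)"
proof -
  have [measurable]: "trunc_mgf p R X M \<in> borel_measurable (lebp p)" "trunc_mgf p R' X M \<in> borel_measurable (lebp p)"
    by (rule trunc_mgf_measurable; fact)+
  have [measurable]: "vnorm p \<in> borel_measurable (lebp p)"
    using measurable_vnorm[of p] unfolding measurable_cong_sets[OF sets_lebp_Rvec refl] .
  have "subexp_body p R R' X M = {\<theta> \<in> space (lebp p). vnorm p \<theta> \<le> 1 \<and> trunc_mgf p R X M \<theta> \<le> 10 \<and> trunc_mgf p R' X M \<theta> \<le> 10}"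
    by (simp add: subexp_body_def space_lebp)
  also have "\<dots> \<in> sets (lebp p)" by measurable
  finally show ?thesis .
qed

lemma exp_1_le_10: "exp (1 :: real) \<le> 10"
  using exp_le by simp

lemma subexp_body_emeasure:
  assumes R: "prob_space R" and X: "X \<in> R \<rightarrow>\<^sub>M Rvec_borel p"
    and R': "prob_space R'" and X': "X \<in> R' \<rightarrow>\<^sub>M Rvec_borel p" and M: "0 \<le> M"
  shows "emeasure (lebp p) (subexp_body p R R' X M) \<noteq> 0" "emeasure (lebp p) (subexp_body p R R' X M) \<noteq> \<infinity>"
proof -
  interpret P: product_sigma_finite "\<lambda>_::nat. lborel :: real measure" ..
  \<comment> \<open>Every point of the cube [-\<rho>, \<rho>]^p has norm at most 1/(M + 1); the
    truncated exponent is then at most 1, and exp 1 is below 10.\<close>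
  define \<rho> where "\<rho> = 1 / ((M + 1) * (real p + 1))"
  have \<rho>: "0 < \<rho>" using M by (simp add: \<rho>_def)
  have small: "trunc_mgf p P X M \<theta> \<le> 10" if P: "prob_space P" and \<theta>: "M * vnorm p \<theta> \<le> 1" and XP: "X \<in> P \<rightarrow>\<^sub>M Rvec_borel p" for P \<theta>
  proof -
    interpret prob_space P by fact
    have "trunc_mgf p P X M \<theta> \<le> (\<integral>z. exp 1 \<partial>P)"
      unfolding trunc_mgf_def
    proof (rule integral_mono[OF trunc_mgf_integrable[OF P XP M]])
      show "exp (of_bool (vnorm p (X z) \<le> M) * \<bar>dotp p \<theta> (X z)\<bar>) \<le> exp 1" for z
        using order_trans[OF trunc_exp_bounded[OF M] \<theta>, of "X z"] by (simp only: exp_le_cancel_iff)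
    qed simp
    then show ?thesis using exp_1_le_10 by (simp add: prob_space)
  qed
  have sub: "(\<Pi>\<^sub>E i\<in>{..<p}. {-\<rho>..\<rho>}) \<subseteq> subexp_body p R R' X M"
  proof
    fix \<theta> assume \<theta>: "\<theta> \<in> (\<Pi>\<^sub>E i\<in>{..<p}. {-\<rho>..\<rho>})"
    have "vnorm p \<theta> \<le> (\<Sum>i<p. \<bar>\<theta> i\<bar>)" by (rule vnorm_le_sum)
    also have "\<dots> \<le> (\<Sum>i<p. \<rho>)" using \<theta> by (intro sum_mono) (auto simp: PiE_iff abs_le_iff minus_le_iff)
    also have "\<dots> = real p * \<rho>" by simp
    finally have v: "vnorm p \<theta> \<le> real p * \<rho>" .
    also have "real p * \<rho> = (real p / (real p + 1)) * (1 / (M + 1))"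
      by (simp add: \<rho>_def)
    also have "\<dots> \<le> 1 * (1 / (M + 1))"
      using M by (intro mult_right_mono) auto
    finally have v: "vnorm p \<theta> \<le> 1 / (M + 1)" by simp
    have "M * vnorm p \<theta> \<le> M * (1 / (M + 1))" using v M by (intro mult_left_mono)
    also have "\<dots> \<le> 1" using M by simp
    finally have "M * vnorm p \<theta> \<le> 1" .
    moreover have "1 / (M + 1) \<le> 1" using M by simp
    then have "vnorm p \<theta> \<le> 1" using v by linarith
    ultimately show "\<theta> \<in> subexp_body p R R' X M"
      using small[OF R _ X] small[OF R' _ X'] \<theta> by (auto simp: subexp_body_def Rvec_def)
  qed
  have meas: "subexp_body p R R' X M \<in> sets (lebp p)"
    by (rule subexp_body_measurable; fact)
  have "emeasure (lebp p) (\<Pi>\<^sub>E i\<in>{..<p}. {-\<rho>..\<rho>}) = (\<Prod>i<p. emeasure lborel {-\<rho>..\<rho>})"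
    by (rule P.emeasure_PiM) auto
  also have "\<dots> \<noteq> 0" using \<rho> by simp
  finally show "emeasure (lebp p) (subexp_body p R R' X M) \<noteq> 0"
    using emeasure_mono[OF sub meas] by auto
  have sub2: "subexp_body p R R' X M \<subseteq> (\<Pi>\<^sub>E i\<in>{..<p}. {-1..1})"
  proof
    fix \<theta> assume \<theta>: "\<theta> \<in> subexp_body p R R' X M"
    have "\<bar>\<theta> i\<bar> \<le> 1" if "i < p" for i
      using abs_coord_le_vnorm[OF that, of \<theta>] \<theta> by (auto simp: subexp_body_def)
    then have "\<theta> i \<in> {-1..1}" if "i < p" for i using that by (auto simp: abs_le_iff minus_le_iff)
    then show "\<theta> \<in> (\<Pi>\<^sub>E i\<in>{..<p}. {-1..1})"
      using \<theta> by (auto simp: subexp_body_def Rvec_def PiE_iff)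
  qed
  have "emeasure (lebp p) (\<Pi>\<^sub>E i\<in>{..<p}. {-1..1}) = (\<Prod>i<p. emeasure lborel {-1..1::real})"
    by (rule P.emeasure_PiM) auto
  also have "\<dots> < \<infinity>" by (simp add: power_less_top_ennreal)
  finally show "emeasure (lebp p) (subexp_body p R R' X M) \<noteq> \<infinity>"
    using emeasure_mono[OF sub2, of "lebp p"] by (auto simp: top_unique sets_PiM_I_finite)
qed

lemma trunc_mgf_le_nn:
  assumes R: "prob_space R" and X[measurable]: "X \<in> R \<rightarrow>\<^sub>M Rvec_borel p" and M: "0 \<le> M" and \<kappa>: "0 < \<kappa>"
    and b: "(\<integral>\<^sup>+z. ennreal (exp (\<bar>dotp p \<theta> (X z)\<bar> / \<kappa>)) \<partial>R) \<le> 10"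
  shows "trunc_mgf p R X M (affp p (\<lambda>_. 0) \<kappa> \<theta>) \<le> 10"
proof -
  have d: "dotp p (affp p (\<lambda>_. 0) \<kappa> \<theta>) x = dotp p \<theta> x / \<kappa>" for x
    by (simp add: dotp_def affp_def sum_divide_distrib)
  have "ennreal (trunc_mgf p R X M (affp p (\<lambda>_. 0) \<kappa> \<theta>)) =
    (\<integral>\<^sup>+z. ennreal (exp (of_bool (vnorm p (X z) \<le> M) * \<bar>dotp p (affp p (\<lambda>_. 0) \<kappa> \<theta>) (X z)\<bar>)) \<partial>R)"
    unfolding trunc_mgf_def
    by (rule nn_integral_eq_integral[symmetric]) (auto intro: trunc_mgf_integrable[OF R X M])
  also have "\<dots> \<le> (\<integral>\<^sup>+z. ennreal (exp (\<bar>dotp p \<theta> (X z)\<bar> / \<kappa>)) \<partial>R)"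
    using \<kappa> by (intro nn_integral_mono ennreal_leI) (auto simp: d)
  finally have "ennreal (trunc_mgf p R X M (affp p (\<lambda>_. 0) \<kappa> \<theta>)) \<le> ennreal 10"
    using b by simp
  then show ?thesis by (subst (asm) ennreal_le_iff) auto
qed

text \<open>One step of chaining: with \<open>s\<close> the supremum over \<open>K\<close> and
  \<open>m\<close> the maximum over the net, s \<le> m + s/2, because twice the residual of a point
  is again in \<open>K\<close>. A maximum over finitely many directions thus controls all directions
  of the body.\<close>

lemma half_net_bound:
  fixes x :: "nat \<Rightarrow> nat \<Rightarrow> real"
  assumes K: "\<And>\<theta>. \<theta> \<in> K \<Longrightarrow> vnorm p \<theta> \<le> 1" and H: "finite H"
    and net: "\<And>\<theta>. \<theta> \<in> K \<Longrightarrow> \<exists>\<phi>\<in>H. affp p \<phi> (1/2) \<theta> \<in> K" and \<theta>: "\<theta> \<in> K"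
  shows "(\<Sum>j<n. \<bar>dotp p \<theta> (x j)\<bar>) \<le> 2 * (MAX \<phi>\<in>H. \<Sum>j<n. \<bar>dotp p \<phi> (x j)\<bar>)"
proof -
  define q where "q \<theta> = (\<Sum>j<n. \<bar>dotp p \<theta> (x j)\<bar>)" for \<theta>
  define m where "m = (MAX \<phi>\<in>H. q \<phi>)"
  \<comment> \<open>The unit ball makes \<open>s\<close> a genuine supremum, so that
    \<open>s / 2\<close> can be absorbed on the left.\<close>
  have b: "bdd_above (q ` K)"
  proof (rule bdd_aboveI2[of _ _ "\<Sum>j<n. vnorm p (x j)"])
    fix \<theta> assume "\<theta> \<in> K"
    then show "q \<theta> \<le> (\<Sum>j<n. vnorm p (x j))"
      unfolding q_def using K
      by (intro sum_mono order_trans[OF abs_dotp_le]) (auto intro: mult_left_le_one_le)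
  qed
  define s where "s = (SUP \<theta>\<in>K. q \<theta>)"
  have "q \<theta> \<le> m + s / 2" if \<theta>: "\<theta> \<in> K" for \<theta>
  proof -
    obtain \<phi> where \<phi>: "\<phi> \<in> H" "affp p \<phi> (1/2) \<theta> \<in> K" using net[OF \<theta>] by blast
    have "dotp p \<theta> y = dotp p \<phi> y + dotp p (affp p \<phi> (1/2) \<theta>) y / 2" for y
      unfolding dotp_def sum_divide_distrib sum.distrib[symmetric]
      by (rule sum.cong) (auto simp: affp_def field_simps)
    then have "q \<theta> \<le> (\<Sum>j<n. \<bar>dotp p \<phi> (x j)\<bar> + \<bar>dotp p (affp p \<phi> (1/2) \<theta>) (x j)\<bar> / 2)"
      unfolding q_def by (intro sum_mono) simp
    also have "\<dots> = q \<phi> + q (affp p \<phi> (1/2) \<theta>) / 2"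
      by (simp add: q_def sum.distrib sum_divide_distrib)
    also have "\<dots> \<le> m + s / 2"
      unfolding m_def s_def using \<phi> H b by (intro add_mono divide_right_mono cSUP_upper Max_ge) auto
    finally show ?thesis .
  qed
  then have "s \<le> m + s / 2"
    unfolding s_def using \<theta> by (intro cSUP_least) auto
  moreover have "q \<theta> \<le> s" unfolding s_def using b \<theta> by (intro cSUP_upper)
  ultimately show ?thesis by (simp add: q_def m_def)
qed

text \<open>Exponential moments and a union over the net: the sums contribute 10^n and the net 5^p,
  both exponential in \<open>n\<close>, so the expected maximum of the averages stays bounded
  independently of \<open>n\<close>, of \<open>p\<close> and of the truncation level
  \<open>M\<close>.\<close>

lemma expected_max_bound:
  fixes X :: "'z \<Rightarrow> nat \<Rightarrow> real"
  assumes R: "prob_space R" and X[measurable]: "X \<in> R \<rightarrow>\<^sub>M Rvec_borel p" and M: "0 \<le> M" and n: "0 < n"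
    and H: "finite H" "H \<noteq> {}" "real (card H) \<le> 5 ^ p" "\<And>\<phi>. \<phi> \<in> H \<Longrightarrow> trunc_mgf p R X M \<phi> \<le> 10"
    and C0: "real p \<le> C0 * real n"
  defines "t \<equiv> \<lambda>w. (MAX \<phi>\<in>H. (1 / real n) * (\<Sum>j<n. of_bool (vnorm p (X (w j)) \<le> M) * \<bar>dotp p \<phi> (X (w j))\<bar>))"
  shows "integrable (PiM {..<n} (\<lambda>_. R)) t"
    and "(\<integral>w. t w \<partial>PiM {..<n} (\<lambda>_. R)) \<le> ln 10 + C0 * ln 5 + 1"
proof -
  interpret R: prob_space R by fact
  interpret P: product_prob_space "\<lambda>_::nat. R" by (rule product_prob_spaceI) (rule R)
  let ?P = "PiM {..<n} (\<lambda>_. R)"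
  have pP: "prob_space ?P" by (rule prob_space_PiM) (rule R)
  interpret PP: prob_space ?P by fact
  \<comment> \<open>exp (n c) = 10^n 5^(C0 n) outweighs the moment bound times the cardinality of
    the net, because p \<le> C0 n.\<close>
  define c where "c = ln 10 + C0 * ln 5"
  define g where "g \<phi> z = of_bool (vnorm p (X z) \<le> M) * \<bar>dotp p \<phi> (X z)\<bar>" for \<phi> z
  have gm[measurable]: "g \<phi> \<in> borel_measurable R" for \<phi> unfolding g_def by measurable
  have tm: "t \<in> borel_measurable ?P"
  proof -
    have m: "(\<lambda>w. (1 / real n) * (\<Sum>j<n. g \<phi> (w j))) \<in> borel_measurable ?P" for \<phi> by measurable
    show ?thesis unfolding t_def g_def[symmetric]
      using H(1,2) m by (intro borel_measurable_Max) auto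
  qed
  define b where "b = (\<Sum>\<phi>\<in>H. M * vnorm p \<phi>)"
  have g0: "0 \<le> g \<phi> z" for \<phi> z by (simp add: g_def)
  have gb: "g \<phi> z \<le> b" if "\<phi> \<in> H" for \<phi> z
  proof -
    have "g \<phi> z \<le> M * vnorm p \<phi>" unfolding g_def by (rule trunc_exp_bounded[OF M])
    also have "\<dots> \<le> b" unfolding b_def using that H(1) M by (intro member_le_sum) auto
    finally show ?thesis .
  qed
  have t_in: "\<exists>\<phi>\<in>H. t w = (1 / real n) * (\<Sum>j<n. g \<phi> (w j))" for w
  proof -
    have "t w \<in> (\<lambda>\<phi>. (1 / real n) * (\<Sum>j<n. g \<phi> (w j))) ` H"
      unfolding t_def g_def[symmetric] using H(1,2) by (intro Max_in) auto
    then show ?thesis by auto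
  qed
  have tb: "\<bar>t w\<bar> \<le> b" for w
  proof -
    obtain \<phi> where \<phi>: "\<phi> \<in> H" "t w = (1 / real n) * (\<Sum>j<n. g \<phi> (w j))" using t_in by blast
    have "(\<Sum>j<n. g \<phi> (w j)) \<le> (\<Sum>j<n. b)" using gb[OF \<phi>(1)] by (intro sum_mono)
    then have "t w \<le> b" using n by (simp add: \<phi>(2) field_simps)
    moreover have "0 \<le> t w" unfolding \<phi>(2) using g0 by (intro mult_nonneg_nonneg sum_nonneg) auto
    ultimately show ?thesis by simp
  qed
  show int: "integrable ?P t" by (rule integrable_bounded[OF pP tm tb])
  have intg: "integrable R (\<lambda>z. exp (g \<phi> z))" for \<phi>
    unfolding g_def by (rule trunc_mgf_integrable[OF R X M])
  have intp: "integrable ?P (\<lambda>w. \<Prod>j<n. exp (g \<phi> (w j)))" for \<phi>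
    by (rule P.product_integrable_prod) (auto intro: intg)
  have E: "(\<integral>w. (\<Prod>j<n. exp (g \<phi> (w j))) \<partial>?P) \<le> 10 ^ n" if "\<phi> \<in> H" for \<phi>
  proof -
    have "(\<integral>w. (\<Prod>j<n. exp (g \<phi> (w j))) \<partial>?P) = (\<Prod>j<n. \<integral>z. exp (g \<phi> z) \<partial>R)"
      by (rule P.product_integral_prod) (auto intro: intg)
    also have "\<dots> = (trunc_mgf p R X M \<phi>) ^ n" by (simp add: trunc_mgf_def g_def)
    also have "\<dots> \<le> 10 ^ n"
      using H(4)[OF that] by (intro power_mono) (auto simp: trunc_mgf_def)
    finally show ?thesis .
  qed
  \<comment> \<open>The expectation is reached through y \<le> exp y at y = n (t - c); the
    exponential of the maximum is then bounded by a sum over the net.\<close>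
  have pt: "t w \<le> c + (\<Sum>\<phi>\<in>H. exp (- (real n * c)) * (\<Prod>j<n. exp (g \<phi> (w j)))) / real n" for w
  proof -
    obtain \<phi> where \<phi>: "\<phi> \<in> H" "t w = (1 / real n) * (\<Sum>j<n. g \<phi> (w j))" using t_in by blast
    have nt: "real n * t w = (\<Sum>j<n. g \<phi> (w j))" using n by (simp add: \<phi>(2))
    have "real n * (t w - c) \<le> exp (real n * (t w - c))"
      using exp_ge_add_one_self[of "real n * (t w - c)"] by linarith
    also have "\<dots> = exp (- (real n * c)) * (\<Prod>j<n. exp (g \<phi> (w j)))"
      by (simp add: exp_sum[symmetric] nt[symmetric] mult_exp_exp algebra_simps)
    also have "\<dots> \<le> (\<Sum>\<phi>\<in>H. exp (- (real n * c)) * (\<Prod>j<n. exp (g \<phi> (w j))))"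
      by (rule member_le_sum[OF \<phi>(1)]) (use H(1) in \<open>auto intro!: mult_nonneg_nonneg prod_nonneg\<close>)
    finally show ?thesis using n by (simp add: field_simps)
  qed
  have "(\<integral>w. t w \<partial>?P) \<le> (\<integral>w. c + (\<Sum>\<phi>\<in>H. exp (- (real n * c)) * (\<Prod>j<n. exp (g \<phi> (w j)))) / real n \<partial>?P)"
    using int intp pt by (intro integral_mono) auto
  also have "\<dots> = c + (\<Sum>\<phi>\<in>H. exp (- (real n * c)) * (\<integral>w. (\<Prod>j<n. exp (g \<phi> (w j))) \<partial>?P)) / real n"
    using intp by (simp add: PP.prob_space)
  also have "\<dots> \<le> c + (\<Sum>\<phi>\<in>H. exp (- (real n * c)) * 10 ^ n) / real n"
    using E by (intro add_left_mono divide_right_mono sum_mono mult_left_mono) auto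
  also have "\<dots> \<le> c + 1"
  proof -
    have "(\<Sum>\<phi>\<in>H. exp (- (real n * c)) * 10 ^ n) = real (card H) * (exp (- (real n * c)) * 10 ^ n)" by simp
    also have "\<dots> \<le> 5 ^ p * (exp (- (real n * c)) * 10 ^ n)"
      using H(3) by (intro mult_right_mono) auto
    also have "5 ^ p * (exp (- (real n * c)) * 10 ^ n) = exp (real p * ln 5 - C0 * real n * ln 5)"
    proof -
      have "(5::real) ^ p = exp (real p * ln 5)" "(10::real) ^ n = exp (real n * ln 10)"
        by (simp_all add: exp_of_nat_mult)
      then show ?thesis by (simp add: mult_exp_exp c_def algebra_simps)
    qed
    also have "\<dots> \<le> 1" using C0 by (simp add: mult_right_mono)
    finally have "(\<Sum>\<phi>\<in>H. exp (- (real n * c)) * 10 ^ n) \<le> 1" .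
    then have "(\<Sum>\<phi>\<in>H. exp (- (real n * c)) * 10 ^ n) / real n \<le> 1 / 1"
      using n by (intro frac_le) (auto intro!: sum_nonneg)
    then show ?thesis by simp
  qed
  finally show "(\<integral>w. t w \<partial>?P) \<le> ln 10 + C0 * ln 5 + 1" by (simp add: c_def)
qed

text \<open>Tightness of one law, without a rate: the level may depend on \<open>n\<close> and
  \<open>p\<close> in any way, as the bounds of \<open>packing_bound\<close> and
  \<open>expected_max_bound\<close> do not involve it.\<close>

lemma exists_truncation_level:
  assumes R: "prob_space R" and X[measurable]: "X \<in> R \<rightarrow>\<^sub>M Rvec_borel p" and e: "0 < e"
  shows "\<exists>m::nat. \<forall>M\<ge>real m. measure R {z \<in> space R. M < vnorm p (X z)} \<le> e"
proof -
  interpret prob_space R by fact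
  define A where "A m = {z \<in> space R. real m < vnorm p (X z)}" for m
  have Am[measurable]: "A m \<in> sets R" for m unfolding A_def by measurable
  have "(\<lambda>m. measure R (A m)) \<longlonglongrightarrow> measure R (\<Inter>m. A m)"
    by (rule finite_Lim_measure_decseq) (auto simp: A_def decseq_def)
  also have "(\<Inter>m. A m) = {}"
  proof -
    have "z \<notin> (\<Inter>m. A m)" for z
    proof -
      obtain m where "vnorm p (X z) < real m" using reals_Archimedean2 by blast
      then have "z \<notin> A m" by (auto simp: A_def)
      then show ?thesis by blast
    qed
    then show ?thesis by blast
  qed
  finally have "(\<lambda>m. measure R (A m)) \<longlonglongrightarrow> 0" by simp
  then have "eventually (\<lambda>m. measure R (A m) < e) sequentially"
    by (rule order_tendstoD) (rule e)
  then obtain m where m: "measure R (A m) < e" by (auto simp: eventually_sequentially)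
  have "measure R {z \<in> space R. M < vnorm p (X z)} \<le> e" if "real m \<le> M" for M
  proof -
    have "measure R {z \<in> space R. M < vnorm p (X z)} \<le> measure R (A m)"
      using that by (intro finite_measure_mono) (auto simp: A_def)
    with m show ?thesis by simp
  qed
  then show ?thesis by blast
qed

section \<open>Nets of matrices and the discretized minimum\<close>

lemma norm_proj_diff_le:
  fixes \<Theta> \<Theta>' :: "(nat \<Rightarrow> real) ^ 'k"
  assumes "0 < \<delta>"
  shows "norm (proj p \<Theta> x - proj p \<Theta>' x) \<le> \<delta> * (\<Sum>j\<in>UNIV. \<bar>dotp p (affp p (\<Theta>' $ j) \<delta> (\<Theta> $ j)) x\<bar>)"
proof -
  have e: "dotp p (\<Theta> $ j) x - dotp p (\<Theta>' $ j) x = \<delta> * dotp p (affp p (\<Theta>' $ j) \<delta> (\<Theta> $ j)) x" for j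
    unfolding dotp_def sum_distrib_left sum_subtractf[symmetric]
    using assms by (intro sum.cong) (auto simp: affp_def field_simps)
  have "norm (proj p \<Theta> x - proj p \<Theta>' x) \<le> (\<Sum>j\<in>UNIV. \<bar>(proj p \<Theta> x - proj p \<Theta>' x) $ j\<bar>)"
    by (rule norm_le_l1_cart)
  also have "\<dots> = \<delta> * (\<Sum>j\<in>UNIV. \<bar>dotp p (affp p (\<Theta>' $ j) \<delta> (\<Theta> $ j)) x\<bar>)"
    using assms by (simp add: proj_def e abs_mult sum_distrib_left)
  finally show ?thesis .
qed

lemma frob_dist_le:
  fixes \<Theta> \<Theta>' :: "(nat \<Rightarrow> real) ^ 'k"
  assumes "0 < \<delta>"
  shows "frob_dist p \<Theta> \<Theta>' \<le> \<delta> * (\<Sum>j\<in>UNIV. vnorm p (affp p (\<Theta>' $ j) \<delta> (\<Theta> $ j)))"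
proof -
  have "frob_dist p \<Theta> \<Theta>' = sqrt (\<Sum>j\<in>UNIV. \<Sum>i<p. ((\<Theta> $ j) i - (\<Theta>' $ j) i)\<^sup>2)"
    by (simp add: frob_dist_def L2_set_def sum.cartesian_product case_prod_beta')
  also have "\<dots> = sqrt (\<Sum>j\<in>UNIV. (\<delta> * vnorm p (affp p (\<Theta>' $ j) \<delta> (\<Theta> $ j)))\<^sup>2)"
  proof -
    have "(\<Sum>i<p. ((\<Theta> $ j) i - (\<Theta>' $ j) i)\<^sup>2) = (\<delta> * vnorm p (affp p (\<Theta>' $ j) \<delta> (\<Theta> $ j)))\<^sup>2" for j
      unfolding vnorm_def L2_set_def power_mult_distrib
      using assms by (subst real_sqrt_pow2)
        (auto intro!: sum_nonneg sum.cong simp: affp_def sum_distrib_left power_divide)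
    then show ?thesis by simp
  qed
  also have "\<dots> \<le> (\<Sum>j\<in>UNIV. \<delta> * vnorm p (affp p (\<Theta>' $ j) \<delta> (\<Theta> $ j)))"
    unfolding L2_set_def[symmetric] using assms by (intro L2_set_le_sum) auto
  finally show ?thesis by (simp add: sum_distrib_left)
qed

lemma borel_measurable_INF_finite:
  fixes f :: "'t \<Rightarrow> 'z \<Rightarrow> real"
  assumes "finite T" "T \<noteq> {}" "\<And>\<theta>. \<theta> \<in> T \<Longrightarrow> f \<theta> \<in> borel_measurable N"
  shows "(\<lambda>w. INF \<theta>\<in>T. f \<theta> w) \<in> borel_measurable N"
proof -
  have "(INF \<theta>\<in>T. f \<theta> w) = (MIN \<theta>\<in>T. f \<theta> w)" for w
    using assms by (intro cInf_eq_Min) auto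
  then show ?thesis using assms borel_measurable_Min[of T f N] by simp
qed

lemma lipschitz_measurable:
  fixes \<psi> :: "real \<Rightarrow> real"
  assumes "\<And>x y. \<bar>\<psi> x - \<psi> y\<bar> \<le> L * \<bar>x - y\<bar>" "0 \<le> L"
  shows "\<psi> \<in> borel_measurable borel"
  by (intro borel_measurable_continuous_onI lipschitz_on_continuous_on[of L])
    (use assms in \<open>auto intro!: lipschitz_onI simp: dist_real_def\<close>)

lemma card_cols_in:
  assumes "finite T0"
  shows "finite (cols_in T0 :: ((nat \<Rightarrow> real) ^ 'k) set)"
    "card (cols_in T0 :: ((nat \<Rightarrow> real) ^ 'k) set) = card T0 ^ CARD('k)"
proof -
  have eq: "(cols_in T0 :: ((nat \<Rightarrow> real) ^ 'k) set) = vec_lambda ` (UNIV \<rightarrow>\<^sub>E T0)"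
  proof (intro equalityI subsetI)
    fix \<Theta> :: "(nat \<Rightarrow> real) ^ 'k" assume "\<Theta> \<in> cols_in T0"
    then have "\<Theta> = vec_lambda (vec_nth \<Theta>)" "vec_nth \<Theta> \<in> UNIV \<rightarrow>\<^sub>E T0"
      by (auto simp: cols_in_def)
    then show "\<Theta> \<in> vec_lambda ` (UNIV \<rightarrow>\<^sub>E T0)" by blast
  qed (auto simp: cols_in_def PiE_iff)
  show "finite (cols_in T0 :: ((nat \<Rightarrow> real) ^ 'k) set)"
    unfolding eq using assms by (intro finite_imageI finite_PiE) auto
  have "inj_on vec_lambda (UNIV \<rightarrow>\<^sub>E T0 :: ('k \<Rightarrow> nat \<Rightarrow> real) set)"
    by (intro inj_onI) (metis vec_lambda_inverse UNIV_I)
  then show "card (cols_in T0 :: ((nat \<Rightarrow> real) ^ 'k) set) = card T0 ^ CARD('k)"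
    unfolding eq by (simp add: card_image card_PiE)
qed

text \<open>If no sample exceeds the truncation level, moving every column to its net point changes
  the objective by at most \<delta> k (2 KA t + Kr), with \<open>t\<close> the maximum controlled by
  \<open>expected_max_bound\<close>. Otherwise, with probability at most \<delta>, the test function
  changes by at most 2B. Both costs are proportional to \<delta>, with constants free of
  \<open>n\<close> and of the level.\<close>

lemma discretization:
  fixes la :: "real ^ 'k \<Rightarrow> 'z \<Rightarrow> real" and r :: "(nat \<Rightarrow> real) ^ 'k \<Rightarrow> real" and \<psi> :: "real \<Rightarrow> real"
  assumes Q: "prob_space Q" and Q': "prob_space Q'" and sets: "sets Q' = sets Q"
    and X: "X \<in> Q \<rightarrow>\<^sub>M Rvec_borel p"
    and n: "0 < n" and C0: "real p \<le> C0 * real n"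
    and \<delta>: "0 < \<delta>" and \<kappa>: "0 < \<kappa>"
    and C: "C \<noteq> {}" "C \<subseteq> Rvec p" "\<And>\<theta>. \<theta> \<in> C \<Longrightarrow> vnorm p \<theta> \<le> \<kappa>"
      "\<And>\<theta>. \<theta> \<in> C \<Longrightarrow> (\<integral>\<^sup>+z. ennreal (exp (\<bar>dotp p \<theta> (X z)\<bar> / \<kappa>)) \<partial>Q) \<le> 10"
      "\<And>\<theta>. \<theta> \<in> C \<Longrightarrow> (\<integral>\<^sup>+z. ennreal (exp (\<bar>dotp p \<theta> (X z)\<bar> / \<kappa>)) \<partial>Q') \<le> 10"
    and la: "\<And>u z. 0 \<le> la u z" "\<And>u u' z. \<bar>la u z - la u' z\<bar> \<le> KA * norm (u - u')" "0 \<le> KA"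
    and lam: "\<And>\<Theta>. (\<lambda>z. la (proj p \<Theta> (X z)) z) \<in> borel_measurable Q"
    and r: "\<And>\<Theta>. \<Theta> \<in> cols_in C \<Longrightarrow> 0 \<le> r \<Theta>"
      "\<And>\<Theta> \<Theta>'. \<Theta> \<in> cols_in C \<Longrightarrow> \<Theta>' \<in> cols_in C \<Longrightarrow> \<bar>r \<Theta> - r \<Theta>'\<bar> \<le> Kr * frob_dist p \<Theta> \<Theta>'" "0 \<le> Kr"
    and \<psi>: "\<And>x. \<bar>\<psi> x\<bar> \<le> B" and lip: "\<And>x y. \<bar>\<psi> x - \<psi> y\<bar> \<le> L * \<bar>x - y\<bar>" and L: "0 \<le> L"
  defines "obj \<equiv> \<lambda>w \<Theta>. (1 / real n) * (\<Sum>j<n. la (proj p \<Theta> (X (w j))) (w j)) + r \<Theta>"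
  assumes VC: "(\<lambda>w. INF \<Theta>\<in>cols_in C. obj w \<Theta>) \<in> borel_measurable (PiM {..<n} (\<lambda>_. Q))"
  obtains T where "finite T" "T \<noteq> {}" "T \<subseteq> cols_in C"
    "real (card T) \<le> ((1 + 2 * \<kappa> / \<delta>) ^ p) ^ CARD('k)"
    "\<forall>R\<in>{Q, Q'}.
      \<bar>(\<integral>w. \<psi> (INF \<Theta>\<in>cols_in C. obj w \<Theta>) \<partial>PiM {..<n} (\<lambda>_. R)) - (\<integral>w. \<psi> (INF \<Theta>\<in>T. obj w \<Theta>) \<partial>PiM {..<n} (\<lambda>_. R))\<bar>
       \<le> \<delta> * (L * real CARD('k) * (2 * KA * (ln 10 + C0 * ln 5 + 1) + Kr) + 2 * B)"
proof -
  have X': "X \<in> Q' \<rightarrow>\<^sub>M Rvec_borel p" using X unfolding measurable_cong_sets[OF sets refl] .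
  \<comment> \<open>A failure probability of \<delta>/n per sample adds up to at most \<delta> over
    the n samples.\<close>
  have en: "0 < \<delta> / real n" using \<delta> n by simp
  obtain m where m: "\<And>M. real m \<le> M \<Longrightarrow> measure Q {z \<in> space Q. M < vnorm p (X z)} \<le> \<delta> / real n"
    using exists_truncation_level[OF Q X en] by blast
  obtain m' where m': "\<And>M. real m' \<le> M \<Longrightarrow> measure Q' {z \<in> space Q'. M < vnorm p (X z)} \<le> \<delta> / real n"
    using exists_truncation_level[OF Q' X' en] by blast
  define M where "M = max (real m) (real m')"
  have M0: "0 \<le> M" by (simp add: M_def)
  define K where "K = subexp_body p Q Q' X M"
  have Kc: "sym_convex p K" unfolding K_def by (rule subexp_body_convex; fact)
  have Km: "K \<in> sets (lebp p)" unfolding K_def by (rule subexp_body_measurable; fact)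
  have Ke: "emeasure (lebp p) K \<noteq> 0" "emeasure (lebp p) K \<noteq> \<infinity>"
    unfolding K_def by (rule subexp_body_emeasure; fact)+
  have K1: "vnorm p \<theta> \<le> 1" if "\<theta> \<in> K" for \<theta> using that by (simp add: K_def subexp_body_def)
  have CK: "affp p (\<lambda>_. 0) \<kappa> \<theta> \<in> K" if \<theta>: "\<theta> \<in> C" for \<theta>
  proof -
    have "vnorm p (affp p (\<lambda>_. 0) \<kappa> \<theta>) = vnorm p (vscale p (1 / \<kappa>) \<theta>)"
      by (simp add: affp_def vscale_def)
    also have "\<dots> \<le> 1" using C(3)[OF \<theta>] \<kappa> by (simp add: vnorm_vscale)
    finally show ?thesis
      using trunc_mgf_le_nn[OF Q X M0 \<kappa> C(4)[OF \<theta>]] trunc_mgf_le_nn[OF Q' X' M0 \<kappa> C(5)[OF \<theta>]]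
      by (simp add: K_def subexp_body_def)
  qed
  obtain T0 where T0: "finite T0" "T0 \<subseteq> C" "real (card T0) \<le> (1 + 2 * \<kappa> / \<delta>) ^ p"
    "\<And>\<theta>. \<theta> \<in> C \<Longrightarrow> \<exists>\<theta>'\<in>T0. affp p \<theta>' \<delta> \<theta> \<in> K"
    using net_exists[OF Kc Km Ke \<delta> \<kappa> C(2) CK] by blast
  have KK: "affp p (\<lambda>_. 0) 1 \<theta> \<in> K" if "\<theta> \<in> K" for \<theta>
  proof -
    have "affp p (\<lambda>_. 0) 1 \<theta> = \<theta>"
      using that by (auto simp: affp_def K_def subexp_body_def Rvec_def PiE_iff extensional_def)
    with that show ?thesis by simp
  qed
  have KR: "K \<subseteq> Rvec p" by (auto simp: K_def subexp_body_def)
  \<comment> \<open>A second net, of \<open>K\<close> itself at mesh 1/2, as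
    \<open>half_net_bound\<close> requires; with \<kappa> = 1 its cardinality is at most
    5^p.\<close>
  obtain H where H: "finite H" "H \<subseteq> K" "real (card H) \<le> (1 + 2 * 1 / (1/2)) ^ p"
    "\<And>\<theta>. \<theta> \<in> K \<Longrightarrow> \<exists>\<theta>'\<in>H. affp p \<theta>' (1/2) \<theta> \<in> K"
    using net_exists[OF Kc Km Ke, of "1/2" 1 K] KK KR by auto
  have H5: "real (card H) \<le> 5 ^ p" using H(3) by simp
  obtain \<theta>1 where \<theta>1: "\<theta>1 \<in> C" using C(1) by blast
  then have Hne: "H \<noteq> {}" using H(4)[OF CK[OF \<theta>1]] by blast
  define T where "T = (cols_in T0 :: ((nat \<Rightarrow> real) ^ 'k) set)"
  have Tf: "finite T" unfolding T_def by (rule card_cols_in(1)[OF T0(1)])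
  have Tsub: "T \<subseteq> cols_in C" using T0(2) by (auto simp: T_def cols_in_def)
  have near: "\<exists>\<Theta>'\<in>T. \<forall>j. affp p (\<Theta>' $ j) \<delta> (\<Theta> $ j) \<in> K" if "\<Theta> \<in> cols_in C" for \<Theta> :: "(nat \<Rightarrow> real) ^ 'k"
  proof -
    have "\<forall>j. \<exists>\<theta>'. \<theta>' \<in> T0 \<and> affp p \<theta>' \<delta> (\<Theta> $ j) \<in> K"
      using T0(4) that unfolding cols_in_def by blast
    then obtain f where f: "\<And>j. f j \<in> T0 \<and> affp p (f j) \<delta> (\<Theta> $ j) \<in> K" by metis
    show ?thesis
      by (rule bexI[of _ "\<chi> j. f j"]) (use f in \<open>auto simp: T_def cols_in_def\<close>)
  qed
  have Cne: "cols_in C \<noteq> ({} :: ((nat \<Rightarrow> real) ^ 'k) set)"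
  proof -
    have "(\<chi> j. \<theta>1) \<in> (cols_in C :: ((nat \<Rightarrow> real) ^ 'k) set)" using \<theta>1 by (simp add: cols_in_def)
    then show ?thesis by blast
  qed
  then have Tne: "T \<noteq> {}" using near by blast
  define t where "t w = (MAX \<phi>\<in>H. (1 / real n) * (\<Sum>j<n. of_bool (vnorm p (X (w j)) \<le> M) * \<bar>dotp p \<phi> (X (w j))\<bar>))" for w
  define k where "k = real CARD('k)"
  have obj0: "0 \<le> obj w \<Theta>" if "\<Theta> \<in> cols_in C" for w \<Theta>
    using la(1) r(1)[OF that] by (auto simp: obj_def intro!: add_nonneg_nonneg divide_nonneg_nonneg sum_nonneg)
  have bdC: "bdd_below (obj w ` cols_in C)" for w
    by (rule bdd_belowI2[of _ 0]) (rule obj0)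
  have good: "\<bar>(INF \<Theta>\<in>cols_in C. obj w \<Theta>) - (INF \<Theta>\<in>T. obj w \<Theta>)\<bar> \<le> \<delta> * k * (2 * KA * t w + Kr)"
    if w: "\<And>j. j < n \<Longrightarrow> vnorm p (X (w j)) \<le> M" for w
  proof -
    define e where "e = \<delta> * k * (2 * KA * t w + Kr)"
    have tw: "t w = (MAX \<phi>\<in>H. \<Sum>j<n. \<bar>dotp p \<phi> (X (w j))\<bar>) / real n"
    proof -
      have "t w = (MAX \<phi>\<in>H. (\<Sum>j<n. \<bar>dotp p \<phi> (X (w j))\<bar>) / real n)"
        unfolding t_def using w by (intro arg_cong[of _ _ Max] image_cong refl) auto
      also have "\<dots> = (MAX \<phi>\<in>H. \<Sum>j<n. \<bar>dotp p \<phi> (X (w j))\<bar>) / real n"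
        using mono_Max_commute[of "\<lambda>x. x / real n" "(\<lambda>\<phi>. \<Sum>j<n. \<bar>dotp p \<phi> (X (w j))\<bar>) ` H"] H(1) Hne
        by (simp add: image_image mono_def divide_right_mono)
      finally show ?thesis .
    qed
    have av: "(1 / real n) * (\<Sum>j<n. \<bar>dotp p \<theta> (X (w j))\<bar>) \<le> 2 * t w" if "\<theta> \<in> K" for \<theta>
      unfolding tw using half_net_bound[OF K1 H(1) H(4) that, of "\<lambda>j. X (w j)" n] n
      by (simp add: divide_right_mono)
    have cmp: "obj w \<Theta>' \<le> obj w \<Theta> + e"
      if \<Theta>: "\<Theta> \<in> cols_in C" and \<Theta>': "\<Theta>' \<in> T" "\<And>j. affp p (\<Theta>' $ j) \<delta> (\<Theta> $ j) \<in> K" for \<Theta> \<Theta>'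
    proof -
      let ?a = "\<lambda>l. affp p (\<Theta>' $ l) \<delta> (\<Theta> $ l)"
      have "la (proj p \<Theta>' (X (w j))) (w j) \<le> la (proj p \<Theta> (X (w j))) (w j) + KA * (\<delta> * (\<Sum>l\<in>UNIV. \<bar>dotp p (?a l) (X (w j))\<bar>))" for j
        using la(2)[of "proj p \<Theta> (X (w j))" "w j" "proj p \<Theta>' (X (w j))"]
          mult_left_mono[OF norm_proj_diff_le[OF \<delta>, of p \<Theta> "X (w j)" \<Theta>'] la(3)] by linarith
      then have "(\<Sum>j<n. la (proj p \<Theta>' (X (w j))) (w j)) \<le> (\<Sum>j<n. la (proj p \<Theta> (X (w j))) (w j) + KA * (\<delta> * (\<Sum>l\<in>UNIV. \<bar>dotp p (?a l) (X (w j))\<bar>)))"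
        by (intro sum_mono)
      also have "\<dots> = (\<Sum>j<n. la (proj p \<Theta> (X (w j))) (w j)) + KA * \<delta> * (\<Sum>l\<in>UNIV. \<Sum>j<n. \<bar>dotp p (?a l) (X (w j))\<bar>)"
        by (subst sum.swap) (simp add: sum.distrib sum_distrib_left algebra_simps)
      finally have "(1 / real n) * (\<Sum>j<n. la (proj p \<Theta>' (X (w j))) (w j)) \<le>
          (1 / real n) * ((\<Sum>j<n. la (proj p \<Theta> (X (w j))) (w j)) + KA * \<delta> * (\<Sum>l\<in>UNIV. \<Sum>j<n. \<bar>dotp p (?a l) (X (w j))\<bar>))"
        by (intro mult_left_mono) auto
      also have "\<dots> = (1 / real n) * (\<Sum>j<n. la (proj p \<Theta> (X (w j))) (w j)) + KA * \<delta> * (\<Sum>l\<in>UNIV. (1 / real n) * (\<Sum>j<n. \<bar>dotp p (?a l) (X (w j))\<bar>))"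
        by (simp add: sum_distrib_left algebra_simps add_divide_distrib sum_divide_distrib)
      also have "\<dots> \<le> (1 / real n) * (\<Sum>j<n. la (proj p \<Theta> (X (w j))) (w j)) + KA * \<delta> * (\<Sum>l\<in>(UNIV::'k set). 2 * t w)"
        using la(3) \<delta> by (intro add_left_mono mult_left_mono sum_mono av \<Theta>'(2)) auto
      finally have 1: "(1 / real n) * (\<Sum>j<n. la (proj p \<Theta>' (X (w j))) (w j)) \<le>
         (1 / real n) * (\<Sum>j<n. la (proj p \<Theta> (X (w j))) (w j)) + KA * \<delta> * (k * (2 * t w))"
        by (simp add: k_def)
      have "frob_dist p \<Theta> \<Theta>' \<le> \<delta> * (\<Sum>j\<in>UNIV. vnorm p (?a j))" by (rule frob_dist_le[OF \<delta>])
      also have "\<dots> \<le> \<delta> * (\<Sum>j\<in>(UNIV::'k set). 1)"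
        using \<delta> by (intro mult_left_mono sum_mono K1 \<Theta>'(2)) auto
      finally have "Kr * frob_dist p \<Theta> \<Theta>' \<le> Kr * (\<delta> * k)" using r(3) by (intro mult_left_mono) (auto simp: k_def)
      then have 2: "r \<Theta>' \<le> r \<Theta> + Kr * (\<delta> * k)"
        using r(2)[OF \<Theta>, of \<Theta>'] \<Theta>'(1) Tsub by auto
      show ?thesis using 1 2 by (simp add: obj_def e_def algebra_simps)
    qed
    have le1: "(INF \<Theta>\<in>cols_in C. obj w \<Theta>) \<le> (INF \<Theta>\<in>T. obj w \<Theta>)"
      by (rule cINF_superset_mono[OF Tne bdC Tsub]) simp
    have "(INF \<Theta>\<in>T. obj w \<Theta>) - e \<le> (INF \<Theta>\<in>cols_in C. obj w \<Theta>)"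
    proof (rule cINF_greatest[OF Cne])
      fix \<Theta> :: "(nat \<Rightarrow> real) ^ 'k" assume \<Theta>: "\<Theta> \<in> cols_in C"
      obtain \<Theta>' where \<Theta>': "\<Theta>' \<in> T" "\<And>j. affp p (\<Theta>' $ j) \<delta> (\<Theta> $ j) \<in> K" using near[OF \<Theta>] by blast
      have "(INF \<Theta>\<in>T. obj w \<Theta>) \<le> obj w \<Theta>'"
        using \<Theta>'(1) bdd_below_mono[OF bdC image_mono[OF Tsub]] by (intro cINF_lower)
      then show "(INF \<Theta>\<in>T. obj w \<Theta>) - e \<le> obj w \<Theta>" using cmp[OF \<Theta> \<Theta>'] by linarith
    qed
    with le1 show ?thesis unfolding e_def by linarith
  qed
  have t0: "0 \<le> t w" for w
  proof -
    obtain \<phi> where \<phi>: "\<phi> \<in> H" using Hne by blast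
    have "0 \<le> (1 / real n) * (\<Sum>j<n. of_bool (vnorm p (X (w j)) \<le> M) * \<bar>dotp p \<phi> (X (w j))\<bar>)"
      by (intro mult_nonneg_nonneg sum_nonneg) auto
    also have "\<dots> \<le> t w" unfolding t_def using \<phi> H(1) by (intro Max_ge) auto
    finally show ?thesis .
  qed
  have B0: "0 \<le> B" using \<psi>[of 0] by simp
  \<comment> \<open>One pointwise bound covers good and bad samples alike: a single violated
    truncation makes the sum of indicators at least 1.\<close>
  have pt: "\<bar>\<psi> (INF \<Theta>\<in>cols_in C. obj w \<Theta>) - \<psi> (INF \<Theta>\<in>T. obj w \<Theta>)\<bar> \<le>
     L * (\<delta> * k * (2 * KA * t w + Kr)) + 2 * B * (\<Sum>j<n. of_bool (M < vnorm p (X (w j))))" for w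
  proof (cases "\<forall>j<n. vnorm p (X (w j)) \<le> M")
    case True
    have "\<bar>\<psi> (INF \<Theta>\<in>cols_in C. obj w \<Theta>) - \<psi> (INF \<Theta>\<in>T. obj w \<Theta>)\<bar> \<le> L * (\<delta> * k * (2 * KA * t w + Kr))"
      by (rule order_trans[OF lip], rule mult_left_mono[OF good L]) (use True in auto)
    moreover have "0 \<le> 2 * B * (\<Sum>j<n. of_bool (M < vnorm p (X (w j))))" using B0 by (intro mult_nonneg_nonneg sum_nonneg) auto
    ultimately show ?thesis by linarith
  next
    case False
    then obtain j where j: "j < n" "M < vnorm p (X (w j))" by (auto simp: not_le)
    have "(of_bool (M < vnorm p (X (w j))) :: real) \<le> (\<Sum>j<n. of_bool (M < vnorm p (X (w j))))"
      using j by (intro member_le_sum) auto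
    then have "2 * B * 1 \<le> 2 * B * (\<Sum>j<n. of_bool (M < vnorm p (X (w j))))"
      using j B0 by (intro mult_left_mono) auto
    moreover have "0 \<le> L * (\<delta> * k * (2 * KA * t w + Kr))"
      using L \<delta> la(3) r(3) t0 by (simp add: k_def)
    ultimately show ?thesis
      using \<psi>[of "INF \<Theta>\<in>cols_in C. obj w \<Theta>"] \<psi>[of "INF \<Theta>\<in>T. obj w \<Theta>"] by linarith
  qed
  have bound: "\<bar>(\<integral>w. \<psi> (INF \<Theta>\<in>cols_in C. obj w \<Theta>) \<partial>PiM {..<n} (\<lambda>_. R)) - (\<integral>w. \<psi> (INF \<Theta>\<in>T. obj w \<Theta>) \<partial>PiM {..<n} (\<lambda>_. R))\<bar>
       \<le> \<delta> * (L * real CARD('k) * (2 * KA * (ln 10 + C0 * ln 5 + 1) + Kr) + 2 * B)"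
    if R: "prob_space R" and RQ: "sets R = sets Q" and RX: "X \<in> R \<rightarrow>\<^sub>M Rvec_borel p"
      and HR: "\<And>\<phi>. \<phi> \<in> K \<Longrightarrow> trunc_mgf p R X M \<phi> \<le> 10"
      and MR: "measure R {z \<in> space R. M < vnorm p (X z)} \<le> \<delta> / real n" for R
  proof -
    interpret R: prob_space R by fact
    interpret P: product_prob_space "\<lambda>_::nat. R" by (rule product_prob_spaceI) (rule R)
    let ?P = "PiM {..<n} (\<lambda>_. R)"
    have pP: "prob_space ?P" by (rule prob_space_PiM) (rule R)
    interpret PP: prob_space ?P by fact
    note [measurable] = RX
    have setsP: "sets ?P = sets (PiM {..<n} (\<lambda>_. Q))" by (intro sets_PiM_cong refl RQ)
    have VCR: "(\<lambda>w. INF \<Theta>\<in>cols_in C. obj w \<Theta>) \<in> borel_measurable ?P"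
      using VC unfolding measurable_cong_sets[OF setsP refl] .
    have lamR[measurable]: "(\<lambda>z. la (proj p \<Theta> (X z)) z) \<in> borel_measurable R" for \<Theta>
      using lam unfolding measurable_cong_sets[OF RQ refl] .
    have VTR: "(\<lambda>w. INF \<Theta>\<in>T. obj w \<Theta>) \<in> borel_measurable ?P"
      unfolding obj_def by (intro borel_measurable_INF_finite[OF Tf Tne]) measurable
    note \<psi>m = lipschitz_measurable[of \<psi> L, OF lip L]
    have i1: "integrable ?P (\<lambda>w. \<psi> (INF \<Theta>\<in>cols_in C. obj w \<Theta>))"
      by (rule integrable_bounded[OF pP measurable_compose[OF VCR \<psi>m], where B = B]) (rule \<psi>)
    have i2: "integrable ?P (\<lambda>w. \<psi> (INF \<Theta>\<in>T. obj w \<Theta>))"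
      by (rule integrable_bounded[OF pP measurable_compose[OF VTR \<psi>m], where B = B]) (rule \<psi>)
    have HK: "trunc_mgf p R X M \<phi> \<le> 10" if "\<phi> \<in> H" for \<phi> using that H(2) HR by blast
    have it: "integrable ?P t" and et: "(\<integral>w. t w \<partial>?P) \<le> ln 10 + C0 * ln 5 + 1"
      unfolding t_def by (rule expected_max_bound[OF R RX M0 n H(1) Hne H5 HK C0]; assumption)+
    have comp: "integrable ?P (\<lambda>w. of_bool (M < vnorm p (X (w j))) :: real)"
      "(\<integral>w. of_bool (M < vnorm p (X (w j))) \<partial>?P) \<le> \<delta> / real n" if j: "j < n" for j
    proof -
      show "integrable ?P (\<lambda>w. of_bool (M < vnorm p (X (w j))) :: real)"
        by (rule integrable_bounded[OF pP, where B = 1]) (use j in auto)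
      have "(\<integral>w. of_bool (M < vnorm p (X (w j))) \<partial>?P) = (\<integral>z. (of_bool (M < vnorm p (X z)) :: real) \<partial>distr ?P R (\<lambda>w. w j))"
        by (rule integral_distr[symmetric]) (use j in auto)
      also have "distr ?P R (\<lambda>w. w j) = R"
        using j by (intro distr_PiM_component R) auto
      also have "(\<integral>z. (of_bool (M < vnorm p (X z)) :: real) \<partial>R) = (\<integral>z. indicator {z \<in> space R. M < vnorm p (X z)} z \<partial>R)"
        by (intro Bochner_Integration.integral_cong) (auto simp: indicator_def)
      also have "\<dots> = measure R {z \<in> space R. M < vnorm p (X z)}" by simp
      finally show "(\<integral>w. of_bool (M < vnorm p (X (w j))) \<partial>?P) \<le> \<delta> / real n" using MR by simp
    qed
    have is0: "integrable ?P (\<lambda>w. \<Sum>j<n. of_bool (M < vnorm p (X (w j))) :: real)"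
      by (rule Bochner_Integration.integrable_sum) (use comp(1) in auto)
    have i3: "integrable ?P (\<lambda>w. L * (\<delta> * k * (2 * KA * t w + Kr)) + 2 * B * (\<Sum>j<n. of_bool (M < vnorm p (X (w j)))))"
      using it is0 by (simp del: sum_of_bool_eq)
    have "\<bar>(\<integral>w. \<psi> (INF \<Theta>\<in>cols_in C. obj w \<Theta>) \<partial>?P) - (\<integral>w. \<psi> (INF \<Theta>\<in>T. obj w \<Theta>) \<partial>?P)\<bar> =
       \<bar>\<integral>w. \<psi> (INF \<Theta>\<in>cols_in C. obj w \<Theta>) - \<psi> (INF \<Theta>\<in>T. obj w \<Theta>) \<partial>?P\<bar>"
      using i1 i2 by simp
    also have "\<dots> \<le> (\<integral>w. \<bar>\<psi> (INF \<Theta>\<in>cols_in C. obj w \<Theta>) - \<psi> (INF \<Theta>\<in>T. obj w \<Theta>)\<bar> \<partial>?P)"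
      by (rule integral_abs_bound)
    also have "\<dots> \<le> (\<integral>w. L * (\<delta> * k * (2 * KA * t w + Kr)) + 2 * B * (\<Sum>j<n. of_bool (M < vnorm p (X (w j)))) \<partial>?P)"
      by (rule integral_mono) (use i1 i2 i3 pt in \<open>simp_all del: sum_of_bool_eq\<close>)
    also have "\<dots> = L * (\<delta> * k * (2 * KA * (\<integral>w. t w \<partial>?P) + Kr)) + 2 * B * (\<Sum>j<n. (\<integral>w. of_bool (M < vnorm p (X (w j))) \<partial>?P))"
      using it is0 comp(1) by (simp add: PP.prob_space del: sum_of_bool_eq)
    also have "\<dots> \<le> L * (\<delta> * k * (2 * KA * (ln 10 + C0 * ln 5 + 1) + Kr)) + 2 * B * (\<Sum>j<n. \<delta> / real n)"
      using L \<delta> la(3) B0 et comp(2)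
      by (intro add_mono mult_left_mono sum_mono add_right_mono) (auto simp: k_def)
    also have "\<dots> = \<delta> * (L * real CARD('k) * (2 * KA * (ln 10 + C0 * ln 5 + 1) + Kr) + 2 * B)"
      using n by (simp add: k_def algebra_simps)
    finally show ?thesis .
  qed
  show ?thesis
  proof (rule that[OF Tf Tne Tsub])
    have "real (card T) = real (card T0) ^ CARD('k)" by (simp add: T_def card_cols_in(2)[OF T0(1)])
    also have "\<dots> \<le> ((1 + 2 * \<kappa> / \<delta>) ^ p) ^ CARD('k)" by (rule power_mono[OF T0(3)]) simp
    finally show "real (card T) \<le> ((1 + 2 * \<kappa> / \<delta>) ^ p) ^ CARD('k)" .
  next
    show "\<forall>R\<in>{Q, Q'}. \<bar>(\<integral>w. \<psi> (INF \<Theta>\<in>cols_in C. obj w \<Theta>) \<partial>PiM {..<n} (\<lambda>_. R)) - (\<integral>w. \<psi> (INF \<Theta>\<in>T. obj w \<Theta>) \<partial>PiM {..<n} (\<lambda>_. R))\<bar>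
       \<le> \<delta> * (L * real CARD('k) * (2 * KA * (ln 10 + C0 * ln 5 + 1) + Kr) + 2 * B)"
      using bound[OF Q refl X] bound[OF Q' sets X'] m[of M] m'[of M]
      by (auto simp: K_def subexp_body_def M_def)
  qed
qed

section \<open>Reduction to replica moments\<close>

lemma cols_in_dense:
  fixes C :: "(nat \<Rightarrow> real) set"
  obtains D :: "((nat \<Rightarrow> real) ^ 'k) set" where "countable D" "D \<subseteq> cols_in C"
    "\<And>\<Theta>. \<Theta> \<in> cols_in C \<Longrightarrow> \<exists>s. (\<forall>m. s m \<in> D) \<and> s \<longlonglongrightarrow> \<Theta>"
proof -
  obtain D0 where D0: "countable D0" "D0 \<subseteq> C" "C \<subseteq> closure D0"
    using separable[of C] by blast
  define D where "D = (cols_in D0 :: ((nat \<Rightarrow> real) ^ 'k) set)"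
  have "D = vec_lambda ` (UNIV \<rightarrow>\<^sub>E D0)"
  proof (intro equalityI subsetI)
    fix \<Theta> :: "(nat \<Rightarrow> real) ^ 'k" assume "\<Theta> \<in> D"
    then have "\<Theta> = vec_lambda (vec_nth \<Theta>)" "vec_nth \<Theta> \<in> UNIV \<rightarrow>\<^sub>E D0"
      by (auto simp: D_def cols_in_def)
    then show "\<Theta> \<in> vec_lambda ` (UNIV \<rightarrow>\<^sub>E D0)" by blast
  qed (auto simp: D_def cols_in_def PiE_iff)
  then have "countable D"
    using D0(1) by (simp add: countable_PiE)
  moreover have "D \<subseteq> cols_in C" using D0(2) by (auto simp: D_def cols_in_def)
  moreover have "\<exists>s. (\<forall>m. s m \<in> D) \<and> s \<longlonglongrightarrow> \<Theta>" if "\<Theta> \<in> cols_in C" for \<Theta> :: "(nat \<Rightarrow> real) ^ 'k"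
  proof -
    have "\<forall>j. \<exists>s. (\<forall>m. s m \<in> D0) \<and> s \<longlonglongrightarrow> \<Theta> $ j"
      using that D0(3) unfolding cols_in_def closure_sequential[symmetric] by blast
    then obtain s where s: "\<And>j. (\<forall>m. s j m \<in> D0) \<and> s j \<longlonglongrightarrow> \<Theta> $ j" by metis
    have "(\<lambda>m. \<chi> j. s j m) \<longlonglongrightarrow> \<Theta>"
      by (rule vec_tendstoI) (use s in simp)
    moreover have "(\<chi> j. s j m) \<in> D" for m using s by (simp add: D_def cols_in_def)
    ultimately show ?thesis by (intro exI[of _ "\<lambda>m. \<chi> j. s j m"]) auto
  qed
  ultimately show ?thesis by (rule that)
qed

text \<open>By continuity the infimum agrees with the one over a countable dense subset, and
  countable infima of measurable functions are measurable.\<close>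

lemma borel_measurable_INF_cols:
  fixes f :: "'w \<Rightarrow> (nat \<Rightarrow> real) ^ 'k \<Rightarrow> real"
  assumes C: "C \<noteq> {}" and cont: "\<And>w. w \<in> space N \<Longrightarrow> continuous_on (cols_in C) (f w)"
    and b: "\<And>w \<Theta>. w \<in> space N \<Longrightarrow> \<Theta> \<in> cols_in C \<Longrightarrow> 0 \<le> f w \<Theta>"
    and m: "\<And>\<Theta>. \<Theta> \<in> cols_in C \<Longrightarrow> (\<lambda>w. f w \<Theta>) \<in> borel_measurable N"
  shows "(\<lambda>w. INF \<Theta>\<in>cols_in C. f w \<Theta>) \<in> borel_measurable N"
proof -
  obtain D :: "((nat \<Rightarrow> real) ^ 'k) set" where D: "countable D" "D \<subseteq> cols_in C"
    "\<And>\<Theta>. \<Theta> \<in> cols_in C \<Longrightarrow> \<exists>s. (\<forall>m. s m \<in> D) \<and> s \<longlonglongrightarrow> \<Theta>"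
    using cols_in_dense[of C] by blast
  obtain \<theta>1 where "\<theta>1 \<in> C" using C by blast
  then have \<theta>1: "(\<chi> j. \<theta>1) \<in> (cols_in C :: ((nat \<Rightarrow> real) ^ 'k) set)" by (simp add: cols_in_def)
  with D(3) have Dne: "D \<noteq> {}" by blast
  have eq: "(INF \<Theta>\<in>cols_in C. f w \<Theta>) = (INF \<Theta>\<in>D. f w \<Theta>)" if w: "w \<in> space N" for w
  proof (rule antisym)
    have bd: "bdd_below (f w ` cols_in C)" by (rule bdd_belowI2[of _ 0]) (rule b[OF w])
    show "(INF \<Theta>\<in>cols_in C. f w \<Theta>) \<le> (INF \<Theta>\<in>D. f w \<Theta>)"
      by (rule cINF_superset_mono[OF Dne bd D(2)]) simp
    have bD: "bdd_below (f w ` D)" by (rule bdd_below_mono[OF bd image_mono[OF D(2)]])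
    show "(INF \<Theta>\<in>D. f w \<Theta>) \<le> (INF \<Theta>\<in>cols_in C. f w \<Theta>)"
    proof (rule cINF_greatest)
      fix \<Theta> :: "(nat \<Rightarrow> real) ^ 'k" assume \<Theta>: "\<Theta> \<in> cols_in C"
      obtain s where s: "\<And>m. s m \<in> D" "s \<longlonglongrightarrow> \<Theta>" using D(3)[OF \<Theta>] by blast
      have "(\<lambda>m. f w (s m)) \<longlonglongrightarrow> f w \<Theta>"
        by (rule continuous_on_tendsto_compose[OF cont[OF w] s(2) \<Theta>]) (use s(1) D(2) in \<open>auto intro!: always_eventually\<close>)
      then show "(INF \<Theta>\<in>D. f w \<Theta>) \<le> f w \<Theta>"
        by (rule LIMSEQ_le_const) (use s(1) bD in \<open>auto intro: cINF_lower\<close>)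
    qed (use \<theta>1 in blast)
  qed
  have "(\<lambda>w. INF \<Theta>\<in>D. f w \<Theta>) \<in> borel_measurable N"
    by (rule borel_measurable_cINF_real[OF D(1)]) (use m D(2) in auto)
  then show ?thesis by (subst measurable_cong[OF eq])
qed

lemma continuous_on_proj: "continuous_on S (\<lambda>\<Theta>. proj p \<Theta> x)"
proof -
  have "continuous_on S (\<lambda>\<Theta>. (\<Theta> $ j) i)" for j i
    by (rule continuous_on_product_then_coordinatewise) (intro continuous_intros)
  then show ?thesis
    unfolding proj_def dotp_def by (intro continuous_on_vec_lambda continuous_intros) auto
qed

text \<open>Near a point \<open>x\<close> the function agrees with its truncation at any level above
  \<open>f x\<close>, and continuity is local. This gives the untruncated loss the continuity that
  measurability of its minimum relies on.\<close>

lemma continuous_of_truncations: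
  fixes f :: "'u::real_normed_vector \<Rightarrow> real"
  assumes "\<And>A. 0 < A \<Longrightarrow> \<exists>K\<ge>0. \<forall>u u'. \<bar>min A (f u) - min A (f u')\<bar> \<le> K * norm (u - u')" and f0: "\<And>u. 0 \<le> f u"
  shows "continuous_on UNIV f"
proof -
  have "isCont f x" for x
  proof -
    define A where "A = f x + 1"
    have A: "0 < A" using f0[of x] by (simp add: A_def)
    obtain K where K: "0 \<le> K" "\<And>u u'. \<bar>min A (f u) - min A (f u')\<bar> \<le> K * norm (u - u')"
      using assms(1)[OF A] by blast
    have "continuous_on UNIV (\<lambda>u. min A (f u))"
      by (rule lipschitz_on_continuous_on[of K]) (use K in \<open>auto intro!: lipschitz_onI simp: dist_real_def dist_norm\<close>)
    then have "((\<lambda>u. min A (f u)) \<longlongrightarrow> min A (f x)) (at x)"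
      by (auto simp: continuous_on_eq_continuous_at isCont_def)
    moreover have "min A (f x) = f x" by (simp add: A_def)
    ultimately have t: "((\<lambda>u. min A (f u)) \<longlongrightarrow> f x) (at x)" by (simp only:)
    then have "eventually (\<lambda>u. min A (f u) < A) (at x)"
      by (rule order_tendstoD) (simp add: A_def)
    then have "eventually (\<lambda>u. min A (f u) = f u) (at x)"
      by eventually_elim (auto simp: min_def split: if_splits)
    with t show ?thesis unfolding isCont_def by (rule Lim_transform_eventually)
  qed
  then show ?thesis by (simp add: continuous_at_imp_continuous_on)
qed

lemma abs_integral_diff_le:
  fixes f :: "'z \<Rightarrow> real"
  assumes "prob_space Q" "f \<in> borel_measurable Q" "g \<in> borel_measurable Q"
    "\<And>z. z \<in> space Q \<Longrightarrow> \<bar>f z\<bar> \<le> B" "\<And>z. z \<in> space Q \<Longrightarrow> \<bar>g z\<bar> \<le> B" "\<And>z. z \<in> space Q \<Longrightarrow> \<bar>f z - g z\<bar> \<le> e"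
  shows "\<bar>(\<integral>z. f z \<partial>Q) - (\<integral>z. g z \<partial>Q)\<bar> \<le> e"
proof -
  have "(\<integral>z. f z \<partial>Q) - (\<integral>z. g z \<partial>Q) = (\<integral>z. f z - g z \<partial>Q)"
    by (rule Bochner_Integration.integral_diff[symmetric]; rule integrable_bounded[where B=B]) (use assms in auto)
  also have "\<bar>\<dots>\<bar> \<le> e" by (rule abs_integral_le) (use assms in auto)
  finally show ?thesis .
qed

text \<open>Sample space and loss are abstract, and the loss may depend on \<open>n\<close>, so that
  both alternatives become instances: each supplies Lipschitz bounds for the truncated losses,
  second moments, and the closeness \<open>weak\<close> of replica products. The comparison of the
  two expectations splits into seven differences of at most e/8: truncation, discretization and
  smoothed soft minimum for each law, and the exchange of laws in between.\<close>

theorem abstract_universality: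
  fixes lo :: "nat \<Rightarrow> real ^ 'k \<Rightarrow> 'z \<Rightarrow> real" and X :: "nat \<Rightarrow> 'z \<Rightarrow> nat \<Rightarrow> real"
    and r :: "nat \<Rightarrow> (nat \<Rightarrow> real) ^ 'k \<Rightarrow> real"
  assumes Q: "\<And>n. prob_space (Q n)" and Q': "\<And>n. prob_space (Q' n)" and sets: "\<And>n. sets (Q' n) = sets (Q n)"
    and X: "\<And>n. X n \<in> Q n \<rightarrow>\<^sub>M Rvec_borel (p n)"
    and C0: "\<And>n. 1 \<le> n \<Longrightarrow> real (p n) \<le> C0 * real n" and \<kappa>: "0 < \<kappa>"
    and C: "\<And>n. C n \<noteq> {}" "\<And>n. C n \<subseteq> Rvec (p n)" "\<And>n \<theta>. 1 \<le> n \<Longrightarrow> \<theta> \<in> C n \<Longrightarrow> vnorm (p n) \<theta> \<le> \<kappa>"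
      "\<And>n \<theta>. 1 \<le> n \<Longrightarrow> \<theta> \<in> C n \<Longrightarrow> (\<integral>\<^sup>+z. ennreal (exp (\<bar>dotp (p n) \<theta> (X n z)\<bar> / \<kappa>)) \<partial>Q n) \<le> 10"
      "\<And>n \<theta>. 1 \<le> n \<Longrightarrow> \<theta> \<in> C n \<Longrightarrow> (\<integral>\<^sup>+z. ennreal (exp (\<bar>dotp (p n) \<theta> (X n z)\<bar> / \<kappa>)) \<partial>Q' n) \<le> 10"
    and lo0: "\<And>n u z. 0 \<le> lo n u z"
    and lom: "\<And>n \<Theta>. (\<lambda>z. lo n (proj (p n) \<Theta> (X n z)) z) \<in> borel_measurable (Q n)"
    and trunc: "\<And>A. 0 < A \<Longrightarrow> \<exists>K\<ge>0. \<forall>n u u' z. \<bar>min A (lo n u z) - min A (lo n u' z)\<bar> \<le> K * norm (u - u')"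
    and mom: "\<And>n \<Theta> R. 1 \<le> n \<Longrightarrow> \<Theta> \<in> cols_in (C n) \<Longrightarrow> R \<in> {Q n, Q' n} \<Longrightarrow>
       integrable R (\<lambda>z. (lo n (proj (p n) \<Theta> (X n z)) z)\<^sup>2) \<and> (\<integral>z. (lo n (proj (p n) \<Theta> (X n z)) z)\<^sup>2 \<partial>R) \<le> c2"
    and r: "\<And>n \<Theta>. \<Theta> \<in> cols_in (C n) \<Longrightarrow> 0 \<le> r n \<Theta>" "\<And>n. continuous_on (cols_in (C n)) (r n)"
      "\<And>n \<Theta> \<Theta>'. \<Theta> \<in> cols_in (C n) \<Longrightarrow> \<Theta>' \<in> cols_in (C n) \<Longrightarrow> \<bar>r n \<Theta> - r n \<Theta>'\<bar> \<le> Kr * frob_dist (p n) \<Theta> \<Theta>'" "0 \<le> Kr"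
    and weak: "\<And>A \<beta> (k :: nat) \<tau>. 0 < A \<Longrightarrow> 0 < \<beta> \<Longrightarrow> 0 < \<tau> \<Longrightarrow>
      eventually (\<lambda>n. \<forall>\<Theta>. (\<forall>j<k. \<Theta> j \<in> cols_in (C n)) \<longrightarrow>
        \<bar>(\<integral>z. (\<Prod>j<k. exp (- \<beta> * min A (lo n (proj (p n) (\<Theta> j) (X n z)) z))) \<partial>Q n) -
         (\<integral>z. (\<Prod>j<k. exp (- \<beta> * min A (lo n (proj (p n) (\<Theta> j) (X n z)) z))) \<partial>Q' n)\<bar> \<le> \<tau>) sequentially"
  defines "V \<equiv> \<lambda>n w. INF \<Theta>\<in>cols_in (C n). (1 / real n) * (\<Sum>j<n. lo n (proj (p n) \<Theta> (X n (w j))) (w j)) + r n \<Theta>"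
  shows "V n \<in> borel_measurable (PiM {..<n} (\<lambda>_. Q n))"
    and "bounded_lipschitz \<psi> \<Longrightarrow>
      (\<lambda>n. \<bar>(\<integral>w. \<psi> (V n w) \<partial>PiM {..<n} (\<lambda>_. Q n)) - (\<integral>w. \<psi> (V n w) \<partial>PiM {..<n} (\<lambda>_. Q' n))\<bar>) \<longlonglongrightarrow> 0"
proof -
  have lo_cont: "continuous_on UNIV (\<lambda>u. lo n u z)" for n z
  proof (rule continuous_of_truncations)
    fix A :: real assume "0 < A"
    then show "\<exists>K\<ge>0. \<forall>u u'. \<bar>min A (lo n u z) - min A (lo n u' z)\<bar> \<le> K * norm (u - u')"
      using trunc[of A] by blast
  qed (rule lo0)
  have lo_cont': "continuous_on S (\<lambda>\<Theta>. lo n (proj (p n) \<Theta> x) z)" for S n x z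
    by (rule continuous_on_compose2[OF lo_cont continuous_on_proj]) auto
  \<comment> \<open>At \<open>m = 0\<close> this is the untruncated minimum and at
    \<open>m = n\<close> the truncated one; the values between are the hybrids of
    \<open>truncation_swap\<close>.\<close>
  have meas: "(\<lambda>w. INF \<Theta>\<in>cols_in (C n). (1 / real n) * (\<Sum>j<n. if j < m then min A (lo n (proj (p n) \<Theta> (X n (w j))) (w j))
      else lo n (proj (p n) \<Theta> (X n (w j))) (w j)) + r n \<Theta>) \<in> borel_measurable (PiM {..<n} (\<lambda>_. Q n))"
    if A: "0 \<le> A" for m n A
  proof (rule borel_measurable_INF_cols[OF C(1)])
    fix w
    have "continuous_on (cols_in (C n)) (\<lambda>\<Theta>. if j < m then min A (lo n (proj (p n) \<Theta> (X n (w j))) (w j))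
      else lo n (proj (p n) \<Theta> (X n (w j))) (w j))" for j
      by (cases "j < m") (auto intro!: continuous_intros lo_cont')
    then show "continuous_on (cols_in (C n)) (\<lambda>\<Theta>. (1 / real n) * (\<Sum>j<n. if j < m then min A (lo n (proj (p n) \<Theta> (X n (w j))) (w j))
      else lo n (proj (p n) \<Theta> (X n (w j))) (w j)) + r n \<Theta>)"
      by (intro continuous_intros r(2)) auto
  next
    fix w and \<Theta> :: "(nat \<Rightarrow> real) ^ 'k" assume "\<Theta> \<in> cols_in (C n)"
    then show "0 \<le> (1 / real n) * (\<Sum>j<n. if j < m then min A (lo n (proj (p n) \<Theta> (X n (w j))) (w j))
      else lo n (proj (p n) \<Theta> (X n (w j))) (w j)) + r n \<Theta>"
      using r(1) lo0 A by (intro add_nonneg_nonneg mult_nonneg_nonneg sum_nonneg) auto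
  next
    fix \<Theta> :: "(nat \<Rightarrow> real) ^ 'k"
    have c: "(\<lambda>w. lo n (proj (p n) \<Theta> (X n (w j))) (w j)) \<in> borel_measurable (PiM {..<n} (\<lambda>_. Q n))" if "j < n" for j
      using measurable_compose[OF measurable_component_singleton[of j "{..<n}" "\<lambda>_. Q n"] lom] that by simp
    have "(\<lambda>w. if j < m then min A (lo n (proj (p n) \<Theta> (X n (w j))) (w j))
      else lo n (proj (p n) \<Theta> (X n (w j))) (w j)) \<in> borel_measurable (PiM {..<n} (\<lambda>_. Q n))" if "j < n" for j
      using c[OF that] by (cases "j < m") auto
    then show "(\<lambda>w. (1 / real n) * (\<Sum>j<n. if j < m then min A (lo n (proj (p n) \<Theta> (X n (w j))) (w j))
      else lo n (proj (p n) \<Theta> (X n (w j))) (w j)) + r n \<Theta>) \<in> borel_measurable (PiM {..<n} (\<lambda>_. Q n))"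
      by (intro borel_measurable_add borel_measurable_times borel_measurable_sum) auto
  qed
  show Vm: "V n \<in> borel_measurable (PiM {..<n} (\<lambda>_. Q n))" for n
    using meas[of 0 n 0] by (simp add: V_def[abs_def])
  assume bl: "bounded_lipschitz \<psi>"
  then obtain L0 B0 where "L0-lipschitz_on UNIV \<psi>" and B0: "\<And>x. \<bar>\<psi> x\<bar> \<le> B0"
    unfolding bounded_lipschitz_def bounded_iff by (auto simp: image_iff)
  then have L0: "\<And>x y. \<bar>\<psi> x - \<psi> y\<bar> \<le> L0 * \<bar>x - y\<bar>" "0 \<le> L0"
    by (auto simp: lipschitz_on_def dist_real_def)
  \<comment> \<open>The added 1 keeps \<open>L\<close> positive, for it occurs in denominators
    below.\<close>
  define L where "L = L0 + 1"
  have L: "0 < L" using L0 by (simp add: L_def)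
  have lip: "\<bar>\<psi> x - \<psi> y\<bar> \<le> L * \<bar>x - y\<bar>" for x y
    using L0(1)[of x y] by (simp add: L_def algebra_simps)
  define B where "B = B0"
  have B: "\<bar>\<psi> x\<bar> \<le> B" for x using B0 by (simp add: B_def)
  have B_0: "0 \<le> B" using B[of 0] by simp
  have c2: "0 \<le> c2"
  proof -
    obtain \<theta>1 where "\<theta>1 \<in> C 1" using C(1) by blast
    then have "(\<chi> j. \<theta>1) \<in> (cols_in (C 1) :: ((nat \<Rightarrow> real) ^ 'k) set)" by (simp add: cols_in_def)
    then have m: "(\<integral>z. (lo 1 (proj (p 1) (\<chi> j. \<theta>1) (X 1 z)) z)\<^sup>2 \<partial>Q 1) \<le> c2"
      using mom[of 1 _ "Q 1"] by simp
    show ?thesis by (rule order_trans[OF _ m]) simp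
  qed
  have C0_0: "0 \<le> C0" using C0[of 1] by simp
  have "eventually (\<lambda>n. \<bar>(\<integral>w. \<psi> (V n w) \<partial>PiM {..<n} (\<lambda>_. Q n)) - (\<integral>w. \<psi> (V n w) \<partial>PiM {..<n} (\<lambda>_. Q' n))\<bar> < e) sequentially"
    if e: "0 < e" for e
  proof -
    \<comment> \<open>Makes the cost 2L(c2 + 1)/A of \<open>truncation_swap\<close> equal to e/8.
      From here on each constant depends only on earlier ones and never on \<open>n\<close>.\<close>
    define A where "A = 16 * L * (c2 + 1) / e"
    have A: "0 < A" using e L c2 by (simp add: A_def)
    obtain KA where KA: "0 \<le> KA" "\<And>n u u' z. \<bar>min A (lo n u z) - min A (lo n u' z)\<bar> \<le> KA * norm (u - u')"
      using trunc[OF A] by blast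
    define k where "k = real CARD('k)"
    have k: "1 \<le> k" by (simp add: k_def Suc_leI)
    define c where "c = L * real CARD('k) * (2 * KA * (ln 10 + C0 * ln 5 + 1) + Kr) + 2 * B"
    have c: "0 \<le> c" using L KA(1) C0_0 r(4) B_0 by (simp add: c_def)
    \<comment> \<open>The cost of discretization is \<delta> times \<open>c\<close>, and
      \<open>c\<close> does not depend on the mesh.\<close>
    define \<delta> where "\<delta> = e / (8 * (c + 1))"
    have \<delta>: "0 < \<delta>" using c e by (simp add: \<delta>_def)
    have \<delta>c: "\<delta> * c \<le> e / 8"
      using c e by (simp add: \<delta>_def field_simps)
    \<comment> \<open>Bounds the logarithm of the cardinality of the net divided by
      \<open>n\<close>; it is independent of \<open>n\<close> because p \<le> C0 n.\<close>
    define \<Lambda> where "\<Lambda> = C0 * k * ln (1 + 2 * \<kappa> / \<delta>)"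
    have ln0: "0 \<le> ln (1 + 2 * \<kappa> / \<delta>)" using \<kappa> \<delta> by simp
    have \<Lambda>: "0 \<le> \<Lambda>" unfolding \<Lambda>_def using ln0 C0_0 k by simp
    define h where "h = e / (16 * L)"
    have h: "0 < h" "L * h = e / 16" using e L by (auto simp: h_def)
    obtain \<phi> \<phi>' where \<phi>: "\<And>x. (\<phi> has_real_derivative \<phi>' x) (at x)" "\<And>x. \<bar>\<phi> x\<bar> \<le> B"
      "\<And>x. \<bar>\<phi>' x\<bar> \<le> L" "\<And>x y. \<bar>\<phi>' x - \<phi>' y\<bar> \<le> 2 * L / h * \<bar>x - y\<bar>" "\<And>x. \<bar>\<phi> x - \<psi> x\<bar> \<le> L * h"
      using smoothing[OF B lip less_imp_le[OF L] h(1)] by blast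
    \<comment> \<open>The soft minimum over the net is within \<Lambda>/\<beta> of the minimum; this
      choice makes the effect on the test function at most e/16. Smoothing at width \<open>h\<close>
      costs another e/16.\<close>
    define \<beta> where "\<beta> = 16 * L * (\<Lambda> + 1) / e"
    have \<beta>: "0 < \<beta>" using L \<Lambda> e by (simp add: \<beta>_def)
    have L\<Lambda>: "L * (\<Lambda> / \<beta>) \<le> e / 16"
    proof -
      have "L * (\<Lambda> / \<beta>) = (e / 16) * (\<Lambda> / (\<Lambda> + 1))" using L \<Lambda> e by (simp add: \<beta>_def)
      also have "\<dots> \<le> (e / 16) * 1" using \<Lambda> e by (intro mult_left_mono) auto
      finally show ?thesis by simp
    qed
    \<comment> \<open>Makes the first-order cost L \<gamma>/\<beta> of all exchanges together equal
      to e/16.\<close>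
    define \<gamma> where "\<gamma> = \<beta> * e / (16 * L)"
    have \<gamma>: "0 < \<gamma>" using \<beta> e L by (simp add: \<gamma>_def)
    have L\<gamma>: "L * \<gamma> / \<beta> = e / 16" using \<beta> L by (simp add: \<gamma>_def)
    obtain m :: nat and \<tau> :: real where \<tau>: "0 < \<tau>" and lac:
      "\<forall>(Q :: 'z measure) Q' (T :: ((nat \<Rightarrow> real) ^ 'k) set) l u.
      prob_space Q \<longrightarrow> prob_space Q' \<longrightarrow> sets Q' = sets Q \<longrightarrow> finite T \<longrightarrow>
      (\<forall>\<theta>\<in>T. l \<theta> \<in> borel_measurable Q) \<longrightarrow> (\<forall>\<theta>\<in>T. \<forall>z. 0 \<le> l \<theta> z \<and> l \<theta> z \<le> A) \<longrightarrow>
      (\<forall>k\<le>m. \<forall>s. (\<forall>j<k. s j \<in> T) \<longrightarrow>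
        \<bar>(\<integral>z. (\<Prod>j<k. exp (- \<beta> * l (s j) z)) \<partial>Q) - (\<integral>z. (\<Prod>j<k. exp (- \<beta> * l (s j) z)) \<partial>Q')\<bar> \<le> \<tau>) \<longrightarrow>
      (\<forall>\<theta>\<in>T. 0 \<le> u \<theta>) \<longrightarrow> (\<Sum>\<theta>\<in>T. u \<theta>) = 1 \<longrightarrow>
      \<bar>(\<integral>z. ln (\<Sum>\<theta>\<in>T. u \<theta> * exp (- \<beta> * l \<theta> z)) \<partial>Q) -
       (\<integral>z. ln (\<Sum>\<theta>\<in>T. u \<theta> * exp (- \<beta> * l \<theta> z)) \<partial>Q')\<bar> \<le> \<gamma>"
      using log_average_close[OF \<beta> less_imp_le[OF A] \<gamma>] by (elim exE conjE) (rule that)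
    have ev1: "eventually (\<lambda>n. \<forall>k\<in>{..m}. \<forall>\<Theta>. (\<forall>j<k. \<Theta> j \<in> cols_in (C n)) \<longrightarrow>
        \<bar>(\<integral>z. (\<Prod>j<k. exp (- \<beta> * min A (lo n (proj (p n) (\<Theta> j) (X n z)) z))) \<partial>Q n) -
         (\<integral>z. (\<Prod>j<k. exp (- \<beta> * min A (lo n (proj (p n) (\<Theta> j) (X n z)) z))) \<partial>Q' n)\<bar> \<le> \<tau>) sequentially"
      by (intro eventually_ball_finite ballI weak A \<beta> \<tau>) simp
    \<comment> \<open>Second-order cost of all exchanges; \<open>A\<close> and \<open>h\<close> are
      fixed by now, so it vanishes like 1/n.\<close>
    have "(\<lambda>n. 2 * (2 * L / h) * A\<^sup>2 / real n) \<longlonglongrightarrow> 0"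
      by (intro real_tendsto_divide_at_top[OF tendsto_const] filterlim_real_sequentially)
    then have ev2: "eventually (\<lambda>n. 2 * (2 * L / h) * A\<^sup>2 / real n < e / 16) sequentially"
      by (rule order_tendstoD) (use e in simp)
    show ?thesis
      using ev1 ev2 eventually_ge_at_top[of 1]
    proof eventually_elim
      case (elim n)
      have n: "0 < n" using elim(3) by simp
      define l where "l \<Theta> z = lo n (proj (p n) \<Theta> (X n z)) z" for \<Theta> z
      define la where "la u z = min A (lo n u z)" for u z
      let ?P = "PiM {..<n} (\<lambda>_. Q n)" and ?P' = "PiM {..<n} (\<lambda>_. Q' n)"
      define W where "W T w = (INF \<Theta>\<in>T. (1 / real n) * (\<Sum>j<n. la (proj (p n) \<Theta> (X n (w j))) (w j)) + r n \<Theta>)" for T w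
      have setsP: "sets ?P' = sets ?P" by (intro sets_PiM_cong refl sets)
      have P: "prob_space ?P" "prob_space ?P'" by (rule prob_space_PiM, rule Q Q')+
      have Cne: "cols_in (C n) \<noteq> ({} :: ((nat \<Rightarrow> real) ^ 'k) set)"
      proof -
        obtain \<theta>1 where "\<theta>1 \<in> C n" using C(1) by blast
        then have "(\<chi> j. \<theta>1) \<in> (cols_in (C n) :: ((nat \<Rightarrow> real) ^ 'k) set)" by (simp add: cols_in_def)
        then show ?thesis by blast
      qed
      have lm: "l \<Theta> \<in> borel_measurable (Q n)" "l \<Theta> \<in> borel_measurable (Q' n)" for \<Theta>
        using lom unfolding l_def measurable_cong_sets[OF sets refl] by auto
      have s1: "\<bar>(\<integral>w. \<psi> (W (cols_in (C n)) w) \<partial>PiM {..<n} (\<lambda>_. R)) - (\<integral>w. \<psi> (V n w) \<partial>PiM {..<n} (\<lambda>_. R))\<bar> \<le> e / 8"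
        if R: "R \<in> {Q n, Q' n}" for R
      proof -
        have pR: "prob_space R" and sR: "sets R = sets (Q n)" using R Q Q' sets by auto
        have sPR: "sets (PiM {..<n} (\<lambda>_. R)) = sets ?P" by (intro sets_PiM_cong refl sR)
        have "\<bar>(\<integral>w. \<psi> (INF \<Theta>\<in>cols_in (C n). (1 / real n) * (\<Sum>j<n. min A (l \<Theta> (w j))) + r n \<Theta>) \<partial>PiM {..<n} (\<lambda>_. R)) -
           (\<integral>w. \<psi> (INF \<Theta>\<in>cols_in (C n). (1 / real n) * (\<Sum>j<n. l \<Theta> (w j)) + r n \<Theta>) \<partial>PiM {..<n} (\<lambda>_. R))\<bar>
           \<le> 2 * L * (c2 + 1) / A"
        proof (rule truncation_swap[OF pR Cne A n])
          show "(\<lambda>w. INF \<Theta>\<in>cols_in (C n). (1 / real n) * (\<Sum>j<n. if j < m then min A (l \<Theta> (w j)) else l \<Theta> (w j)) + r n \<Theta>)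
            \<in> borel_measurable (PiM {..<n} (\<lambda>_. R))" for m
            unfolding l_def measurable_cong_sets[OF sPR refl] using A by (intro meas) simp
        qed (use lm[unfolded l_def[abs_def]] R mom[OF elim(3) _ R] r(1) lo0 B lip L in \<open>auto simp: l_def\<close>)
        also have "\<dots> = e / 8"
        proof -
          have "2 * L * s / (16 * L * s / e) = e / 8" if "0 < s" for s
            using L e that by (simp add: field_simps)
          from this[of "c2 + 1"] show ?thesis using c2 by (simp only: A_def)
        qed
        finally show ?thesis by (simp add: W_def V_def la_def l_def)
      qed
      have lam: "(\<lambda>z. la (proj (p n) \<Theta> (X n z)) z) \<in> borel_measurable (Q n)" for \<Theta>
        using lm(1)[of \<Theta>] unfolding la_def l_def by measurable
      have WCm: "(\<lambda>w. INF \<Theta>\<in>cols_in (C n). (1 / real n) * (\<Sum>j<n. la (proj (p n) \<Theta> (X n (w j))) (w j)) + r n \<Theta>) \<in> borel_measurable ?P"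
      proof -
        have "(\<Sum>j<n. if j < n then min A (f j) else f j) = (\<Sum>j<n. min A (f j))" for f :: "nat \<Rightarrow> real"
          by (rule sum.cong) auto
        then show ?thesis using meas[of A n n] A by (simp add: la_def)
      qed
      have la0: "0 \<le> la u z" for u z using lo0 A by (simp add: la_def)
      have laK: "\<bar>la u z - la u' z\<bar> \<le> KA * norm (u - u')" for u u' z using KA(2) by (simp add: la_def)
      obtain T where T: "finite T" "T \<noteq> {}" "T \<subseteq> cols_in (C n)"
        "real (card T) \<le> ((1 + 2 * \<kappa> / \<delta>) ^ p n) ^ CARD('k)" and
        dis: "\<forall>R\<in>{Q n, Q' n}.
        \<bar>(\<integral>w. \<psi> (W (cols_in (C n)) w) \<partial>PiM {..<n} (\<lambda>_. R)) - (\<integral>w. \<psi> (W T w) \<partial>PiM {..<n} (\<lambda>_. R))\<bar> \<le> \<delta> * c"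
        unfolding W_def c_def
        by (rule discretization[OF Q Q' sets X n C0[OF elim(3)] \<delta> \<kappa> C(1) C(2) C(3)[OF elim(3)] C(4)[OF elim(3)] C(5)[OF elim(3)]
          la0 laK KA(1) lam r(1) r(3) r(4) B lip less_imp_le[OF L] WCm]) (assumption | rule that)+
      define S where "S w = - (1 / (real n * \<beta>)) *
        ln (\<Sum>\<theta>\<in>T. exp (- (real n * \<beta>) * ((1 / real n) * (\<Sum>j<n. min A (l \<theta> (w j))) + r n \<theta>)))" for w
      have nb: "0 < real n * \<beta>" using n \<beta> by simp
      have card: "ln (real (card T)) / (real n * \<beta>) \<le> \<Lambda> / \<beta>"
      proof -
        have "ln (real (card T)) \<le> ln (((1 + 2 * \<kappa> / \<delta>) ^ p n) ^ CARD('k))"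
          using T(1,2,4) by (intro ln_mono) (auto simp: card_gt_0_iff)
        also have "\<dots> = k * (real (p n) * ln (1 + 2 * \<kappa> / \<delta>))"
          using \<kappa> \<delta> by (simp add: ln_realpow k_def add_pos_pos)
        also have "\<dots> \<le> k * ((C0 * real n) * ln (1 + 2 * \<kappa> / \<delta>))"
          using C0[OF elim(3)] ln0 k by (intro mult_left_mono mult_right_mono) auto
        also have "\<dots> = real n * \<Lambda>" by (simp add: \<Lambda>_def)
        finally have "ln (real (card T)) / (real n * \<beta>) \<le> (real n * \<Lambda>) / (real n * \<beta>)"
          using nb by (intro divide_right_mono) auto
        then show ?thesis using n by simp
      qed
      have WS: "\<bar>W T w - S w\<bar> \<le> \<Lambda> / \<beta>" for w
        using softmin_bounds[OF T(1,2) nb, of "\<lambda>\<Theta>. (1 / real n) * (\<Sum>j<n. min A (l \<Theta> (w j))) + r n \<Theta>"] card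
        unfolding W_def S_def la_def l_def by linarith
      have \<psi>\<phi>: "\<bar>\<psi> (W T w) - \<phi> (S w)\<bar> \<le> e / 8" for w
      proof -
        have "\<bar>\<psi> (W T w) - \<psi> (S w)\<bar> \<le> L * (\<Lambda> / \<beta>)"
          by (rule order_trans[OF lip mult_left_mono[OF WS]]) (use L in simp)
        then show ?thesis using \<phi>(5)[of "S w"] L\<Lambda> h(2) by linarith
      qed
      have WTm: "W T \<in> borel_measurable ?P"
        unfolding W_def[abs_def] la_def l_def[symmetric]
      proof (rule borel_measurable_INF_finite[OF T(1,2)])
        fix \<Theta>
        note [measurable] = lm(1)[of \<Theta>]
        show "(\<lambda>w. (1 / real n) * (\<Sum>j<n. min A (l \<Theta> (w j))) + r n \<Theta>) \<in> borel_measurable ?P"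
          by measurable
      qed
      have Sm: "S \<in> borel_measurable ?P"
        unfolding S_def using lm(1) by measurable
      note \<psi>m = lipschitz_measurable[of \<psi> L, OF lip less_imp_le[OF L]]
      have \<phi>m: "\<phi> \<in> borel_measurable borel"
        by (intro borel_measurable_continuous_onI continuous_at_imp_continuous_on ballI DERIV_isCont[OF \<phi>(1)])
      have s3: "\<bar>(\<integral>w. \<psi> (W T w) \<partial>N) - (\<integral>w. \<phi> (S w) \<partial>N)\<bar> \<le> e / 8"
        if N: "prob_space N" "sets N = sets ?P" for N
        by (rule abs_integral_diff_le[OF N(1), where B = B])
          (use measurable_compose[OF WTm \<psi>m] measurable_compose[OF Sm \<phi>m] B \<phi>(2) \<psi>\<phi> in 
           \<open>auto simp: measurable_cong_sets[OF N(2) refl]\<close>)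
      have l0: "0 \<le> l \<Theta> z" for \<Theta> z by (simp add: l_def lo0)
      have s4: "\<bar>(\<integral>w. \<phi> (S w) \<partial>?P) - (\<integral>w. \<phi> (S w) \<partial>?P')\<bar> \<le> L * \<gamma> / \<beta> + 2 * (2 * L / h) * A\<^sup>2 / real n"
        unfolding S_def
      proof (rule softmin_swap[OF Q Q' sets T(1,2) n \<beta>, where B = B and \<psi>' = \<phi>'])
        fix u :: "(nat \<Rightarrow> real) ^ 'k \<Rightarrow> real"
        assume u: "\<And>\<theta>. \<theta> \<in> T \<Longrightarrow> 0 \<le> u \<theta>" "(\<Sum>\<theta>\<in>T. u \<theta>) = 1"
        show "\<bar>(\<integral>z. ln (\<Sum>\<theta>\<in>T. u \<theta> * exp (- \<beta> * min A (l \<theta> z))) \<partial>Q n) -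
          (\<integral>z. ln (\<Sum>\<theta>\<in>T. u \<theta> * exp (- \<beta> * min A (l \<theta> z))) \<partial>Q' n)\<bar> \<le> \<gamma>"
        proof (rule lac[rule_format, OF Q Q' sets T(1)])
          fix k :: nat and s assume "k \<le> m" and s: "\<And>j. j < k \<Longrightarrow> s j \<in> T"
          then show "\<bar>(\<integral>z. (\<Prod>j<k. exp (- \<beta> * min A (l (s j) z))) \<partial>Q n) - (\<integral>z. (\<Prod>j<k. exp (- \<beta> * min A (l (s j) z))) \<partial>Q' n)\<bar> \<le> \<tau>"
            using elim(1)[rule_format, of k s] T(3) unfolding l_def by blast
        qed (use lm(1) l0 A u in auto)
      qed (use lm(1) l0 A \<phi> L h in auto)
      have s5: "\<bar>(\<integral>w. \<phi> (S w) \<partial>?P) - (\<integral>w. \<phi> (S w) \<partial>?P')\<bar> < e / 8"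
        using s4 elim(2) L\<gamma> by linarith
      show ?case
      proof -
        have a: "\<bar>a1 - a0\<bar> \<le> e / 8 \<Longrightarrow> \<bar>b1 - b0\<bar> \<le> e / 8 \<Longrightarrow> \<bar>a1 - a2\<bar> \<le> \<delta> * c \<Longrightarrow> \<bar>b1 - b2\<bar> \<le> \<delta> * c \<Longrightarrow>
          \<bar>a2 - a3\<bar> \<le> e / 8 \<Longrightarrow> \<bar>b2 - b3\<bar> \<le> e / 8 \<Longrightarrow> \<bar>a3 - b3\<bar> < e / 8 \<Longrightarrow> \<bar>a0 - b0\<bar> < e" for a0 a1 a2 a3 b0 b1 b2 b3 :: real
          using \<delta>c e by linarith
        show ?thesis
          by (rule a[OF s1 s1 dis[rule_format] dis[rule_format] s3[OF P(1) refl] s3[OF P(2) setsP] s5]) auto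
      qed
    qed
  qed
  then show "(\<lambda>n. \<bar>(\<integral>w. \<psi> (V n w) \<partial>PiM {..<n} (\<lambda>_. Q n)) - (\<integral>w. \<psi> (V n w) \<partial>PiM {..<n} (\<lambda>_. Q' n))\<bar>) \<longlonglongrightarrow> 0"
    by (intro tendstoI) (simp add: dist_real_def)
qed

section \<open>Trigonometric approximation\<close>

text \<open>Linear span of cosines of affine functions; the phase \<open>b\<close> yields the sines
  as well. Products are left out of the generators so that inductions meet only cosines, multiples
  and sums; closure under products is derived.\<close>

inductive trig_poly :: "('w::euclidean_space \<Rightarrow> real) \<Rightarrow> bool" where
  cos: "trig_poly (\<lambda>w. cos (a \<bullet> w + b))"
| scale: "trig_poly f \<Longrightarrow> trig_poly (\<lambda>w. c * f w)"
| add: "trig_poly f \<Longrightarrow> trig_poly g \<Longrightarrow> trig_poly (\<lambda>w. f w + g w)"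

lemma trig_poly_const: "trig_poly (\<lambda>w. c)"
  using trig_poly.scale[OF trig_poly.cos[of 0 0], of c] by simp

lemma trig_poly_sum:
  assumes "finite I" "\<And>i. i \<in> I \<Longrightarrow> trig_poly (f i)"
  shows "trig_poly (\<lambda>w. \<Sum>i\<in>I. f i w)"
  using assms
proof (induction I rule: finite_induct)
  case empty
  show ?case by (simp add: trig_poly_const)
next
  case (insert i I)
  have "trig_poly (\<lambda>w. f i w + (\<Sum>i\<in>I. f i w))"
    by (rule trig_poly.add) (use insert in auto)
  then show ?case using insert.hyps by simp
qed

text \<open>Product-to-sum formula for two cosines, extended to the span in each factor by a nested
  induction.\<close>

lemma trig_poly_mult:
  assumes "trig_poly f" "trig_poly g"
  shows "trig_poly (\<lambda>w. f w * g w)"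
  using assms
proof (induction f arbitrary: g rule: trig_poly.induct)
  case (cos a b)
  from cos show ?case
  proof (induction g rule: trig_poly.induct)
    case (cos a' b')
    have "(\<lambda>w. cos (a \<bullet> w + b) * cos (a' \<bullet> w + b')) =
      (\<lambda>w. (1/2) * cos ((a - a') \<bullet> w + (b - b')) + (1/2) * cos ((a + a') \<bullet> w + (b + b')))"
    proof
      fix w
      have 1: "(a - a') \<bullet> w + (b - b') = (a \<bullet> w + b) - (a' \<bullet> w + b')" "(a + a') \<bullet> w + (b + b') = (a \<bullet> w + b) + (a' \<bullet> w + b')"
        by (simp_all add: inner_add_left inner_diff_left)
      show "cos (a \<bullet> w + b) * cos (a' \<bullet> w + b') = (1/2) * cos ((a - a') \<bullet> w + (b - b')) + (1/2) * cos ((a + a') \<bullet> w + (b + b'))"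
        unfolding 1 cos_diff cos_add by (simp add: field_simps)
    qed
    then show ?case
      by (simp only:) (rule trig_poly.add[OF trig_poly.scale[OF trig_poly.cos] trig_poly.scale[OF trig_poly.cos]])
  next
    case (scale f c)
    have "trig_poly (\<lambda>w. c * (cos (a \<bullet> w + b) * f w))" by (rule trig_poly.scale[OF scale.IH])
    then show ?case by (simp only: mult.left_commute)
  next
    case (add f g)
    have "trig_poly (\<lambda>w. cos (a \<bullet> w + b) * f w + cos (a \<bullet> w + b) * g w)" by (rule trig_poly.add[OF add.IH])
    then show ?case by (simp only: distrib_left)
  qed
next
  case (scale f c)
  have "trig_poly (\<lambda>w. c * (f w * g w))" by (rule trig_poly.scale[OF scale.IH[OF scale.prems]])
  then show ?case by (simp only: mult.assoc)
next
  case (add f f')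
  have "trig_poly (\<lambda>w. f w * g w + f' w * g w)" by (rule trig_poly.add[OF add.IH(1)[OF add.prems] add.IH(2)[OF add.prems]])
  then show ?case by (simp only: distrib_right)
qed

lemma trig_poly_continuous: "trig_poly f \<Longrightarrow> continuous_on UNIV f"
  by (induction rule: trig_poly.induct) (auto intro!: continuous_intros)

lemma trig_poly_sin: "trig_poly (\<lambda>w. sin ((w \<bullet> i) / L))"
proof -
  have "(\<lambda>w. sin ((w \<bullet> i) / L)) = (\<lambda>w. cos ((i /\<^sub>R L) \<bullet> w + (- pi / 2)))"
  proof
    fix w
    have "sin t = cos (t + (- pi / 2))" for t :: real unfolding cos_add by simp
    moreover have "(w \<bullet> i) / L = (i /\<^sub>R L) \<bullet> w" by (simp add: inner_commute[of w i] divide_inverse)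
    ultimately show "sin ((w \<bullet> i) / L) = cos ((i /\<^sub>R L) \<bullet> w + (- pi / 2))" by (simp only:)
  qed
  then show ?thesis by (simp only:) (rule trig_poly.cos)
qed

text \<open>Sines of scaled coordinates are trigonometric polynomials, and these form an algebra.
  The approximating polynomials of \<open>trig_poly_approx\<close> live in the variables sin (w_i /
  L).\<close>

lemma trig_poly_of_polynomial:
  fixes g :: "'w::euclidean_space \<Rightarrow> real"
  assumes "real_polynomial_function g"
  shows "trig_poly (\<lambda>w. g (\<Sum>i\<in>Basis. sin ((w \<bullet> i) / L) *\<^sub>R i))"
  using assms
proof (induction rule: real_polynomial_function.induct)
  case (linear f)
  interpret bounded_linear f by fact
  have "(\<lambda>w. f (\<Sum>i\<in>Basis. sin ((w \<bullet> i) / L) *\<^sub>R i)) = (\<lambda>w. \<Sum>i\<in>Basis. f i * sin ((w \<bullet> i) / L))"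
  proof
    fix w
    have "f (\<Sum>i\<in>Basis. sin ((w \<bullet> i) / L) *\<^sub>R i) = (\<Sum>i\<in>Basis. f (sin ((w \<bullet> i) / L) *\<^sub>R i))"
      by (rule sum)
    also have "\<dots> = (\<Sum>i\<in>Basis. f i * sin ((w \<bullet> i) / L))"
      by (intro sum.cong refl) (simp only: scaleR real_scaleR_def mult.commute)
    finally show "f (\<Sum>i\<in>Basis. sin ((w \<bullet> i) / L) *\<^sub>R i) = (\<Sum>i\<in>Basis. f i * sin ((w \<bullet> i) / L))" .
  qed
  then show ?case
    by (simp only:) (rule trig_poly_sum[OF finite_Basis trig_poly.scale[OF trig_poly_sin]])
next
  case (const c)
  show ?case by (rule trig_poly_const)
next
  case (add f g)
  show ?case by (rule trig_poly.add[OF add.IH])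
next
  case (mult f g)
  show ?case by (rule trig_poly_mult[OF mult.IH])
qed

text \<open>
  Precomposing with the triangle wave L arcsin (sin (t / L)), which is the identity for
  \<bar>t\<bar> \<le> L, makes the approximation bounded on the whole space.
\<close>

lemma trig_poly_approx:
  fixes f :: "'w::euclidean_space \<Rightarrow> real"
  assumes f: "continuous_on UNIV f" "\<And>w. \<bar>f w\<bar> \<le> B" and L: "0 < L" and e: "0 < e"
  obtains T where "trig_poly T" "\<And>w. \<bar>T w\<bar> \<le> B + e"
    "\<And>w. (\<And>i. i \<in> Basis \<Longrightarrow> \<bar>w \<bullet> i\<bar> \<le> L) \<Longrightarrow> \<bar>f w - T w\<bar> \<le> e"
proof -
  \<comment> \<open>\<open>f\<close> expressed in the variables sin (w_i / L): a continuous function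
    on a compact cube, on which polynomials are dense.\<close>
  define h where "h s = f (\<Sum>i\<in>Basis. (L * arcsin (s \<bullet> i)) *\<^sub>R i)" for s
  let ?K = "cbox (- One) One :: 'w set"
  have "continuous_on ?K h"
    unfolding h_def
    by (intro continuous_on_compose2[OF f(1)] continuous_intros) (auto simp: mem_box)
  then obtain g where g: "real_polynomial_function g" "\<And>x. x \<in> ?K \<Longrightarrow> \<bar>h x - g x\<bar> < e"
    using Stone_Weierstrass_real_polynomial_function[of ?K h e] e by auto
  define \<sigma> where "\<sigma> w = (\<Sum>i\<in>Basis. sin ((w \<bullet> i) / L) *\<^sub>R i)" for w :: 'w
  have \<sigma>i: "\<sigma> w \<bullet> i = sin ((w \<bullet> i) / L)" if "i \<in> Basis" for w i
    using that by (simp add: \<sigma>_def)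
  have \<sigma>K: "\<sigma> w \<in> ?K" for w by (auto simp: mem_box \<sigma>i)
  show ?thesis
  proof (rule that[of "\<lambda>w. g (\<sigma> w)"])
    show "trig_poly (\<lambda>w. g (\<sigma> w))" unfolding \<sigma>_def by (rule trig_poly_of_polynomial[OF g(1)])
    show "\<bar>g (\<sigma> w)\<bar> \<le> B + e" for w
      using g(2)[OF \<sigma>K, of w] f(2)[of "\<Sum>i\<in>Basis. (L * arcsin (\<sigma> w \<bullet> i)) *\<^sub>R i"] unfolding h_def by linarith
    fix w :: 'w assume w: "\<And>i. i \<in> Basis \<Longrightarrow> \<bar>w \<bullet> i\<bar> \<le> L"
    have "L * arcsin (\<sigma> w \<bullet> i) = w \<bullet> i" if i: "i \<in> Basis" for i
    proof -
      have "\<bar>(w \<bullet> i) / L\<bar> \<le> 1" using w[OF i] L by simp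
      then have "- (pi / 2) \<le> (w \<bullet> i) / L" "(w \<bullet> i) / L \<le> pi / 2" using pi_ge_two by linarith+
      then have "arcsin (sin ((w \<bullet> i) / L)) = (w \<bullet> i) / L" by (rule arcsin_sin)
      then show ?thesis using L by (simp add: \<sigma>i[OF i])
    qed
    then have "h (\<sigma> w) = f w" by (simp add: h_def euclidean_representation)
    then show "\<bar>f w - g (\<sigma> w)\<bar> \<le> e" using g(2)[OF \<sigma>K, of w] by simp
  qed
qed

lemma integral_pair_mult:
  fixes f :: "'x \<Rightarrow> real" and g :: "'e \<Rightarrow> real"
  assumes P: "prob_space P" and E: "prob_space E"
    and f: "f \<in> borel_measurable P" "\<And>x. \<bar>f x\<bar> \<le> B" and g: "g \<in> borel_measurable E" "\<And>x. \<bar>g x\<bar> \<le> B'"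
  shows "integrable (P \<Otimes>\<^sub>M E) (\<lambda>z. f (fst z) * g (snd z))"
    and "(\<integral>z. f (fst z) * g (snd z) \<partial>(P \<Otimes>\<^sub>M E)) = (\<integral>x. f x \<partial>P) * (\<integral>e. g e \<partial>E)"
proof -
  interpret P: prob_space P by fact
  interpret E: prob_space E by fact
  interpret PE: pair_prob_space P E ..
  have pp: "prob_space (P \<Otimes>\<^sub>M E)" by (rule PE.prob_space_axioms)
  note [measurable] = f(1) g(1)
  show int: "integrable (P \<Otimes>\<^sub>M E) (\<lambda>z. f (fst z) * g (snd z))"
  proof (rule integrable_bounded[OF pp, where B = "B * B'"])
    show "(\<lambda>z. f (fst z) * g (snd z)) \<in> borel_measurable (P \<Otimes>\<^sub>M E)" by measurable
    fix z :: "'x \<times> 'e"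
    have "0 \<le> B" using f(2)[of "fst z"] by linarith
    then show "\<bar>f (fst z) * g (snd z)\<bar> \<le> B * B'"
      unfolding abs_mult by (intro mult_mono f(2) g(2)) auto
  qed
  have "(\<integral>z. f (fst z) * g (snd z) \<partial>(P \<Otimes>\<^sub>M E)) = (\<integral>x. (\<integral>e. f x * g e \<partial>E) \<partial>P)"
    using PE.integral_fst'[OF int] by (simp only: fst_conv snd_conv)
  then show "(\<integral>z. f (fst z) * g (snd z) \<partial>(P \<Otimes>\<^sub>M E)) = (\<integral>x. f x \<partial>P) * (\<integral>e. g e \<partial>E)"
    by (simp only: integral_mult_right_zero integral_mult_left_zero)
qed

section \<open>Uniform closeness on the domain of Gaussianity\<close>

text \<open>Stated for laws instead of random variables. The noise law \<open>Pe\<close> is a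
  parameter: in alternative (I) it is the law of the noise, while for binary labels, where the label
  is integrated out beforehand, a point mass takes its place.\<close>

locale gaussian_features =
  fixes p :: "nat \<Rightarrow> nat" and Px Pg :: "nat \<Rightarrow> (nat \<Rightarrow> real) measure" and Pe :: "nat \<Rightarrow> real measure"
    and S C :: "nat \<Rightarrow> (nat \<Rightarrow> real) set" and \<Theta>s :: "nat \<Rightarrow> (nat \<Rightarrow> real) ^ 's" and \<kappa> :: real
  assumes prob: "\<And>n. prob_space (Px n)" "\<And>n. prob_space (Pg n)" "\<And>n. prob_space (Pe n)"
    and sets_P: "\<And>n. sets (Px n) = sets (Rvec_borel (p n))" "\<And>n. sets (Pg n) = sets (Rvec_borel (p n))"
      "\<And>n. sets (Pe n) = sets borel"
    and S: "\<And>n. sym_convex (p n) (S n)"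
    and dom: "\<And>\<phi>. bounded_lipschitz \<phi> \<Longrightarrow>
        (\<lambda>n. SUP \<theta>\<in>S n. \<bar>(\<integral>x. \<phi> (dotp (p n) \<theta> x) \<partial>Pg n) - (\<integral>x. \<phi> (dotp (p n) \<theta> x) \<partial>Px n)\<bar>) \<longlonglongrightarrow> 0"
    and CS: "\<And>n. C n \<subseteq> S n" and \<Theta>sS: "\<And>n l. \<Theta>s n $ l \<in> S n" and \<kappa>: "0 < \<kappa>"
    and subexp: "\<And>n \<theta>. 1 \<le> n \<Longrightarrow> \<theta> \<in> C n \<union> range (($) (\<Theta>s n)) \<Longrightarrow> (\<integral>\<^sup>+x. ennreal (exp (\<bar>dotp (p n) \<theta> x\<bar> / \<kappa>)) \<partial>Px n) \<le> 10"
      "\<And>n \<theta>. 1 \<le> n \<Longrightarrow> \<theta> \<in> C n \<union> range (($) (\<Theta>s n)) \<Longrightarrow> (\<integral>\<^sup>+x. ennreal (exp (\<bar>dotp (p n) \<theta> x\<bar> / \<kappa>)) \<partial>Pg n) \<le> 10"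
      "\<And>n. 1 \<le> n \<Longrightarrow> (\<integral>\<^sup>+e. ennreal (exp (\<bar>e\<bar> / \<kappa>)) \<partial>Pe n) \<le> 10"
begin

definition Q where "Q n = Px n \<Otimes>\<^sub>M Pe n"
definition Q' where "Q' n = Pg n \<Otimes>\<^sub>M Pe n"

definition wv :: "nat \<Rightarrow> (nat \<Rightarrow> real) ^ 'k \<Rightarrow> (nat \<Rightarrow> real) \<times> real \<Rightarrow> ((real ^ 'k) \<times> (real ^ 's)) \<times> real" where
  "wv n \<Theta> z = ((proj (p n) \<Theta> (fst z), proj (p n) (\<Theta>s n) (fst z)), snd z)"

lemma prob_Q: "prob_space (Q n)" "prob_space (Q' n)"
proof -
  interpret Px: prob_space "Px n" by (rule prob)
  interpret Pg: prob_space "Pg n" by (rule prob)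
  interpret Pe: prob_space "Pe n" by (rule prob)
  interpret a: pair_prob_space "Px n" "Pe n" ..
  interpret b: pair_prob_space "Pg n" "Pe n" ..
  show "prob_space (Q n)" "prob_space (Q' n)"
    unfolding Q_def Q'_def by (rule a.prob_space_axioms b.prob_space_axioms)+
qed

lemma sets_Q: "sets (Q n) = sets (Rvec_borel (p n) \<Otimes>\<^sub>M borel)" "sets (Q' n) = sets (Rvec_borel (p n) \<Otimes>\<^sub>M borel)"
  unfolding Q_def Q'_def by (intro sets_pair_measure_cong sets_P)+

lemma measurable_wv: "wv n \<Theta> \<in> borel_measurable (Rvec_borel (p n) \<Otimes>\<^sub>M borel)"
proof -
  have m: "(\<lambda>z. proj (p n) \<Theta> (fst z)) \<in> borel_measurable (Rvec_borel (p n) \<Otimes>\<^sub>M (borel :: real measure))" for \<Theta> :: "(nat \<Rightarrow> real) ^ 'q"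
  proof (subst borel_measurable_euclidean_space, intro ballI)
    fix i :: "real ^ 'q" assume "i \<in> Basis"
    then obtain j where j: "i = axis j 1" by (auto simp: Basis_vec_def)
    show "(\<lambda>z. proj (p n) \<Theta> (fst z) \<bullet> i) \<in> borel_measurable (Rvec_borel (p n) \<Otimes>\<^sub>M (borel :: real measure))"
      unfolding j proj_def inner_axis by simp
  qed
  show ?thesis
    unfolding wv_def[abs_def] by (intro borel_measurable_Pair m) measurable
qed

definition tuples :: "nat \<Rightarrow> nat \<Rightarrow> (nat \<Rightarrow> (nat \<Rightarrow> real) ^ 'k) set" where
  "tuples m n = {\<Theta>. \<forall>j<m. \<Theta> j \<in> cols_in (C n)}"

definition uniformly_close :: "nat \<Rightarrow> (nat \<Rightarrow> (nat \<Rightarrow> (nat \<Rightarrow> real) ^ 'k) \<Rightarrow> (nat \<Rightarrow> real) \<times> real \<Rightarrow> real) \<Rightarrow> bool" where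
  "uniformly_close m F \<longleftrightarrow> (\<forall>\<tau>>0. eventually (\<lambda>n. \<forall>\<Theta>\<in>tuples m n. \<bar>(\<integral>z. F n \<Theta> z \<partial>Q n) - (\<integral>z. F n \<Theta> z \<partial>Q' n)\<bar> \<le> \<tau>) sequentially)"

definition uniformly_bounded :: "nat \<Rightarrow> (nat \<Rightarrow> (nat \<Rightarrow> (nat \<Rightarrow> real) ^ 'k) \<Rightarrow> (nat \<Rightarrow> real) \<times> real \<Rightarrow> real) \<Rightarrow> bool" where
  "uniformly_bounded m F \<longleftrightarrow> (\<exists>B. \<forall>n. \<forall>\<Theta>\<in>tuples m n. F n \<Theta> \<in> borel_measurable (Rvec_borel (p n) \<Otimes>\<^sub>M borel) \<and> (\<forall>z. \<bar>F n \<Theta> z\<bar> \<le> B))"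

lemma uniformly_bounded_integrable:
  assumes "uniformly_bounded m F" "\<Theta> \<in> tuples m n"
  shows "integrable (Q n) (F n \<Theta>)" "integrable (Q' n) (F n \<Theta>)"
proof -
  obtain B where B: "F n \<Theta> \<in> borel_measurable (Rvec_borel (p n) \<Otimes>\<^sub>M borel)" "\<And>z. \<bar>F n \<Theta> z\<bar> \<le> B"
    using assms unfolding uniformly_bounded_def by blast
  show "integrable (Q n) (F n \<Theta>)" "integrable (Q' n) (F n \<Theta>)"
    by (rule integrable_bounded[where B = B]; 
        use prob_Q B in \<open>simp add: measurable_cong_sets[OF sets_Q(1) refl] measurable_cong_sets[OF sets_Q(2) refl]\<close>)+
qed

lemma uniformly_close_add:
  assumes F: "uniformly_close m F" "uniformly_bounded m F" and G: "uniformly_close m G" "uniformly_bounded m G"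
  shows "uniformly_close m (\<lambda>n \<Theta> z. F n \<Theta> z + G n \<Theta> z)"
  unfolding uniformly_close_def
proof (intro allI impI)
  fix \<tau> :: real assume "0 < \<tau>"
  then have t: "0 < \<tau> / 2" by simp
  show "eventually (\<lambda>n. \<forall>\<Theta>\<in>tuples m n. \<bar>(\<integral>z. F n \<Theta> z + G n \<Theta> z \<partial>Q n) - (\<integral>z. F n \<Theta> z + G n \<Theta> z \<partial>Q' n)\<bar> \<le> \<tau>) sequentially"
    using F(1)[unfolded uniformly_close_def, rule_format, OF t] G(1)[unfolded uniformly_close_def, rule_format, OF t]
  proof eventually_elim
    case (elim n)
    show ?case
    proof
      fix \<Theta> :: "nat \<Rightarrow> (nat \<Rightarrow> real) ^ 'a" assume \<Theta>: "\<Theta> \<in> tuples m n"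
      show "\<bar>(\<integral>z. F n \<Theta> z + G n \<Theta> z \<partial>Q n) - (\<integral>z. F n \<Theta> z + G n \<Theta> z \<partial>Q' n)\<bar> \<le> \<tau>"
        using elim(1)[rule_format, OF \<Theta>] elim(2)[rule_format, OF \<Theta>]
          Bochner_Integration.integral_add[OF uniformly_bounded_integrable(1)[OF F(2) \<Theta>] uniformly_bounded_integrable(1)[OF G(2) \<Theta>]]
          Bochner_Integration.integral_add[OF uniformly_bounded_integrable(2)[OF F(2) \<Theta>] uniformly_bounded_integrable(2)[OF G(2) \<Theta>]]
        by linarith
    qed
  qed
qed

lemma uniformly_close_scale:
  assumes F: "uniformly_close m F"
  shows "uniformly_close m (\<lambda>n \<Theta> z. c * F n \<Theta> z)"
  unfolding uniformly_close_def
proof (intro allI impI)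
  fix \<tau> :: real assume "0 < \<tau>"
  then have t: "0 < \<tau> / (\<bar>c\<bar> + 1)" by (simp add: add_nonneg_pos)
  show "eventually (\<lambda>n. \<forall>\<Theta>\<in>tuples m n. \<bar>(\<integral>z. c * F n \<Theta> z \<partial>Q n) - (\<integral>z. c * F n \<Theta> z \<partial>Q' n)\<bar> \<le> \<tau>) sequentially"
    using F[unfolded uniformly_close_def, rule_format, OF t]
  proof eventually_elim
    case (elim n)
    show ?case
    proof
      fix \<Theta> :: "nat \<Rightarrow> (nat \<Rightarrow> real) ^ 'a" assume \<Theta>: "\<Theta> \<in> tuples m n"
      have "\<bar>(\<integral>z. c * F n \<Theta> z \<partial>Q n) - (\<integral>z. c * F n \<Theta> z \<partial>Q' n)\<bar> = \<bar>c\<bar> * \<bar>(\<integral>z. F n \<Theta> z \<partial>Q n) - (\<integral>z. F n \<Theta> z \<partial>Q' n)\<bar>"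
        by (simp add: abs_mult[symmetric] right_diff_distrib)
      also have "\<dots> \<le> (\<bar>c\<bar> + 1) * (\<tau> / (\<bar>c\<bar> + 1))"
        using elim[rule_format, OF \<Theta>] by (intro mult_mono) auto
      also have "\<dots> = \<tau>" by (simp add: add_nonneg_pos[THEN less_imp_neq, symmetric])
      finally show "\<bar>(\<integral>z. c * F n \<Theta> z \<partial>Q n) - (\<integral>z. c * F n \<Theta> z \<partial>Q' n)\<bar> \<le> \<tau>" .
    qed
  qed
qed

lemma uniformly_close_approx:
  assumes "\<And>\<tau>. 0 < \<tau> \<Longrightarrow> \<exists>G. uniformly_close m G \<and> (\<forall>n\<ge>1. \<forall>\<Theta>\<in>tuples m n. \<forall>R\<in>{Q n, Q' n}. \<bar>(\<integral>z. F n \<Theta> z \<partial>R) - (\<integral>z. G n \<Theta> z \<partial>R)\<bar> \<le> \<tau>)"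
  shows "uniformly_close m F"
  unfolding uniformly_close_def
proof (intro allI impI)
  fix \<tau> :: real assume "0 < \<tau>"
  then have t: "0 < \<tau> / 3" by simp
  obtain G where G: "uniformly_close m G" "\<And>n \<Theta> R. 1 \<le> n \<Longrightarrow> \<Theta> \<in> tuples m n \<Longrightarrow> R \<in> {Q n, Q' n} \<Longrightarrow> \<bar>(\<integral>z. F n \<Theta> z \<partial>R) - (\<integral>z. G n \<Theta> z \<partial>R)\<bar> \<le> \<tau> / 3"
    using assms[OF t] by blast
  show "eventually (\<lambda>n. \<forall>\<Theta>\<in>tuples m n. \<bar>(\<integral>z. F n \<Theta> z \<partial>Q n) - (\<integral>z. F n \<Theta> z \<partial>Q' n)\<bar> \<le> \<tau>) sequentially"
    using G(1)[unfolded uniformly_close_def, rule_format, OF t] eventually_ge_at_top[of 1]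
  proof eventually_elim
    case (elim n)
    show ?case
    proof
      fix \<Theta> :: "nat \<Rightarrow> (nat \<Rightarrow> real) ^ 'a" assume \<Theta>: "\<Theta> \<in> tuples m n"
      show "\<bar>(\<integral>z. F n \<Theta> z \<partial>Q n) - (\<integral>z. F n \<Theta> z \<partial>Q' n)\<bar> \<le> \<tau>"
        using elim(1)[rule_format, OF \<Theta>] G(2)[OF elim(2) \<Theta> insertI1] G(2)[OF elim(2) \<Theta> insertI2[OF singletonI]]
        by linarith
    qed
  qed
qed

text \<open>
  The scale s does not depend on n, and this class is closed under linear combinations because
  S is symmetric and convex.
\<close>

definition single_direction :: "nat \<Rightarrow> (nat \<Rightarrow> (nat \<Rightarrow> (nat \<Rightarrow> real) ^ 'k) \<Rightarrow> (nat \<Rightarrow> real) \<times> real \<Rightarrow> real) \<Rightarrow> bool" where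
  "single_direction m ph \<longleftrightarrow> (\<exists>s\<ge>0. \<exists>c b. \<forall>n. \<forall>\<Theta>\<in>tuples m n. \<exists>\<theta>\<in>S n. \<forall>z. ph n \<Theta> z = s * dotp (p n) \<theta> (fst z) + c * snd z + b)"

lemma single_directionI:
  assumes "0 \<le> s" "\<And>n \<Theta>. \<Theta> \<in> tuples m n \<Longrightarrow> \<exists>\<theta>\<in>S n. \<forall>z. ph n \<Theta> z = s * dotp (p n) \<theta> (fst z) + c * snd z + b"
  shows "single_direction m ph"
  unfolding single_direction_def using assms by blast

lemma single_direction_add:
  assumes "single_direction m f" "single_direction m g"
  shows "single_direction m (\<lambda>n \<Theta> z. f n \<Theta> z + g n \<Theta> z)"
proof -
  obtain s c b where 1: "0 \<le> s" "\<And>n \<Theta>. \<Theta> \<in> tuples m n \<Longrightarrow> \<exists>\<theta>\<in>S n. \<forall>z. f n \<Theta> z = s * dotp (p n) \<theta> (fst z) + c * snd z + b"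
    using assms(1) unfolding single_direction_def by blast
  obtain s' c' b' where 2: "0 \<le> s'" "\<And>n \<Theta>. \<Theta> \<in> tuples m n \<Longrightarrow> \<exists>\<theta>\<in>S n. \<forall>z. g n \<Theta> z = s' * dotp (p n) \<theta> (fst z) + c' * snd z + b'"
    using assms(2) unfolding single_direction_def by blast
  show ?thesis
  proof (rule single_directionI[of "s + s'"])
    fix n and \<Theta> :: "nat \<Rightarrow> (nat \<Rightarrow> real) ^ 'a" assume \<Theta>: "\<Theta> \<in> tuples m n"
    obtain \<theta> where \<theta>: "\<theta> \<in> S n" "\<And>z. f n \<Theta> z = s * dotp (p n) \<theta> (fst z) + c * snd z + b" using 1(2)[OF \<Theta>] by blast
    obtain \<theta>' where \<theta>': "\<theta>' \<in> S n" "\<And>z. g n \<Theta> z = s' * dotp (p n) \<theta>' (fst z) + c' * snd z + b'" using 2(2)[OF \<Theta>] by blast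
    show "\<exists>\<theta>''\<in>S n. \<forall>z. f n \<Theta> z + g n \<Theta> z = (s + s') * dotp (p n) \<theta>'' (fst z) + (c + c') * snd z + (b + b')"
    \<comment> \<open>The combined direction is the average of the two with weights \<open>s\<close>
      and \<open>s'\<close>, rescaled by \<open>s + s'\<close>. Normalization fails only if both
      scales vanish, and then any direction serves.\<close>
    proof (cases "s + s' = 0")
      case True
      then have "s = 0" "s' = 0" using 1(1) 2(1) by auto
      then show ?thesis using \<theta> \<theta>' by (intro bexI[of _ \<theta>]) (auto simp: algebra_simps)
    next
      case False
      then have pos: "0 < s + s'" using 1(1) 2(1) by linarith
      let ?\<theta> = "\<lambda>i\<in>{..<p n}. (s / (s + s')) * \<theta> i + (s' / (s + s')) * \<theta>' i"
      have in_S: "?\<theta> \<in> S n"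
        by (rule sym_convex_comb[OF S \<theta>(1) \<theta>'(1)]) (use 1(1) 2(1) pos in \<open>auto simp: add_divide_distrib[symmetric]\<close>)
      have mix: "q * ((s / q) * x + (s' / q) * y) = s * x + s' * y" if "0 < q" for q x y :: real
        using that by (simp add: distrib_left)
      have "f n \<Theta> z + g n \<Theta> z = (s + s') * dotp (p n) ?\<theta> (fst z) + (c + c') * snd z + (b + b')" for z
        unfolding dotp_comb mix[OF pos] \<theta> \<theta>' by (simp add: algebra_simps)
      then show ?thesis using in_S by blast
    qed
  qed (use 1(1) 2(1) in simp)
qed

lemma dotp_neg: "dotp q (\<lambda>i\<in>{..<q}. - \<theta> i) x = - dotp q \<theta> x"
  by (simp add: dotp_def sum_negf)

lemma single_direction_scale:
  assumes "single_direction m f"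
  shows "single_direction m (\<lambda>n \<Theta> z. t * f n \<Theta> z)"
proof -
  obtain s c b where 1: "0 \<le> s" "\<And>n \<Theta>. \<Theta> \<in> tuples m n \<Longrightarrow> \<exists>\<theta>\<in>S n. \<forall>z. f n \<Theta> z = s * dotp (p n) \<theta> (fst z) + c * snd z + b"
    using assms(1) unfolding single_direction_def by blast
  show ?thesis
  proof (rule single_directionI[of "\<bar>t\<bar> * s"])
    fix n and \<Theta> :: "nat \<Rightarrow> (nat \<Rightarrow> real) ^ 'a" assume \<Theta>: "\<Theta> \<in> tuples m n"
    obtain \<theta> where \<theta>: "\<theta> \<in> S n" "\<And>z. f n \<Theta> z = s * dotp (p n) \<theta> (fst z) + c * snd z + b" using 1(2)[OF \<Theta>] by blast
    show "\<exists>\<theta>''\<in>S n. \<forall>z. t * f n \<Theta> z = (\<bar>t\<bar> * s) * dotp (p n) \<theta>'' (fst z) + (t * c) * snd z + t * b"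
    proof (cases "0 \<le> t")
      case True
      then show ?thesis using \<theta> by (intro bexI[of _ \<theta>]) (auto simp: algebra_simps)
    next
      case False
      then show ?thesis using \<theta>(2)
        by (intro bexI[OF _ sym_convex_neg[OF S \<theta>(1)]]) (auto simp: dotp_neg algebra_simps)
    qed
  qed (use 1(1) in simp)
qed

lemma single_direction_const: "single_direction m (\<lambda>n \<Theta> z. b)"
  \<comment> \<open>At scale 0 a direction merely has to exist; a column of the true parameter lies
    in \<open>S n\<close>.\<close>
  by (rule single_directionI[of 0 _ _ 0 b]) (auto intro: \<Theta>sS)

lemma single_direction_noise: "single_direction m (\<lambda>n \<Theta> z. snd z)"
  by (rule single_directionI[of 0 _ _ 1 0]) (auto intro: \<Theta>sS)

lemma single_direction_star: "single_direction m (\<lambda>n \<Theta> z. dotp (p n) (\<Theta>s n $ l) (fst z))"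
  by (rule single_directionI[of 1 _ _ 0 0]) (auto intro: bexI[OF _ \<Theta>sS[of _ l]])

lemma single_direction_column:
  assumes "j < m"
  shows "single_direction m (\<lambda>n \<Theta> z. dotp (p n) (\<Theta> j $ l) (fst z))"
proof (rule single_directionI[of 1 _ _ 0 0])
  fix n and \<Theta> :: "nat \<Rightarrow> (nat \<Rightarrow> real) ^ 'a" assume "\<Theta> \<in> tuples m n"
  then have "\<Theta> j $ l \<in> S n" using assms CS by (auto simp: tuples_def cols_in_def)
  then show "\<exists>\<theta>\<in>S n. \<forall>z. dotp (p n) (\<Theta> j $ l) (fst z) = 1 * dotp (p n) \<theta> (fst z) + 0 * snd z + 0"
    by (intro bexI[of _ "\<Theta> j $ l"]) auto
qed simp

lemma single_direction_sum:
  assumes "finite I" "\<And>i. i \<in> I \<Longrightarrow> single_direction m (f i)"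
  shows "single_direction m (\<lambda>n \<Theta> z. \<Sum>i\<in>I. f i n \<Theta> z)"
  using assms by (induction I rule: finite_induct) (auto intro: single_direction_add single_direction_const)

lemma single_direction_linear:
  assumes "j < m"
  shows "single_direction m (\<lambda>n \<Theta> z. a \<bullet> wv n (\<Theta> j) z + b)"
proof -
  obtain a1 a2 a3 where a: "a = ((a1, a2), a3)" by (metis prod.exhaust)
  have "(\<lambda>n \<Theta> z. a \<bullet> wv n (\<Theta> j) z + b) =
     (\<lambda>n \<Theta> z. (\<Sum>l\<in>UNIV. a1 $ l * dotp (p n) (\<Theta> j $ l) (fst z)) + (\<Sum>l\<in>UNIV. a2 $ l * dotp (p n) (\<Theta>s n $ l) (fst z)) + a3 * snd z + b)"
    by (auto simp: fun_eq_iff wv_def a inner_vec_def proj_def)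
  then show ?thesis
    by (simp only:) (rule single_direction_add[OF single_direction_add[OF single_direction_add[OF single_direction_sum[OF finite single_direction_scale[OF single_direction_column[OF assms]]]
      single_direction_sum[OF finite single_direction_scale[OF single_direction_star]]] single_direction_scale[OF single_direction_noise]] single_direction_const])
qed

section \<open>Cosines of one direction under the two laws\<close>

lemma bounded_lipschitz_trig:
  "bounded_lipschitz (\<lambda>t. cos (s * t))" "bounded_lipschitz (\<lambda>t. sin (s * t))"
proof -
  have b: "bounded (range (\<lambda>t. cos (s * t)))" "bounded (range (\<lambda>t. sin (s * t)))"
    unfolding bounded_iff by (auto intro!: exI[of _ 1])
  have "norm (cos (s * x) - cos (s * y)) \<le> \<bar>s\<bar> * norm (x - y)" for x y :: real
  proof (rule field_differentiable_bound[where S = UNIV])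
    show "((\<lambda>t. cos (s * t)) has_field_derivative - sin (s * z) * s) (at z within UNIV)" for z
      by (auto intro!: derivative_eq_intros)
    show "norm (- sin (s * z) * s) \<le> \<bar>s\<bar>" for z
      using abs_sin_le_one[of "s * z"] by (simp add: abs_mult mult_left_le_one_le)
  qed auto
  then have "\<bar>s\<bar>-lipschitz_on UNIV (\<lambda>t. cos (s * t))"
    by (intro lipschitz_onI) (auto simp: dist_norm)
  moreover have "norm (sin (s * x) - sin (s * y)) \<le> \<bar>s\<bar> * norm (x - y)" for x y :: real
  proof (rule field_differentiable_bound[where S = UNIV])
    show "((\<lambda>t. sin (s * t)) has_field_derivative cos (s * z) * s) (at z within UNIV)" for z
      by (auto intro!: derivative_eq_intros)
    show "norm (cos (s * z) * s) \<le> \<bar>s\<bar>" for z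
      using abs_cos_le_one[of "s * z"] by (simp add: abs_mult mult_left_le_one_le)
  qed auto
  then have "\<bar>s\<bar>-lipschitz_on UNIV (\<lambda>t. sin (s * t))"
    by (intro lipschitz_onI) (auto simp: dist_norm)
  ultimately show "bounded_lipschitz (\<lambda>t. cos (s * t))" "bounded_lipschitz (\<lambda>t. sin (s * t))"
    using b by (auto simp: bounded_lipschitz_def)
qed

lemma dom_uniform:
  assumes "bounded_lipschitz \<phi>" "0 < \<tau>"
  shows "eventually (\<lambda>n. \<forall>\<theta>\<in>S n. \<bar>(\<integral>x. \<phi> (dotp (p n) \<theta> x) \<partial>Px n) - (\<integral>x. \<phi> (dotp (p n) \<theta> x) \<partial>Pg n)\<bar> \<le> \<tau>) sequentially"
proof -
  obtain B where B: "\<And>t. \<bar>\<phi> t\<bar> \<le> B"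
    using assms(1) unfolding bounded_lipschitz_def bounded_iff by (auto simp: image_iff)
  have cont: "\<phi> \<in> borel_measurable borel"
  proof -
    obtain K where "K-lipschitz_on UNIV \<phi>" using assms(1) unfolding bounded_lipschitz_def by blast
    then show ?thesis by (intro borel_measurable_continuous_onI lipschitz_on_continuous_on)
  qed
  have m: "(\<lambda>x. \<phi> (dotp (p n) \<theta> x)) \<in> borel_measurable (Rvec_borel (p n))" for n \<theta>
    by (rule measurable_compose[OF measurable_dotp cont])
  have ib: "\<bar>\<integral>x. \<phi> (dotp (p n) \<theta> x) \<partial>P\<bar> \<le> B" if "prob_space P" "sets P = sets (Rvec_borel (p n))" for P n \<theta>
    by (rule abs_integral_le[OF that(1)]) (use m B in \<open>auto simp: measurable_cong_sets[OF that(2) refl]\<close>)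
  let ?d = "\<lambda>n \<theta>. \<bar>(\<integral>x. \<phi> (dotp (p n) \<theta> x) \<partial>Pg n) - (\<integral>x. \<phi> (dotp (p n) \<theta> x) \<partial>Px n)\<bar>"
  \<comment> \<open>A supremum of reals dominates its terms only over a set that is bounded above;
    boundedness of \<open>\<phi>\<close> provides this.\<close>
  have bd: "bdd_above (?d n ` S n)" for n
  proof (rule bdd_aboveI2[of _ _ "2 * B"])
    fix \<theta>
    show "?d n \<theta> \<le> 2 * B" using ib[OF prob(1) sets_P(1), of n \<theta>] ib[OF prob(2) sets_P(2), of n \<theta>] by linarith
  qed
  have "eventually (\<lambda>n. (SUP \<theta>\<in>S n. ?d n \<theta>) < \<tau>) sequentially"
    using dom[OF assms(1)] assms(2) by (rule order_tendstoD)
  then show ?thesis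
  proof eventually_elim
    case (elim n)
    show ?case
    proof
      fix \<theta> assume "\<theta> \<in> S n"
      then have "?d n \<theta> \<le> (SUP \<theta>\<in>S n. ?d n \<theta>)" by (rule cSUP_upper[OF _ bd])
      then show "\<bar>(\<integral>x. \<phi> (dotp (p n) \<theta> x) \<partial>Px n) - (\<integral>x. \<phi> (dotp (p n) \<theta> x) \<partial>Pg n)\<bar> \<le> \<tau>"
        using elim by (simp add: abs_minus_commute)
    qed
  qed
qed

text \<open>The addition formula separates features from noise. The noise factors are common to both
  models and at most 1 in absolute value; the feature factors are the functions cos (s t) and sin (s
  t) of \<open>t = dotp (p n) \<theta> x\<close>, admissible as test functions because
  \<open>s\<close> does not vary with \<open>n\<close>.\<close>

lemma single_direction_cos:
  assumes "single_direction m ph"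
  shows "uniformly_close m (\<lambda>n \<Theta> z. cos (ph n \<Theta> z))"
  unfolding uniformly_close_def
proof (intro allI impI)
  fix \<tau> :: real assume "0 < \<tau>"
  then have t: "0 < \<tau> / 2" by simp
  obtain s c b where 1: "0 \<le> s" "\<And>n \<Theta>. \<Theta> \<in> tuples m n \<Longrightarrow> \<exists>\<theta>\<in>S n. \<forall>z. ph n \<Theta> z = s * dotp (p n) \<theta> (fst z) + c * snd z + b"
    using assms(1) unfolding single_direction_def by blast
  show "eventually (\<lambda>n. \<forall>\<Theta>\<in>tuples m n. \<bar>(\<integral>z. cos (ph n \<Theta> z) \<partial>Q n) - (\<integral>z. cos (ph n \<Theta> z) \<partial>Q' n)\<bar> \<le> \<tau>) sequentially"
    using dom_uniform[OF bounded_lipschitz_trig(1)[of s] t] dom_uniform[OF bounded_lipschitz_trig(2)[of s] t]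
  proof eventually_elim
    case (elim n)
    show ?case
    proof
      fix \<Theta> :: "nat \<Rightarrow> (nat \<Rightarrow> real) ^ 'a" assume \<Theta>: "\<Theta> \<in> tuples m n"
      obtain \<theta> where \<theta>: "\<theta> \<in> S n" "\<And>z. ph n \<Theta> z = s * dotp (p n) \<theta> (fst z) + c * snd z + b" using 1(2)[OF \<Theta>] by blast
      define ce where "ce = (\<integral>e. cos (c * e + b) \<partial>Pe n)"
      define se where "se = (\<integral>e. sin (c * e + b) \<partial>Pe n)"
      have "(\<lambda>e. cos (c * e + b)) \<in> borel_measurable (Pe n)" "(\<lambda>e. sin (c * e + b)) \<in> borel_measurable (Pe n)"
        unfolding measurable_cong_sets[OF sets_P(3) refl] by measurable
      then have ee: "\<bar>ce\<bar> \<le> 1" "\<bar>se\<bar> \<le> 1"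
        unfolding ce_def se_def by (auto intro!: abs_integral_le[OF prob(3)])
      have eq: "(\<integral>z. cos (ph n \<Theta> z) \<partial>(P \<Otimes>\<^sub>M Pe n)) = (\<integral>x. cos (s * dotp (p n) \<theta> x) \<partial>P) * ce - (\<integral>x. sin (s * dotp (p n) \<theta> x) \<partial>P) * se"
        if P: "prob_space P" "sets P = sets (Rvec_borel (p n))" for P
      proof -
        have dm: "dotp (p n) \<theta> \<in> borel_measurable P"
          using measurable_dotp unfolding measurable_cong_sets[OF P(2) refl] .
        have f: "(\<lambda>x. cos (s * dotp (p n) \<theta> x)) \<in> borel_measurable P" "(\<lambda>x. sin (s * dotp (p n) \<theta> x)) \<in> borel_measurable P"
          using dm by measurable
        have g: "(\<lambda>e. cos (c * e + b)) \<in> borel_measurable (Pe n)" "(\<lambda>e. sin (c * e + b)) \<in> borel_measurable (Pe n)"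
          unfolding measurable_cong_sets[OF sets_P(3) refl] by measurable
        note cc = integral_pair_mult[OF P(1) prob(3) f(1) abs_cos_le_one g(1) abs_cos_le_one]
        note ss = integral_pair_mult[OF P(1) prob(3) f(2) abs_sin_le_one g(2) abs_sin_le_one]
        have "(\<integral>z. cos (ph n \<Theta> z) \<partial>(P \<Otimes>\<^sub>M Pe n)) = (\<integral>z. cos (s * dotp (p n) \<theta> (fst z)) * cos (c * snd z + b) - sin (s * dotp (p n) \<theta> (fst z)) * sin (c * snd z + b) \<partial>(P \<Otimes>\<^sub>M Pe n))"
          unfolding \<theta>(2) add.assoc cos_add ..
        also have "\<dots> = (\<integral>z. cos (s * dotp (p n) \<theta> (fst z)) * cos (c * snd z + b) \<partial>(P \<Otimes>\<^sub>M Pe n)) - (\<integral>z. sin (s * dotp (p n) \<theta> (fst z)) * sin (c * snd z + b) \<partial>(P \<Otimes>\<^sub>M Pe n))"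
          by (rule Bochner_Integration.integral_diff[OF cc(1) ss(1)])
        also have "(\<integral>z. cos (s * dotp (p n) \<theta> (fst z)) * cos (c * snd z + b) \<partial>(P \<Otimes>\<^sub>M Pe n)) = (\<integral>x. cos (s * dotp (p n) \<theta> x) \<partial>P) * ce"
          unfolding ce_def by (rule cc(2))
        also have "(\<integral>z. sin (s * dotp (p n) \<theta> (fst z)) * sin (c * snd z + b) \<partial>(P \<Otimes>\<^sub>M Pe n)) = (\<integral>x. sin (s * dotp (p n) \<theta> x) \<partial>P) * se"
          unfolding se_def by (rule ss(2))
        finally show ?thesis .
      qed
      have real: "\<bar>(c1 * ce - s1 * se) - (c2 * ce - s2 * se)\<bar> \<le> \<tau>" if "\<bar>c1 - c2\<bar> \<le> \<tau> / 2" "\<bar>s1 - s2\<bar> \<le> \<tau> / 2" for c1 c2 s1 s2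
      proof -
        have "(c1 * ce - s1 * se) - (c2 * ce - s2 * se) = (c1 - c2) * ce - (s1 - s2) * se"
          by (simp add: algebra_simps)
        also have "\<bar>\<dots>\<bar> \<le> \<bar>c1 - c2\<bar> * \<bar>ce\<bar> + \<bar>s1 - s2\<bar> * \<bar>se\<bar>"
          unfolding abs_mult[symmetric] by (rule abs_triangle_ineq4)
        also have "\<dots> \<le> (\<tau> / 2) * 1 + (\<tau> / 2) * 1"
          by (intro add_mono mult_mono that ee) (use t in auto)
        finally show ?thesis by simp
      qed
      show "\<bar>(\<integral>z. cos (ph n \<Theta> z) \<partial>Q n) - (\<integral>z. cos (ph n \<Theta> z) \<partial>Q' n)\<bar> \<le> \<tau>"
        unfolding Q_def Q'_def eq[OF prob(1) sets_P(1)] eq[OF prob(2) sets_P(2)]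
        by (rule real[OF bspec[OF elim(1) \<theta>(1)] bspec[OF elim(2) \<theta>(1)]])
    qed
  qed
qed

end

section \<open>Tails of the projections and products over replicas\<close>

lemma trig_poly_bounded: "trig_poly f \<Longrightarrow> \<exists>K. \<forall>w. \<bar>f w\<bar> \<le> K"
proof (induction rule: trig_poly.induct)
  case (cos a b)
  show ?case by (rule exI[of _ 1]) simp
next
  case (scale f c)
  then obtain K where K: "\<And>w. \<bar>f w\<bar> \<le> K" by blast
  have "\<bar>c * f w\<bar> \<le> \<bar>c\<bar> * K" for w unfolding abs_mult by (intro mult_left_mono K) auto
  then show ?case by blast
next
  case (add f g)
  then obtain K K' where "\<And>w. \<bar>f w\<bar> \<le> K" "\<And>w. \<bar>g w\<bar> \<le> K'" by blast
  then have "\<bar>f w + g w\<bar> \<le> K + K'" for w by (intro order_trans[OF abs_triangle_ineq] add_mono)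
  then show ?case by blast
qed

lemma nn_integral_pair_fst:
  assumes P: "prob_space P" and E: "prob_space E" and f: "f \<in> borel_measurable P"
  shows "(\<integral>\<^sup>+z. f (fst z) \<partial>(P \<Otimes>\<^sub>M E)) = (\<integral>\<^sup>+x. f x \<partial>P)"
proof -
  interpret E: prob_space E by fact
  have "(\<integral>\<^sup>+z. f (fst z) \<partial>(P \<Otimes>\<^sub>M E)) = (\<integral>\<^sup>+x. (\<integral>\<^sup>+e. f (fst (x, e)) \<partial>E) \<partial>P)"
    by (rule E.nn_integral_fst[symmetric]) (rule measurable_compose[OF measurable_fst f])
  then show ?thesis by (simp add: E.emeasure_space_1)
qed

lemma nn_integral_pair_snd:
  assumes P: "prob_space P" and E: "prob_space E" and f: "f \<in> borel_measurable E"
  shows "(\<integral>\<^sup>+z. f (snd z) \<partial>(P \<Otimes>\<^sub>M E)) = (\<integral>\<^sup>+x. f x \<partial>E)"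
proof -
  interpret P: prob_space P by fact
  interpret E: prob_space E by fact
  have "(\<integral>\<^sup>+z. f (snd z) \<partial>(P \<Otimes>\<^sub>M E)) = (\<integral>\<^sup>+x. (\<integral>\<^sup>+e. f (snd (x, e)) \<partial>E) \<partial>P)"
    by (rule E.nn_integral_fst[symmetric]) (rule measurable_compose[OF measurable_snd f])
  then show ?thesis by (simp add: P.emeasure_space_1)
qed

lemma exists_exp_small:
  assumes "0 < \<kappa>" "0 < (q :: real)"
  obtains L where "0 < L" "exp (- L / \<kappa>) \<le> q"
proof (rule that[of "max 1 (- \<kappa> * ln q)"])
  have "- max 1 (- \<kappa> * ln q) / \<kappa> \<le> (\<kappa> * ln q) / \<kappa>"
    using assms by (intro divide_right_mono) auto
  also have "\<dots> = ln q" using assms by simp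
  finally have "exp (- max 1 (- \<kappa> * ln q) / \<kappa>) \<le> exp (ln q)" by (simp only: exp_le_cancel_iff)
  then show "exp (- max 1 (- \<kappa> * ln q) / \<kappa>) \<le> q" using assms by simp
qed simp

context gaussian_features
begin

lemma wv_subexp:
  assumes n: "1 \<le> n" and \<Theta>: "\<Theta> \<in> cols_in (C n)" and R: "R \<in> {Q n, Q' n}" and i: "i \<in> Basis"
  shows "(\<integral>\<^sup>+z. ennreal (exp (\<bar>wv n \<Theta> z \<bullet> i\<bar> / \<kappa>)) \<partial>R) \<le> 10"
proof -
  have fm: "(\<lambda>x. ennreal (exp (\<bar>dotp (p n) \<theta> x\<bar> / \<kappa>))) \<in> borel_measurable (Rvec_borel (p n))" for \<theta>
    by measurable
  have em: "(\<lambda>e. ennreal (exp (\<bar>e\<bar> / \<kappa>))) \<in> borel_measurable (Pe n)"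
    unfolding measurable_cong_sets[OF sets_P(3) refl] by measurable
  have F: "(\<integral>\<^sup>+z. ennreal (exp (\<bar>dotp (p n) \<theta> (fst z)\<bar> / \<kappa>)) \<partial>R) \<le> 10"
    if "\<theta> \<in> C n \<union> range (($) (\<Theta>s n))" for \<theta>
    using R nn_integral_pair_fst[OF prob(1) prob(3), of "\<lambda>x. ennreal (exp (\<bar>dotp (p n) \<theta> x\<bar> / \<kappa>))" n]
      nn_integral_pair_fst[OF prob(2) prob(3), of "\<lambda>x. ennreal (exp (\<bar>dotp (p n) \<theta> x\<bar> / \<kappa>))" n] fm[of \<theta>]
      subexp(1)[OF n that] subexp(2)[OF n that]
    by (auto simp: Q_def Q'_def measurable_cong_sets[OF sets_P(1) refl] measurable_cong_sets[OF sets_P(2) refl])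
  have E: "(\<integral>\<^sup>+z. ennreal (exp (\<bar>snd z\<bar> / \<kappa>)) \<partial>R) \<le> 10"
    using R nn_integral_pair_snd[OF prob(1) prob(3) em] nn_integral_pair_snd[OF prob(2) prob(3) em] subexp(3)[OF n]
    by (auto simp: Q_def Q'_def)
  consider j where "i = ((axis j 1, 0), 0)" | l where "i = ((0, axis l 1), 0)" | "i = ((0, 0), 1)"
    using i by (auto simp: Basis_prod_def Basis_vec_def zero_prod_def)
  then show ?thesis
  proof cases
    case 1
    then have "wv n \<Theta> z \<bullet> i = dotp (p n) (\<Theta> $ j) (fst z)" for z
      by (simp add: wv_def proj_def inner_axis)
    then show ?thesis using F[of "\<Theta> $ j"] \<Theta> by (simp add: cols_in_def)
  next
    case 2
    then have "wv n \<Theta> z \<bullet> i = dotp (p n) (\<Theta>s n $ l) (fst z)" for z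
      by (simp add: wv_def proj_def inner_axis)
    then show ?thesis using F[of "\<Theta>s n $ l"] by simp
  next
    case 3
    then have "wv n \<Theta> z \<bullet> i = snd z" for z by (simp add: wv_def)
    then show ?thesis using E by simp
  qed
qed

lemma measurable_wv_R:
  assumes R: "R \<in> {Q n, Q' n}"
  shows "wv n \<Theta> \<in> borel_measurable R"
proof -
  have s: "sets R = sets (Rvec_borel (p n) \<Otimes>\<^sub>M borel)" using R sets_Q by blast
  show ?thesis unfolding measurable_cong_sets[OF s refl] by (rule measurable_wv)
qed

lemma prob_R: "R \<in> {Q n, Q' n} \<Longrightarrow> prob_space R"
  using prob_Q by blast

text \<open>Markov's inequality for the exponential of a coordinate over \<kappa>, whose mean is at
  most 10, and a union over the coordinates, whose number is fixed. The bound does not involve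
  \<open>n\<close> or \<open>p\<close>.\<close>

lemma wv_tail:
  fixes \<Theta> :: "(nat \<Rightarrow> real) ^ 'k"
  assumes n: "1 \<le> n" and \<Theta>: "\<Theta> \<in> cols_in (C n)" and R: "R \<in> {Q n, Q' n}"
  shows "measure R {z \<in> space R. \<exists>i\<in>Basis. L < \<bar>wv n \<Theta> z \<bullet> i\<bar>} \<le> real (DIM(((real ^ 'k) \<times> (real ^ 's)) \<times> real)) * (10 * exp (- L / \<kappa>))"
    (is "measure R ?A \<le> _")
proof -
  interpret prob_space R by (rule prob_R[OF R])
  note [measurable] = measurable_wv_R[OF R, of \<Theta>]
  have one: "measure R {z \<in> space R. L < \<bar>wv n \<Theta> z \<bullet> i\<bar>} \<le> 10 * exp (- L / \<kappa>)"
    if i: "i \<in> Basis" for i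
  proof -
    let ?B = "{z \<in> space R. L < \<bar>wv n \<Theta> z \<bullet> i\<bar>}"
    have Bm: "?B \<in> sets R" by measurable
    have "emeasure R ?B = (\<integral>\<^sup>+z. indicator ?B z \<partial>R)" using Bm by simp
    also have "\<dots> \<le> (\<integral>\<^sup>+z. ennreal (exp (- L / \<kappa>)) * ennreal (exp (\<bar>wv n \<Theta> z \<bullet> i\<bar> / \<kappa>)) \<partial>R)"
    proof (rule nn_integral_mono)
      fix z
      show "indicator ?B z \<le> ennreal (exp (- L / \<kappa>)) * ennreal (exp (\<bar>wv n \<Theta> z \<bullet> i\<bar> / \<kappa>))"
      proof (cases "L < \<bar>wv n \<Theta> z \<bullet> i\<bar>")
        case True
        have "1 \<le> exp (- L / \<kappa> + \<bar>wv n \<Theta> z \<bullet> i\<bar> / \<kappa>)"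
        proof -
          have "L / \<kappa> \<le> \<bar>wv n \<Theta> z \<bullet> i\<bar> / \<kappa>" using True \<kappa> by (intro divide_right_mono) auto
          then show ?thesis by simp
        qed
        then have "ennreal 1 \<le> ennreal (exp (- L / \<kappa>) * exp (\<bar>wv n \<Theta> z \<bullet> i\<bar> / \<kappa>))"
          unfolding mult_exp_exp by (rule ennreal_leI)
        then show ?thesis
          by (subst ennreal_mult[symmetric]) (auto simp: indicator_def)
      qed simp
    qed
    also have "\<dots> = ennreal (exp (- L / \<kappa>)) * (\<integral>\<^sup>+z. ennreal (exp (\<bar>wv n \<Theta> z \<bullet> i\<bar> / \<kappa>)) \<partial>R)"
      by (rule nn_integral_cmult) measurable
    also have "\<dots> \<le> ennreal (exp (- L / \<kappa>)) * 10"
      by (intro mult_left_mono wv_subexp[OF n \<Theta> R i]) simp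
    also have "\<dots> = ennreal (10 * exp (- L / \<kappa>))"
      by (subst mult.commute, subst ennreal_mult) auto
    finally show ?thesis by (simp add: emeasure_eq_measure)
  qed
  have "?A = (\<Union>i\<in>Basis. {z \<in> space R. L < \<bar>wv n \<Theta> z \<bullet> i\<bar>})" by blast
  then have "measure R ?A \<le> (\<Sum>i\<in>(Basis :: (((real ^ 'k) \<times> (real ^ 's)) \<times> real) set). measure R {z \<in> space R. L < \<bar>wv n \<Theta> z \<bullet> i\<bar>})"
    by (simp only:) (rule finite_measure_subadditive_finite, auto)
  also have "\<dots> \<le> (\<Sum>i\<in>(Basis :: (((real ^ 'k) \<times> (real ^ 's)) \<times> real) set). 10 * exp (- L / \<kappa>))"
    by (intro sum_mono one)
  finally show ?thesis by simp
qed

text \<open>Localization: functions are approximated only while all projections and the noise stay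
  in a box, and the exponential tail pays for the complement.\<close>

lemma wv_box:
  fixes f g :: "(nat \<Rightarrow> real) \<times> real \<Rightarrow> real" and \<Theta> :: "(nat \<Rightarrow> real) ^ 'k"
  assumes n: "1 \<le> n" and \<Theta>: "\<Theta> \<in> cols_in (C n)" and R: "R \<in> {Q n, Q' n}"
    and f: "f \<in> borel_measurable R" "\<And>z. \<bar>f z\<bar> \<le> B" and g: "g \<in> borel_measurable R" "\<And>z. \<bar>g z\<bar> \<le> B'"
    and box: "\<And>z. (\<And>i. i \<in> Basis \<Longrightarrow> \<bar>wv n \<Theta> z \<bullet> i\<bar> \<le> L) \<Longrightarrow> \<bar>f z - g z\<bar> \<le> e"
    and out: "\<And>z. \<bar>f z - g z\<bar> \<le> D" and e: "0 \<le> e" and D: "0 \<le> D"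
  shows "\<bar>(\<integral>z. f z \<partial>R) - (\<integral>z. g z \<partial>R)\<bar> \<le> e + D * (real (DIM(((real ^ 'k) \<times> (real ^ 's)) \<times> real)) * (10 * exp (- L / \<kappa>)))"
proof -
  interpret prob_space R by (rule prob_R[OF R])
  note [measurable] = measurable_wv_R[OF R, of \<Theta>]
  let ?A = "{z \<in> space R. \<exists>i\<in>Basis. L < \<bar>wv n \<Theta> z \<bullet> i\<bar>}"
  have Am: "?A \<in> sets R" by measurable
  have fi: "integrable R f" by (rule integrable_bounded[OF prob_R[OF R] f])
  have gi: "integrable R g" by (rule integrable_bounded[OF prob_R[OF R] g])
  have A1: "integrable R (indicat_real ?A)"
    by (rule integrable_bounded[OF prob_R[OF R], where B = 1]) (use Am in \<open>auto simp: indicator_def\<close>)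
  have Ai: "integrable R (\<lambda>z. e + D * indicator ?A z)" using A1 by simp
  have "\<bar>(\<integral>z. f z \<partial>R) - (\<integral>z. g z \<partial>R)\<bar> = \<bar>\<integral>z. f z - g z \<partial>R\<bar>"
    using fi gi by simp
  also have "\<dots> \<le> (\<integral>z. \<bar>f z - g z\<bar> \<partial>R)" by (rule integral_abs_bound)
  also have "\<dots> \<le> (\<integral>z. e + D * indicator ?A z \<partial>R)"
  proof (rule integral_mono[OF _ Ai])
    show "integrable R (\<lambda>z. \<bar>f z - g z\<bar>)" using fi gi by simp
    fix z assume z: "z \<in> space R"
    show "\<bar>f z - g z\<bar> \<le> e + D * indicator ?A z"
    proof (cases "z \<in> ?A")
      case True
      then show ?thesis using out[of z] e by simp
    next
      case False
      then have "\<bar>f z - g z\<bar> \<le> e" using z by (intro box) (auto simp: not_less)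
      then show ?thesis using False by simp
    qed
  qed
  also have "\<dots> = e + D * measure R ?A"
    using Am A1 by (subst Bochner_Integration.integral_add) (simp_all add: prob_space)
  also have "\<dots> \<le> e + D * (real (DIM(((real ^ 'k) \<times> (real ^ 's)) \<times> real)) * (10 * exp (- L / \<kappa>)))"
    by (intro add_left_mono mult_left_mono wv_tail[OF n \<Theta> R] D)
  finally show ?thesis .
qed

lemma uniformly_bounded_mult:
  assumes "uniformly_bounded m F" "uniformly_bounded m G"
  shows "uniformly_bounded m (\<lambda>n \<Theta> z. F n \<Theta> z * G n \<Theta> z)"
proof -
  obtain B where B: "\<And>n \<Theta>. \<Theta> \<in> tuples m n \<Longrightarrow> F n \<Theta> \<in> borel_measurable (Rvec_borel (p n) \<Otimes>\<^sub>M borel)" "\<And>n \<Theta> z. \<Theta> \<in> tuples m n \<Longrightarrow> \<bar>F n \<Theta> z\<bar> \<le> B"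
    using assms(1) unfolding uniformly_bounded_def by blast
  obtain B' where B': "\<And>n \<Theta>. \<Theta> \<in> tuples m n \<Longrightarrow> G n \<Theta> \<in> borel_measurable (Rvec_borel (p n) \<Otimes>\<^sub>M borel)" "\<And>n \<Theta> z. \<Theta> \<in> tuples m n \<Longrightarrow> \<bar>G n \<Theta> z\<bar> \<le> B'"
    using assms(2) unfolding uniformly_bounded_def by blast
  have "\<bar>F n \<Theta> z * G n \<Theta> z\<bar> \<le> B * B'" if "\<Theta> \<in> tuples m n" for n \<Theta> z
    unfolding abs_mult using B(2)[OF that, of z] B'(2)[OF that, of z] by (intro mult_mono) auto
  moreover have "(\<lambda>z. F n \<Theta> z * G n \<Theta> z) \<in> borel_measurable (Rvec_borel (p n) \<Otimes>\<^sub>M borel)" if "\<Theta> \<in> tuples m n" for n \<Theta>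
    using B(1)[OF that] B'(1)[OF that] by (rule borel_measurable_times)
  ultimately show ?thesis unfolding uniformly_bounded_def by blast
qed

lemma uniformly_bounded_const: "uniformly_bounded m (\<lambda>n \<Theta> z. c)"
  unfolding uniformly_bounded_def by (rule exI[of _ "\<bar>c\<bar>"]) auto

lemma uniformly_bounded_prod:
  assumes "\<And>j. j < (i :: nat) \<Longrightarrow> uniformly_bounded m (F j)"
  shows "uniformly_bounded m (\<lambda>n \<Theta> z. \<Prod>j<i. F j n \<Theta> z)"
  using assms
proof (induction i)
  case 0
  show ?case using uniformly_bounded_const[of m 1] by simp
next
  case (Suc i)
  have "uniformly_bounded m (\<lambda>n \<Theta> z. (\<Prod>j<i. F j n \<Theta> z) * F i n \<Theta> z)"
    by (intro uniformly_bounded_mult Suc) auto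
  then show ?case by simp
qed

lemma uniformly_bounded_wv:
  assumes "continuous_on UNIV f" "\<And>w. \<bar>f w\<bar> \<le> B"
  shows "uniformly_bounded m (\<lambda>n \<Theta> z. f (wv n (\<Theta> j) z))"
  unfolding uniformly_bounded_def
  using measurable_compose[OF measurable_wv borel_measurable_continuous_onI[OF assms(1)]] assms(2) by blast

lemma uniformly_bounded_single_direction:
  assumes "single_direction m ph"
  shows "uniformly_bounded m (\<lambda>n \<Theta> z. cos (ph n \<Theta> z))"
proof -
  have "(\<lambda>z. cos (ph n \<Theta> z)) \<in> borel_measurable (Rvec_borel (p n) \<Otimes>\<^sub>M borel)" if \<Theta>: "\<Theta> \<in> tuples m n" for n \<Theta>
  proof -
    obtain s c b \<theta> where "\<And>z. ph n \<Theta> z = s * dotp (p n) \<theta> (fst z) + c * snd z + b"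
      using assms \<Theta> unfolding single_direction_def by blast
    then show ?thesis by simp
  qed
  then show ?thesis unfolding uniformly_bounded_def by (intro exI[of _ 1]) simp
qed

text \<open>Induction on the number of continuous factors, with the phase generalized. The last
  factor is replaced by a trigonometric polynomial; each of its cosines merges with the cosine of
  \<open>ph\<close> into two cosines whose phases are again single directions. With no factor left,
  \<open>single_direction_cos\<close> applies.\<close>

lemma replica_uniformly_close_cos:
  fixes f :: "nat \<Rightarrow> ((real ^ 'k) \<times> (real ^ 's)) \<times> real \<Rightarrow> real"
  assumes "i \<le> m" "single_direction m ph" "\<And>j. j < i \<Longrightarrow> continuous_on UNIV (f j)" "\<And>j w. j < i \<Longrightarrow> \<bar>f j w\<bar> \<le> B" "1 \<le> B"
  shows "uniformly_close m (\<lambda>n \<Theta> z. cos (ph n \<Theta> z) * (\<Prod>j<i. f j (wv n (\<Theta> j) z)))"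
  using assms
proof (induction i arbitrary: ph)
  case 0
  then show ?case using single_direction_cos[of m ph] by simp
next
  case (Suc i)
  note B = Suc.prems(5)
  define P where "P = (\<lambda>n \<Theta> z. \<Prod>j<i. f j (wv n (\<Theta> j) z))"
  have IH: "uniformly_close m (\<lambda>n \<Theta> z. cos (ph n \<Theta> z) * P n \<Theta> z)" if "single_direction m ph" for ph
    unfolding P_def by (rule Suc.IH) (use that Suc.prems in auto)
  have Pm: "uniformly_bounded m P" unfolding P_def by (rule uniformly_bounded_prod, rule uniformly_bounded_wv[where B = B]) (use Suc.prems in auto)
  have PB: "\<bar>P n \<Theta> z\<bar> \<le> B ^ i" for n \<Theta> z
  proof -
    have "\<bar>P n \<Theta> z\<bar> \<le> (\<Prod>j<i. B)"
      unfolding P_def abs_prod using Suc.prems(4) by (intro prod_mono) auto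
    then show ?thesis by simp
  qed
  \<comment> \<open>Inner induction over the trigonometric polynomial; the hypothesis of the outer
    one is used at the cosines, with the sum and the difference of the phases.\<close>
  have T: "uniformly_close m (\<lambda>n \<Theta> z. (cos (ph n \<Theta> z) * P n \<Theta> z) * T (wv n (\<Theta> i) z))" if "trig_poly T" for T
    using that
  proof (induction rule: trig_poly.induct)
    case (cos a b)
    have l: "single_direction m (\<lambda>n \<Theta> z. a \<bullet> wv n (\<Theta> i) z + b)" by (rule single_direction_linear) (use Suc.prems in simp)
    have 1: "single_direction m (\<lambda>n \<Theta> z. ph n \<Theta> z + (a \<bullet> wv n (\<Theta> i) z + b))" by (rule single_direction_add[OF Suc.prems(2) l])
    have 2: "single_direction m (\<lambda>n \<Theta> z. ph n \<Theta> z + (- 1) * (a \<bullet> wv n (\<Theta> i) z + b))" by (rule single_direction_add[OF Suc.prems(2) single_direction_scale[OF l]])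
    have eq: "(cos x * q) * cos y = (1/2) * (cos (x + y) * q) + (1/2) * (cos (x + (- 1) * y) * q)" for x y q :: real
      by (simp add: cos_add cos_diff field_simps)
    show ?case
      unfolding eq
      by (intro uniformly_close_add uniformly_close_scale IH 1 2 uniformly_bounded_mult uniformly_bounded_const uniformly_bounded_single_direction Pm)
  next
    case (scale f c)
    have "uniformly_close m (\<lambda>n \<Theta> z. c * ((cos (ph n \<Theta> z) * P n \<Theta> z) * f (wv n (\<Theta> i) z)))"
      by (rule uniformly_close_scale[OF scale.IH])
    then show ?case by (simp only: mult.left_commute)
  next
    case (add f g)
    have b: "uniformly_bounded m (\<lambda>n \<Theta> z. (cos (ph n \<Theta> z) * P n \<Theta> z) * h (wv n (\<Theta> i) z))" if h: "trig_poly h" for h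
    proof -
      obtain K where K: "\<And>w. \<bar>h w\<bar> \<le> K" using trig_poly_bounded[OF h] by blast
      show ?thesis by (intro uniformly_bounded_mult uniformly_bounded_single_direction Suc.prems(2) Pm uniformly_bounded_wv[OF trig_poly_continuous[OF h] K])
    qed
    show ?case unfolding distrib_left by (intro uniformly_close_add add.IH b add.hyps)
  qed
  have "uniformly_close m (\<lambda>n \<Theta> z. (cos (ph n \<Theta> z) * P n \<Theta> z) * f i (wv n (\<Theta> i) z))"
  proof (rule uniformly_close_approx)
    fix \<tau> :: real assume \<tau>: "0 < \<tau>"
    define d where "d = real (DIM(((real ^ 'k) \<times> (real ^ 's)) \<times> real))"
    have d: "0 < d" by (simp add: d_def)
    have Bi: "0 < B ^ i" using B by simp
    \<comment> \<open>As e \<le> 1 \<le> B, the approximant is at most 2B, so the discrepancy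
      outside the box is at most 3B, the factor occurring in \<open>D\<close>. The bound B^i on the
      earlier factors is divided out.\<close>
    define e where "e = min 1 (\<tau> / (2 * B ^ i))"
    have e: "0 < e" "e \<le> 1" "B ^ i * e \<le> \<tau> / 2"
    proof -
      show "0 < e" "e \<le> 1" using \<tau> Bi by (auto simp: e_def)
      have "B ^ i * e \<le> B ^ i * (\<tau> / (2 * B ^ i))" using Bi by (intro mult_left_mono) (auto simp: e_def)
      also have "q * (\<tau> / (2 * q)) = \<tau> / 2" if "0 < q" for q :: real using that by simp
      from this[OF Bi] have "B ^ i * (\<tau> / (2 * B ^ i)) = \<tau> / 2" .
      finally show "B ^ i * e \<le> \<tau> / 2" .
    qed
    define D where "D = B ^ i * (3 * B)"
    have D: "0 < D" using Bi B by (simp add: D_def)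
    have q: "0 < \<tau> / (2 * (D * d * 10))" using \<tau> D d by simp
    obtain L where L: "0 < L" "exp (- L / \<kappa>) \<le> \<tau> / (2 * (D * d * 10))"
      using exists_exp_small[OF \<kappa> q] by blast
    have DL: "D * (d * (10 * exp (- L / \<kappa>))) \<le> \<tau> / 2"
    proof -
      have "D * (d * (10 * exp (- L / \<kappa>))) = (D * d * 10) * exp (- L / \<kappa>)" by simp
      also have "\<dots> \<le> (D * d * 10) * (\<tau> / (2 * (D * d * 10)))"
        using D d by (intro mult_left_mono L) auto
      also have "\<dots> = \<tau> / 2" using D d by simp
      finally show ?thesis .
    qed
    have fi: "continuous_on UNIV (f i)" "\<And>w. \<bar>f i w\<bar> \<le> B" using Suc.prems by auto
    obtain T where T': "trig_poly T" "\<And>w. \<bar>T w\<bar> \<le> B + e"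
      "\<And>w. (\<And>i. i \<in> Basis \<Longrightarrow> \<bar>w \<bullet> i\<bar> \<le> L) \<Longrightarrow> \<bar>f i w - T w\<bar> \<le> e"
      using trig_poly_approx[OF fi L(1) e(1)] by blast
    show "\<exists>G. uniformly_close m G \<and> (\<forall>n\<ge>1. \<forall>\<Theta>\<in>tuples m n. \<forall>R\<in>{Q n, Q' n}.
        \<bar>(\<integral>z. (cos (ph n \<Theta> z) * P n \<Theta> z) * f i (wv n (\<Theta> i) z) \<partial>R) - (\<integral>z. G n \<Theta> z \<partial>R)\<bar> \<le> \<tau>)"
    proof (intro exI conjI allI impI ballI)
      show "uniformly_close m (\<lambda>n \<Theta> z. (cos (ph n \<Theta> z) * P n \<Theta> z) * T (wv n (\<Theta> i) z))" by (rule T[OF T'(1)])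
      fix n and \<Theta> :: "nat \<Rightarrow> (nat \<Rightarrow> real) ^ 'k" and R assume n: "1 \<le> n" and \<Theta>: "\<Theta> \<in> tuples m n" and R: "R \<in> {Q n, Q' n}"
      have sR: "sets R = sets (Rvec_borel (p n) \<Otimes>\<^sub>M borel)" using R sets_Q by blast
      have \<Theta>i: "\<Theta> i \<in> cols_in (C n)" using \<Theta> Suc.prems(1) by (simp add: tuples_def)
      have am: "(\<lambda>z. cos (ph n \<Theta> z) * P n \<Theta> z) \<in> borel_measurable R"
        using uniformly_bounded_mult[OF uniformly_bounded_single_direction[OF Suc.prems(2)] Pm] \<Theta> unfolding uniformly_bounded_def measurable_cong_sets[OF sR refl] by blast
      have ab: "\<bar>cos (ph n \<Theta> z) * P n \<Theta> z\<bar> \<le> B ^ i" for z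
        using mult_mono[OF abs_cos_le_one[of "ph n \<Theta> z"] PB[of n \<Theta> z]] by (simp add: abs_mult)
      have cm: "(\<lambda>z. h (wv n (\<Theta> i) z)) \<in> borel_measurable R" if "continuous_on UNIV h" for h :: "_ \<Rightarrow> real"
        by (rule measurable_compose[OF measurable_wv_R[OF R] borel_measurable_continuous_onI[OF that]])
      have diff: "\<bar>(cos (ph n \<Theta> z) * P n \<Theta> z) * f i w - (cos (ph n \<Theta> z) * P n \<Theta> z) * T w\<bar> \<le> B ^ i * \<bar>f i w - T w\<bar>" for z w
        unfolding right_diff_distrib[symmetric] abs_mult[of "cos (ph n \<Theta> z) * P n \<Theta> z"] by (intro mult_right_mono ab) auto
      have "\<bar>(\<integral>z. (cos (ph n \<Theta> z) * P n \<Theta> z) * f i (wv n (\<Theta> i) z) \<partial>R) - (\<integral>z. (cos (ph n \<Theta> z) * P n \<Theta> z) * T (wv n (\<Theta> i) z) \<partial>R)\<bar>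
         \<le> B ^ i * e + D * (d * (10 * exp (- L / \<kappa>)))"
        unfolding d_def
      proof (rule wv_box[OF n \<Theta>i R])
        show "(\<lambda>z. (cos (ph n \<Theta> z) * P n \<Theta> z) * f i (wv n (\<Theta> i) z)) \<in> borel_measurable R"
          by (intro borel_measurable_times[OF am] cm fi)
        show "(\<lambda>z. (cos (ph n \<Theta> z) * P n \<Theta> z) * T (wv n (\<Theta> i) z)) \<in> borel_measurable R"
          by (intro borel_measurable_times[OF am] cm trig_poly_continuous[OF T'(1)])
        show "\<bar>(cos (ph n \<Theta> z) * P n \<Theta> z) * f i (wv n (\<Theta> i) z)\<bar> \<le> B ^ i * B" for z
          unfolding abs_mult[of "cos (ph n \<Theta> z) * P n \<Theta> z"] by (intro mult_mono ab fi) (use Bi in auto)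
        show "\<bar>(cos (ph n \<Theta> z) * P n \<Theta> z) * T (wv n (\<Theta> i) z)\<bar> \<le> B ^ i * (B + e)" for z
          unfolding abs_mult[of "cos (ph n \<Theta> z) * P n \<Theta> z"] by (intro mult_mono ab T') (use Bi in auto)
        show "\<bar>(cos (ph n \<Theta> z) * P n \<Theta> z) * f i (wv n (\<Theta> i) z) - (cos (ph n \<Theta> z) * P n \<Theta> z) * T (wv n (\<Theta> i) z)\<bar> \<le> B ^ i * e"
          if "\<And>l. l \<in> Basis \<Longrightarrow> \<bar>wv n (\<Theta> i) z \<bullet> l\<bar> \<le> L" for z
          by (rule order_trans[OF diff], rule mult_left_mono[OF T'(3)[OF that]]) (use Bi in auto)
        show "\<bar>(cos (ph n \<Theta> z) * P n \<Theta> z) * f i (wv n (\<Theta> i) z) - (cos (ph n \<Theta> z) * P n \<Theta> z) * T (wv n (\<Theta> i) z)\<bar> \<le> D" for z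
          unfolding D_def
        proof (rule order_trans[OF diff], rule mult_left_mono)
          show "\<bar>f i (wv n (\<Theta> i) z) - T (wv n (\<Theta> i) z)\<bar> \<le> 3 * B"
            using fi(2)[of "wv n (\<Theta> i) z"] T'(2)[of "wv n (\<Theta> i) z"] e(2) B by linarith
        qed (use Bi in simp)
      qed (use e Bi D in auto)
      also have "\<dots> \<le> \<tau>" using e(3) DL by linarith
      finally show "\<bar>(\<integral>z. (cos (ph n \<Theta> z) * P n \<Theta> z) * f i (wv n (\<Theta> i) z) \<partial>R) - (\<integral>z. (cos (ph n \<Theta> z) * P n \<Theta> z) * T (wv n (\<Theta> i) z) \<partial>R)\<bar> \<le> \<tau>" .
    qed
  qed
  then show ?case by (simp only: P_def prod.lessThan_Suc mult.assoc)
qed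

lemma replica_uniformly_close:
  fixes f :: "nat \<Rightarrow> ((real ^ 'k) \<times> (real ^ 's)) \<times> real \<Rightarrow> real"
  assumes "\<And>j. j < m \<Longrightarrow> continuous_on UNIV (f j)" "\<And>j w. j < m \<Longrightarrow> \<bar>f j w\<bar> \<le> 1"
  shows "uniformly_close m (\<lambda>n \<Theta> z. \<Prod>j<m. f j (wv n (\<Theta> j) z))"
  using replica_uniformly_close_cos[of m m "\<lambda>n \<Theta> z. 0" f 1] single_direction_const[of m 0] assms by simp

text \<open>In contrast to \<open>uniformly_close_scale\<close>, the coefficient varies with
  \<open>n\<close>; it will be the value of a weight \<open>w n\<close> at a fixed point.\<close>

lemma uniformly_close_coef:
  assumes F: "uniformly_close m F" and c: "\<And>n. \<bar>c n\<bar> \<le> 1"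
  shows "uniformly_close m (\<lambda>n \<Theta> z. c n * F n \<Theta> z)"
  unfolding uniformly_close_def
proof (intro allI impI)
  fix \<tau> :: real assume t: "0 < \<tau>"
  show "eventually (\<lambda>n. \<forall>\<Theta>\<in>tuples m n. \<bar>(\<integral>z. c n * F n \<Theta> z \<partial>Q n) - (\<integral>z. c n * F n \<Theta> z \<partial>Q' n)\<bar> \<le> \<tau>) sequentially"
    using F[unfolded uniformly_close_def, rule_format, OF t]
  proof eventually_elim
    case (elim n)
    show ?case
    proof
      fix \<Theta> :: "nat \<Rightarrow> (nat \<Rightarrow> real) ^ 'a" assume \<Theta>: "\<Theta> \<in> tuples m n"
      have "\<bar>(\<integral>z. c n * F n \<Theta> z \<partial>Q n) - (\<integral>z. c n * F n \<Theta> z \<partial>Q' n)\<bar> = \<bar>c n\<bar> * \<bar>(\<integral>z. F n \<Theta> z \<partial>Q n) - (\<integral>z. F n \<Theta> z \<partial>Q' n)\<bar>"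
        unfolding integral_mult_right_zero right_diff_distrib[symmetric] abs_mult ..
      also have "\<dots> \<le> 1 * \<tau>"
        by (intro mult_mono c bspec[OF elim \<Theta>]) auto
      finally show "\<bar>(\<integral>z. c n * F n \<Theta> z \<partial>Q n) - (\<integral>z. c n * F n \<Theta> z \<partial>Q' n)\<bar> \<le> \<tau>" by simp
    qed
  qed
qed

lemma uniformly_close_sum:
  fixes F :: "'i \<Rightarrow> nat \<Rightarrow> (nat \<Rightarrow> (nat \<Rightarrow> real) ^ 'k) \<Rightarrow> (nat \<Rightarrow> real) \<times> real \<Rightarrow> real"
  assumes "finite I" "\<And>i. i \<in> I \<Longrightarrow> uniformly_close m (F i)" "\<And>i. i \<in> I \<Longrightarrow> uniformly_bounded m (F i)"
  shows "uniformly_close m (\<lambda>n \<Theta> z. \<Sum>i\<in>I. F i n \<Theta> z) \<and> uniformly_bounded m (\<lambda>n \<Theta> z. \<Sum>i\<in>I. F i n \<Theta> z)"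
  using assms
proof (induction I rule: finite_induct)
  case empty
  have "uniformly_close m (\<lambda>n \<Theta> z. 0)" by (auto simp: uniformly_close_def)
  then show ?case using uniformly_bounded_const[of m 0] by simp
next
  case (insert i I)
  have Fi: "uniformly_close m (F i)" "uniformly_bounded m (F i)" by (rule insert.prems, simp)+
  have I: "uniformly_close m (\<lambda>n \<Theta> z. \<Sum>i\<in>I. F i n \<Theta> z) \<and> uniformly_bounded m (\<lambda>n \<Theta> z. \<Sum>i\<in>I. F i n \<Theta> z)"
    by (rule insert.IH; rule insert.prems; simp)
  have "uniformly_close m (\<lambda>n \<Theta> z. F i n \<Theta> z + (\<Sum>i\<in>I. F i n \<Theta> z))"
    by (rule uniformly_close_add[OF Fi I[THEN conjunct1] I[THEN conjunct2]])
  moreover have "uniformly_bounded m (\<lambda>n \<Theta> z. F i n \<Theta> z + (\<Sum>i\<in>I. F i n \<Theta> z))"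
  proof -
    obtain B B' where B: "\<And>n \<Theta>. \<Theta> \<in> tuples m n \<Longrightarrow> F i n \<Theta> \<in> borel_measurable (Rvec_borel (p n) \<Otimes>\<^sub>M borel) \<and> (\<forall>z. \<bar>F i n \<Theta> z\<bar> \<le> B)"
      and B': "\<And>n \<Theta>. \<Theta> \<in> tuples m n \<Longrightarrow> (\<lambda>z. \<Sum>i\<in>I. F i n \<Theta> z) \<in> borel_measurable (Rvec_borel (p n) \<Otimes>\<^sub>M borel) \<and> (\<forall>z. \<bar>\<Sum>i\<in>I. F i n \<Theta> z\<bar> \<le> B')"
      using Fi(2) I[THEN conjunct2] unfolding uniformly_bounded_def by blast
    show ?thesis
      unfolding uniformly_bounded_def
    proof (intro exI[of _ "B + B'"] allI ballI conjI)
      fix n and \<Theta> :: "nat \<Rightarrow> (nat \<Rightarrow> real) ^ 'k" assume \<Theta>: "\<Theta> \<in> tuples m n"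
      show "(\<lambda>z. F i n \<Theta> z + (\<Sum>i\<in>I. F i n \<Theta> z)) \<in> borel_measurable (Rvec_borel (p n) \<Otimes>\<^sub>M borel)"
        using B[OF \<Theta>] B'[OF \<Theta>] by (intro borel_measurable_add) blast+
      show "\<bar>F i n \<Theta> z + (\<Sum>i\<in>I. F i n \<Theta> z)\<bar> \<le> B + B'" for z
        using B[OF \<Theta>] B'[OF \<Theta>] by (intro order_trans[OF abs_triangle_ineq] add_mono) blast+
    qed
  qed
  ultimately show ?case using insert.hyps by simp
qed

end

text \<open>
  A partition of unity on the ball of radius B reduces an equicontinuous family of weights to
  finitely many fixed functions with bounded coefficients.
\<close>

lemma partition_of_unity:
  fixes B e :: real
  assumes e: "0 < e"
  obtains V :: "'v::euclidean_space set" and h :: "'v \<Rightarrow> 'v \<Rightarrow> real" where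
    "finite V" "V \<subseteq> cball 0 B" "\<forall>v\<in>V. continuous_on UNIV (h v)"
    "\<forall>v\<in>V. \<forall>x. 0 \<le> h v x" "\<forall>x. (\<Sum>v\<in>V. h v x) \<le> 1" "\<forall>x\<in>cball 0 B. (\<Sum>v\<in>V. h v x) = 1"
    "\<forall>v\<in>V. \<forall>x. h v x \<noteq> 0 \<longrightarrow> norm (x - v) \<le> 2 * e"
proof -
  obtain V :: "'v set" where V: "finite V" "V \<subseteq> cball 0 B" "cball 0 B \<subseteq> (\<Union>v\<in>V. ball v e)"
    using seq_compact_imp_totally_bounded[OF compact_imp_seq_compact[OF compact_cball[of 0 B]], rule_format, OF e]
    by (elim exE conjE) (rule that)
  define b where "b v x = max 0 (2 * e - norm (x - v))" for v x :: 'v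
  \<comment> \<open>The lower cutoff \<open>e\<close> keeps the denominator positive everywhere. On
    the ball it changes nothing, since a centre at distance less than \<open>e\<close> contributes
    at least \<open>e\<close> to the sum.\<close>
  define s where "s x = max e (\<Sum>v\<in>V. b v x)" for x
  define h where "h v x = b v x / s x" for v x
  have b0: "0 \<le> b v x" for v x by (simp add: b_def)
  have s0: "0 < s x" for x using e by (simp add: s_def max_def)
  have sum: "(\<Sum>v\<in>V. h v x) = (\<Sum>v\<in>V. b v x) / s x" for x by (simp add: h_def sum_divide_distrib)
  show ?thesis
  proof (rule that[OF V(1,2)]; intro ballI allI impI)
    have "max e t \<noteq> 0" for t using e by (simp add: max_def)
    then show "continuous_on UNIV (h v)" for v
      unfolding h_def s_def b_def by (intro continuous_intros ballI)
    show "0 \<le> h v x" for v x using b0 s0[of x] by (simp add: h_def)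
    show "(\<Sum>v\<in>V. h v x) \<le> 1" for x unfolding sum using s0[of x] by (simp add: s_def)
    show "(\<Sum>v\<in>V. h v x) = 1" if x: "x \<in> cball 0 B" for x
    proof -
      obtain v where v: "v \<in> V" "dist v x < e" using subsetD[OF V(3) x] by (auto simp only: UN_iff mem_ball)
      have "e \<le> b v x" using v(2) by (simp add: b_def dist_norm norm_minus_commute)
      also have "\<dots> \<le> (\<Sum>v\<in>V. b v x)" by (rule member_le_sum[OF v(1)]) (use b0 V(1) in auto)
      finally show ?thesis unfolding sum s_def using e by (simp add: max_absorb2)
    qed
    show "norm (x - v) \<le> 2 * e" if "h v x \<noteq> 0" for v x
    proof -
      have "b v x \<noteq> 0" using that by (auto simp: h_def)
      then show ?thesis unfolding b_def by (simp add: max_def split: if_splits)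
    qed
  qed
qed

context gaussian_features
begin

text \<open>The weight stands for the conditional probability of a label, which changes with
  \<open>n\<close> under a common modulus of continuity. It is frozen at the centres
  \<open>v\<close> of a partition of unity; each bump \<open>h v\<close> is a fixed function of the
  projections on the true parameter and is absorbed into the first replica factor.\<close>

lemma replica_uniformly_close_weighted:
  fixes f :: "nat \<Rightarrow> ((real ^ 'k) \<times> (real ^ 's)) \<times> real \<Rightarrow> real" and w :: "nat \<Rightarrow> real ^ 's \<Rightarrow> real"
  assumes f: "\<And>j. j < m \<Longrightarrow> continuous_on UNIV (f j)" "\<And>j w. j < m \<Longrightarrow> \<bar>f j w\<bar> \<le> 1" and m: "0 < m"
    and w: "\<And>n v. 0 \<le> w n v" "\<And>n v. w n v \<le> 1" "0 \<le> K"
      "\<And>n v v'. \<bar>w n v - w n v'\<bar> \<le> K * (1 + norm v + norm v') * norm (v - v')"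
  shows "uniformly_close m (\<lambda>n \<Theta> z. w n (proj (p n) (\<Theta>s n) (fst z)) * (\<Prod>j<m. f j (wv n (\<Theta> j) z)))"
proof (rule uniformly_close_approx)
  fix \<tau> :: real assume \<tau>: "0 < \<tau>"
  define d where "d = real (DIM(((real ^ 'k) \<times> (real ^ 's)) \<times> real))"
  have d: "0 < d" by (simp add: d_def)
  have q: "0 < \<tau> / (2 * (d * 10))" using \<tau> d by simp
  obtain L where L: "0 < L" "exp (- L / \<kappa>) \<le> \<tau> / (2 * (d * 10))"
    using exists_exp_small[OF \<kappa> q] by blast
  have DL: "1 * (d * (10 * exp (- L / \<kappa>))) \<le> \<tau> / 2"
  proof -
    have "1 * (d * (10 * exp (- L / \<kappa>))) = (d * 10) * exp (- L / \<kappa>)" by simp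
    also have "\<dots> \<le> (d * 10) * (\<tau> / (2 * (d * 10)))"
      using d by (intro mult_left_mono L) auto
    also have "\<dots> = \<tau> / 2" using d by simp
    finally show ?thesis .
  qed
  \<comment> \<open>Coordinates of size at most \<open>L\<close> put the projection on the true
    parameter in the ball of radius \<open>B\<close>, on which \<open>M\<close> is a Lipschitz
    constant of every \<open>w n\<close>.\<close>
  define B where "B = real CARD('s) * L"
  have B: "0 \<le> B" using L by (simp add: B_def)
  define M where "M = K * (1 + B + B)"
  have M: "0 \<le> M" using w(3) B by (simp add: M_def)
  \<comment> \<open>A bump reaches as far as 2e from its centre, so freezing the weight there errs
    by at most 2 M e, which this choice keeps below half of \<tau>.\<close>
  define e where "e = \<tau> / (4 * (M + 1))"
  have e: "0 < e" using \<tau> M by (simp add: e_def)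
  have Me: "M * (2 * e) \<le> \<tau> / 2"
  proof -
    have "M * (2 * (\<tau> / (4 * q))) = (\<tau> / 2) * (M / q)" for q by simp
    then have "M * (2 * e) = (\<tau> / 2) * (M / (M + 1))" unfolding e_def .
    also have "\<dots> \<le> (\<tau> / 2) * 1" using M \<tau> by (intro mult_left_mono) auto
    finally show ?thesis by simp
  qed
  obtain V :: "(real ^ 's) set" and h :: "real ^ 's \<Rightarrow> real ^ 's \<Rightarrow> real" where V: "finite V" "V \<subseteq> cball 0 B" and h': "\<forall>v\<in>V. continuous_on UNIV (h v)"
    "\<forall>v\<in>V. \<forall>x. 0 \<le> h v x" "\<forall>x. (\<Sum>v\<in>V. h v x) \<le> 1" "\<forall>x\<in>cball 0 B. (\<Sum>v\<in>V. h v x) = 1"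
    "\<forall>v\<in>V. \<forall>x. h v x \<noteq> 0 \<longrightarrow> norm (x - v) \<le> 2 * e"
  proof (rule partition_of_unity[OF e, of B])
    fix V :: "(real ^ 's) set" and h :: "real ^ 's \<Rightarrow> real ^ 's \<Rightarrow> real"
    assume "finite V" "V \<subseteq> cball 0 B" "\<forall>v\<in>V. continuous_on UNIV (h v)"
      "\<forall>v\<in>V. \<forall>x. 0 \<le> h v x" "\<forall>x. (\<Sum>v\<in>V. h v x) \<le> 1" "\<forall>x\<in>cball 0 B. (\<Sum>v\<in>V. h v x) = 1"
      "\<forall>v\<in>V. \<forall>x. h v x \<noteq> 0 \<longrightarrow> norm (x - v) \<le> 2 * e"
    then show thesis by (rule that[of V h])
  qed
  note h = h'[rule_format]
  have h1: "h v x \<le> 1" if "v \<in> V" for v x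
    using member_le_sum[of v V "\<lambda>v. h v x"] that V(1) h(2) h(3)[of x] by force
  define us where "us n z = proj (p n) (\<Theta>s n) (fst z)" for n and z :: "(nat \<Rightarrow> real) \<times> real"
  define P where "P n \<Theta> z = (\<Prod>j<m. f j (wv n (\<Theta> j) z))" for n \<Theta> z
  have P1: "\<bar>P n \<Theta> z\<bar> \<le> 1" for n \<Theta> z
  proof -
    have "\<bar>P n \<Theta> z\<bar> \<le> (\<Prod>j<m. 1)" unfolding P_def abs_prod using f(2) by (intro prod_mono) auto
    then show ?thesis by simp
  qed
  have one: "uniformly_close m (\<lambda>n \<Theta> z. h v (us n z) * P n \<Theta> z) \<and> uniformly_bounded m (\<lambda>n \<Theta> z. h v (us n z) * P n \<Theta> z)" if v: "v \<in> V" for v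
  proof -
    \<comment> \<open>The bump reads the second component of the loss argument, which all replicas
      share; replica 0 carries it, and exists because m > 0.\<close>
    define f' where "f' j = (if j = 0 then (\<lambda>x. h v (snd (fst x)) * f 0 x) else f j)" for j
    have hv: "continuous_on UNIV (\<lambda>x :: ((real ^ 'k) \<times> (real ^ 's)) \<times> real. h v (snd (fst x)))"
      by (rule continuous_on_compose2[OF h(1)[OF v]]) (auto intro!: continuous_intros)
    have c: "continuous_on UNIV (f' j)" if "j < m" for j
      using f(1)[OF that] f(1)[of 0] m hv by (cases "j = 0") (auto simp: f'_def intro!: continuous_on_mult)
    have b: "\<bar>f' j x\<bar> \<le> 1" if "j < m" for j x
    proof (cases "j = 0")
      case True
      have "\<bar>h v (snd (fst x)) * f 0 x\<bar> \<le> 1 * 1"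
        unfolding abs_mult using h(2)[OF v] h1[OF v] f(2)[OF m] by (intro mult_mono) auto
      then show ?thesis by (simp add: f'_def True)
    qed (use f(2)[OF that] in \<open>simp add: f'_def\<close>)
    have eq: "(\<Prod>j<m. f' j (wv n (\<Theta> j) z)) = h v (us n z) * P n \<Theta> z" for n \<Theta> z
    proof -
      obtain m' where m': "m = Suc m'" using m by (cases m) auto
      show ?thesis
        unfolding P_def m' prod.lessThan_Suc_shift
        by (simp add: f'_def us_def wv_def)
    qed
    have "uniformly_close m (\<lambda>n \<Theta> z. \<Prod>j<m. f' j (wv n (\<Theta> j) z))" by (rule replica_uniformly_close[OF c b])
    moreover have "uniformly_bounded m (\<lambda>n \<Theta> z. \<Prod>j<m. f' j (wv n (\<Theta> j) z))"
      by (rule uniformly_bounded_prod, rule uniformly_bounded_wv[where B = 1]) (use c b in auto)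
    ultimately show ?thesis unfolding eq by blast
  qed
  have wV: "\<bar>w n v\<bar> \<le> 1" for n v using w(1,2)[of n v] by (simp add: abs_le_iff)
  have bmc: "uniformly_bounded m (\<lambda>n \<Theta> z. w n v * (h v (us n z) * P n \<Theta> z))" if v: "v \<in> V" for v
  proof (rule uniformly_bounded_mult)
    show "uniformly_bounded m (\<lambda>n (\<Theta> :: nat \<Rightarrow> (nat \<Rightarrow> real) ^ 'k) z. w n v)" unfolding uniformly_bounded_def using wV by (intro exI[of _ 1]) simp
  qed (use one[OF v] in blast)
  have G: "uniformly_close m (\<lambda>n \<Theta> z. \<Sum>v\<in>V. w n v * (h v (us n z) * P n \<Theta> z)) \<and> uniformly_bounded m (\<lambda>n \<Theta> z. \<Sum>v\<in>V. w n v * (h v (us n z) * P n \<Theta> z))"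
  proof (rule uniformly_close_sum[OF V(1)])
    fix v assume v: "v \<in> V"
    show "uniformly_close m (\<lambda>n \<Theta> z. w n v * (h v (us n z) * P n \<Theta> z))"
      using one[OF v, THEN conjunct1] wV by (rule uniformly_close_coef)
    show "uniformly_bounded m (\<lambda>n \<Theta> z. w n v * (h v (us n z) * P n \<Theta> z))" by (rule bmc[OF v])
  qed
  have wc: "continuous_on UNIV (w n)" for n
  proof -
    have "continuous (at x) (w n)" for x
    proof -
      have "((\<lambda>y. K * (1 + norm y + norm x) * norm (y - x)) \<longlongrightarrow> K * (1 + norm x + norm x) * norm (x - x)) (at x)"
        by (intro tendsto_intros)
      then have "((\<lambda>y. K * (1 + norm y + norm x) * norm (y - x)) \<longlongrightarrow> 0) (at x)" by simp
      then have "((\<lambda>y. w n y - w n x) \<longlongrightarrow> 0) (at x)"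
        by (rule Lim_null_comparison[rotated]) (use w(4) in auto)
      then show ?thesis unfolding continuous_at by (rule LIM_zero_cancel)
    qed
    then show ?thesis by (simp add: continuous_at_imp_continuous_on)
  qed
  show "\<exists>G. uniformly_close m G \<and> (\<forall>n\<ge>1. \<forall>\<Theta>\<in>tuples m n. \<forall>R\<in>{Q n, Q' n}.
      \<bar>(\<integral>z. w n (proj (p n) (\<Theta>s n) (fst z)) * (\<Prod>j<m. f j (wv n (\<Theta> j) z)) \<partial>R) - (\<integral>z. G n \<Theta> z \<partial>R)\<bar> \<le> \<tau>)"
    unfolding us_def[symmetric] P_def[symmetric]
  proof (intro exI conjI allI impI ballI)
    show "uniformly_close m (\<lambda>n \<Theta> z. \<Sum>v\<in>V. w n v * (h v (us n z) * P n \<Theta> z))" using G by blast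
    fix n and \<Theta> :: "nat \<Rightarrow> (nat \<Rightarrow> real) ^ 'k" and R assume n: "1 \<le> n" and \<Theta>: "\<Theta> \<in> tuples m n" and R: "R \<in> {Q n, Q' n}"
    have sR: "sets R = sets (Rvec_borel (p n) \<Otimes>\<^sub>M borel)" using R sets_Q by blast
    have \<Theta>0: "\<Theta> 0 \<in> cols_in (C n)" using \<Theta> m by (simp add: tuples_def)
    have Pm: "uniformly_bounded m P" unfolding P_def by (rule uniformly_bounded_prod, rule uniformly_bounded_wv[where B = 1]) (use f in auto)
    have PR: "P n \<Theta> \<in> borel_measurable R"
      using Pm \<Theta> unfolding uniformly_bounded_def measurable_cong_sets[OF sR refl] by blast
    have usw: "us n z = snd (fst (wv n (\<Theta> 0) z))" for z by (simp add: us_def wv_def)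
    have usm: "us n \<in> borel_measurable R"
    proof -
      have "(\<lambda>x. snd (fst x)) \<in> borel_measurable (borel :: (((real ^ 'k) \<times> (real ^ 's)) \<times> real) measure)"
        by (intro borel_measurable_continuous_onI continuous_intros)
      from measurable_compose[OF measurable_wv_R[OF R] this] show ?thesis
        unfolding usw[abs_def] .
    qed
    have wm: "(\<lambda>z. w n (us n z)) \<in> borel_measurable R"
      by (rule measurable_compose[OF usm borel_measurable_continuous_onI[OF wc]])
    define g where "g z = (\<Sum>v\<in>V. w n v * h v (us n z))" for z
    have Geq: "(\<Sum>v\<in>V. w n v * (h v (us n z) * P n \<Theta> z)) = g z * P n \<Theta> z" for z
      unfolding g_def sum_distrib_right by (simp only: mult.assoc)
    have g0: "0 \<le> g z" for z unfolding g_def using w(1) h(2) by (intro sum_nonneg mult_nonneg_nonneg) auto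
    have g1: "g z \<le> 1" for z
    proof -
      have "g z \<le> (\<Sum>v\<in>V. 1 * h v (us n z))" unfolding g_def using w(2) h(2) by (intro sum_mono mult_right_mono) auto
      then show ?thesis using h(3)[of "us n z"] by simp
    qed
    have gm: "(\<lambda>z. g z * P n \<Theta> z) \<in> borel_measurable R"
      using G \<Theta> unfolding uniformly_bounded_def measurable_cong_sets[OF sR refl] Geq[symmetric] by blast
    have dif: "\<bar>w n (us n z) * P n \<Theta> z - g z * P n \<Theta> z\<bar> \<le> \<bar>w n (us n z) - g z\<bar>" for z
      unfolding left_diff_distrib[symmetric] abs_mult using P1[of n \<Theta> z] by (simp add: mult_right_le_one_le)
    have "\<bar>(\<integral>z. w n (us n z) * P n \<Theta> z \<partial>R) - (\<integral>z. g z * P n \<Theta> z \<partial>R)\<bar> \<le> \<tau> / 2 + 1 * (d * (10 * exp (- L / \<kappa>)))"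
      unfolding d_def
    proof (rule wv_box[OF n \<Theta>0 R])
      show "(\<lambda>z. w n (us n z) * P n \<Theta> z) \<in> borel_measurable R" by (intro borel_measurable_times wm PR)
      show "\<bar>w n (us n z) * P n \<Theta> z\<bar> \<le> 1 * 1" for z
        unfolding abs_mult by (intro mult_mono wV P1) auto
      show "\<bar>g z * P n \<Theta> z\<bar> \<le> 1 * 1" for z
        unfolding abs_mult using g0[of z] g1[of z] by (intro mult_mono P1) auto
      show "\<bar>w n (us n z) * P n \<Theta> z - g z * P n \<Theta> z\<bar> \<le> 1" for z
        by (rule order_trans[OF dif]) (use g0[of z] g1[of z] w(1,2)[of n "us n z"] in linarith)
      fix z assume box: "\<And>i. i \<in> Basis \<Longrightarrow> \<bar>wv n (\<Theta> 0) z \<bullet> i\<bar> \<le> L"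
      have comp: "\<bar>us n z $ l\<bar> \<le> L" for l
      proof -
        have "axis l (1 :: real) \<in> Basis" by (auto simp: Basis_vec_def)
        then have "(0 :: real ^ 'k, axis l (1 :: real)) \<in> Basis" unfolding Basis_prod_def by (intro UnI2 imageI)
        then have "((0, axis l 1), 0) \<in> (Basis :: (((real ^ 'k) \<times> (real ^ 's)) \<times> real) set)"
          unfolding Basis_prod_def[where 'b = real] by (intro UnI1 imageI)
        from box[OF this] show ?thesis by (simp add: usw inner_prod_def inner_axis)
      qed
      have "norm (us n z) \<le> (\<Sum>l\<in>UNIV. \<bar>us n z $ l\<bar>)" by (rule norm_le_l1_cart)
      also have "\<dots> \<le> (\<Sum>l\<in>(UNIV :: 's set). L)" by (intro sum_mono comp)
      also have "\<dots> = B" by (simp add: B_def)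
      finally have uB: "norm (us n z) \<le> B" .
      then have s1: "(\<Sum>v\<in>V. h v (us n z)) = 1" by (intro h(4)) (simp add: mem_cball)
      have "w n (us n z) - g z = (\<Sum>v\<in>V. (w n (us n z) - w n v) * h v (us n z))"
        unfolding left_diff_distrib sum_subtractf sum_distrib_left[symmetric] s1 g_def by simp
      also have "\<bar>\<dots>\<bar> \<le> (\<Sum>v\<in>V. (M * (2 * e)) * h v (us n z))"
      proof (rule order_trans[OF sum_abs], rule sum_mono)
        fix v assume v: "v \<in> V"
        show "\<bar>(w n (us n z) - w n v) * h v (us n z)\<bar> \<le> (M * (2 * e)) * h v (us n z)"
        proof (cases "h v (us n z) = 0")
          case False
          have "norm v \<le> B" using V(2) v by auto
          have "\<bar>w n (us n z) - w n v\<bar> \<le> K * (1 + norm (us n z) + norm v) * norm (us n z - v)" by (rule w(4))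
          also have "\<dots> \<le> M * (2 * e)"
            unfolding M_def using uB \<open>norm v \<le> B\<close> w(3) B by (intro mult_mono h(5)[OF v False]) auto
          finally show ?thesis
            unfolding abs_mult using h(2)[OF v, of "us n z"] by (simp add: mult_right_mono)
        qed simp
      qed
      also have "\<dots> = M * (2 * e)" unfolding sum_distrib_left[symmetric] s1 by simp
      finally show "\<bar>w n (us n z) * P n \<Theta> z - g z * P n \<Theta> z\<bar> \<le> \<tau> / 2"
        using dif[of z] Me by linarith
    qed (use gm \<tau> in auto)
    also have "\<dots> \<le> \<tau>" using DL by linarith
    finally show "\<bar>(\<integral>z. w n (us n z) * P n \<Theta> z \<partial>R) - (\<integral>z. (\<Sum>v\<in>V. w n v * (h v (us n z) * P n \<Theta> z)) \<partial>R)\<bar> \<le> \<tau>"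
      unfolding Geq .
  qed
qed

end

section \<open>Consequences of weak universality\<close>

lemma ramp_bounded_lipschitz:
  fixes a b :: real
  shows "bounded_lipschitz (\<lambda>t. max 0 (min 1 (a * t + b)))" "bounded_lipschitz (\<lambda>t. max 0 (min 1 (a * \<bar>t - c\<bar> + b)))"
proof -
  have b: "bounded (range (\<lambda>t. max 0 (min 1 (f t :: real))))" for f :: "real \<Rightarrow> real"
    unfolding bounded_iff by (intro exI[of _ 1]) auto
  have l: "bounded_lipschitz (\<lambda>t. max 0 (min 1 (f t)))" if f: "\<And>x y. \<bar>f x - f y\<bar> \<le> \<bar>a\<bar> * \<bar>x - y\<bar>" for f :: "real \<Rightarrow> real"
  proof -
    have "\<bar>max 0 (min 1 (f x)) - max 0 (min 1 (f y))\<bar> \<le> \<bar>f x - f y\<bar>" for x y by linarith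
    then have "\<bar>max 0 (min 1 (f x)) - max 0 (min 1 (f y))\<bar> \<le> \<bar>a\<bar> * \<bar>x - y\<bar>" for x y
      using f order_trans by blast
    then have "\<bar>a\<bar>-lipschitz_on UNIV (\<lambda>t. max 0 (min 1 (f t)))"
      by (intro lipschitz_onI) (simp_all add: dist_real_def)
    then show ?thesis using b unfolding bounded_lipschitz_def by blast
  qed
  show "bounded_lipschitz (\<lambda>t. max 0 (min 1 (a * t + b)))"
    by (rule l) (simp add: abs_mult[symmetric] right_diff_distrib)
  show "bounded_lipschitz (\<lambda>t. max 0 (min 1 (a * \<bar>t - c\<bar> + b)))"
  proof (rule l)
    fix x y
    have "\<bar>(a * \<bar>x - c\<bar> + b) - (a * \<bar>y - c\<bar> + b)\<bar> = \<bar>a\<bar> * \<bar>\<bar>x - c\<bar> - \<bar>y - c\<bar>\<bar>"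
      by (simp add: abs_mult[symmetric] right_diff_distrib)
    also have "\<dots> \<le> \<bar>a\<bar> * \<bar>x - y\<bar>" by (intro mult_left_mono) auto
    finally show "\<bar>(a * \<bar>x - c\<bar> + b) - (a * \<bar>y - c\<bar> + b)\<bar> \<le> \<bar>a\<bar> * \<bar>x - y\<bar>" .
  qed
qed

lemma bounded_lipschitz_measurable:
  assumes "bounded_lipschitz \<phi>"
  shows "\<phi> \<in> borel_measurable borel"
proof -
  obtain K where "K-lipschitz_on UNIV \<phi>" using assms unfolding bounded_lipschitz_def by blast
  then show ?thesis by (intro borel_measurable_continuous_onI lipschitz_on_continuous_on)
qed

lemma measure_le_integral_sandwich:
  fixes \<phi> :: "real \<Rightarrow> real"
  assumes M: "prob_space M" and Y: "Y \<in> borel_measurable M" and \<phi>: "\<phi> \<in> borel_measurable borel"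
    and b: "\<And>t. 0 \<le> \<phi> t" "\<And>t. \<phi> t \<le> 1" and S: "{t. P t} \<in> sets borel"
  shows "(\<And>t. P t \<Longrightarrow> \<phi> t = 1) \<Longrightarrow> measure M {\<omega> \<in> space M. P (Y \<omega>)} \<le> (\<integral>\<omega>. \<phi> (Y \<omega>) \<partial>M)"
    and "(\<And>t. \<not> P t \<Longrightarrow> \<phi> t = 0) \<Longrightarrow> (\<integral>\<omega>. \<phi> (Y \<omega>) \<partial>M) \<le> measure M {\<omega> \<in> space M. P (Y \<omega>)}"
proof -
  interpret prob_space M by fact
  have A: "{\<omega> \<in> space M. P (Y \<omega>)} \<in> sets M"
    using measurable_sets[OF Y S] by (simp add: vimage_def Int_def conj_commute)
  have i: "integrable M (\<lambda>\<omega>. \<phi> (Y \<omega>))"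
    by (rule integrable_bounded[OF M measurable_compose[OF Y \<phi>], where B = 1]) (use b in \<open>auto simp: abs_le_iff intro: order_trans[of _ 0]\<close>)
  have j: "integrable M (indicat_real {\<omega> \<in> space M. P (Y \<omega>)})"
    by (rule integrable_bounded[OF M, where B = 1]) (use A in \<open>auto simp: indicator_def\<close>)
  have m: "measure M {\<omega> \<in> space M. P (Y \<omega>)} = (\<integral>\<omega>. indicat_real {\<omega> \<in> space M. P (Y \<omega>)} \<omega> \<partial>M)"
    using A by simp
  show "measure M {\<omega> \<in> space M. P (Y \<omega>)} \<le> (\<integral>\<omega>. \<phi> (Y \<omega>) \<partial>M)" if "\<And>t. P t \<Longrightarrow> \<phi> t = 1"
    unfolding m by (rule integral_mono[OF j i]) (use that b in \<open>auto simp: indicator_def\<close>)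
  show "(\<integral>\<omega>. \<phi> (Y \<omega>) \<partial>M) \<le> measure M {\<omega> \<in> space M. P (Y \<omega>)}" if "\<And>t. \<not> P t \<Longrightarrow> \<phi> t = 0"
    unfolding m by (rule integral_mono[OF i j]) (use that b in \<open>auto simp: indicator_def\<close>)
qed

text \<open>Indicators of half-lines are not Lipschitz, so a ramp is placed between \<rho> and
  \<rho> + \<delta>, or between \<rho> - \<delta> and \<rho>; this is where \<delta> is spent. For
  convergence in probability the ramp rises between e/2 and e, and the comparison is run in both
  directions.\<close>

lemma universality_consequences:
  fixes M :: "nat \<Rightarrow> 'a measure" and RX RG :: "nat \<Rightarrow> 'a \<Rightarrow> real"
  assumes M: "\<And>n. prob_space (M n)"
    and m: "\<And>n. 1 \<le> n \<Longrightarrow> RX n \<in> borel_measurable (M n)" "\<And>n. 1 \<le> n \<Longrightarrow> RG n \<in> borel_measurable (M n)"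
    and uni: "\<And>\<psi>. bounded_lipschitz \<psi> \<Longrightarrow>
       (\<lambda>n. \<bar>(\<integral>\<omega>. \<psi> (RX n \<omega>) \<partial>M n) - (\<integral>\<omega>. \<psi> (RG n \<omega>) \<partial>M n)\<bar>) \<longlonglongrightarrow> 0"
  shows "(\<forall>\<rho> \<delta>. 0 < \<delta> \<longrightarrow>
            limsup (\<lambda>n. ereal (measure (M n) {\<omega> \<in> space (M n). RX n \<omega> \<ge> \<rho> + \<delta>}))
              \<le> limsup (\<lambda>n. ereal (measure (M n) {\<omega> \<in> space (M n). RG n \<omega> \<ge> \<rho>})) \<and>
            limsup (\<lambda>n. ereal (measure (M n) {\<omega> \<in> space (M n). RX n \<omega> \<le> \<rho> - \<delta>}))
              \<le> limsup (\<lambda>n. ereal (measure (M n) {\<omega> \<in> space (M n). RG n \<omega> \<le> \<rho>})) \<and>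
            liminf (\<lambda>n. ereal (measure (M n) {\<omega> \<in> space (M n). RX n \<omega> \<ge> \<rho> + \<delta>}))
              \<le> liminf (\<lambda>n. ereal (measure (M n) {\<omega> \<in> space (M n). RG n \<omega> \<ge> \<rho>})) \<and>
            liminf (\<lambda>n. ereal (measure (M n) {\<omega> \<in> space (M n). RX n \<omega> \<le> \<rho> - \<delta>}))
              \<le> liminf (\<lambda>n. ereal (measure (M n) {\<omega> \<in> space (M n). RG n \<omega> \<le> \<rho>}))) \<and>
         (\<forall>\<rho>. converges_in_prob M RX \<rho> \<longleftrightarrow> converges_in_prob M RG \<rho>)"
proof -
  define dd where "dd \<phi> n = \<bar>(\<integral>\<omega>. \<phi> (RX n \<omega>) \<partial>M n) - (\<integral>\<omega>. \<phi> (RG n \<omega>) \<partial>M n)\<bar>" for \<phi> :: "real \<Rightarrow> real" and n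
  have dd0: "dd \<phi> \<longlonglongrightarrow> 0" if "bounded_lipschitz \<phi>" for \<phi>
    unfolding dd_def[abs_def] by (rule uni[OF that])
  \<comment> \<open>A test function that is 1 on \<open>P1\<close> and 0 off \<open>P2\<close>
    compares the two probabilities through its expectations. The pair \<open>(Y, Y')\<close> covers
    both directions.\<close>
  have cmp: "eventually (\<lambda>n. measure (M n) {\<omega> \<in> space (M n). P1 (Y n \<omega>)} \<le> dd \<phi> n + measure (M n) {\<omega> \<in> space (M n). P2 (Y' n \<omega>)}) sequentially"
    if \<phi>: "bounded_lipschitz \<phi>" "\<And>t. 0 \<le> \<phi> t" "\<And>t. \<phi> t \<le> 1" and P: "{t. P1 t} \<in> sets borel" "{t. P2 t} \<in> sets borel"
      "\<And>t. P1 t \<Longrightarrow> \<phi> t = 1" "\<And>t. \<not> P2 t \<Longrightarrow> \<phi> t = 0"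
      and Y: "(Y, Y') \<in> {(RX, RG), (RG, RX)}" for \<phi> P1 P2 Y Y'
    using eventually_ge_at_top[of 1]
  proof eventually_elim
    case (elim n)
    have Ym: "Y n \<in> borel_measurable (M n)" "Y' n \<in> borel_measurable (M n)" using m[OF elim] Y by auto
    have "measure (M n) {\<omega> \<in> space (M n). P1 (Y n \<omega>)} \<le> (\<integral>\<omega>. \<phi> (Y n \<omega>) \<partial>M n)"
      by (rule measure_le_integral_sandwich(1)[OF M Ym(1) bounded_lipschitz_measurable[OF \<phi>(1)] \<phi>(2,3) P(1) P(3)])
    moreover have "(\<integral>\<omega>. \<phi> (Y' n \<omega>) \<partial>M n) \<le> measure (M n) {\<omega> \<in> space (M n). P2 (Y' n \<omega>)}"
      by (rule measure_le_integral_sandwich(2)[OF M Ym(2) bounded_lipschitz_measurable[OF \<phi>(1)] \<phi>(2,3) P(2) P(4)])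
    moreover have "\<bar>(\<integral>\<omega>. \<phi> (Y n \<omega>) \<partial>M n) - (\<integral>\<omega>. \<phi> (Y' n \<omega>) \<partial>M n)\<bar> = dd \<phi> n"
      using Y by (auto simp: dd_def abs_minus_commute)
    ultimately show ?case by linarith
  qed
  \<comment> \<open>Adding a sequence that tends to 0 changes neither limit; in the extended reals
    both limits exist for arbitrary sequences.\<close>
  have lims: "limsup (\<lambda>n. ereal (a n)) \<le> limsup (\<lambda>n. ereal (b n)) \<and> liminf (\<lambda>n. ereal (a n)) \<le> liminf (\<lambda>n. ereal (b n))"
    if d: "d \<longlonglongrightarrow> 0" "eventually (\<lambda>n. a n \<le> d n + b n) sequentially" for a b d :: "nat \<Rightarrow> real"
  proof -
    have ed: "(\<lambda>n. ereal (d n)) \<longlonglongrightarrow> 0" unfolding zero_ereal_def by (rule tendsto_ereal[OF d(1)])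
    have le: "eventually (\<lambda>n. ereal (a n) \<le> ereal (d n) + ereal (b n)) sequentially"
      using d(2) by eventually_elim simp
    have "limsup (\<lambda>n. ereal (a n)) \<le> limsup (\<lambda>n. ereal (d n) + ereal (b n))" by (rule Limsup_mono[OF le])
    also have "\<dots> = 0 + limsup (\<lambda>n. ereal (b n))" by (rule ereal_limsup_lim_add[OF ed]) simp
    finally have 1: "limsup (\<lambda>n. ereal (a n)) \<le> limsup (\<lambda>n. ereal (b n))" by simp
    have "liminf (\<lambda>n. ereal (a n)) \<le> liminf (\<lambda>n. ereal (d n) + ereal (b n))" by (rule Liminf_mono[OF le])
    also have "\<dots> = 0 + liminf (\<lambda>n. ereal (b n))" by (rule ereal_liminf_lim_add[OF ed]) simp
    finally show ?thesis using 1 by simp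
  qed
  have one: "max 0 (min 1 y) = 1" if "1 \<le> y" for y :: real using that by simp
  have zero: "max 0 (min 1 y) = 0" if "y \<le> 0" for y :: real using that by simp
  define up where "up \<rho> \<delta> t = max 0 (min 1 ((1 / \<delta>) * t + (- \<rho> / \<delta>)))" for \<rho> \<delta> t :: real
  have upL: "bounded_lipschitz (up \<rho> \<delta>)" for \<rho> \<delta> unfolding up_def[abs_def] by (rule ramp_bounded_lipschitz)
  have upE: "eventually (\<lambda>n. measure (M n) {\<omega> \<in> space (M n). \<rho> + \<delta> \<le> RX n \<omega>} \<le> dd (up \<rho> \<delta>) n + measure (M n) {\<omega> \<in> space (M n). \<rho> \<le> RG n \<omega>}) sequentially"
    if \<delta>: "0 < \<delta>" for \<rho> \<delta>
  proof (rule cmp[where \<phi> = "up \<rho> \<delta>" and Y = RX and Y' = RG and ?P1.0 = "\<lambda>t. \<rho> + \<delta> \<le> t" and ?P2.0 = "\<lambda>t. \<rho> \<le> t", OF upL])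
    have e: "(1 / \<delta>) * t + (- \<rho> / \<delta>) = (t - \<rho>) / \<delta>" for t by (simp add: diff_divide_distrib)
    show "up \<rho> \<delta> t = 1" if "\<rho> + \<delta> \<le> t" for t
      unfolding up_def e by (rule one) (use that \<delta> in \<open>simp add: pos_le_divide_eq\<close>)
    show "up \<rho> \<delta> t = 0" if "\<not> \<rho> \<le> t" for t
      unfolding up_def e by (rule zero) (use that \<delta> in \<open>simp add: pos_divide_le_eq\<close>)
  qed (auto simp: up_def)
  define down where "down \<rho> \<delta> t = max 0 (min 1 ((- 1 / \<delta>) * t + (\<rho> / \<delta>)))" for \<rho> \<delta> t :: real
  have downL: "bounded_lipschitz (down \<rho> \<delta>)" for \<rho> \<delta> unfolding down_def[abs_def] by (rule ramp_bounded_lipschitz)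
  have downE: "eventually (\<lambda>n. measure (M n) {\<omega> \<in> space (M n). RX n \<omega> \<le> \<rho> - \<delta>} \<le> dd (down \<rho> \<delta>) n + measure (M n) {\<omega> \<in> space (M n). RG n \<omega> \<le> \<rho>}) sequentially"
    if \<delta>: "0 < \<delta>" for \<rho> \<delta>
  proof (rule cmp[where \<phi> = "down \<rho> \<delta>" and Y = RX and Y' = RG and ?P1.0 = "\<lambda>t. t \<le> \<rho> - \<delta>" and ?P2.0 = "\<lambda>t. t \<le> \<rho>", OF downL])
    have e: "(- 1 / \<delta>) * t + (\<rho> / \<delta>) = (\<rho> - t) / \<delta>" for t by (simp add: diff_divide_distrib)
    show "down \<rho> \<delta> t = 1" if "t \<le> \<rho> - \<delta>" for t
      unfolding down_def e by (rule one) (use that \<delta> in \<open>simp add: pos_le_divide_eq\<close>)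
    show "down \<rho> \<delta> t = 0" if "\<not> t \<le> \<rho>" for t
      unfolding down_def e by (rule zero) (use that \<delta> in \<open>simp add: pos_divide_le_eq\<close>)
  qed (auto simp: down_def)
  define away where "away \<rho> e t = max 0 (min 1 ((2 / e) * \<bar>t - \<rho>\<bar> + (- 1)))" for \<rho> e t :: real
  have awayL: "bounded_lipschitz (away \<rho> e)" for \<rho> e unfolding away_def[abs_def] by (rule ramp_bounded_lipschitz)
  have awayE: "eventually (\<lambda>n. measure (M n) {\<omega> \<in> space (M n). e < \<bar>Y n \<omega> - \<rho>\<bar>} \<le> dd (away \<rho> e) n + measure (M n) {\<omega> \<in> space (M n). e / 2 < \<bar>Y' n \<omega> - \<rho>\<bar>}) sequentially"
    if e: "0 < e" and Y: "(Y, Y') \<in> {(RX, RG), (RG, RX)}" for e \<rho> Y Y'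
  proof (rule cmp[where \<phi> = "away \<rho> e" and Y = Y and Y' = Y' and ?P1.0 = "\<lambda>t. e < \<bar>t - \<rho>\<bar>" and ?P2.0 = "\<lambda>t. e / 2 < \<bar>t - \<rho>\<bar>", OF awayL _ _ _ _ _ _ Y])
    have q: "(2 / e) * y + (- 1) = (2 * y - e) / e" for y using e by (simp add: diff_divide_distrib)
    show "away \<rho> e t = 1" if "e < \<bar>t - \<rho>\<bar>" for t
      unfolding away_def q by (rule one) (use that e in \<open>simp add: pos_le_divide_eq\<close>)
    show "away \<rho> e t = 0" if "\<not> e / 2 < \<bar>t - \<rho>\<bar>" for t
      unfolding away_def q by (rule zero) (use that e in \<open>simp add: pos_divide_le_eq\<close>)
  qed (auto simp: away_def)
  have conv: "converges_in_prob M Y \<rho>" if c: "converges_in_prob M Y' \<rho>" and Y: "(Y, Y') \<in> {(RX, RG), (RG, RX)}" for Y Y' \<rho>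
    unfolding converges_in_prob_def
  proof (intro allI impI)
    fix e :: real assume e: "0 < e"
    have e2: "0 < e / 2" using e by simp
    have "(\<lambda>n. dd (away \<rho> e) n + measure (M n) {\<omega> \<in> space (M n). e / 2 < \<bar>Y' n \<omega> - \<rho>\<bar>}) \<longlonglongrightarrow> 0 + 0"
      by (rule tendsto_add[OF dd0[OF awayL] c[unfolded converges_in_prob_def, rule_format, OF e2]])
    then have t: "(\<lambda>n. dd (away \<rho> e) n + measure (M n) {\<omega> \<in> space (M n). e / 2 < \<bar>Y' n \<omega> - \<rho>\<bar>}) \<longlonglongrightarrow> 0"
      by (simp only: add_0)
    have n: "eventually (\<lambda>n. 0 \<le> measure (M n) {\<omega> \<in> space (M n). e < \<bar>Y n \<omega> - \<rho>\<bar>}) sequentially"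
      by (simp add: measure_nonneg)
    show "(\<lambda>n. measure (M n) {\<omega> \<in> space (M n). e < \<bar>Y n \<omega> - \<rho>\<bar>}) \<longlonglongrightarrow> 0"
      by (rule tendsto_sandwich[OF n awayE[OF e Y] tendsto_const t])
  qed
  show ?thesis
  proof (intro conjI allI impI)
    fix \<rho> \<delta> :: real assume \<delta>: "0 < \<delta>"
    note u = lims[OF dd0[OF upL] upE[OF \<delta>, of \<rho>]] and d = lims[OF dd0[OF downL] downE[OF \<delta>, of \<rho>]]
    show "limsup (\<lambda>n. ereal (measure (M n) {\<omega> \<in> space (M n). RX n \<omega> \<ge> \<rho> + \<delta>}))
              \<le> limsup (\<lambda>n. ereal (measure (M n) {\<omega> \<in> space (M n). RG n \<omega> \<ge> \<rho>}))" by (rule u[THEN conjunct1])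
    show "limsup (\<lambda>n. ereal (measure (M n) {\<omega> \<in> space (M n). RX n \<omega> \<le> \<rho> - \<delta>}))
              \<le> limsup (\<lambda>n. ereal (measure (M n) {\<omega> \<in> space (M n). RG n \<omega> \<le> \<rho>}))" by (rule d[THEN conjunct1])
    show "liminf (\<lambda>n. ereal (measure (M n) {\<omega> \<in> space (M n). RX n \<omega> \<ge> \<rho> + \<delta>}))
              \<le> liminf (\<lambda>n. ereal (measure (M n) {\<omega> \<in> space (M n). RG n \<omega> \<ge> \<rho>}))" by (rule u[THEN conjunct2])
    show "liminf (\<lambda>n. ereal (measure (M n) {\<omega> \<in> space (M n). RX n \<omega> \<le> \<rho> - \<delta>}))
              \<le> liminf (\<lambda>n. ereal (measure (M n) {\<omega> \<in> space (M n). RG n \<omega> \<le> \<rho>}))" by (rule d[THEN conjunct2])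
  next
    fix \<rho>
    show "converges_in_prob M RX \<rho> \<longleftrightarrow> converges_in_prob M RG \<rho>"
      using conv[of RG \<rho> RX] conv[of RX \<rho> RG] by auto
  qed
qed

text \<open>Independence of the two families makes the joint law of the two vectors a product of two
  product measures; regrouping the coordinates into pairs turns it into a product of copies of
  \<open>R\<close>. This brings the given variables into the setting of product laws in which the
  exchange of samples is carried out.\<close>

lemma iid_pairs_law:
  fixes Z :: "nat \<Rightarrow> 'a \<Rightarrow> 'b" and e :: "nat \<Rightarrow> 'a \<Rightarrow> 'c"
  assumes M: "prob_space M" and n: "1 \<le> n" and Z: "iid_copies M N n z Z" and e: "iid M N' n e"
    and ind: "indep_families M n N Z N' e"
  defines "R \<equiv> distr M N z \<Otimes>\<^sub>M distr M N' (e 0)"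
  shows "(\<lambda>\<omega>. \<lambda>i\<in>{..<n}. (Z i \<omega>, e i \<omega>)) \<in> M \<rightarrow>\<^sub>M PiM {..<n} (\<lambda>_. N \<Otimes>\<^sub>M N')"
    and "distr M (PiM {..<n} (\<lambda>_. N \<Otimes>\<^sub>M N')) (\<lambda>\<omega>. \<lambda>i\<in>{..<n}. (Z i \<omega>, e i \<omega>)) = PiM {..<n} (\<lambda>_. R)"
proof -
  interpret prob_space M by fact
  let ?I = "{..<n}"
  have ne: "?I \<noteq> {}" using n by (simp add: lessThan_empty_iff)
  have Zi: "indep_vars (\<lambda>_. N) Z ?I" and ei: "indep_vars (\<lambda>_. N') e ?I" and zm: "z \<in> M \<rightarrow>\<^sub>M N"
    and Zd: "\<And>i. i < n \<Longrightarrow> distr M N (Z i) = distr M N z" and ed: "\<And>i. i < n \<Longrightarrow> distr M N' (e i) = distr M N' (e 0)"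
    using Z[unfolded iid_copies_def iid_def] e[unfolded iid_def] n by fast+
  have Zm: "Z i \<in> M \<rightarrow>\<^sub>M N" if "i \<in> ?I" for i using Zi that by (auto simp: indep_vars_def)
  have em: "e i \<in> M \<rightarrow>\<^sub>M N'" if "i \<in> ?I" for i using ei that by (auto simp: indep_vars_def)
  let ?Z = "\<lambda>\<omega>. \<lambda>i\<in>?I. Z i \<omega>" and ?e = "\<lambda>\<omega>. \<lambda>i\<in>?I. e i \<omega>"
  let ?P = "distr M N z" and ?E = "distr M N' (e 0)"
  have e0: "e 0 \<in> M \<rightarrow>\<^sub>M N'" using em[of 0] n by simp
  have pP: "prob_space ?P" by (rule prob_space_distr[OF zm])
  have pE: "prob_space ?E" by (rule prob_space_distr[OF e0])
  interpret P: prob_space ?P by fact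
  interpret E: prob_space ?E by fact
  interpret PE: pair_prob_space ?P ?E ..
  have pR: "prob_space R" unfolding R_def by (rule PE.prob_space_axioms)
  have Zlaw: "distr M (PiM ?I (\<lambda>_. N)) ?Z = PiM ?I (\<lambda>_. ?P)"
  proof -
    have "distr M (PiM ?I (\<lambda>_. N)) ?Z = PiM ?I (\<lambda>i. distr M N (Z i))"
    proof (rule iffD1[OF indep_vars_iff_distr_eq_PiM'[OF ne] Zi])
      show "random_variable N (Z i)" if "i \<in> ?I" for i by (rule Zm[OF that])
    qed
    also have "\<dots> = PiM ?I (\<lambda>_. ?P)" by (rule PiM_cong[OF refl]) (rule Zd, simp)
    finally show ?thesis .
  qed
  have elaw: "distr M (PiM ?I (\<lambda>_. N')) ?e = PiM ?I (\<lambda>_. ?E)"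
  proof -
    have "distr M (PiM ?I (\<lambda>_. N')) ?e = PiM ?I (\<lambda>i. distr M N' (e i))"
    proof (rule iffD1[OF indep_vars_iff_distr_eq_PiM'[OF ne] ei])
      show "random_variable N' (e i)" if "i \<in> ?I" for i by (rule em[OF that])
    qed
    also have "\<dots> = PiM ?I (\<lambda>_. ?E)" by (rule PiM_cong[OF refl]) (rule ed, simp)
    finally show ?thesis .
  qed
  have ZM: "?Z \<in> M \<rightarrow>\<^sub>M PiM ?I (\<lambda>_. N)" using Zm by (intro measurable_restrict) auto
  have eM: "?e \<in> M \<rightarrow>\<^sub>M PiM ?I (\<lambda>_. N')" using em by (intro measurable_restrict) auto
  have setsZ: "sets (PiM ?I (\<lambda>_. ?P)) = sets (PiM ?I (\<lambda>_. N))" and setse: "sets (PiM ?I (\<lambda>_. ?E)) = sets (PiM ?I (\<lambda>_. N'))"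
    by (intro sets_PiM_cong; simp)+
  have pZ: "prob_space (PiM ?I (\<lambda>_. ?P))" and pe: "prob_space (PiM ?I (\<lambda>_. ?E))"
    by (rule prob_space_PiM, rule pP pE)+
  have ZeM: "(\<lambda>\<omega>. (?Z \<omega>, ?e \<omega>)) \<in> M \<rightarrow>\<^sub>M PiM ?I (\<lambda>_. N) \<Otimes>\<^sub>M PiM ?I (\<lambda>_. N')"
    by (rule measurable_Pair[OF ZM eM])
  \<comment> \<open>Independence is assumed for the sigma-algebras generated by the two vectors; it
    gives the product formula on rectangles, which determine the measure.\<close>
  have joint: "PiM ?I (\<lambda>_. ?P) \<Otimes>\<^sub>M PiM ?I (\<lambda>_. ?E) = distr M (PiM ?I (\<lambda>_. N) \<Otimes>\<^sub>M PiM ?I (\<lambda>_. N')) (\<lambda>\<omega>. (?Z \<omega>, ?e \<omega>))"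
  proof (rule pair_measure_eqI)
    show "sigma_finite_measure (PiM ?I (\<lambda>_. ?P))" "sigma_finite_measure (PiM ?I (\<lambda>_. ?E))"
      by (rule prob_space_imp_sigma_finite, rule pZ pe)+
    show "sets (PiM ?I (\<lambda>_. ?P) \<Otimes>\<^sub>M PiM ?I (\<lambda>_. ?E)) = sets (distr M (PiM ?I (\<lambda>_. N) \<Otimes>\<^sub>M PiM ?I (\<lambda>_. N')) (\<lambda>\<omega>. (?Z \<omega>, ?e \<omega>)))"
      unfolding sets_distr by (intro sets_pair_measure_cong setsZ setse)
    fix A B assume "A \<in> sets (PiM ?I (\<lambda>_. ?P))" "B \<in> sets (PiM ?I (\<lambda>_. ?E))"
    then have A: "A \<in> sets (PiM ?I (\<lambda>_. N))" and B: "B \<in> sets (PiM ?I (\<lambda>_. N'))" unfolding setsZ setse .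
    let ?a = "?Z -` A \<inter> space M" and ?b = "?e -` B \<inter> space M"
    have ab: "?a \<in> sets (vimage_algebra (space M) ?Z (PiM ?I (\<lambda>_. N)))" "?b \<in> sets (vimage_algebra (space M) ?e (PiM ?I (\<lambda>_. N')))"
      using A B by (auto intro: in_vimage_algebra)
    have "prob (?a \<inter> ?b) = prob ?a * prob ?b"
      using ind ab unfolding indep_families_def indep_sets2_eq by blast
    then have "emeasure M (?a \<inter> ?b) = emeasure M ?a * emeasure M ?b"
      by (simp only: emeasure_eq_measure ennreal_mult[OF measure_nonneg measure_nonneg])
    moreover have "emeasure (PiM ?I (\<lambda>_. ?P)) A = emeasure M ?a" unfolding Zlaw[symmetric] by (rule emeasure_distr[OF ZM A])
    moreover have "emeasure (PiM ?I (\<lambda>_. ?E)) B = emeasure M ?b" unfolding elaw[symmetric] by (rule emeasure_distr[OF eM B])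
    moreover have "emeasure (distr M (PiM ?I (\<lambda>_. N) \<Otimes>\<^sub>M PiM ?I (\<lambda>_. N')) (\<lambda>\<omega>. (?Z \<omega>, ?e \<omega>))) (A \<times> B) = emeasure M (?a \<inter> ?b)"
    proof -
      have "A \<times> B \<in> sets (PiM ?I (\<lambda>_. N) \<Otimes>\<^sub>M PiM ?I (\<lambda>_. N'))" using A B by (rule pair_measureI)
      then have "emeasure (distr M (PiM ?I (\<lambda>_. N) \<Otimes>\<^sub>M PiM ?I (\<lambda>_. N')) (\<lambda>\<omega>. (?Z \<omega>, ?e \<omega>))) (A \<times> B) =
        emeasure M ((\<lambda>\<omega>. (?Z \<omega>, ?e \<omega>)) -` (A \<times> B) \<inter> space M)" by (rule emeasure_distr[OF ZeM])
      also have "(\<lambda>\<omega>. (?Z \<omega>, ?e \<omega>)) -` (A \<times> B) \<inter> space M = ?a \<inter> ?b" by blast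
      finally show ?thesis .
    qed
    ultimately show "emeasure (PiM ?I (\<lambda>_. ?P)) A * emeasure (PiM ?I (\<lambda>_. ?E)) B =
      emeasure (distr M (PiM ?I (\<lambda>_. N) \<Otimes>\<^sub>M PiM ?I (\<lambda>_. N')) (\<lambda>\<omega>. (?Z \<omega>, ?e \<omega>))) (A \<times> B)" by (simp only:)
  qed
  define J where "J = (\<lambda>(a, b). \<lambda>i\<in>?I. (a i, b i) :: 'b \<times> 'c)"
  have Jm: "J \<in> PiM ?I (\<lambda>_. N) \<Otimes>\<^sub>M PiM ?I (\<lambda>_. N') \<rightarrow>\<^sub>M PiM ?I (\<lambda>_. N \<Otimes>\<^sub>M N')"
    unfolding J_def case_prod_beta' by (rule measurable_restrict) measurable
  have comp: "(\<lambda>\<omega>. \<lambda>i\<in>?I. (Z i \<omega>, e i \<omega>)) = (\<lambda>\<omega>. J (?Z \<omega>, ?e \<omega>))"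
    by (auto simp: J_def fun_eq_iff)
  show "(\<lambda>\<omega>. \<lambda>i\<in>?I. (Z i \<omega>, e i \<omega>)) \<in> M \<rightarrow>\<^sub>M PiM ?I (\<lambda>_. N \<Otimes>\<^sub>M N')"
    unfolding comp by (rule measurable_compose[OF ZeM Jm])
  have setsR: "sets R = sets (N \<Otimes>\<^sub>M N')" unfolding R_def by (intro sets_pair_measure_cong) auto
  have sets1: "sets (PiM ?I (\<lambda>_. ?P) \<Otimes>\<^sub>M PiM ?I (\<lambda>_. ?E)) = sets (PiM ?I (\<lambda>_. N) \<Otimes>\<^sub>M PiM ?I (\<lambda>_. N'))"
    by (intro sets_pair_measure_cong sets_PiM_cong) auto
  have sets2: "sets (PiM ?I (\<lambda>_. R)) = sets (PiM ?I (\<lambda>_. N \<Otimes>\<^sub>M N'))"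
    by (intro sets_PiM_cong refl setsR)
  have "distr M (PiM ?I (\<lambda>_. N \<Otimes>\<^sub>M N')) (\<lambda>\<omega>. \<lambda>i\<in>?I. (Z i \<omega>, e i \<omega>)) =
    distr (PiM ?I (\<lambda>_. ?P) \<Otimes>\<^sub>M PiM ?I (\<lambda>_. ?E)) (PiM ?I (\<lambda>_. N \<Otimes>\<^sub>M N')) J"
    unfolding comp joint by (subst distr_distr[OF Jm ZeM]) (simp add: comp_def)
  also have "\<dots> = PiM ?I (\<lambda>_. R)"
  proof -
    interpret PP: product_prob_space "\<lambda>_::nat. ?P" by (rule product_prob_spaceI) (rule pP)
    interpret EE: product_prob_space "\<lambda>_::nat. ?E" by (rule product_prob_spaceI) (rule pE)
    interpret RR: product_prob_space "\<lambda>_::nat. R" by (rule product_prob_spaceI) (rule pR)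
    have pEE: "prob_space (PiM ?I (\<lambda>_. ?E))" by (rule prob_space_PiM) (rule pE)
    interpret EI: prob_space "PiM ?I (\<lambda>_. ?E)" by fact
    show ?thesis
    \<comment> \<open>The sides \<open>A i\<close> are arbitrary measurable sets of pairs and need
      not be rectangles. The noise is integrated first, factor by factor for fixed features, and the
      features afterwards.\<close>
    proof (rule RR.PiM_eqI)
      fix A :: "nat \<Rightarrow> ('b \<times> 'c) set" assume A: "\<And>i. i \<in> ?I \<Longrightarrow> A i \<in> sets R"
      have AN: "A i \<in> sets (N \<Otimes>\<^sub>M N')" if "i \<in> ?I" for i using A[OF that] setsR by simp
      have box: "Pi\<^sub>E ?I A \<in> sets (PiM ?I (\<lambda>_. N \<Otimes>\<^sub>M N'))" using AN by (intro sets_PiM_I_finite) auto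
      have Jm': "J \<in> PiM ?I (\<lambda>_. ?P) \<Otimes>\<^sub>M PiM ?I (\<lambda>_. ?E) \<rightarrow>\<^sub>M PiM ?I (\<lambda>_. N \<Otimes>\<^sub>M N')"
        using Jm unfolding measurable_cong_sets[OF sets1 refl] .
      have im: "(\<lambda>x. indicator (A i) (x, b)) \<in> borel_measurable ?P" 
        "(\<lambda>y. indicator (A i) (a, y)) \<in> borel_measurable ?E" if "i \<in> ?I" "a \<in> space N" "b \<in> space N'" for i a b
        using AN[OF that(1)] that(2,3) by measurable
      have "emeasure (distr (PiM ?I (\<lambda>_. ?P) \<Otimes>\<^sub>M PiM ?I (\<lambda>_. ?E)) (PiM ?I (\<lambda>_. N \<Otimes>\<^sub>M N')) J) (Pi\<^sub>E ?I A)
         = (\<integral>\<^sup>+w. indicator (Pi\<^sub>E ?I A) (J w) \<partial>(PiM ?I (\<lambda>_. ?P) \<Otimes>\<^sub>M PiM ?I (\<lambda>_. ?E)))"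
        using box by (subst nn_integral_indicator[symmetric], simp, subst nn_integral_distr[OF Jm']) auto
      also have "\<dots> = (\<integral>\<^sup>+a. (\<integral>\<^sup>+b. indicator (Pi\<^sub>E ?I A) (J (a, b)) \<partial>PiM ?I (\<lambda>_. ?E)) \<partial>PiM ?I (\<lambda>_. ?P))"
        using measurable_compose[OF Jm' borel_measurable_indicator[OF box]] by (intro EI.nn_integral_fst[symmetric]) simp
      also have "\<dots> = (\<integral>\<^sup>+a. (\<integral>\<^sup>+b. (\<Prod>i\<in>?I. indicator (A i) (a i, b i)) \<partial>PiM ?I (\<lambda>_. ?E)) \<partial>PiM ?I (\<lambda>_. ?P))"
      proof (intro nn_integral_cong)
        fix a b
        show "indicator (Pi\<^sub>E ?I A) (J (a, b)) = (\<Prod>i\<in>?I. indicator (A i) (a i, b i) :: ennreal)"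
          by (auto simp: J_def indicator_def PiE_iff prod_eq_1_iff)
      qed
      also have "\<dots> = (\<integral>\<^sup>+a. (\<Prod>i\<in>?I. \<integral>\<^sup>+y. indicator (A i) (a i, y) \<partial>?E) \<partial>PiM ?I (\<lambda>_. ?P))"
      proof (intro nn_integral_cong)
        fix a assume a: "a \<in> space (PiM ?I (\<lambda>_. ?P))"
        obtain b0 where "b0 \<in> space ?E" using E.not_empty by blast
        then show "(\<integral>\<^sup>+b. (\<Prod>i\<in>?I. indicator (A i) (a i, b i)) \<partial>PiM ?I (\<lambda>_. ?E)) = (\<Prod>i\<in>?I. \<integral>\<^sup>+y. indicator (A i) (a i, y) \<partial>?E)"
          using a by (intro EE.product_nn_integral_prod im) (auto simp: space_PiM PiE_iff)
      qed
      also have "\<dots> = (\<Prod>i\<in>?I. \<integral>\<^sup>+x. (\<integral>\<^sup>+y. indicator (A i) (x, y) \<partial>?E) \<partial>?P)"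
      proof (rule PP.product_nn_integral_prod)
        fix i assume i: "i \<in> ?I"
        have "(\<lambda>w. indicator (A i) w) \<in> borel_measurable R" using A[OF i] by simp
        then show "(\<lambda>x. \<integral>\<^sup>+y. indicator (A i) (x, y) \<partial>?E) \<in> borel_measurable ?P"
          unfolding R_def by (intro E.borel_measurable_nn_integral) (simp add: case_prod_beta')
      qed simp
      also have "\<dots> = (\<Prod>i\<in>?I. emeasure R (A i))"
      proof (rule prod.cong[OF refl])
        fix i assume i: "i \<in> ?I"
        have "(\<integral>\<^sup>+x. (\<integral>\<^sup>+y. indicator (A i) (x, y) \<partial>?E) \<partial>?P) = (\<integral>\<^sup>+w. indicator (A i) w \<partial>R)"
          unfolding R_def using A[OF i] by (intro E.nn_integral_fst) (simp add: R_def)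
        then show "(\<integral>\<^sup>+x. (\<integral>\<^sup>+y. indicator (A i) (x, y) \<partial>?E) \<partial>?P) = emeasure R (A i)" using A[OF i] by simp
      qed
      finally show "emeasure (distr (PiM ?I (\<lambda>_. ?P) \<Otimes>\<^sub>M PiM ?I (\<lambda>_. ?E)) (PiM ?I (\<lambda>_. N \<Otimes>\<^sub>M N')) J) (Pi\<^sub>E ?I A) = (\<Prod>i\<in>?I. emeasure R (A i))" .
    qed (use sets2 in auto)
  qed
  finally show "distr M (PiM ?I (\<lambda>_. N \<Otimes>\<^sub>M N')) (\<lambda>\<omega>. \<lambda>i\<in>?I. (Z i \<omega>, e i \<omega>)) = PiM ?I (\<lambda>_. R)" .
qed

section \<open>Exponential moments\<close>

text \<open>For an admissible scale t \<le> \<kappa> one has |Z|/\<kappa> \<le> 1 + Z^2/t^2, so the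
  moment is at most 2 exp 1, hence at most 6.\<close>

lemma psi2_norm_subexp:
  assumes Z: "Z \<in> borel_measurable M" and K: "psi2_norm M Z \<le> ennreal K" and \<kappa>: "\<bar>K\<bar> + 1 \<le> \<kappa>"
  shows "(\<integral>\<^sup>+\<omega>. ennreal (exp (\<bar>Z \<omega>\<bar> / \<kappa>)) \<partial>M) \<le> 10"
proof -
  \<comment> \<open>The infimum in the norm need not be attained, and \<open>ennreal K\<close> is 0
    for negative \<open>K\<close>; strict comparison with |K| + 1 yields an admissible
    \<open>t\<close> below that value.\<close>
  have "ennreal K \<le> ennreal \<bar>K\<bar>" by (rule ennreal_leI) simp
  also have "\<dots> < ennreal (\<bar>K\<bar> + 1)" by (rule ennreal_lessI) auto
  finally have "psi2_norm M Z < ennreal (\<bar>K\<bar> + 1)" using K by (rule le_less_trans[rotated])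
  then obtain t where t: "0 < t" "ennreal t < ennreal (\<bar>K\<bar> + 1)"
    "(\<integral>\<^sup>+\<omega>. ennreal (exp ((Z \<omega>)\<^sup>2 / t\<^sup>2)) \<partial>M) \<le> 2"
    unfolding psi2_norm_def Inf_less_iff by blast
  have "t < \<bar>K\<bar> + 1" using t(1,2) by (subst (asm) ennreal_less_iff) auto
  then have t\<kappa>: "t \<le> \<kappa>" using \<kappa> by linarith
  have "(\<integral>\<^sup>+\<omega>. ennreal (exp (\<bar>Z \<omega>\<bar> / \<kappa>)) \<partial>M) \<le> (\<integral>\<^sup>+\<omega>. ennreal (exp 1) * ennreal (exp ((Z \<omega>)\<^sup>2 / t\<^sup>2)) \<partial>M)"
  proof (rule nn_integral_mono)
    fix \<omega>
    have "\<bar>Z \<omega>\<bar> / \<kappa> \<le> \<bar>Z \<omega>\<bar> / t" using t\<kappa> t(1) by (intro divide_left_mono) auto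
    also have "\<dots> \<le> 1 + (\<bar>Z \<omega>\<bar> / t)\<^sup>2"
    proof -
      have "y \<le> 1 + y\<^sup>2" for y :: real
        using zero_le_power2[of "y - 1 / 2"] by (simp add: power2_eq_square algebra_simps)
      then show ?thesis .
    qed
    also have "(\<bar>Z \<omega>\<bar> / t)\<^sup>2 = (Z \<omega>)\<^sup>2 / t\<^sup>2" by (simp add: power_divide)
    finally have "exp (\<bar>Z \<omega>\<bar> / \<kappa>) \<le> exp 1 * exp ((Z \<omega>)\<^sup>2 / t\<^sup>2)" unfolding mult_exp_exp by simp
    then show "ennreal (exp (\<bar>Z \<omega>\<bar> / \<kappa>)) \<le> ennreal (exp 1) * ennreal (exp ((Z \<omega>)\<^sup>2 / t\<^sup>2))"
      by (subst ennreal_mult[symmetric]) (auto intro: ennreal_leI)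
  qed
  also have "\<dots> = ennreal (exp 1) * (\<integral>\<^sup>+\<omega>. ennreal (exp ((Z \<omega>)\<^sup>2 / t\<^sup>2)) \<partial>M)"
    by (rule nn_integral_cmult) (use Z in measurable)
  also have "\<dots> \<le> ennreal 3 * 2"
    by (intro mult_mono t(3) ennreal_leI exp_le) auto
  also have "\<dots> = ennreal 6" by (simp add: ennreal_mult[symmetric] flip: ennreal_numeral)
  also have "\<dots> \<le> ennreal 10" by (rule ennreal_leI) simp
  finally show ?thesis by simp
qed

text \<open>Completing the square: a normal density tilted by exp (s t) is a multiple of the normal
  density whose mean is shifted by s \<sigma>^2.\<close>

lemma nn_integral_normal_exp:
  assumes \<sigma>: "0 < \<sigma>"
  shows "(\<integral>\<^sup>+t. ennreal (normal_density m \<sigma> t) * ennreal (exp (s * t)) \<partial>lborel) = ennreal (exp (s * m + s\<^sup>2 * \<sigma>\<^sup>2 / 2))"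
proof -
  have e: "normal_density m \<sigma> t * exp (s * t) = exp (s * m + s\<^sup>2 * \<sigma>\<^sup>2 / 2) * normal_density (m + s * \<sigma>\<^sup>2) \<sigma> t" for t
  proof -
    have "- (t - m)\<^sup>2 / (2 * \<sigma>\<^sup>2) + s * t = (s * m + s\<^sup>2 * \<sigma>\<^sup>2 / 2) + - (t - (m + s * \<sigma>\<^sup>2))\<^sup>2 / (2 * \<sigma>\<^sup>2)"
      using \<sigma> by (simp add: field_simps power2_eq_square)
    then have "exp (- (t - m)\<^sup>2 / (2 * \<sigma>\<^sup>2)) * exp (s * t) = exp (s * m + s\<^sup>2 * \<sigma>\<^sup>2 / 2) * exp (- (t - (m + s * \<sigma>\<^sup>2))\<^sup>2 / (2 * \<sigma>\<^sup>2))"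
      unfolding mult_exp_exp by (simp only:)
    then show ?thesis unfolding normal_density_def by (simp only: mult.assoc mult.left_commute)
  qed
  have nd: "(\<lambda>t. ennreal (normal_density a b t)) \<in> borel_measurable lborel" for a b
    unfolding measurable_lborel1 measurable_lborel2 by (rule measurable_compose[OF borel_measurable_normal_density measurable_ennreal])
  have "(\<integral>\<^sup>+t. ennreal (normal_density m \<sigma> t) * ennreal (exp (s * t)) \<partial>lborel) =
     (\<integral>\<^sup>+t. ennreal (exp (s * m + s\<^sup>2 * \<sigma>\<^sup>2 / 2)) * ennreal (normal_density (m + s * \<sigma>\<^sup>2) \<sigma> t) \<partial>lborel)"
  proof (rule nn_integral_cong)
    fix t
    show "ennreal (normal_density m \<sigma> t) * ennreal (exp (s * t)) = ennreal (exp (s * m + s\<^sup>2 * \<sigma>\<^sup>2 / 2)) * ennreal (normal_density (m + s * \<sigma>\<^sup>2) \<sigma> t)"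
      by (simp only: ennreal_mult[symmetric] normal_density_nonneg exp_ge_zero e)
  qed
  also have "\<dots> = ennreal (exp (s * m + s\<^sup>2 * \<sigma>\<^sup>2 / 2)) * (\<integral>\<^sup>+t. ennreal (normal_density (m + s * \<sigma>\<^sup>2) \<sigma> t) \<partial>lborel)"
    by (rule nn_integral_cmult[OF nd])
  also have "(\<integral>\<^sup>+t. ennreal (normal_density (m + s * \<sigma>\<^sup>2) \<sigma> t) \<partial>lborel) = 1"
  proof -
    interpret prob_space "density lborel (\<lambda>t. ennreal (normal_density (m + s * \<sigma>\<^sup>2) \<sigma> t))"
      by (rule prob_space_normal_density[OF \<sigma>])
    show ?thesis using emeasure_space_1 by (simp add: emeasure_density)
  qed
  finally show ?thesis by simp
qed

text \<open>The exponential of |t|/\<kappa> is at most the sum of those of t/\<kappa> and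
  -t/\<kappa>. Each of the two has a Laplace transform with exponent at most 1/2 + 1/8, hence at
  most 3, and 6 is below the common bound 10.\<close>

lemma normal_law_subexp:
  assumes \<kappa>: "0 < \<kappa>" and m: "\<bar>m\<bar> \<le> \<kappa> / 2" and v: "0 \<le> v" "v \<le> (\<kappa> / 2)\<^sup>2"
  shows "(\<integral>\<^sup>+t. ennreal (exp (\<bar>t\<bar> / \<kappa>)) \<partial>normal_law m v) \<le> 10"
proof (cases "v = 0")
  case True
  have "\<bar>m\<bar> / \<kappa> \<le> 1" using m \<kappa> by simp
  then have "exp (\<bar>m\<bar> / \<kappa>) \<le> exp 1" by simp
  then have "ennreal (exp (\<bar>m\<bar> / \<kappa>)) \<le> ennreal 10" using exp_le by (intro ennreal_leI) linarith
  then show ?thesis using True by (simp add: normal_law_def nn_integral_return)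
next
  case False
  then have v0: "0 < v" using v by simp
  have \<sigma>: "0 < sqrt v" using v0 by simp
  have bound: "ennreal (exp (s * m + s\<^sup>2 * (sqrt v)\<^sup>2 / 2)) \<le> ennreal 3" if s: "\<bar>s\<bar> = 1 / \<kappa>" for s
  proof (rule ennreal_leI)
    have "s * m \<le> \<bar>s\<bar> * \<bar>m\<bar>" by (simp add: abs_mult[symmetric])
    also have "\<dots> \<le> (1 / \<kappa>) * (\<kappa> / 2)" unfolding s using m \<kappa> by (intro mult_left_mono) auto
    also have "\<dots> = 1 / 2" using \<kappa> by simp
    finally have 1: "s * m \<le> 1 / 2" .
    have "s\<^sup>2 * (sqrt v)\<^sup>2 / 2 = (1 / \<kappa>)\<^sup>2 * v / 2" using v s by (simp flip: power2_abs[of s])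
    also have "\<dots> \<le> (1 / \<kappa>)\<^sup>2 * (\<kappa> / 2)\<^sup>2 / 2" using v by (intro divide_right_mono mult_left_mono) auto
    also have "\<dots> = 1 / 8" using \<kappa> by (simp add: power2_eq_square)
    finally have "exp (s * m + s\<^sup>2 * (sqrt v)\<^sup>2 / 2) \<le> exp 1" using 1 by simp
    then show "exp (s * m + s\<^sup>2 * (sqrt v)\<^sup>2 / 2) \<le> 3" using exp_le by linarith
  qed
  have nd: "(\<lambda>t. ennreal (normal_density a b t)) \<in> borel_measurable lborel" for a b
    unfolding measurable_lborel1 measurable_lborel2 by (rule measurable_compose[OF borel_measurable_normal_density measurable_ennreal])
  have ex: "(\<lambda>t :: real. ennreal (exp (c * t))) \<in> borel_measurable lborel" for c
    unfolding measurable_lborel1 measurable_lborel2 by (intro measurable_compose[OF _ measurable_ennreal] borel_measurable_continuous_onI continuous_intros)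
  have "(\<integral>\<^sup>+t. ennreal (exp (\<bar>t\<bar> / \<kappa>)) \<partial>normal_law m v) =
    (\<integral>\<^sup>+t. ennreal (normal_density m (sqrt v) t) * ennreal (exp (\<bar>t\<bar> / \<kappa>)) \<partial>lborel)"
    using False by (simp add: normal_law_def nn_integral_density)
  also have "\<dots> \<le> (\<integral>\<^sup>+t. ennreal (normal_density m (sqrt v) t) * ennreal (exp ((1 / \<kappa>) * t)) + ennreal (normal_density m (sqrt v) t) * ennreal (exp ((- 1 / \<kappa>) * t)) \<partial>lborel)"
  proof (rule nn_integral_mono)
    fix t
    have "exp (\<bar>t\<bar> / \<kappa>) \<le> exp ((1 / \<kappa>) * t) + exp ((- 1 / \<kappa>) * t)"
      by (cases "0 \<le> t") (auto simp: add_increasing add_increasing2)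
    then have "ennreal (exp (\<bar>t\<bar> / \<kappa>)) \<le> ennreal (exp ((1 / \<kappa>) * t) + exp ((- 1 / \<kappa>) * t))"
      by (rule ennreal_leI)
    also have "\<dots> = ennreal (exp ((1 / \<kappa>) * t)) + ennreal (exp ((- 1 / \<kappa>) * t))" by (rule ennreal_plus) auto
    finally have "ennreal (exp (\<bar>t\<bar> / \<kappa>)) \<le> ennreal (exp ((1 / \<kappa>) * t)) + ennreal (exp ((- 1 / \<kappa>) * t))" .
    then show "ennreal (normal_density m (sqrt v) t) * ennreal (exp (\<bar>t\<bar> / \<kappa>)) \<le> ennreal (normal_density m (sqrt v) t) * ennreal (exp ((1 / \<kappa>) * t)) + ennreal (normal_density m (sqrt v) t) * ennreal (exp ((- 1 / \<kappa>) * t))"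
      unfolding distrib_left[symmetric] by (rule mult_left_mono) simp
  qed
  also have "\<dots> = ennreal (exp ((1 / \<kappa>) * m + (1 / \<kappa>)\<^sup>2 * (sqrt v)\<^sup>2 / 2)) + ennreal (exp ((- 1 / \<kappa>) * m + (- 1 / \<kappa>)\<^sup>2 * (sqrt v)\<^sup>2 / 2))"
    by (subst nn_integral_add[OF borel_measurable_times_ennreal[OF nd ex] borel_measurable_times_ennreal[OF nd ex]])
      (simp only: nn_integral_normal_exp[OF \<sigma>])
  also have "\<dots> \<le> ennreal 3 + ennreal 3"
    using \<kappa> by (intro add_mono bound) auto
  also have "\<dots> = ennreal 6" by (subst ennreal_plus[symmetric]) auto
  also have "\<dots> \<le> ennreal 10" by (rule ennreal_leI) simp
  finally show ?thesis by simp
qed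

lemma dotp_mat_vec_sqrt:
  assumes "is_psd_sqrt p T \<Sigma>"
  shows "dotp p \<theta> (mat_vec p \<Sigma> \<theta>) = (vnorm p (mat_vec p T \<theta>))\<^sup>2"
proof -
  have T: "T i j = T j i" if "i < p" "j < p" for i j using assms that unfolding is_psd_sqrt_def sym_psd_def by blast
  have S: "\<Sigma> i j = (\<Sum>l<p. T i l * T l j)" if "i < p" "j < p" for i j using assms that unfolding is_psd_sqrt_def by blast
  have "dotp p \<theta> (mat_vec p \<Sigma> \<theta>) = (\<Sum>i<p. \<Sum>j<p. \<Sum>l<p. (T l i * \<theta> i) * (T l j * \<theta> j))"
  proof -
    have e: "\<theta> i * (\<Sigma> i j * \<theta> j) = (\<Sum>l<p. (T l i * \<theta> i) * (T l j * \<theta> j))" if "i < p" "j < p" for i j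
      unfolding S[OF that] sum_distrib_right sum_distrib_left
      by (intro sum.cong refl) (use T[OF that(1)] in \<open>simp add: mult_ac\<close>)
    have "dotp p \<theta> (mat_vec p \<Sigma> \<theta>) = (\<Sum>i<p. \<Sum>j<p. \<theta> i * (\<Sigma> i j * \<theta> j))"
      by (simp add: dotp_def mat_vec_def sum_distrib_left)
    also have "\<dots> = (\<Sum>i<p. \<Sum>j<p. \<Sum>l<p. (T l i * \<theta> i) * (T l j * \<theta> j))"
      by (intro sum.cong refl e) auto
    finally show ?thesis .
  qed
  also have "\<dots> = (\<Sum>i<p. \<Sum>l<p. \<Sum>j<p. (T l i * \<theta> i) * (T l j * \<theta> j))"
    by (intro sum.cong refl sum.swap)
  also have "\<dots> = (\<Sum>l<p. \<Sum>i<p. \<Sum>j<p. (T l i * \<theta> i) * (T l j * \<theta> j))"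
    by (rule sum.swap)
  also have "\<dots> = (\<Sum>l<p. (\<Sum>i<p. T l i * \<theta> i)\<^sup>2)"
    by (simp only: power2_eq_square sum_product)
  also have "\<dots> = (vnorm p (mat_vec p T \<theta>))\<^sup>2"
    unfolding vnorm_def L2_set_def mat_vec_def by (subst real_sqrt_pow2) (auto intro: sum_nonneg)
  finally show ?thesis .
qed

lemma gaussian_subexp:
  assumes g: "gaussian_vector M p \<mu> \<Sigma> g" and T: "is_psd_sqrt p T \<Sigma>" and \<theta>: "\<theta> \<in> Rvec p" and \<kappa>: "0 < \<kappa>"
    and m: "\<bar>dotp p \<theta> \<mu>\<bar> \<le> \<kappa> / 2" and v: "vnorm p (mat_vec p T \<theta>) \<le> \<kappa> / 2"
  shows "(\<integral>\<^sup>+\<omega>. ennreal (exp (\<bar>dotp p \<theta> (g \<omega>)\<bar> / \<kappa>)) \<partial>M) \<le> 10"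
proof -
  have gm: "(\<lambda>\<omega>. dotp p \<theta> (g \<omega>)) \<in> borel_measurable M"
    using g measurable_compose[OF _ measurable_dotp] unfolding gaussian_vector_def by blast
  have "(\<integral>\<^sup>+\<omega>. ennreal (exp (\<bar>dotp p \<theta> (g \<omega>)\<bar> / \<kappa>)) \<partial>M) = (\<integral>\<^sup>+t. ennreal (exp (\<bar>t\<bar> / \<kappa>)) \<partial>distr M borel (\<lambda>\<omega>. dotp p \<theta> (g \<omega>)))"
    by (rule nn_integral_distr[symmetric, OF gm])
      (unfold measurable_distr_eq1, intro measurable_compose[OF _ measurable_ennreal] borel_measurable_continuous_onI continuous_intros, use \<kappa> in auto)
  also have "distr M borel (\<lambda>\<omega>. dotp p \<theta> (g \<omega>)) = normal_law (dotp p \<theta> \<mu>) (dotp p \<theta> (mat_vec p \<Sigma> \<theta>))"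
    using g \<theta> unfolding gaussian_vector_def by blast
  also have "(\<integral>\<^sup>+t. ennreal (exp (\<bar>t\<bar> / \<kappa>)) \<partial>\<dots>) \<le> 10"
    unfolding dotp_mat_vec_sqrt[OF T] using v by (intro normal_law_subexp[OF \<kappa> m] power_mono) auto
  finally show ?thesis .
qed

lemma mat_vec_vscale: "vnorm p (mat_vec p T (vscale p t \<theta>)) = \<bar>t\<bar> * vnorm p (mat_vec p T \<theta>)"
proof -
  have "mat_vec p T (vscale p t \<theta>) = vscale p t (mat_vec p T \<theta>)"
    by (auto simp: mat_vec_def vscale_def sum_distrib_left mult_ac fun_eq_iff intro!: sum.cong)
  then show ?thesis by (simp only: vnorm_vscale)
qed

lemma dotp_vscale: "dotp p x (vscale p t \<theta>) = t * dotp p \<theta> x"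
  by (auto simp: dotp_def vscale_def sum_distrib_left mult_ac intro!: sum.cong)

text \<open>One scale for both models and for all vectors of the constraint sets. It is stated for
  every larger \<kappa> as well, because the noise of alternative (I) may force an increase.\<close>

lemma constraint_subexp:
  fixes \<Theta>s :: "nat \<Rightarrow> (nat \<Rightarrow> real) ^ 's"
  assumes x: "\<And>n. x n \<in> M n \<rightarrow>\<^sub>M Rvec_borel (p n)"
    and g: "\<And>n. gaussian_vector (M n) (p n) (\<mu> n) (\<Sigma> n) (g n)" and T: "\<And>n. is_psd_sqrt (p n) (\<Sigma>half n) (\<Sigma> n)"
    and constraints: "constraint_sets p C \<Theta>s" and subgaussian: "restricted_subgaussian M p x \<mu> \<Sigma>half C \<Theta>s"
  obtains \<kappa>0 where "0 < \<kappa>0" "\<forall>\<kappa>\<ge>\<kappa>0. \<forall>n. \<forall>\<theta>\<in>C n \<union> range (($) (\<Theta>s n)). vnorm (p n) \<theta> \<le> \<kappa> \<and>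
    (\<integral>\<^sup>+\<omega>. ennreal (exp (\<bar>dotp (p n) \<theta> (x n \<omega>)\<bar> / \<kappa>)) \<partial>M n) \<le> 10 \<and>
    (\<integral>\<^sup>+\<omega>. ennreal (exp (\<bar>dotp (p n) \<theta> (g n \<omega>)\<bar> / \<kappa>)) \<partial>M n) \<le> 10"
proof -
  obtain R where R: "\<And>n D \<theta>. D \<in> constraint_family (C n) (\<Theta>s n) \<Longrightarrow> \<theta> \<in> D \<Longrightarrow> \<theta> \<in> Rvec (p n) \<and> vnorm (p n) \<theta> \<le> R"
    using constraints unfolding constraint_sets_def by blast
  obtain K where K: "\<And>n D \<theta>. D \<in> constraint_family (C n) (\<Theta>s n) \<Longrightarrow>
       (SUP \<theta>\<in>unit_part (p n) D. psi2_norm (M n) (\<lambda>\<omega>. dotp (p n) (x n \<omega>) \<theta>)) \<le> ennreal K"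
    "\<And>n D \<theta>. D \<in> constraint_family (C n) (\<Theta>s n) \<Longrightarrow> \<theta> \<in> unit_part (p n) D \<Longrightarrow> vnorm (p n) (mat_vec (p n) (\<Sigma>half n) \<theta>) \<le> K"
    "\<And>n. vnorm (p n) (\<mu> n) \<le> K"
    using subgaussian unfolding restricted_subgaussian_def by blast
  define R' where "R' = max 1 R"
  \<comment> \<open>The hypotheses concern vectors shortened by a factor of at most
    \<open>R'\<close>; undoing this multiplies the constant by at most \<open>R'\<close>. The factor
    2 serves the Gaussian functional, whose mean and standard deviation must each be at most
    \<kappa>/2.\<close>
  define \<kappa>0 where "\<kappa>0 = 2 * (R' * (\<bar>K\<bar> + 1))"
  have R'1: "1 \<le> R'" by (simp add: R'_def)
  have R'K: "1 * 1 \<le> R' * (\<bar>K\<bar> + 1)" "R' * 1 \<le> R' * (\<bar>K\<bar> + 1)" using R'1 by (intro mult_mono; simp)+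
  show ?thesis
  proof (rule that)
    show "0 < \<kappa>0" using R'K by (simp add: \<kappa>0_def)
    show "\<forall>\<kappa>\<ge>\<kappa>0. \<forall>n. \<forall>\<theta>\<in>C n \<union> range (($) (\<Theta>s n)). vnorm (p n) \<theta> \<le> \<kappa> \<and>
      (\<integral>\<^sup>+\<omega>. ennreal (exp (\<bar>dotp (p n) \<theta> (x n \<omega>)\<bar> / \<kappa>)) \<partial>M n) \<le> 10 \<and>
      (\<integral>\<^sup>+\<omega>. ennreal (exp (\<bar>dotp (p n) \<theta> (g n \<omega>)\<bar> / \<kappa>)) \<partial>M n) \<le> 10"
    proof (intro allI impI ballI)
      fix \<kappa> n \<theta> assume \<kappa>: "\<kappa>0 \<le> \<kappa>" and "\<theta> \<in> C n \<union> range (($) (\<Theta>s n))"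
      then obtain D where D: "D \<in> constraint_family (C n) (\<Theta>s n)" "\<theta> \<in> D"
        unfolding constraint_family_def by blast
      have \<theta>: "\<theta> \<in> Rvec (p n)" "vnorm (p n) \<theta> \<le> R" using R[OF D] by auto
      define \<rho> where "\<rho> = max 1 (vnorm (p n) \<theta>)"
      have \<rho>: "1 \<le> \<rho>" "\<rho> \<le> R'" using \<theta>(2) by (auto simp: \<rho>_def R'_def)
      define \<theta>' where "\<theta>' = vscale (p n) (1 / \<rho>) \<theta>"
      have \<theta>': "\<theta>' \<in> unit_part (p n) D" unfolding unit_part_def \<theta>'_def \<rho>_def using D(2) by blast
      have \<kappa>pos: "0 < \<kappa>" using R'K \<kappa> by (simp add: \<kappa>0_def)
      have "psi2_norm (M n) (\<lambda>\<omega>. dotp (p n) (x n \<omega>) \<theta>') \<le> ennreal K"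
        by (rule order_trans[OF SUP_upper[OF \<theta>'] K(1)[OF D(1)]])
      moreover have "(\<lambda>\<omega>. dotp (p n) (x n \<omega>) \<theta>') = (\<lambda>\<omega>. (1 / \<rho>) * dotp (p n) \<theta> (x n \<omega>))"
        by (simp only: \<theta>'_def dotp_vscale)
      ultimately have ps: "psi2_norm (M n) (\<lambda>\<omega>. (1 / \<rho>) * dotp (p n) \<theta> (x n \<omega>)) \<le> ennreal K" by (simp only:)
      have xm: "(\<lambda>\<omega>. (1 / \<rho>) * dotp (p n) \<theta> (x n \<omega>)) \<in> borel_measurable (M n)"
        by (intro borel_measurable_times borel_measurable_const measurable_compose[OF x measurable_dotp])
      have "\<rho> * (\<bar>K\<bar> + 1) \<le> R' * (\<bar>K\<bar> + 1)" using \<rho> by (intro mult_right_mono) auto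
      then have "\<rho> * (\<bar>K\<bar> + 1) \<le> \<kappa>" using \<kappa> R'K by (simp add: \<kappa>0_def)
      then have "\<bar>K\<bar> + 1 \<le> \<kappa> / \<rho>" using \<rho> by (simp add: pos_le_divide_eq mult.commute)
      from psi2_norm_subexp[OF xm ps this]
      have 1: "(\<integral>\<^sup>+\<omega>. ennreal (exp (\<bar>dotp (p n) \<theta> (x n \<omega>)\<bar> / \<kappa>)) \<partial>M n) \<le> 10"
        using \<rho> by (simp add: abs_mult)
      have "vnorm (p n) (mat_vec (p n) (\<Sigma>half n) \<theta>') = (1 / \<rho>) * vnorm (p n) (mat_vec (p n) (\<Sigma>half n) \<theta>)"
        unfolding \<theta>'_def mat_vec_vscale using \<rho> by simp
      then have "(1 / \<rho>) * vnorm (p n) (mat_vec (p n) (\<Sigma>half n) \<theta>) \<le> K"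
        using K(2)[OF D(1) \<theta>'] by simp
      then have "vnorm (p n) (mat_vec (p n) (\<Sigma>half n) \<theta>) \<le> \<rho> * K" using \<rho> by (simp add: pos_divide_le_eq mult.commute)
      also have "\<dots> \<le> R' * (\<bar>K\<bar> + 1)" using \<rho> by (intro order_trans[OF mult_left_mono mult_right_mono]) auto
      finally have v: "vnorm (p n) (mat_vec (p n) (\<Sigma>half n) \<theta>) \<le> \<kappa> / 2" using \<kappa> by (simp add: \<kappa>0_def)
      have "\<bar>dotp (p n) \<theta> (\<mu> n)\<bar> \<le> vnorm (p n) \<theta> * vnorm (p n) (\<mu> n)" by (rule abs_dotp_le)
      also have "\<dots> \<le> R' * (\<bar>K\<bar> + 1)" using \<theta>(2) K(3)[of n] R'1 by (intro mult_mono) (auto simp: R'_def)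
      finally have m: "\<bar>dotp (p n) \<theta> (\<mu> n)\<bar> \<le> \<kappa> / 2" using \<kappa> by (simp add: \<kappa>0_def)
      have "vnorm (p n) \<theta> \<le> \<kappa>" using \<theta>(2) R'K \<kappa> by (simp add: \<kappa>0_def R'_def)
      then show "vnorm (p n) \<theta> \<le> \<kappa> \<and> (\<integral>\<^sup>+\<omega>. ennreal (exp (\<bar>dotp (p n) \<theta> (x n \<omega>)\<bar> / \<kappa>)) \<partial>M n) \<le> 10 \<and>
        (\<integral>\<^sup>+\<omega>. ennreal (exp (\<bar>dotp (p n) \<theta> (g n \<omega>)\<bar> / \<kappa>)) \<partial>M n) \<le> 10"
        using 1 gaussian_subexp[OF g T \<theta>(1) \<kappa>pos m v] by blast
    qed
  qed
qed

section \<open>Growth of the loss\<close>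

text \<open>In the locally Lipschitz case the lower growth bound makes the loss at least
  \<open>A\<close> outside a ball, so the truncated loss is constant there; a segment that leaves
  the ball is cut at the sphere. Growth thus turns a local into a global Lipschitz bound after
  truncation.\<close>

lemma truncated_loss_lipschitz:
  fixes lo :: "('w::real_normed_vector \<times> real) \<Rightarrow> real"
  assumes "loss_lipschitz lo \<or> (loss_locally_lipschitz lo \<and> loss_growth lo)" and A: "0 < A"
  shows "\<exists>K\<ge>0. \<forall>w w' e. \<bar>min A (lo (w, e)) - min A (lo (w', e))\<bar> \<le> K * norm (w - w')"
  using assms(1)
proof
  assume "loss_lipschitz lo"
  then obtain K where K: "\<And>w e w' e'. \<bar>lo (w, e) - lo (w', e')\<bar> \<le> K * (norm (w - w') + \<bar>e - e'\<bar>)"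
    unfolding loss_lipschitz_def by blast
  have "\<bar>min A (lo (w, e)) - min A (lo (w', e))\<bar> \<le> \<bar>K\<bar> * norm (w - w')" for w w' e
  proof -
    have "\<bar>min A (lo (w, e)) - min A (lo (w', e))\<bar> \<le> \<bar>lo (w, e) - lo (w', e)\<bar>" by linarith
    also have "\<dots> \<le> K * norm (w - w')" using K[of w e w' e] by simp
    also have "\<dots> \<le> \<bar>K\<bar> * norm (w - w')" by (intro mult_right_mono) auto
    finally show ?thesis .
  qed
  then show ?thesis by (intro exI[of _ "\<bar>K\<bar>"]) auto
next
  assume H: "loss_locally_lipschitz lo \<and> loss_growth lo"
  obtain K0 K1 K a b where a: "0 < K1" "0 < a" and gr: "\<And>w e. - K0 + K1 * (norm w powr a + \<bar>e\<bar> powr a) \<le> lo (w, e)"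
    using H unfolding loss_growth_def by blast
  \<comment> \<open>The lower bound reaches \<open>A\<close> as soon as \<open>norm w\<close> or |e|
    is at least \<open>q\<close>; outside the ball of radius 2q one of them is.\<close>
  define q where "q = ((A + \<bar>K0\<bar>) / K1) powr (1 / a)"
  have q0: "0 < q" using A a by (simp add: q_def)
  have qa: "q powr a = (A + \<bar>K0\<bar>) / K1" using A a by (simp add: q_def powr_powr)
  define \<rho> where "\<rho> = 2 * q"
  have \<rho>: "0 < \<rho>" using q0 by (simp add: \<rho>_def)
  have big: "A \<le> lo (w, e)" if "\<rho> \<le> norm (w, e)" for w e
  proof -
    have "norm (w, e) \<le> norm w + \<bar>e\<bar>" using norm_Pair_le[of w e] by simp
    then have "q \<le> norm w \<or> q \<le> \<bar>e\<bar>" using that by (auto simp: \<rho>_def)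
    then have "q powr a \<le> norm w powr a + \<bar>e\<bar> powr a"
    proof
      assume "q \<le> norm w"
      then have "q powr a \<le> norm w powr a" using q0 a by (intro powr_mono2) auto
      moreover have "0 \<le> \<bar>e\<bar> powr a" by simp
      ultimately show ?thesis by linarith
    next
      assume "q \<le> \<bar>e\<bar>"
      then have "q powr a \<le> \<bar>e\<bar> powr a" using q0 a by (intro powr_mono2) auto
      moreover have "0 \<le> norm w powr a" by simp
      ultimately show ?thesis by linarith
    qed
    then have "K1 * q powr a \<le> K1 * (norm w powr a + \<bar>e\<bar> powr a)" using a by (intro mult_left_mono) auto
    moreover have "K1 * q powr a = A + \<bar>K0\<bar>" using a by (simp add: qa)
    ultimately show ?thesis using gr[of w e] by linarith
  qed
  obtain L where L: "\<And>w e w' e'. norm (w, e) \<le> \<rho> \<Longrightarrow> norm (w', e') \<le> \<rho> \<Longrightarrow>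
      \<bar>lo (w, e) - lo (w', e')\<bar> \<le> L * (norm (w - w') + \<bar>e - e'\<bar>)"
    using H \<rho> unfolding loss_locally_lipschitz_def by blast
  have inside: "\<bar>min A (lo (w, e)) - min A (lo (w', e))\<bar> \<le> \<bar>L\<bar> * norm (w - w')"
    if "norm (w, e) \<le> \<rho>" "norm (w', e) \<le> \<rho>" for w w' e
  proof -
    have "\<bar>min A (lo (w, e)) - min A (lo (w', e))\<bar> \<le> \<bar>lo (w, e) - lo (w', e)\<bar>" by linarith
    also have "\<dots> \<le> L * norm (w - w')" using L[OF that] by simp
    also have "\<dots> \<le> \<bar>L\<bar> * norm (w - w')" by (intro mult_right_mono) auto
    finally show ?thesis .
  qed
  have mixed: "\<bar>min A (lo (w, e)) - min A (lo (w', e))\<bar> \<le> \<bar>L\<bar> * norm (w - w')"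
    if w: "norm (w, e) \<le> \<rho>" and w': "\<rho> \<le> norm (w', e)" for w w' e
  proof -
    \<comment> \<open>The segment moves \<open>w\<close> and keeps \<open>e\<close>. Where it meets
      the sphere the truncated loss already equals \<open>A\<close>, its value at the far
      end.\<close>
    have "\<exists>t\<ge>0. t \<le> 1 \<and> norm (w + t *\<^sub>R (w' - w), e) = \<rho>"
      by (rule IVT') (use w w' in \<open>auto intro!: continuous_intros\<close>)
    then obtain t where t: "0 \<le> t" "t \<le> 1" "norm (w + t *\<^sub>R (w' - w), e) = \<rho>" by blast
    let ?v = "w + t *\<^sub>R (w' - w)"
    have "min A (lo (w', e)) = A" "min A (lo (?v, e)) = A" using big[OF w'] big[of ?v e] t(3) by auto
    then have "\<bar>min A (lo (w, e)) - min A (lo (w', e))\<bar> = \<bar>min A (lo (w, e)) - min A (lo (?v, e))\<bar>" by simp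
    also have "\<dots> \<le> \<bar>L\<bar> * norm (w - ?v)" using t(3) by (intro inside w) simp
    also have "norm (w - ?v) = t * norm (w' - w)" using t(1) by simp
    also have "\<bar>L\<bar> * (t * norm (w' - w)) \<le> \<bar>L\<bar> * (1 * norm (w' - w))" using t(2) by (intro mult_left_mono mult_right_mono) auto
    finally show ?thesis by (simp add: norm_minus_commute)
  qed
  have "\<bar>min A (lo (w, e)) - min A (lo (w', e))\<bar> \<le> \<bar>L\<bar> * norm (w - w')" for w w' e
  proof -
    consider "norm (w, e) \<le> \<rho>" "norm (w', e) \<le> \<rho>" | "norm (w, e) \<le> \<rho>" "\<rho> \<le> norm (w', e)"
      | "\<rho> \<le> norm (w, e)" "norm (w', e) \<le> \<rho>" | "\<rho> \<le> norm (w, e)" "\<rho> \<le> norm (w', e)" by linarith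
    then show ?thesis
    proof cases
      case 1 then show ?thesis by (rule inside)
    next
      case 2 then show ?thesis by (rule mixed)
    next
      case 3
      then show ?thesis using mixed[OF 3(2) 3(1)] by (simp add: norm_minus_commute abs_minus_commute)
    next
      case 4
      then have "min A (lo (w, e)) = A" "min A (lo (w', e)) = A" using big by auto
      then show ?thesis by simp
    qed
  qed
  then show ?thesis by (intro exI[of _ "\<bar>L\<bar>"]) auto
qed

lemma loss_continuous:
  fixes lo :: "('w::real_normed_vector \<times> real) \<Rightarrow> real"
  assumes "loss_lipschitz lo \<or> loss_locally_lipschitz lo"
  shows "continuous_on UNIV lo"
proof -
  have loc: "loss_locally_lipschitz lo"
    using assms unfolding loss_lipschitz_def loss_locally_lipschitz_def by blast
  have "isCont lo z" for z
  proof -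
    obtain w e where z: "z = (w, e)" by fastforce
    have B: "0 < norm z + 1" by (simp add: add_nonneg_pos)
    obtain K where K: "\<And>w e w' e'. norm (w, e) \<le> norm z + 1 \<Longrightarrow> norm (w', e') \<le> norm z + 1 \<Longrightarrow>
        \<bar>lo (w, e) - lo (w', e')\<bar> \<le> K * (norm (w - w') + \<bar>e - e'\<bar>)"
      using loc[unfolded loss_locally_lipschitz_def, rule_format, OF B] by blast
    have ev: "eventually (\<lambda>y. norm y < norm z + 1) (at z)"
      by (rule order_tendstoD(2)[of norm "norm z"]) (auto intro!: tendsto_intros)
    have "((\<lambda>y. K * (norm (fst y - fst z) + \<bar>snd y - snd z\<bar>)) \<longlongrightarrow> K * (norm (fst z - fst z) + \<bar>snd z - snd z\<bar>)) (at z)"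
      by (intro tendsto_intros)
    then have lim: "((\<lambda>y. K * (norm (fst y - fst z) + \<bar>snd y - snd z\<bar>)) \<longlongrightarrow> 0) (at z)" by simp
    have "((\<lambda>y. lo y - lo z) \<longlongrightarrow> 0) (at z)"
    proof (rule Lim_null_comparison[OF _ lim])
      show "eventually (\<lambda>y. norm (lo y - lo z) \<le> K * (norm (fst y - fst z) + \<bar>snd y - snd z\<bar>)) (at z)"
        using ev
      proof eventually_elim
        case (elim y)
        show ?case using K[of "fst y" "snd y" "fst z" "snd z"] elim by simp
      qed
    qed
    then show ?thesis unfolding isCont_def by (rule LIM_zero_cancel)
  qed
  then show ?thesis by (simp add: continuous_at_imp_continuous_on)
qed

text \<open>A single power bound for both kinds of loss, with exponent 1 in the Lipschitz case, so
  that the second moments are estimated only once.\<close>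

lemma loss_upper_growth:
  fixes lo :: "('w::real_normed_vector \<times> real) \<Rightarrow> real"
  assumes "loss_lipschitz lo \<or> (loss_locally_lipschitz lo \<and> loss_growth lo)"
  obtains K b where "0 \<le> K" "0 < b" "\<forall>z. lo z \<le> K * (1 + 2 * norm z powr b)"
proof -
  have wn: "norm w \<le> norm (w, e)" "\<bar>e\<bar> \<le> norm (w, e)" for w :: 'w and e :: real
    by (rule norm_fst_le) (unfold real_norm_def[symmetric], rule norm_snd_le)
  from assms show ?thesis
  proof
    assume "loss_lipschitz lo"
    then obtain K where K: "\<And>w e w' e'. \<bar>lo (w, e) - lo (w', e')\<bar> \<le> K * (norm (w - w') + \<bar>e - e'\<bar>)"
      unfolding loss_lipschitz_def by blast
    define K' where "K' = \<bar>K\<bar> + \<bar>lo (0, 0)\<bar>"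
    have "lo z \<le> K' * (1 + 2 * norm z powr 1)" for z
    proof -
      obtain w e where z: "z = (w, e)" by fastforce
      have "lo z \<le> \<bar>lo (0, 0)\<bar> + K * (norm w + \<bar>e\<bar>)" using K[of w e 0 0] z by simp
      also have "\<dots> \<le> \<bar>lo (0, 0)\<bar> + \<bar>K\<bar> * (2 * norm z)"
        using wn(1)[of w e] wn(2)[of e w] z by (intro add_left_mono mult_mono) auto
      also have "\<dots> \<le> K' * (1 + 2 * norm z)"
        by (simp add: K'_def algebra_simps)
      finally show ?thesis by (simp add: powr_one)
    qed
    then show ?thesis by (intro that[of K' 1]) (auto simp: K'_def)
  next
    assume "loss_locally_lipschitz lo \<and> loss_growth lo"
    then obtain K0 K1 K a b where b: "0 < a" "a \<le> b" and gr: "\<And>w e. lo (w, e) \<le> K * (1 + norm w powr b + \<bar>e\<bar> powr b)"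
      unfolding loss_growth_def by blast
    have "lo z \<le> \<bar>K\<bar> * (1 + 2 * norm z powr b)" for z
    proof -
      obtain w e where z: "z = (w, e)" by fastforce
      have "norm w powr b \<le> norm z powr b" "\<bar>e\<bar> powr b \<le> norm z powr b"
        using wn(1)[of w e] wn(2)[of e w] b z by (auto intro!: powr_mono2)
      then have "K * (1 + norm w powr b + \<bar>e\<bar> powr b) \<le> \<bar>K\<bar> * (1 + 2 * norm z powr b)"
        by (intro mult_mono) auto
      then show ?thesis using gr[of w e] z by simp
    qed
    then show ?thesis using b by (intro that[of "\<bar>K\<bar>" b]) auto
  qed
qed

text \<open>The inequality y \<le> exp y at y = c t / b, raised to the power b.\<close>

lemma powr_le_exp:
  fixes t b c :: real
  assumes "0 \<le> t" "0 < b" "0 < c"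
  shows "t powr b \<le> (b / c) powr b * exp (c * t)"
proof -
  have "c * t / b \<le> exp (c * t / b)" using exp_ge_add_one_self[of "c * t / b"] by linarith
  then have "(c * t / b) powr b \<le> exp (c * t / b) powr b" using assms by (intro powr_mono2) auto
  also have "\<dots> = exp (c * t)" using assms by (simp add: exp_powr_real)
  finally have "(c * t / b) powr b \<le> exp (c * t)" .
  then have "(b / c) powr b * (c * t / b) powr b \<le> (b / c) powr b * exp (c * t)" by (intro mult_left_mono) auto
  also have "(b / c) powr b * (c * t / b) powr b = t powr b"
    using assms by (subst powr_mult[symmetric]) auto
  finally show ?thesis .
qed

text \<open>Powers of the norm are dominated by an exponential of the norm, and some coordinate is
  at least norm z / d in absolute value; so the coordinate exponentials, whose moments are under
  control, dominate the squared growth bound.\<close>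

lemma growth_square_bound:
  assumes K: "0 \<le> K" and b: "0 < b" and \<kappa>: "0 < \<kappa>"
  obtains c where "0 \<le> c" "\<forall>z :: 'w::euclidean_space. (K * (1 + 2 * norm z powr b))\<^sup>2 \<le> c * (\<Sum>i\<in>Basis. exp (\<bar>z \<bullet> i\<bar> / \<kappa>))"
proof -
  define d where "d = real (DIM('w))"
  have d: "0 < d" by (simp add: d_def)
  \<comment> \<open>The rate leaves a factor 2 for the square and a factor \<open>d\<close> for
    passing from the norm to one coordinate.\<close>
  define s where "s = 1 / (2 * d * \<kappa>)"
  have s: "0 < s" using d \<kappa> by (simp add: s_def)
  define c where "c = (K * (1 + 2 * (b / s) powr b))\<^sup>2"
  have "(K * (1 + 2 * norm z powr b))\<^sup>2 \<le> c * (\<Sum>i\<in>Basis. exp (\<bar>z \<bullet> i\<bar> / \<kappa>))" for z :: 'w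
  proof -
    have "1 + 2 * norm z powr b \<le> exp (s * norm z) + 2 * ((b / s) powr b * exp (s * norm z))"
      using s by (intro add_mono mult_left_mono powr_le_exp b) auto
    also have "\<dots> = (1 + 2 * (b / s) powr b) * exp (s * norm z)" by (simp add: algebra_simps)
    finally have "K * (1 + 2 * norm z powr b) \<le> K * ((1 + 2 * (b / s) powr b) * exp (s * norm z))"
      using K by (intro mult_left_mono)
    then have "(K * (1 + 2 * norm z powr b))\<^sup>2 \<le> (K * ((1 + 2 * (b / s) powr b) * exp (s * norm z)))\<^sup>2"
      using K by (intro power_mono) auto
    also have "\<dots> = c * exp (2 * s * norm z)"
      by (simp only: c_def power_mult_distrib mult.assoc exp_double)
    also have "\<dots> \<le> c * (\<Sum>i\<in>Basis. exp (\<bar>z \<bullet> i\<bar> / \<kappa>))"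
    proof (rule mult_left_mono)
      have "\<exists>i\<in>Basis. norm z / d \<le> \<bar>z \<bullet> i\<bar>"
      proof (rule ccontr)
        assume "\<not> ?thesis"
        then have "(\<Sum>i\<in>Basis. \<bar>z \<bullet> i\<bar>) < (\<Sum>i\<in>(Basis :: 'w set). norm z / d)"
          by (intro sum_strict_mono) (auto simp: not_le)
        also have "\<dots> = norm z" using d by (simp add: d_def)
        finally show False using norm_le_l1[of z] by simp
      qed
      then obtain i where i: "i \<in> Basis" "norm z / d \<le> \<bar>z \<bullet> i\<bar>" by blast
      have "2 * s * norm z = (norm z / d) / \<kappa>" using d by (simp add: s_def)
      also have "\<dots> \<le> \<bar>z \<bullet> i\<bar> / \<kappa>" using i(2) \<kappa> by (intro divide_right_mono) auto
      finally have "exp (2 * s * norm z) \<le> exp (\<bar>z \<bullet> i\<bar> / \<kappa>)" by simp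
      also have "\<dots> \<le> (\<Sum>i\<in>Basis. exp (\<bar>z \<bullet> i\<bar> / \<kappa>))"
        by (rule member_le_sum[OF i(1)]) auto
      finally show "exp (2 * s * norm z) \<le> (\<Sum>i\<in>Basis. exp (\<bar>z \<bullet> i\<bar> / \<kappa>))" .
    qed (simp add: c_def)
    finally show ?thesis .
  qed
  then show ?thesis by (intro that[of c]) (auto simp: c_def)
qed

lemma square_integrable_of_subexp:
  assumes R: "prob_space R" and f: "f \<in> borel_measurable R" and I: "finite I" and c: "0 \<le> c"
    and q: "\<And>i. i \<in> I \<Longrightarrow> (\<lambda>z. q i z) \<in> borel_measurable R" "\<And>i. i \<in> I \<Longrightarrow> (\<integral>\<^sup>+z. ennreal (exp (\<bar>q i z\<bar> / \<kappa>)) \<partial>R) \<le> 10"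
    and b: "\<And>z. (f z)\<^sup>2 \<le> c * (\<Sum>i\<in>I. exp (\<bar>q i z\<bar> / \<kappa>))"
  shows "integrable R (\<lambda>z. (f z)\<^sup>2) \<and> (\<integral>z. (f z)\<^sup>2 \<partial>R) \<le> c * (real (card I) * 10)"
proof -
  have m: "(\<lambda>z. (f z)\<^sup>2) \<in> borel_measurable R" using f by measurable
  have em: "(\<lambda>z. ennreal (exp (\<bar>q i z\<bar> / \<kappa>))) \<in> borel_measurable R" if "i \<in> I" for i
    using q(1)[OF that] by measurable
  have "(\<integral>\<^sup>+z. ennreal ((f z)\<^sup>2) \<partial>R) \<le> (\<integral>\<^sup>+z. ennreal c * (\<Sum>i\<in>I. ennreal (exp (\<bar>q i z\<bar> / \<kappa>))) \<partial>R)"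
  proof (rule nn_integral_mono)
    fix z
    have "ennreal ((f z)\<^sup>2) \<le> ennreal (c * (\<Sum>i\<in>I. exp (\<bar>q i z\<bar> / \<kappa>)))" by (rule ennreal_leI[OF b])
    also have "\<dots> = ennreal c * ennreal (\<Sum>i\<in>I. exp (\<bar>q i z\<bar> / \<kappa>))"
      using c by (intro ennreal_mult sum_nonneg) auto
    also have "ennreal (\<Sum>i\<in>I. exp (\<bar>q i z\<bar> / \<kappa>)) = (\<Sum>i\<in>I. ennreal (exp (\<bar>q i z\<bar> / \<kappa>)))"
      by (rule sum_ennreal[symmetric]) simp
    finally show "ennreal ((f z)\<^sup>2) \<le> ennreal c * (\<Sum>i\<in>I. ennreal (exp (\<bar>q i z\<bar> / \<kappa>)))" .
  qed
  also have "\<dots> = ennreal c * (\<integral>\<^sup>+z. (\<Sum>i\<in>I. ennreal (exp (\<bar>q i z\<bar> / \<kappa>))) \<partial>R)"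
    using em by (intro nn_integral_cmult borel_measurable_sum)
  also have "(\<integral>\<^sup>+z. (\<Sum>i\<in>I. ennreal (exp (\<bar>q i z\<bar> / \<kappa>))) \<partial>R) = (\<Sum>i\<in>I. \<integral>\<^sup>+z. ennreal (exp (\<bar>q i z\<bar> / \<kappa>)) \<partial>R)"
    by (rule nn_integral_sum[OF em])
  also have "ennreal c * \<dots> \<le> ennreal c * (\<Sum>i\<in>I. 10)"
    by (intro mult_left_mono sum_mono q(2)) auto
  also have "\<dots> = ennreal (c * (real (card I) * 10))"
    using c by (simp add: ennreal_mult ennreal_of_nat_eq_real_of_nat)
  finally have le: "(\<integral>\<^sup>+z. ennreal ((f z)\<^sup>2) \<partial>R) \<le> ennreal (c * (real (card I) * 10))" .
  have int: "integrable R (\<lambda>z. (f z)\<^sup>2)"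
  proof (rule integrableI_nonneg[OF m])
    show "(\<integral>\<^sup>+z. ennreal ((f z)\<^sup>2) \<partial>R) < \<infinity>" using le by (rule le_less_trans) simp
  qed simp
  have "ennreal (\<integral>z. (f z)\<^sup>2 \<partial>R) = (\<integral>\<^sup>+z. ennreal ((f z)\<^sup>2) \<partial>R)"
    by (rule nn_integral_eq_integral[OF int, symmetric]) simp
  then have "ennreal (\<integral>z. (f z)\<^sup>2 \<partial>R) \<le> ennreal (c * (real (card I) * 10))" using le by simp
  then have "(\<integral>z. (f z)\<^sup>2 \<partial>R) \<le> c * (real (card I) * 10)" using c by (subst (asm) ennreal_le_iff) auto
  with int show ?thesis by blast
qed

section \<open>Empirical risk minimization\<close>

lemma measurable_proj: "(\<lambda>x. proj p \<Theta> x) \<in> borel_measurable (Rvec_borel p)"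
proof (subst borel_measurable_euclidean_space, intro ballI)
  fix i :: "real ^ 'a" assume "i \<in> Basis"
  then obtain j where j: "i = axis j 1" by (auto simp: Basis_vec_def)
  show "(\<lambda>x. proj p \<Theta> x \<bullet> i) \<in> borel_measurable (Rvec_borel p)"
    unfolding j proj_def inner_axis by simp
qed

lemma frob_norm_le:
  fixes \<Theta> :: "(nat \<Rightarrow> real) ^ 'k"
  assumes "\<And>j. vnorm p (\<Theta> $ j) \<le> R"
  shows "frob_norm p \<Theta> \<le> real CARD('k) * R"
proof -
  have "frob_norm p \<Theta> = sqrt (\<Sum>j\<in>UNIV. \<Sum>i<p. ((\<Theta> $ j) i)\<^sup>2)"
    by (simp add: frob_norm_def L2_set_def sum.cartesian_product case_prod_beta')
  also have "\<dots> = L2_set (\<lambda>j. vnorm p (\<Theta> $ j)) UNIV"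
    unfolding vnorm_def L2_set_def by (simp add: sum_nonneg)
  also have "\<dots> \<le> (\<Sum>j\<in>UNIV. vnorm p (\<Theta> $ j))"
    by (intro L2_set_le_sum vnorm_nonneg)
  also have "\<dots> \<le> (\<Sum>j\<in>(UNIV :: 'k set). R)" by (intro sum_mono assms)
  finally show ?thesis by simp
qed

lemma iid_first_pair_law:
  assumes M: "prob_space M" and n: "1 \<le> n" and Z: "iid_copies M N n z Z" and e: "iid M N' n e"
    and ind: "indep_families M n N Z N' e"
  shows "(\<lambda>\<omega>. (Z 0 \<omega>, e 0 \<omega>)) \<in> M \<rightarrow>\<^sub>M N \<Otimes>\<^sub>M N'"
    and "distr M (N \<Otimes>\<^sub>M N') (\<lambda>\<omega>. (Z 0 \<omega>, e 0 \<omega>)) = distr M N z \<Otimes>\<^sub>M distr M N' (e 0)"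
proof -
  interpret prob_space M by fact
  let ?W = "\<lambda>\<omega>. \<lambda>i\<in>{..<n}. (Z i \<omega>, e i \<omega>)" and ?N = "N \<Otimes>\<^sub>M N'" and ?R = "distr M N z \<Otimes>\<^sub>M distr M N' (e 0)"
  note W = iid_pairs_law[OF M n Z e ind]
  have 0: "0 \<in> {..<n}" using n by simp
  have zm: "z \<in> M \<rightarrow>\<^sub>M N" using Z unfolding iid_copies_def by blast
  have c0: "(\<lambda>w. w 0) \<in> PiM {..<n} (\<lambda>_. ?N) \<rightarrow>\<^sub>M ?N" by (rule measurable_component_singleton[OF 0])
  have eq: "(\<lambda>w. w 0) \<circ> ?W = (\<lambda>\<omega>. (Z 0 \<omega>, e 0 \<omega>))" using 0 by (auto simp: fun_eq_iff)
  show m: "(\<lambda>\<omega>. (Z 0 \<omega>, e 0 \<omega>)) \<in> M \<rightarrow>\<^sub>M ?N"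
    using measurable_comp[OF W(1) c0] unfolding eq .
  have "e 0 = snd \<circ> (\<lambda>\<omega>. (Z 0 \<omega>, e 0 \<omega>))" by (auto simp: fun_eq_iff)
  then have em: "e 0 \<in> M \<rightarrow>\<^sub>M N'" using measurable_comp[OF m measurable_snd] by simp
  interpret A: prob_space "distr M N z" by (rule prob_space_distr[OF zm])
  interpret B: prob_space "distr M N' (e 0)" by (rule prob_space_distr[OF em])
  interpret AB: pair_prob_space "distr M N z" "distr M N' (e 0)" ..
  have s: "sets ?R = sets ?N" by (intro sets_pair_measure_cong) simp_all
  have "distr M ?N (\<lambda>\<omega>. (Z 0 \<omega>, e 0 \<omega>)) = distr (distr M (PiM {..<n} (\<lambda>_. ?N)) ?W) ?N (\<lambda>w. w 0)"
    by (simp only: distr_distr[OF c0 W(1)] eq)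
  also have "\<dots> = distr (PiM {..<n} (\<lambda>_. ?R)) ?N (\<lambda>w. w 0)" by (simp only: W(2))
  also have "\<dots> = distr (PiM {..<n} (\<lambda>_. ?R)) ?R (\<lambda>w. w 0)" by (rule distr_cong) (simp_all add: s)
  also have "\<dots> = ?R" by (rule distr_PiM_component[OF _ 0]) (rule AB.prob_space_axioms)
  finally show "distr M ?N (\<lambda>\<omega>. (Z 0 \<omega>, e 0 \<omega>)) = ?R" .
qed

text \<open>Hypotheses common to both alternatives, with restricted subgaussianity in the form of
  the exponential moments of \<open>constraint_subexp\<close>. The loss and the label function stay
  outside, as parameters of the lemmas.\<close>

locale erm_models =
  fixes M :: "nat \<Rightarrow> 'a measure" and p :: "nat \<Rightarrow> nat"
    and x g :: "nat \<Rightarrow> 'a \<Rightarrow> nat \<Rightarrow> real" and X G :: "nat \<Rightarrow> nat \<Rightarrow> 'a \<Rightarrow> nat \<Rightarrow> real"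
    and \<epsilon> :: "nat \<Rightarrow> nat \<Rightarrow> 'a \<Rightarrow> real"
    and C S :: "nat \<Rightarrow> (nat \<Rightarrow> real) set" and \<Theta>s :: "nat \<Rightarrow> (nat \<Rightarrow> real) ^ 's"
    and r :: "nat \<Rightarrow> (nat \<Rightarrow> real) ^ 'k \<Rightarrow> real" and \<kappa>0 :: real
  assumes prob: "\<And>n. prob_space (M n)"
    and X: "\<And>n. iid_copies (M n) (Rvec_borel (p n)) n (x n) (X n)"
    and G: "\<And>n. iid_copies (M n) (Rvec_borel (p n)) n (g n) (G n)"
    and \<epsilon>: "\<And>n. iid (M n) borel n (\<epsilon> n)"
    and indep_X: "\<And>n. indep_families (M n) n (Rvec_borel (p n)) (X n) borel (\<epsilon> n)"
    and indep_G: "\<And>n. indep_families (M n) n (Rvec_borel (p n)) (G n) borel (\<epsilon> n)"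
    and regime: "proportional_regime p"
    and constraints: "constraint_sets p C \<Theta>s"
    and pen: "penalty p r"
    and domain: "domain_of_gaussianity M p x g S"
    and C_sub: "\<And>n. C n \<subseteq> S n"
    and \<Theta>s_in: "\<And>n l. \<Theta>s n $ l \<in> S n"
    and \<kappa>0: "0 < \<kappa>0" "\<forall>\<kappa>\<ge>\<kappa>0. \<forall>n. \<forall>\<theta>\<in>C n \<union> range (($) (\<Theta>s n)). vnorm (p n) \<theta> \<le> \<kappa> \<and>
        (\<integral>\<^sup>+\<omega>. ennreal (exp (\<bar>dotp (p n) \<theta> (x n \<omega>)\<bar> / \<kappa>)) \<partial>M n) \<le> 10 \<and>
        (\<integral>\<^sup>+\<omega>. ennreal (exp (\<bar>dotp (p n) \<theta> (g n \<omega>)\<bar> / \<kappa>)) \<partial>M n) \<le> 10"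
begin

definition Px where "Px n = distr (M n) (Rvec_borel (p n)) (x n)"
definition Pg where "Pg n = distr (M n) (Rvec_borel (p n)) (g n)"
text \<open>At \<open>n = 0\<close> independence over an empty index set says nothing about the
  noise; the point mass keeps \<open>Pe n\<close> a probability law for every
  \<open>n\<close>.\<close>

definition Pe where "Pe n = (if n = 0 then return borel 0 else distr (M n) borel (\<epsilon> n 0))"

lemma xg_measurable: "x n \<in> M n \<rightarrow>\<^sub>M Rvec_borel (p n)" "g n \<in> M n \<rightarrow>\<^sub>M Rvec_borel (p n)"
  by (rule X[of n, unfolded iid_copies_def, THEN conjunct1] G[of n, unfolded iid_copies_def, THEN conjunct1])+

lemma \<epsilon>_measurable: "i < n \<Longrightarrow> \<epsilon> n i \<in> borel_measurable (M n)"
  using \<epsilon>[of n, unfolded iid_def, THEN conjunct1, unfolded prob_space.indep_vars_def[OF prob], THEN conjunct1] by simp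

lemma prob_P: "prob_space (Px n)" "prob_space (Pg n)" "prob_space (Pe n)"
proof -
  show "prob_space (Px n)" unfolding Px_def by (rule prob_space.prob_space_distr[OF prob xg_measurable(1)])
  show "prob_space (Pg n)" unfolding Pg_def by (rule prob_space.prob_space_distr[OF prob xg_measurable(2)])
  show "prob_space (Pe n)"
  proof (cases "n = 0")
    case True
    then show ?thesis by (simp add: Pe_def prob_space_return)
  next
    case False
    then have "\<epsilon> n 0 \<in> borel_measurable (M n)" by (intro \<epsilon>_measurable) simp
    then show ?thesis using False by (simp add: Pe_def prob_space.prob_space_distr[OF prob])
  qed
qed

lemma sets_P: "sets (Px n) = sets (Rvec_borel (p n))" "sets (Pg n) = sets (Rvec_borel (p n))" "sets (Pe n) = sets borel"
  unfolding Px_def Pg_def Pe_def by auto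

lemma subexp_P:
  assumes "\<kappa>0 \<le> \<kappa>" "\<theta> \<in> C n \<union> range (($) (\<Theta>s n))"
  shows "(\<integral>\<^sup>+x. ennreal (exp (\<bar>dotp (p n) \<theta> x\<bar> / \<kappa>)) \<partial>Px n) \<le> 10"
    "(\<integral>\<^sup>+x. ennreal (exp (\<bar>dotp (p n) \<theta> x\<bar> / \<kappa>)) \<partial>Pg n) \<le> 10"
proof -
  have m: "(\<lambda>x. ennreal (exp (\<bar>dotp (p n) \<theta> x\<bar> / \<kappa>))) \<in> borel_measurable (distr (M n) (Rvec_borel (p n)) f)" for f
    unfolding measurable_distr_eq1 by measurable
  note k = \<kappa>0(2)[rule_format, OF assms, THEN conjunct2]
  show "(\<integral>\<^sup>+x. ennreal (exp (\<bar>dotp (p n) \<theta> x\<bar> / \<kappa>)) \<partial>Px n) \<le> 10"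
    "(\<integral>\<^sup>+x. ennreal (exp (\<bar>dotp (p n) \<theta> x\<bar> / \<kappa>)) \<partial>Pg n) \<le> 10"
    unfolding Px_def Pg_def nn_integral_distr[OF xg_measurable(1) m] nn_integral_distr[OF xg_measurable(2) m]
    by (rule k[THEN conjunct1] k[THEN conjunct2])+
qed

lemma subexp_pair:
  assumes "\<kappa>0 \<le> \<kappa>" "\<theta> \<in> C n \<union> range (($) (\<Theta>s n))" and R: "R \<in> {Px n \<Otimes>\<^sub>M Pe n, Pg n \<Otimes>\<^sub>M Pe n}"
  shows "(\<integral>\<^sup>+z. ennreal (exp (\<bar>dotp (p n) \<theta> (fst z)\<bar> / \<kappa>)) \<partial>R) \<le> 10"
proof -
  have "(\<lambda>x. ennreal (exp (\<bar>dotp (p n) \<theta> x\<bar> / \<kappa>))) \<in> borel_measurable (Rvec_borel (p n))" by measurable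
  then show ?thesis
    using nn_integral_pair_fst[OF prob_P(1) prob_P(3), of "\<lambda>x. ennreal (exp (\<bar>dotp (p n) \<theta> x\<bar> / \<kappa>))" n]
      nn_integral_pair_fst[OF prob_P(2) prob_P(3), of "\<lambda>x. ennreal (exp (\<bar>dotp (p n) \<theta> x\<bar> / \<kappa>))" n]
      subexp_P[OF assms(1,2)] R
    by (auto simp: measurable_cong_sets[OF sets_P(1) refl] measurable_cong_sets[OF sets_P(2) refl])
qed

lemma features:
  assumes \<kappa>: "\<kappa>0 \<le> \<kappa>" and E: "\<And>n. prob_space (E n)" "\<And>n. sets (E n) = sets borel"
    "\<And>n. 1 \<le> n \<Longrightarrow> (\<integral>\<^sup>+e. ennreal (exp (\<bar>e\<bar> / \<kappa>)) \<partial>E n) \<le> 10"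
  shows "gaussian_features p Px Pg E S C \<Theta>s \<kappa>"
proof (rule gaussian_features.intro)
  fix \<phi> assume \<phi>: "bounded_lipschitz \<phi>"
  have m: "(\<lambda>x. \<phi> (dotp (p n) \<theta> x)) \<in> borel_measurable (Rvec_borel (p n))" for n \<theta>
    by (rule measurable_compose[OF _ bounded_lipschitz_measurable[OF \<phi>]]) measurable
  show "(\<lambda>n. SUP \<theta>\<in>S n. \<bar>(\<integral>x. \<phi> (dotp (p n) \<theta> x) \<partial>Pg n) - (\<integral>x. \<phi> (dotp (p n) \<theta> x) \<partial>Px n)\<bar>) \<longlonglongrightarrow> 0"
    unfolding Px_def Pg_def integral_distr[OF xg_measurable(1) m] integral_distr[OF xg_measurable(2) m]
    using domain \<phi> unfolding domain_of_gaussianity_def by blast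
next
  show "sym_convex (p n) (S n)" for n using domain unfolding domain_of_gaussianity_def by blast
  show "0 < \<kappa>" using \<kappa> \<kappa>0(1) by linarith
qed (assumption | rule prob_P E sets_P C_sub \<Theta>s_in subexp_P[OF \<kappa>])+

lemma cols_bounds:
  shows "C n \<noteq> {}" "C n \<subseteq> Rvec (p n)" "\<theta> \<in> C n \<Longrightarrow> vnorm (p n) \<theta> \<le> \<kappa>0"
proof -
  have "C n \<in> constraint_family (C n) (\<Theta>s n)" by (simp add: constraint_family_def)
  then show "C n \<noteq> {}" "C n \<subseteq> Rvec (p n)" using constraints unfolding constraint_sets_def by blast+
  show "\<theta> \<in> C n \<Longrightarrow> vnorm (p n) \<theta> \<le> \<kappa>0" using \<kappa>0(2) by blast
qed

text \<open>Columns in \<open>C n\<close> have norm at most \<open>\<kappa>0\<close>, so the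
  Frobenius norms are bounded independently of \<open>n\<close>, and one radius in the penalty
  assumption suffices.\<close>

lemma penalty_on_cols:
  obtains Kr where "0 \<le> Kr" "\<forall>n. \<forall>\<Theta>\<in>cols_in (C n). 0 \<le> r n \<Theta>" "\<forall>n. continuous_on (cols_in (C n)) (r n)"
    "\<forall>n. \<forall>\<Theta>\<in>cols_in (C n). \<forall>\<Theta>'\<in>cols_in (C n). \<bar>r n \<Theta> - r n \<Theta>'\<bar> \<le> Kr * frob_dist (p n) \<Theta> \<Theta>'"
proof -
  have sub: "cols_in (C n) \<subseteq> (cols_in (Rvec (p n)) :: ((nat \<Rightarrow> real) ^ 'k) set)" for n
    using cols_bounds(2)[of n] by (auto simp: cols_in_def)
  have fr: "frob_norm (p n) \<Theta> \<le> real CARD('k) * \<kappa>0" if "\<Theta> \<in> cols_in (C n)" for n and \<Theta> :: "(nat \<Rightarrow> real) ^ 'k"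
    using that by (intro frob_norm_le cols_bounds(3)) (auto simp: cols_in_def)
  have "0 < real CARD('k) * \<kappa>0" using \<kappa>0(1) by simp
  then obtain Kr where Kr: "0 < Kr" "\<forall>n. \<forall>\<Theta>\<in>cols_in (Rvec (p n)). \<forall>\<Theta>'\<in>cols_in (Rvec (p n)).
        frob_norm (p n) \<Theta> \<le> real CARD('k) * \<kappa>0 \<longrightarrow> frob_norm (p n) \<Theta>' \<le> real CARD('k) * \<kappa>0 \<longrightarrow>
        \<bar>r n \<Theta> - r n \<Theta>'\<bar> \<le> Kr * frob_dist (p n) \<Theta> \<Theta>'"
    using pen unfolding penalty_def by blast
  show ?thesis
  proof (rule that[of Kr])
    show "0 \<le> Kr" using Kr(1) by simp
    show "\<forall>n. \<forall>\<Theta>\<in>cols_in (C n). 0 \<le> r n \<Theta>" using pen sub unfolding penalty_def by blast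
    show "\<forall>n. continuous_on (cols_in (C n)) (r n)"
      using pen continuous_on_subset[OF _ sub] unfolding penalty_def by blast
    show "\<forall>n. \<forall>\<Theta>\<in>cols_in (C n). \<forall>\<Theta>'\<in>cols_in (C n). \<bar>r n \<Theta> - r n \<Theta>'\<bar> \<le> Kr * frob_dist (p n) \<Theta> \<Theta>'"
      using Kr(2) sub fr by (meson subsetD)
  qed
qed

text \<open>The loss receives the whole sample \<open>z\<close> besides the projection
  \<open>u\<close>: the projection on the true parameter, the noise and the label are all functions
  of \<open>z\<close>.\<close>

definition V :: "(nat \<Rightarrow> real ^ 'k \<Rightarrow> (nat \<Rightarrow> real) \<times> real \<Rightarrow> real) \<Rightarrow> nat \<Rightarrow> (nat \<Rightarrow> (nat \<Rightarrow> real) \<times> real) \<Rightarrow> real" where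
  "V lo n w = (INF \<Theta>\<in>cols_in (C n). (1 / real n) * (\<Sum>j<n. lo n (proj (p n) \<Theta> (fst (w j))) (w j)) + r n \<Theta>)"

lemma V_pairs:
  "V lo n (\<lambda>i\<in>{..<n}. (a i, b i)) =
    (INF \<Theta>\<in>cols_in (C n). (1 / real n) * (\<Sum>j<n. lo n (proj (p n) \<Theta> (a j)) (a j, b j)) + r n \<Theta>)"
  unfolding V_def by (intro arg_cong[where f = Inf] image_cong refl arg_cong2[where f = "(+)"] arg_cong2[where f = "(*)"] sum.cong) auto

text \<open>Carries \<open>abstract_universality\<close> from product laws back to the given random
  variables. The two sample laws differ in their feature marginals and share the noise law.\<close>

lemma universality_of_loss:
  fixes lo :: "nat \<Rightarrow> real ^ 'k \<Rightarrow> (nat \<Rightarrow> real) \<times> real \<Rightarrow> real"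
  assumes \<kappa>: "\<kappa>0 \<le> \<kappa>" and lo0: "\<And>n u z. 0 \<le> lo n u z"
    and lom: "\<And>n \<Theta>. (\<lambda>z. lo n (proj (p n) \<Theta> (fst z)) z) \<in> borel_measurable (Rvec_borel (p n) \<Otimes>\<^sub>M borel)"
    and trunc: "\<And>A. 0 < A \<Longrightarrow> \<exists>K\<ge>0. \<forall>n u u' z. \<bar>min A (lo n u z) - min A (lo n u' z)\<bar> \<le> K * norm (u - u')"
    and mom: "\<And>n \<Theta> R. 1 \<le> n \<Longrightarrow> \<Theta> \<in> cols_in (C n) \<Longrightarrow> R \<in> {Px n \<Otimes>\<^sub>M Pe n, Pg n \<Otimes>\<^sub>M Pe n} \<Longrightarrow>
       integrable R (\<lambda>z. (lo n (proj (p n) \<Theta> (fst z)) z)\<^sup>2) \<and> (\<integral>z. (lo n (proj (p n) \<Theta> (fst z)) z)\<^sup>2 \<partial>R) \<le> c2"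
    and weak: "\<And>A \<beta> (k :: nat) \<tau>. 0 < A \<Longrightarrow> 0 < \<beta> \<Longrightarrow> 0 < \<tau> \<Longrightarrow>
      eventually (\<lambda>n. \<forall>\<Theta>. (\<forall>j<k. \<Theta> j \<in> cols_in (C n)) \<longrightarrow>
        \<bar>(\<integral>z. (\<Prod>j<k. exp (- \<beta> * min A (lo n (proj (p n) (\<Theta> j) (fst z)) z))) \<partial>(Px n \<Otimes>\<^sub>M Pe n)) -
         (\<integral>z. (\<Prod>j<k. exp (- \<beta> * min A (lo n (proj (p n) (\<Theta> j) (fst z)) z))) \<partial>(Pg n \<Otimes>\<^sub>M Pe n))\<bar> \<le> \<tau>) sequentially"
  shows "V lo n \<in> borel_measurable (PiM {..<n} (\<lambda>_. Rvec_borel (p n) \<Otimes>\<^sub>M borel))"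
    and "bounded_lipschitz \<psi> \<Longrightarrow>
      (\<lambda>n. \<bar>(\<integral>\<omega>. \<psi> (V lo n (\<lambda>i\<in>{..<n}. (X n i \<omega>, \<epsilon> n i \<omega>))) \<partial>M n) -
            (\<integral>\<omega>. \<psi> (V lo n (\<lambda>i\<in>{..<n}. (G n i \<omega>, \<epsilon> n i \<omega>))) \<partial>M n)\<bar>) \<longlonglongrightarrow> 0"
proof -
  define Q where "Q n = Px n \<Otimes>\<^sub>M Pe n" for n
  define Q' where "Q' n = Pg n \<Otimes>\<^sub>M Pe n" for n
  have pQ: "prob_space (Q n)" and pQ': "prob_space (Q' n)" for n
  proof -
    interpret a: prob_space "Px n" by (rule prob_P)
    interpret b: prob_space "Pg n" by (rule prob_P)
    interpret c: prob_space "Pe n" by (rule prob_P)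
    interpret ac: pair_prob_space "Px n" "Pe n" ..
    interpret bc: pair_prob_space "Pg n" "Pe n" ..
    show "prob_space (Q n)" "prob_space (Q' n)"
      unfolding Q_def Q'_def by (rule ac.prob_space_axioms bc.prob_space_axioms)+
  qed
  have sQ: "sets (Q n) = sets (Rvec_borel (p n) \<Otimes>\<^sub>M borel)" "sets (Q' n) = sets (Rvec_borel (p n) \<Otimes>\<^sub>M borel)" for n
    unfolding Q_def Q'_def by (intro sets_pair_measure_cong sets_P)+
  obtain C0 where C0: "0 < C0" "\<forall>n\<ge>1. inverse C0 \<le> real (p n) / real n \<and> real (p n) / real n \<le> C0"
    using regime unfolding proportional_regime_def by blast
  have pC0: "real (p n) \<le> C0 * real n" if "1 \<le> n" for n
  proof -
    have "real (p n) / real n \<le> C0" using C0(2) that by blast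
    then show ?thesis using that by (simp add: field_simps)
  qed
  have k0: "0 < \<kappa>" using \<kappa> \<kappa>0(1) by linarith
  have fstm: "fst \<in> Q n \<rightarrow>\<^sub>M Rvec_borel (p n)" for n
    unfolding measurable_cong_sets[OF sQ(1) refl] by (rule measurable_fst)
  have subQ: "(\<integral>\<^sup>+z. ennreal (exp (\<bar>dotp (p n) \<theta> (fst z)\<bar> / \<kappa>)) \<partial>Q n) \<le> 10"
    "(\<integral>\<^sup>+z. ennreal (exp (\<bar>dotp (p n) \<theta> (fst z)\<bar> / \<kappa>)) \<partial>Q' n) \<le> 10" if "\<theta> \<in> C n" for n \<theta>
    by (rule subexp_pair[OF \<kappa>, of \<theta> n]; use that in \<open>simp add: Q_def Q'_def\<close>)+
  obtain Kr where Kr: "0 \<le> Kr" "\<forall>n. \<forall>\<Theta>\<in>cols_in (C n). 0 \<le> r n \<Theta>" "\<forall>n. continuous_on (cols_in (C n)) (r n)"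
    "\<forall>n. \<forall>\<Theta>\<in>cols_in (C n). \<forall>\<Theta>'\<in>cols_in (C n). \<bar>r n \<Theta> - r n \<Theta>'\<bar> \<le> Kr * frob_dist (p n) \<Theta> \<Theta>'"
    by (rule penalty_on_cols)
  have lomQ: "(\<lambda>z. lo n (proj (p n) \<Theta> (fst z)) z) \<in> borel_measurable (Q n)" for n \<Theta>
    unfolding measurable_cong_sets[OF sQ(1) refl] by (rule lom)
  have vk: "vnorm (p n) \<theta> \<le> \<kappa>" if "\<theta> \<in> C n" for n \<theta> using cols_bounds(3)[OF that] \<kappa> by linarith
  have ss: "sets (Q' n) = sets (Q n)" for n by (simp add: sQ)
  note facts = pQ pQ' ss fstm pC0 k0 cols_bounds(1,2) vk subQ lo0 lomQ trunc mom[folded Q_def Q'_def]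
    Kr(2,3,4)[rule_format] Kr(1) weak[folded Q_def Q'_def]
  have U1: "V lo n \<in> borel_measurable (PiM {..<n} (\<lambda>_. Q n))" for n
    unfolding V_def[abs_def]
    by (rule abstract_universality(1)[where Q = Q and Q' = Q' and X = "\<lambda>n. fst" and lo = lo and C = C and r = r and p = p
      and \<kappa> = \<kappa> and ?C0.0 = C0 and Kr = Kr and ?c2.0 = c2]) (assumption | rule facts)+
  have U2: "(\<lambda>n. \<bar>(\<integral>w. \<psi> (V lo n w) \<partial>PiM {..<n} (\<lambda>_. Q n)) - (\<integral>w. \<psi> (V lo n w) \<partial>PiM {..<n} (\<lambda>_. Q' n))\<bar>) \<longlonglongrightarrow> 0"
    if "bounded_lipschitz \<psi>" for \<psi>
    unfolding V_def[abs_def]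
    by (rule abstract_universality(2)[where Q = Q and Q' = Q' and X = "\<lambda>n. fst" and lo = lo and C = C and r = r and p = p
      and \<kappa> = \<kappa> and ?C0.0 = C0 and Kr = Kr and ?c2.0 = c2]) (assumption | rule facts that)+
  have PiM_sets: "sets (PiM {..<n} (\<lambda>_. Q n)) = sets (PiM {..<n} (\<lambda>_. Rvec_borel (p n) \<Otimes>\<^sub>M borel))" for n
    by (rule sets_PiM_cong) (simp_all add: sQ)
  show V: "V lo n \<in> borel_measurable (PiM {..<n} (\<lambda>_. Rvec_borel (p n) \<Otimes>\<^sub>M borel))" for n
    using U1[of n] unfolding measurable_cong_sets[OF PiM_sets refl] .
  assume \<psi>: "bounded_lipschitz \<psi>"
  have m: "(\<lambda>w. \<psi> (V lo n w)) \<in> borel_measurable (PiM {..<n} (\<lambda>_. Rvec_borel (p n) \<Otimes>\<^sub>M borel))" for n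
    by (rule measurable_compose[OF V bounded_lipschitz_measurable[OF \<psi>]])
  have "\<bar>(\<integral>w. \<psi> (V lo n w) \<partial>PiM {..<n} (\<lambda>_. Q n)) - (\<integral>w. \<psi> (V lo n w) \<partial>PiM {..<n} (\<lambda>_. Q' n))\<bar> =
     \<bar>(\<integral>\<omega>. \<psi> (V lo n (\<lambda>i\<in>{..<n}. (X n i \<omega>, \<epsilon> n i \<omega>))) \<partial>M n) -
            (\<integral>\<omega>. \<psi> (V lo n (\<lambda>i\<in>{..<n}. (G n i \<omega>, \<epsilon> n i \<omega>))) \<partial>M n)\<bar>" if n: "1 \<le> n" for n
  proof -
    have PeN: "Pe n = distr (M n) borel (\<epsilon> n 0)" using n by (simp add: Pe_def)
    note WX = iid_pairs_law[OF prob n X \<epsilon> indep_X] and WG = iid_pairs_law[OF prob n G \<epsilon> indep_G]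
    have "(\<integral>w. \<psi> (V lo n w) \<partial>PiM {..<n} (\<lambda>_. Q n)) = (\<integral>\<omega>. \<psi> (V lo n (\<lambda>i\<in>{..<n}. (X n i \<omega>, \<epsilon> n i \<omega>))) \<partial>M n)"
      unfolding Q_def Px_def PeN WX(2)[symmetric] by (rule integral_distr[OF WX(1) m])
    moreover have "(\<integral>w. \<psi> (V lo n w) \<partial>PiM {..<n} (\<lambda>_. Q' n)) = (\<integral>\<omega>. \<psi> (V lo n (\<lambda>i\<in>{..<n}. (G n i \<omega>, \<epsilon> n i \<omega>))) \<partial>M n)"
      unfolding Q'_def Pg_def PeN WG(2)[symmetric] by (rule integral_distr[OF WG(1) m])
    ultimately show ?thesis by simp
  qed
  \<comment> \<open>The laws are identified for n \<ge> 1, which is enough for the limit.\<close>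
  then have ev: "eventually (\<lambda>n. \<bar>(\<integral>w. \<psi> (V lo n w) \<partial>PiM {..<n} (\<lambda>_. Q n)) - (\<integral>w. \<psi> (V lo n w) \<partial>PiM {..<n} (\<lambda>_. Q' n))\<bar> =
     \<bar>(\<integral>\<omega>. \<psi> (V lo n (\<lambda>i\<in>{..<n}. (X n i \<omega>, \<epsilon> n i \<omega>))) \<partial>M n) -
            (\<integral>\<omega>. \<psi> (V lo n (\<lambda>i\<in>{..<n}. (G n i \<omega>, \<epsilon> n i \<omega>))) \<partial>M n)\<bar>) sequentially"
    by (intro eventually_sequentiallyI[of 1])
  show "(\<lambda>n. \<bar>(\<integral>\<omega>. \<psi> (V lo n (\<lambda>i\<in>{..<n}. (X n i \<omega>, \<epsilon> n i \<omega>))) \<partial>M n) -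
            (\<integral>\<omega>. \<psi> (V lo n (\<lambda>i\<in>{..<n}. (G n i \<omega>, \<epsilon> n i \<omega>))) \<partial>M n)\<bar>) \<longlonglongrightarrow> 0"
    using U2[OF \<psi>] tendsto_cong[OF ev] by blast
qed

end

section \<open>Losses continuous in the projections and the noise\<close>

context erm_models
begin

lemma universality_alternative_I:
  fixes L :: "real \<Rightarrow> real \<Rightarrow> real" and F :: "real ^ 'k \<Rightarrow> real" and \<eta> :: "(real ^ 's) \<times> real \<Rightarrow> real"
  assumes alt: "alternative_I M \<epsilon> (loss_ell L F \<eta>)"
  shows "1 \<le> n \<Longrightarrow> opt_risk n (p n) L F \<eta> (r n) (C n) (\<Theta>s n) (X n) (\<epsilon> n) \<in> borel_measurable (M n)"
    and "1 \<le> n \<Longrightarrow> opt_risk n (p n) L F \<eta> (r n) (C n) (\<Theta>s n) (G n) (\<epsilon> n) \<in> borel_measurable (M n)"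
    and "bounded_lipschitz \<psi> \<Longrightarrow>
      (\<lambda>n. \<bar>(\<integral>\<omega>. \<psi> (opt_risk n (p n) L F \<eta> (r n) (C n) (\<Theta>s n) (X n) (\<epsilon> n) \<omega>) \<partial>M n) -
            (\<integral>\<omega>. \<psi> (opt_risk n (p n) L F \<eta> (r n) (C n) (\<Theta>s n) (G n) (\<epsilon> n) \<omega>) \<partial>M n)\<bar>) \<longlonglongrightarrow> 0"
proof -
  define ell where "ell = loss_ell L F \<eta>"
  obtain K where K: "\<forall>n. \<forall>i<n. psi2_norm (M n) (\<epsilon> n i) \<le> ennreal K"
    using alt unfolding alternative_I_def by blast
  have ell0: "0 \<le> ell z" for z using alt unfolding alternative_I_def ell_def by blast
  have reg: "loss_lipschitz ell \<or> (loss_locally_lipschitz ell \<and> loss_growth ell)"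
    using alt unfolding alternative_I_def ell_def by blast
  \<comment> \<open>The scale is enlarged until the noise satisfies the same moment bound as the
    features.\<close>
  define \<kappa> where "\<kappa> = max \<kappa>0 (\<bar>K\<bar> + 1)"
  have \<kappa>: "\<kappa>0 \<le> \<kappa>" "\<bar>K\<bar> + 1 \<le> \<kappa>" by (auto simp: \<kappa>_def)
  then have k0: "0 < \<kappa>" using \<kappa>0(1) by linarith
  have Pe_subexp: "(\<integral>\<^sup>+e. ennreal (exp (\<bar>e\<bar> / \<kappa>)) \<partial>Pe n) \<le> 10" if n: "1 \<le> n" for n
  proof -
    have m: "(\<lambda>e. ennreal (exp (\<bar>e\<bar> / \<kappa>))) \<in> borel_measurable (distr (M n) borel (\<epsilon> n 0))"
      unfolding measurable_distr_eq1
      by (intro measurable_compose[OF _ measurable_ennreal] borel_measurable_continuous_onI continuous_intros) (use k0 in auto)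
    have "0 < n" using n by simp
    note em = \<epsilon>_measurable[OF this]
    have "(\<integral>\<^sup>+e. ennreal (exp (\<bar>e\<bar> / \<kappa>)) \<partial>Pe n) = (\<integral>\<^sup>+\<omega>. ennreal (exp (\<bar>\<epsilon> n 0 \<omega>\<bar> / \<kappa>)) \<partial>M n)"
      using n unfolding Pe_def by (simp add: nn_integral_distr[OF em m])
    also have "\<dots> \<le> 10" by (rule psi2_norm_subexp[OF em _ \<kappa>(2)]) (use K \<open>0 < n\<close> in blast)
    finally show ?thesis .
  qed
  interpret gf: gaussian_features p Px Pg Pe S C \<Theta>s \<kappa>
    by (rule features[OF \<kappa>(1) prob_P(3) sets_P(3) Pe_subexp])
  define lo where "lo n u z = ell ((u, proj (p n) (\<Theta>s n) (fst z)), snd z)" for n and u :: "real ^ 'k" and z :: "(nat \<Rightarrow> real) \<times> real"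
  have lo_wv: "lo n (proj (p n) \<Theta> (fst z)) z = ell (gf.wv n \<Theta> z)" for n \<Theta> z by (simp add: lo_def gf.wv_def)
  have cont: "continuous_on UNIV ell" by (rule loss_continuous) (use reg in blast)
  have ellm: "ell \<in> borel_measurable borel" by (rule borel_measurable_continuous_onI[OF cont])
  have lo0: "0 \<le> lo n u z" for n u z unfolding lo_def by (rule ell0)
  have lom: "(\<lambda>z. lo n (proj (p n) \<Theta> (fst z)) z) \<in> borel_measurable (Rvec_borel (p n) \<Otimes>\<^sub>M borel)" for n \<Theta>
    unfolding lo_wv by (rule measurable_compose[OF gf.measurable_wv ellm])
  have trunc: "\<exists>K\<ge>0. \<forall>n u u' z. \<bar>min A (lo n u z) - min A (lo n u' z)\<bar> \<le> K * norm (u - u')" if A: "0 < A" for A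
  proof -
    obtain K where K: "0 \<le> K" "\<forall>w w' e. \<bar>min A (ell (w, e)) - min A (ell (w', e))\<bar> \<le> K * norm (w - w')"
      using truncated_loss_lipschitz[OF reg A] by blast
    have "\<bar>min A (lo n u z) - min A (lo n u' z)\<bar> \<le> K * norm (u - u')" for n u u' z
      using K(2)[rule_format, of "(u, proj (p n) (\<Theta>s n) (fst z))" "snd z" "(u', proj (p n) (\<Theta>s n) (fst z))"]
      by (simp add: lo_def norm_Pair)
    with K(1) show ?thesis by blast
  qed
  obtain K2 b where K2: "0 \<le> K2" "0 < b" "\<forall>z. ell z \<le> K2 * (1 + 2 * norm z powr b)"
    by (rule loss_upper_growth[OF reg])
  obtain c where c: "0 \<le> c"
    "\<forall>z :: ((real ^ 'k) \<times> (real ^ 's)) \<times> real. (K2 * (1 + 2 * norm z powr b))\<^sup>2 \<le> c * (\<Sum>i\<in>Basis. exp (\<bar>z \<bullet> i\<bar> / \<kappa>))"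
    by (rule growth_square_bound[OF K2(1,2) k0])
  define c2 where "c2 = c * (real (card (Basis :: (((real ^ 'k) \<times> (real ^ 's)) \<times> real) set)) * 10)"
  have mom: "integrable R (\<lambda>z. (lo n (proj (p n) \<Theta> (fst z)) z)\<^sup>2) \<and> (\<integral>z. (lo n (proj (p n) \<Theta> (fst z)) z)\<^sup>2 \<partial>R) \<le> c2"
    if n: "1 \<le> n" and \<Theta>: "\<Theta> \<in> cols_in (C n)" and R: "R \<in> {Px n \<Otimes>\<^sub>M Pe n, Pg n \<Otimes>\<^sub>M Pe n}" for n \<Theta> R
  proof -
    have R': "R \<in> {gf.Q n, gf.Q' n}" using R by (simp add: gf.Q_def gf.Q'_def)
    note wm = gf.measurable_wv_R[OF R']
    show ?thesis unfolding lo_wv c2_def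
    proof (rule square_integrable_of_subexp[where q = "\<lambda>i z. gf.wv n \<Theta> z \<bullet> i" and \<kappa> = \<kappa>])
      show "prob_space R" by (rule gf.prob_R[OF R'])
      show "(\<lambda>z. ell (gf.wv n \<Theta> z)) \<in> borel_measurable R" by (rule measurable_compose[OF wm ellm])
      show "(\<lambda>z. gf.wv n \<Theta> z \<bullet> i) \<in> borel_measurable R" for i
        by (rule borel_measurable_inner[OF wm borel_measurable_const])
      show "(\<integral>\<^sup>+z. ennreal (exp (\<bar>gf.wv n \<Theta> z \<bullet> i\<bar> / \<kappa>)) \<partial>R) \<le> 10" if "i \<in> Basis" for i
        by (rule gf.wv_subexp[OF n \<Theta> R' that])
      show "(ell (gf.wv n \<Theta> z))\<^sup>2 \<le> c * (\<Sum>i\<in>Basis. exp (\<bar>gf.wv n \<Theta> z \<bullet> i\<bar> / \<kappa>))" for z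
      proof -
        have "(ell (gf.wv n \<Theta> z))\<^sup>2 \<le> (K2 * (1 + 2 * norm (gf.wv n \<Theta> z) powr b))\<^sup>2"
          by (rule power_mono[OF K2(3)[rule_format] ell0])
        also have "\<dots> \<le> c * (\<Sum>i\<in>Basis. exp (\<bar>gf.wv n \<Theta> z \<bullet> i\<bar> / \<kappa>))" by (rule c(2)[rule_format])
        finally show ?thesis .
      qed
    qed (use c(1) in auto)
  qed
  have weak: "eventually (\<lambda>n. \<forall>\<Theta>. (\<forall>j<m. \<Theta> j \<in> cols_in (C n)) \<longrightarrow>
        \<bar>(\<integral>z. (\<Prod>j<m. exp (- \<beta> * min A (lo n (proj (p n) (\<Theta> j) (fst z)) z))) \<partial>(Px n \<Otimes>\<^sub>M Pe n)) -
         (\<integral>z. (\<Prod>j<m. exp (- \<beta> * min A (lo n (proj (p n) (\<Theta> j) (fst z)) z))) \<partial>(Pg n \<Otimes>\<^sub>M Pe n))\<bar> \<le> \<tau>) sequentially"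
    if A: "0 < A" and \<beta>: "0 < \<beta>" and \<tau>: "0 < \<tau>" for A \<beta> and m :: nat and \<tau>
  proof -
    \<comment> \<open>As a function of projections and noise this factor is the same for all
      \<open>n\<close> and all replicas, and it is bounded by 1, as
      \<open>replica_uniformly_close\<close> asks.\<close>
    define f where "f w = exp (- \<beta> * min A (ell w))" for w
    have fc: "continuous_on UNIV f" unfolding f_def[abs_def] by (intro continuous_intros cont)
    have f1: "\<bar>f w\<bar> \<le> 1" for w using A \<beta> ell0[of w] by (simp add: f_def)
    have "gf.uniformly_close m (\<lambda>n \<Theta> z. \<Prod>j<m. f (gf.wv n (\<Theta> j) z))"
      by (rule gf.replica_uniformly_close[where f = "\<lambda>_. f"]) (rule fc f1)+
    from this[unfolded gf.uniformly_close_def gf.tuples_def, rule_format, OF \<tau>]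
    show ?thesis unfolding lo_wv f_def gf.Q_def gf.Q'_def by (simp only: mem_Collect_eq Ball_def)
  qed
  have U: "V lo n \<in> borel_measurable (PiM {..<n} (\<lambda>_. Rvec_borel (p n) \<Otimes>\<^sub>M borel))" for n
    by (rule universality_of_loss(1)[where \<kappa> = \<kappa> and ?c2.0 = c2]) (assumption | rule \<kappa>(1) lo0 lom trunc mom weak)+
  have U2: "(\<lambda>n. \<bar>(\<integral>\<omega>. \<psi> (V lo n (\<lambda>i\<in>{..<n}. (X n i \<omega>, \<epsilon> n i \<omega>))) \<partial>M n) -
            (\<integral>\<omega>. \<psi> (V lo n (\<lambda>i\<in>{..<n}. (G n i \<omega>, \<epsilon> n i \<omega>))) \<partial>M n)\<bar>) \<longlonglongrightarrow> 0" if "bounded_lipschitz \<psi>" for \<psi>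
    by (rule universality_of_loss(2)[where \<kappa> = \<kappa> and ?c2.0 = c2]) (assumption | rule \<kappa>(1) lo0 lom trunc mom weak that)+
  have eq: "opt_risk n (p n) L F \<eta> (r n) (C n) (\<Theta>s n) Z (\<epsilon> n) = (\<lambda>\<omega>. V lo n (\<lambda>i\<in>{..<n}. (Z i \<omega>, \<epsilon> n i \<omega>)))" for n Z
    unfolding V_pairs
    by (simp add: fun_eq_iff opt_risk_def min_emp_risk_def emp_risk_def label_def loss_F_def lo_def ell_def loss_ell_def)
  show "opt_risk n (p n) L F \<eta> (r n) (C n) (\<Theta>s n) (X n) (\<epsilon> n) \<in> borel_measurable (M n)" if "1 \<le> n"
    unfolding eq by (rule measurable_compose[OF iid_pairs_law(1)[OF prob that X \<epsilon> indep_X] U])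
  show "opt_risk n (p n) L F \<eta> (r n) (C n) (\<Theta>s n) (G n) (\<epsilon> n) \<in> borel_measurable (M n)" if "1 \<le> n"
    unfolding eq by (rule measurable_compose[OF iid_pairs_law(1)[OF prob that G \<epsilon> indep_G] U])
  show "bounded_lipschitz \<psi> \<Longrightarrow>
      (\<lambda>n. \<bar>(\<integral>\<omega>. \<psi> (opt_risk n (p n) L F \<eta> (r n) (C n) (\<Theta>s n) (X n) (\<epsilon> n) \<omega>) \<partial>M n) -
            (\<integral>\<omega>. \<psi> (opt_risk n (p n) L F \<eta> (r n) (C n) (\<Theta>s n) (G n) (\<epsilon> n) \<omega>) \<partial>M n)\<bar>) \<longlonglongrightarrow> 0"
    unfolding eq by (rule U2)
qed

end

text \<open>The integrand is P2 plus P1 - P2 times the indicator of y = 1. The factor P1 - P2 is a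
  function of the features, so under the integral the indicator may be replaced by its conditional
  expectation given them.\<close>

lemma label_integral:
  fixes h :: "real ^ 's \<Rightarrow> real" and P1 P2 :: "(nat \<Rightarrow> real) \<Rightarrow> real"
  assumes M: "prob_space M" and X: "X \<in> M \<rightarrow>\<^sub>M Rvec_borel p" and y: "y \<in> borel_measurable M"
    and lab: "binary_label M p h X (\<lambda>\<omega>. v (X \<omega>)) y"
    and v: "v \<in> borel_measurable (Rvec_borel p)" and h: "h \<in> borel_measurable borel" "\<And>u. 0 \<le> h u" "\<And>u. h u \<le> 1"
    and P: "P1 \<in> borel_measurable (Rvec_borel p)" "P2 \<in> borel_measurable (Rvec_borel p)"
    and P1: "\<And>x. \<bar>P1 x\<bar> \<le> 1" and P2: "\<And>x. \<bar>P2 x\<bar> \<le> 1"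
  shows "(\<integral>\<omega>. (if y \<omega> = 1 then P1 (X \<omega>) else P2 (X \<omega>)) \<partial>M) =
    (\<integral>x. h (v x) * P1 x + (1 - h (v x)) * P2 x \<partial>distr M (Rvec_borel p) X)"
proof -
  interpret prob_space M by fact
  let ?F = "vimage_algebra (space M) X (Rvec_borel p)"
  let ?Y = "{\<omega> \<in> space M. y \<omega> = 1}"
  define D where "D \<omega> = P1 (X \<omega>) - P2 (X \<omega>)" for \<omega>
  have Xs: "X \<in> space M \<rightarrow> space (Rvec_borel p)" and sF: "sets ?F \<subseteq> sets M"
    using X unfolding measurable_iff_sets by auto
  have sub: "subalgebra M ?F" using sF by (simp add: subalgebra_def)
  interpret F: finite_measure_subalgebra M ?F
    by (intro finite_measure_subalgebra.intro finite_measure_subalgebra_axioms.intro finite_measure_axioms sub)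
  have XF: "X \<in> ?F \<rightarrow>\<^sub>M Rvec_borel p" by (rule measurable_vimage_algebra1[OF Xs])
  have DF: "D \<in> borel_measurable ?F"
    unfolding D_def[abs_def] by (intro borel_measurable_diff measurable_compose[OF XF] P)
  have DM: "D \<in> borel_measurable M"
    unfolding D_def[abs_def] by (intro borel_measurable_diff measurable_compose[OF X] P)
  have P2M: "(\<lambda>\<omega>. P2 (X \<omega>)) \<in> borel_measurable M" by (rule measurable_compose[OF X P(2)])
  have vM: "(\<lambda>\<omega>. h (v (X \<omega>))) \<in> borel_measurable M"
    by (rule measurable_compose[OF X measurable_compose[OF v h(1)]])
  have Ym: "?Y \<in> sets M" using y by measurable
  then have IM: "(indicator ?Y :: _ \<Rightarrow> real) \<in> borel_measurable M" by (rule borel_measurable_indicator)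
  have D2: "\<bar>D \<omega>\<bar> \<le> 2" for \<omega> using P1[of "X \<omega>"] P2[of "X \<omega>"] by (simp add: D_def)
  have intDY: "integrable M (\<lambda>\<omega>. D \<omega> * indicator ?Y \<omega>)"
  proof (rule integrable_bounded[OF M, where B = 2])
    show "\<bar>D \<omega> * indicator ?Y \<omega>\<bar> \<le> 2" for \<omega> using D2[of \<omega>] by (auto simp: indicator_def)
  qed (intro borel_measurable_times DM IM)
  have intP2: "integrable M (\<lambda>\<omega>. P2 (X \<omega>))"
    by (rule integrable_bounded[OF M P2M P2])
  have intDh: "integrable M (\<lambda>\<omega>. D \<omega> * h (v (X \<omega>)))"
  proof (rule integrable_bounded[OF M, where B = "2 * 1"])
    show "\<bar>D \<omega> * h (v (X \<omega>))\<bar> \<le> 2 * 1" for \<omega>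
      unfolding abs_mult using D2[of \<omega>] h(2,3)[of "v (X \<omega>)"] by (intro mult_mono) auto
  qed (intro borel_measurable_times DM vM)
  have "(\<integral>\<omega>. (if y \<omega> = 1 then P1 (X \<omega>) else P2 (X \<omega>)) \<partial>M) = (\<integral>\<omega>. P2 (X \<omega>) + D \<omega> * indicator ?Y \<omega> \<partial>M)"
    by (intro Bochner_Integration.integral_cong) (auto simp: D_def indicator_def)
  also have "\<dots> = (\<integral>\<omega>. P2 (X \<omega>) \<partial>M) + (\<integral>\<omega>. D \<omega> * indicator ?Y \<omega> \<partial>M)"
    by (rule Bochner_Integration.integral_add[OF intP2 intDY])
  also have "(\<integral>\<omega>. D \<omega> * indicator ?Y \<omega> \<partial>M) = (\<integral>\<omega>. D \<omega> * real_cond_exp M ?F (indicator ?Y) \<omega> \<partial>M)"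
    by (rule F.real_cond_exp_intg(2)[OF intDY DF IM, symmetric])
  also have "\<dots> = (\<integral>\<omega>. D \<omega> * h (v (X \<omega>)) \<partial>M)"
  proof (rule integral_cong_AE)
    show "(\<lambda>\<omega>. D \<omega> * real_cond_exp M ?F (indicator ?Y) \<omega>) \<in> borel_measurable M"
      by (rule borel_measurable_integrable[OF F.real_cond_exp_intg(1)[OF intDY DF IM]])
    show "(\<lambda>\<omega>. D \<omega> * h (v (X \<omega>))) \<in> borel_measurable M" by (rule borel_measurable_integrable[OF intDh])
    show "AE \<omega> in M. D \<omega> * real_cond_exp M ?F (indicator ?Y) \<omega> = D \<omega> * h (v (X \<omega>))"
      using lab[unfolded binary_label_def, THEN conjunct2] by eventually_elim simp
  qed
  also have "(\<integral>\<omega>. P2 (X \<omega>) \<partial>M) + (\<integral>\<omega>. D \<omega> * h (v (X \<omega>)) \<partial>M) = (\<integral>\<omega>. P2 (X \<omega>) + D \<omega> * h (v (X \<omega>)) \<partial>M)"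
    by (rule Bochner_Integration.integral_add[OF intP2 intDh, symmetric])
  also have "\<dots> = (\<integral>\<omega>. h (v (X \<omega>)) * P1 (X \<omega>) + (1 - h (v (X \<omega>))) * P2 (X \<omega>) \<partial>M)"
    by (simp add: D_def algebra_simps)
  also have "\<dots> = (\<integral>x. h (v x) * P1 x + (1 - h (v x)) * P2 x \<partial>distr M (Rvec_borel p) X)"
    by (rule integral_distr[symmetric, OF X])
      (intro borel_measurable_add borel_measurable_times borel_measurable_diff borel_measurable_const measurable_compose[OF v h(1)] P)
  finally show ?thesis .
qed

lemma alternative_II_continuous:
  fixes LF :: "'v::real_normed_vector \<Rightarrow> real \<Rightarrow> real"
  assumes Lv: "\<And>v v' y. \<bar>LF v y - LF v' y\<bar> \<le> K * (1 + \<bar>y\<bar>) * norm (v - v')"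
    and Ly: "\<And>v y y'. \<bar>LF v y - LF v y'\<bar> \<le> K * (1 + norm v) * \<bar>y - y'\<bar>"
  shows "continuous_on UNIV (\<lambda>z. LF (fst z) (snd z))"
proof -
  have "isCont (\<lambda>z. LF (fst z) (snd z)) z" for z
  proof -
    let ?b = "\<lambda>y. K * (1 + \<bar>snd y\<bar>) * norm (fst y - fst z) + K * (1 + norm (fst z)) * \<bar>snd y - snd z\<bar>"
    have "(?b \<longlongrightarrow> K * (1 + \<bar>snd z\<bar>) * norm (fst z - fst z) + K * (1 + norm (fst z)) * \<bar>snd z - snd z\<bar>) (at z)"
      by (intro tendsto_intros)
    then have lim: "(?b \<longlongrightarrow> 0) (at z)" by simp
    have "((\<lambda>y. LF (fst y) (snd y) - LF (fst z) (snd z)) \<longlongrightarrow> 0) (at z)"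
    proof (rule Lim_null_comparison[OF always_eventually lim], rule allI)
      fix y
      show "norm (LF (fst y) (snd y) - LF (fst z) (snd z)) \<le> ?b y"
        using Lv[of "fst y" "snd y" "fst z"] Ly[of "fst z" "snd y" "snd z"] unfolding real_norm_def by linarith
    qed
    then show ?thesis unfolding isCont_def by (rule LIM_zero_cancel)
  qed
  then show ?thesis by (simp add: continuous_at_imp_continuous_on)
qed

section \<open>Minimal empirical risk with binary labels\<close>

context erm_models
begin

text \<open>The label is a merely measurable function of projection and noise, so it cannot be
  approximated by trigonometric polynomials uniformly on boxes. Conditioning on the features
  replaces it by the weights \<open>h n\<close> and \<open>1 - h n\<close> at the values 1 and -1,
  and these are continuous in the projection. They depend on \<open>n\<close>, which is what the
  weighted replica lemma is made for.\<close>

lemma universality_alternative_II: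
  fixes L :: "real \<Rightarrow> real \<Rightarrow> real" and F :: "real ^ 'k \<Rightarrow> real" and \<eta> :: "(real ^ 's) \<times> real \<Rightarrow> real"
  assumes \<eta>: "\<eta> \<in> borel_measurable borel" and alt: "alternative_II M p \<eta> \<Theta>s X G \<epsilon> (loss_F L F)"
  shows "1 \<le> n \<Longrightarrow> opt_risk n (p n) L F \<eta> (r n) (C n) (\<Theta>s n) (X n) (\<epsilon> n) \<in> borel_measurable (M n)"
    and "1 \<le> n \<Longrightarrow> opt_risk n (p n) L F \<eta> (r n) (C n) (\<Theta>s n) (G n) (\<epsilon> n) \<in> borel_measurable (M n)"
    and "bounded_lipschitz \<psi> \<Longrightarrow>
      (\<lambda>n. \<bar>(\<integral>\<omega>. \<psi> (opt_risk n (p n) L F \<eta> (r n) (C n) (\<Theta>s n) (X n) (\<epsilon> n) \<omega>) \<partial>M n) -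
            (\<integral>\<omega>. \<psi> (opt_risk n (p n) L F \<eta> (r n) (C n) (\<Theta>s n) (G n) (\<epsilon> n) \<omega>) \<partial>M n)\<bar>) \<longlonglongrightarrow> 0"
proof -
  define LF where "LF = loss_F L F"
  define lab where "lab n z = label (p n) \<eta> (\<Theta>s n) (fst z) (snd z)" for n z
  obtain K where H: "\<forall>v y. 0 \<le> LF v y" "\<forall>v v' y. \<bar>LF v y - LF v' y\<bar> \<le> K * (1 + \<bar>y\<bar>) * norm (v - v')"
    "\<forall>v y y'. \<bar>LF v y - LF v y'\<bar> \<le> K * (1 + norm v) * \<bar>y - y'\<bar>"
    "\<forall>n. \<exists>g. (\<forall>v. 0 \<le> g v \<and> g v \<le> 1) \<and>
           (\<forall>v v'. \<bar>g v - g v'\<bar> \<le> K * (1 + norm v + norm v') * norm (v - v')) \<and>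
           (\<forall>i<n.
              binary_label (M n) (p n) g (X n i) (\<lambda>\<omega>. proj (p n) (\<Theta>s n) (X n i \<omega>))
                (\<lambda>\<omega>. label (p n) \<eta> (\<Theta>s n) (X n i \<omega>) (\<epsilon> n i \<omega>)) \<and>
              binary_label (M n) (p n) g (G n i) (\<lambda>\<omega>. proj (p n) (\<Theta>s n) (G n i \<omega>))
                (\<lambda>\<omega>. label (p n) \<eta> (\<Theta>s n) (G n i \<omega>) (\<epsilon> n i \<omega>)))"
    using alt[unfolded alternative_II_def, folded LF_def] by (elim exE conjE) (rule that)
  note LF0 = H(1)[rule_format] and Lv = H(2)[rule_format] and Ly = H(3)[rule_format]
  obtain h where h: "\<forall>n. (\<forall>v. 0 \<le> h n v \<and> h n v \<le> 1) \<and>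
           (\<forall>v v'. \<bar>h n v - h n v'\<bar> \<le> K * (1 + norm v + norm v') * norm (v - v')) \<and>
           (\<forall>i<n.
              binary_label (M n) (p n) (h n) (X n i) (\<lambda>\<omega>. proj (p n) (\<Theta>s n) (X n i \<omega>))
                (\<lambda>\<omega>. label (p n) \<eta> (\<Theta>s n) (X n i \<omega>) (\<epsilon> n i \<omega>)) \<and>
              binary_label (M n) (p n) (h n) (G n i) (\<lambda>\<omega>. proj (p n) (\<Theta>s n) (G n i \<omega>))
                (\<lambda>\<omega>. label (p n) \<eta> (\<Theta>s n) (G n i \<omega>) (\<epsilon> n i \<omega>)))"
    using choice[OF H(4)] by (elim exE) (rule that)
  have h01: "0 \<le> h n v" "h n v \<le> 1" for n v using h by blast+
  have hl: "\<bar>h n v - h n v'\<bar> \<le> \<bar>K\<bar> * (1 + norm v + norm v') * norm (v - v')" for n v v'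
  proof -
    have "\<bar>h n v - h n v'\<bar> \<le> K * (1 + norm v + norm v') * norm (v - v')" using h by blast
    also have "\<dots> \<le> \<bar>K\<bar> * (1 + norm v + norm v') * norm (v - v')" by (intro mult_right_mono) auto
    finally show ?thesis .
  qed
  have labX: "binary_label (M n) (p n) (h n) (X n i) (\<lambda>\<omega>. proj (p n) (\<Theta>s n) (X n i \<omega>)) (\<lambda>\<omega>. lab n (X n i \<omega>, \<epsilon> n i \<omega>))" if "i < n" for n i
    using h[rule_format, of n, THEN conjunct2, THEN conjunct2, rule_format, OF that] by (simp add: lab_def)
  have labG: "binary_label (M n) (p n) (h n) (G n i) (\<lambda>\<omega>. proj (p n) (\<Theta>s n) (G n i \<omega>)) (\<lambda>\<omega>. lab n (G n i \<omega>, \<epsilon> n i \<omega>))" if "i < n" for n i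
    using h[rule_format, of n, THEN conjunct2, THEN conjunct2, rule_format, OF that] by (simp add: lab_def)
  have hc: "continuous_on UNIV (h n)" for n
  proof -
    have "isCont (h n) v" for v
    proof -
      have "((\<lambda>y. \<bar>K\<bar> * (1 + norm y + norm v) * norm (y - v)) \<longlongrightarrow> \<bar>K\<bar> * (1 + norm v + norm v) * norm (v - v)) (at v)"
        by (intro tendsto_intros)
      then have lim: "((\<lambda>y. \<bar>K\<bar> * (1 + norm y + norm v) * norm (y - v)) \<longlongrightarrow> 0) (at v)" by simp
      have "((\<lambda>y. h n y - h n v) \<longlongrightarrow> 0) (at v)"
        by (rule Lim_null_comparison[OF always_eventually lim]) (simp add: hl)
      then show ?thesis unfolding isCont_def by (rule LIM_zero_cancel)
    qed
    then show ?thesis by (simp add: continuous_at_imp_continuous_on)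
  qed
  have hm: "h n \<in> borel_measurable borel" for n by (rule borel_measurable_continuous_onI[OF hc])
  have LFc: "continuous_on UNIV (\<lambda>z. LF (fst z) (snd z))" by (rule alternative_II_continuous[OF Lv Ly])
  have LFcu: "continuous_on UNIV (\<lambda>u. LF u y)" for y
  proof -
    have "continuous_on UNIV (\<lambda>u. (u, y))" by (intro continuous_intros)
    from continuous_on_compose2[OF LFc this] show ?thesis by simp
  qed
  have labm: "lab n \<in> borel_measurable (Rvec_borel (p n) \<Otimes>\<^sub>M borel)" for n
    unfolding lab_def[abs_def] label_def
    by (rule measurable_compose[OF borel_measurable_Pair \<eta>]) (rule measurable_compose[OF measurable_fst measurable_proj], rule measurable_snd)
  \<comment> \<open>Agrees with the loss off the null set where the label is neither 1 nor -1, and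
    has the Lipschitz constant 2 |K| everywhere, whereas the bound for \<open>LF\<close> grows with
    |y|.\<close>
  define lo where "lo n u z = (if lab n z = 1 then LF u 1 else LF u (- 1))" for n u and z :: "(nat \<Rightarrow> real) \<times> real"
  have lo0: "0 \<le> lo n u z" for n u z by (simp add: lo_def LF0)
  have projm: "(\<lambda>z. proj (p n) \<Theta> (fst z)) \<in> borel_measurable (Rvec_borel (p n) \<Otimes>\<^sub>M (borel :: real measure))" for n and \<Theta> :: "(nat \<Rightarrow> real) ^ 'k"
    by (rule measurable_compose[OF measurable_fst measurable_proj])
  have lom: "(\<lambda>z. lo n (proj (p n) \<Theta> (fst z)) z) \<in> borel_measurable (Rvec_borel (p n) \<Otimes>\<^sub>M borel)" for n \<Theta>
  proof -
    have "(\<lambda>z. LF (proj (p n) \<Theta> (fst z)) y) \<in> borel_measurable (Rvec_borel (p n) \<Otimes>\<^sub>M (borel :: real measure))" for y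
      by (rule measurable_compose[OF projm borel_measurable_continuous_onI[OF LFcu]])
    note A = this
    show ?thesis unfolding lo_def
      by (rule measurable_If[OF A A borel_measurable_eq[OF labm borel_measurable_const]])
  qed
  have lol: "\<bar>lo n u z - lo n u' z\<bar> \<le> 2 * \<bar>K\<bar> * norm (u - u')" for n u u' z
  proof -
    have "\<bar>LF u y - LF u' y\<bar> \<le> 2 * \<bar>K\<bar> * norm (u - u')" if "\<bar>y\<bar> = 1" for y
    proof -
      have "\<bar>LF u y - LF u' y\<bar> \<le> K * 2 * norm (u - u')" using Lv[of u y u'] that by simp
      also have "\<dots> \<le> 2 * \<bar>K\<bar> * norm (u - u')" by (intro mult_right_mono) auto
      finally show ?thesis .
    qed
    then show ?thesis by (simp add: lo_def)
  qed
  have trunc: "\<exists>K\<ge>0. \<forall>n u u' z. \<bar>min A (lo n u z) - min A (lo n u' z)\<bar> \<le> K * norm (u - u')" for A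
  proof -
    have "\<bar>min A (lo n u z) - min A (lo n u' z)\<bar> \<le> 2 * \<bar>K\<bar> * norm (u - u')" for n u u' z
      using lol[of n u z u'] by linarith
    then show ?thesis by (intro exI[of _ "2 * \<bar>K\<bar>"]) auto
  qed
  define K1 where "K1 = LF 0 1 + LF 0 (- 1) + 2 * \<bar>K\<bar>"
  have K1: "0 \<le> K1" unfolding K1_def using LF0 by (intro add_nonneg_nonneg) auto
  have lo_up: "lo n u z \<le> K1 * (1 + 2 * norm u powr 1)" for n u z
  proof -
    have "lo n 0 z \<le> LF 0 1 + LF 0 (- 1)" using LF0[of 0 1] LF0[of 0 "- 1"] by (simp add: lo_def)
    then have "lo n u z \<le> (LF 0 1 + LF 0 (- 1)) * 1 + 2 * \<bar>K\<bar> * norm u" using lol[of n u z 0] by simp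
    also have "\<dots> \<le> (LF 0 1 + LF 0 (- 1)) * (1 + 2 * norm u) + 2 * \<bar>K\<bar> * (1 + 2 * norm u)"
      using LF0[of 0 1] LF0[of 0 "- 1"] by (intro add_mono mult_left_mono) auto
    finally show ?thesis by (simp add: K1_def distrib_right)
  qed
  have one: "(0 :: real) < 1" by simp
  obtain c where c: "0 \<le> c" "\<forall>z :: real ^ 'k. (K1 * (1 + 2 * norm z powr 1))\<^sup>2 \<le> c * (\<Sum>i\<in>Basis. exp (\<bar>z \<bullet> i\<bar> / \<kappa>0))"
    by (rule growth_square_bound[OF K1 one \<kappa>0(1)])
  define c2 where "c2 = c * (real (card (Basis :: (real ^ 'k) set)) * 10)"
  have prob_R: "prob_space R" if R: "R \<in> {Px n \<Otimes>\<^sub>M Pe n, Pg n \<Otimes>\<^sub>M Pe n}" for R n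
    using R by (auto intro!: prob_space_pair prob_P)
  have sets_R: "sets R = sets (Rvec_borel (p n) \<Otimes>\<^sub>M borel)" if R: "R \<in> {Px n \<Otimes>\<^sub>M Pe n, Pg n \<Otimes>\<^sub>M Pe n}" for R n
    using R sets_pair_measure_cong[OF sets_P(1)[of n] sets_P(3)[of n]] sets_pair_measure_cong[OF sets_P(2)[of n] sets_P(3)[of n]] by blast
  have mom: "integrable R (\<lambda>z. (lo n (proj (p n) \<Theta> (fst z)) z)\<^sup>2) \<and> (\<integral>z. (lo n (proj (p n) \<Theta> (fst z)) z)\<^sup>2 \<partial>R) \<le> c2"
    if n: "1 \<le> n" and \<Theta>: "\<Theta> \<in> cols_in (C n)" and R: "R \<in> {Px n \<Otimes>\<^sub>M Pe n, Pg n \<Otimes>\<^sub>M Pe n}" for n \<Theta> R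
    unfolding c2_def
  proof (rule square_integrable_of_subexp[where q = "\<lambda>i z. proj (p n) \<Theta> (fst z) \<bullet> i" and \<kappa> = \<kappa>0])
    show "prob_space R" by (rule prob_R[OF R])
    show "(\<lambda>z. lo n (proj (p n) \<Theta> (fst z)) z) \<in> borel_measurable R"
      unfolding measurable_cong_sets[OF sets_R[OF R] refl] by (rule lom)
    show "(\<lambda>z. proj (p n) \<Theta> (fst z) \<bullet> i) \<in> borel_measurable R" for i
      unfolding measurable_cong_sets[OF sets_R[OF R] refl] by (rule borel_measurable_inner[OF projm borel_measurable_const])
    show "(\<integral>\<^sup>+z. ennreal (exp (\<bar>proj (p n) \<Theta> (fst z) \<bullet> i\<bar> / \<kappa>0)) \<partial>R) \<le> 10" if i: "i \<in> Basis" for i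
    proof -
      obtain j where j: "i = axis j 1" using i by (auto simp: Basis_vec_def)
      have "\<Theta> $ j \<in> C n" using \<Theta> by (simp add: cols_in_def)
      then have "(\<integral>\<^sup>+z. ennreal (exp (\<bar>dotp (p n) (\<Theta> $ j) (fst z)\<bar> / \<kappa>0)) \<partial>R) \<le> 10"
        by (intro subexp_pair[OF order_refl _ R]) blast
      then show ?thesis unfolding j proj_def inner_axis by simp
    qed
    show "(lo n (proj (p n) \<Theta> (fst z)) z)\<^sup>2 \<le> c * (\<Sum>i\<in>Basis. exp (\<bar>proj (p n) \<Theta> (fst z) \<bullet> i\<bar> / \<kappa>0))" for z
      by (rule order_trans[OF power_mono[OF lo_up lo0] c(2)[rule_format]])
  qed (use c(1) in auto)
  \<comment> \<open>Once the label is integrated out only functions of the features remain; a point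
    mass in place of the noise law makes \<open>gaussian_features\<close> applicable to
    them.\<close>
  define E0 :: "nat \<Rightarrow> real measure" where "E0 n = return borel 0" for n
  have E0: "prob_space (E0 n)" "sets (E0 n) = sets borel" "(\<integral>\<^sup>+e. ennreal (exp (\<bar>e\<bar> / \<kappa>0)) \<partial>E0 n) \<le> 10" for n
  proof -
    have "(\<lambda>e :: real. ennreal (exp (\<bar>e\<bar> / \<kappa>0))) \<in> borel_measurable borel"
      by (intro measurable_compose[OF _ measurable_ennreal] borel_measurable_continuous_onI continuous_intros) (use \<kappa>0(1) in auto)
    then show "(\<integral>\<^sup>+e. ennreal (exp (\<bar>e\<bar> / \<kappa>0)) \<partial>E0 n) \<le> 10"
      unfolding E0_def by (subst nn_integral_return) auto
  qed (auto simp: E0_def prob_space_return)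
  interpret gf: gaussian_features p Px Pg E0 S C \<Theta>s \<kappa>0
    by (rule features[OF order_refl E0])
  have weak: "eventually (\<lambda>n. \<forall>\<Theta>. (\<forall>j<m. \<Theta> j \<in> cols_in (C n)) \<longrightarrow>
        \<bar>(\<integral>z. (\<Prod>j<m. exp (- \<beta> * min A (lo n (proj (p n) (\<Theta> j) (fst z)) z))) \<partial>(Px n \<Otimes>\<^sub>M Pe n)) -
         (\<integral>z. (\<Prod>j<m. exp (- \<beta> * min A (lo n (proj (p n) (\<Theta> j) (fst z)) z))) \<partial>(Pg n \<Otimes>\<^sub>M Pe n))\<bar> \<le> \<tau>) sequentially"
    if A: "0 < A" and \<beta>: "0 < \<beta>" and \<tau>: "0 < \<tau>" for A \<beta> and m :: nat and \<tau>
  \<comment> \<open>The weighted replica lemma needs a factor to carry the weight; the empty product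
    integrates to 1 under both laws.\<close>
  proof (cases "m = 0")
    case True
    have "measure (Px n \<Otimes>\<^sub>M Pe n) (space (Px n \<Otimes>\<^sub>M Pe n)) = 1" "measure (Pg n \<Otimes>\<^sub>M Pe n) (space (Pg n \<Otimes>\<^sub>M Pe n)) = 1" for n
      by (rule prob_space.prob_space[OF prob_R[of _ n]]; simp)+
    then show ?thesis using \<tau> True by simp
  next
    case False
    then have m: "0 < m" by simp
    define f where "f y w = exp (- \<beta> * min A (LF (fst (fst w)) y))" for y and w :: "((real ^ 'k) \<times> (real ^ 's)) \<times> real"
    have fc: "continuous_on UNIV (f y)" for y
      unfolding f_def[abs_def]
      by (intro continuous_intros continuous_on_compose2[OF LFcu continuous_on_fst[OF continuous_on_fst[OF continuous_on_id]]]) auto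
    have e1: "exp (- \<beta> * min A (LF u y)) \<le> 1" for u y
    proof -
      have "0 \<le> \<beta> * min A (LF u y)" using A \<beta> LF0[of u y] by (intro mult_nonneg_nonneg) auto
      then show ?thesis by simp
    qed
    have f1: "\<bar>f y w\<bar> \<le> 1" for y w unfolding f_def abs_exp_cancel by (rule e1)
    define P where "P y \<Theta> n x = (\<Prod>j<m. exp (- \<beta> * min A (LF (proj (p n) (\<Theta> j) x) y)))"
      for y and \<Theta> :: "nat \<Rightarrow> (nat \<Rightarrow> real) ^ 'k" and n and x :: "nat \<Rightarrow> real"
    have Pm: "P y \<Theta> n \<in> borel_measurable (Rvec_borel (p n))" for y \<Theta> n
    proof -
      have "continuous_on UNIV (\<lambda>u. exp (- \<beta> * min A (LF u y)))" by (intro continuous_intros LFcu)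
      then show ?thesis unfolding P_def[abs_def]
        by (intro borel_measurable_prod measurable_compose[OF measurable_proj borel_measurable_continuous_onI])
    qed
    have P1: "\<bar>P y \<Theta> n x\<bar> \<le> 1" for y \<Theta> n x
      unfolding P_def abs_prod abs_exp_cancel by (intro prod_le_1 conjI exp_ge_zero e1)
    have Pwv: "(\<Prod>j<m. f y (gf.wv n (\<Theta> j) z)) = P y \<Theta> n (fst z)" for y \<Theta> n z
      by (simp add: P_def f_def gf.wv_def)
    have vm: "(\<lambda>x. proj (p n) (\<Theta>s n) x) \<in> borel_measurable (Rvec_borel (p n))" for n by (rule measurable_proj)
    have hv: "(\<lambda>x. h n (proj (p n) (\<Theta>s n) x)) \<in> borel_measurable (Rvec_borel (p n))" for n
      by (rule measurable_compose[OF vm hm])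
    \<comment> \<open>Contributions of the labels 1 and -1 with their conditional probabilities. All
      replicas are evaluated at the same sample, hence at the same label, so no mixed products
      occur.\<close>
    define Jp where "Jp \<Theta> n x = h n (proj (p n) (\<Theta>s n) x) * P 1 \<Theta> n x" for \<Theta> n x
    define Jm where "Jm \<Theta> n x = (1 - h n (proj (p n) (\<Theta>s n) x)) * P (- 1) \<Theta> n x" for \<Theta> n x
    have Jmeas: "Jp \<Theta> n \<in> borel_measurable (Rvec_borel (p n))" "Jm \<Theta> n \<in> borel_measurable (Rvec_borel (p n))" for \<Theta> n
      unfolding Jp_def[abs_def] Jm_def[abs_def] by (intro borel_measurable_times borel_measurable_diff borel_measurable_const hv Pm)+
    have J1: "\<bar>Jp \<Theta> n x\<bar> \<le> 1" "\<bar>Jm \<Theta> n x\<bar> \<le> 1" for \<Theta> n x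
      unfolding Jp_def Jm_def abs_mult
      using h01[of n "proj (p n) (\<Theta>s n) x"] by (auto intro!: mult_le_one P1)
    have Jint: "integrable R (Jp \<Theta> n)" "integrable R (Jm \<Theta> n)" if "prob_space R" "sets R = sets (Rvec_borel (p n))" for R \<Theta> n
      using Jmeas[of \<Theta> n] J1[of \<Theta> n] unfolding measurable_cong_sets[OF that(2) refl, symmetric]
      by (auto intro: integrable_bounded[OF that(1)])
    have pairJ: "(\<integral>z. J (fst z) \<partial>(R \<Otimes>\<^sub>M E0 n)) = (\<integral>x. J x \<partial>R)" if "J \<in> borel_measurable R" for J :: "(nat \<Rightarrow> real) \<Rightarrow> real" and R n
    proof -
      have "(\<integral>x. J x \<partial>R) = (\<integral>x. J x \<partial>distr (R \<Otimes>\<^sub>M E0 n) R fst)"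
        by (simp only: prob_space.distr_pair_fst[OF E0(1)])
      also have "\<dots> = (\<integral>z. J (fst z) \<partial>(R \<Otimes>\<^sub>M E0 n))" by (rule integral_distr[OF measurable_fst that])
      finally show ?thesis by simp
    qed
    \<comment> \<open>The pair of \<open>Z 0\<close> and \<open>\<epsilon> n 0\<close> realizes the
      law \<open>R \<Otimes>\<^sub>M Pe n\<close>, which makes the conditional probability in the
      label assumption available for the product law.\<close>
    have repl: "(\<integral>z. (\<Prod>j<m. exp (- \<beta> * min A (lo n (proj (p n) (\<Theta> j) (fst z)) z))) \<partial>(R \<Otimes>\<^sub>M Pe n)) =
        (\<integral>z. Jp \<Theta> n (fst z) \<partial>(R \<Otimes>\<^sub>M E0 n)) + (\<integral>z. Jm \<Theta> n (fst z) \<partial>(R \<Otimes>\<^sub>M E0 n))"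
      if n: "1 \<le> n" and Z: "iid_copies (M n) (Rvec_borel (p n)) n z0 Z" and ind: "indep_families (M n) n (Rvec_borel (p n)) Z borel (\<epsilon> n)"
        and lb: "binary_label (M n) (p n) (h n) (Z 0) (\<lambda>\<omega>. proj (p n) (\<Theta>s n) (Z 0 \<omega>)) (\<lambda>\<omega>. lab n (Z 0 \<omega>, \<epsilon> n 0 \<omega>))"
        and R: "R = distr (M n) (Rvec_borel (p n)) z0" for n \<Theta> z0 Z R
    proof -
      have PeN: "Pe n = distr (M n) borel (\<epsilon> n 0)" using n by (simp add: Pe_def)
      have n0: "0 < n" using n by simp
      note W = iid_first_pair_law[OF prob n Z \<epsilon> ind]
      have RZ: "R = distr (M n) (Rvec_borel (p n)) (Z 0)"
        using Z n0 unfolding iid_copies_def R by metis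
      have Z0: "Z 0 \<in> M n \<rightarrow>\<^sub>M Rvec_borel (p n)"
        using measurable_compose[OF W(1) measurable_fst] by simp
      have y: "(\<lambda>\<omega>. lab n (Z 0 \<omega>, \<epsilon> n 0 \<omega>)) \<in> borel_measurable (M n)" by (rule measurable_compose[OF W(1) labm])
      have prodm: "(\<lambda>z. \<Prod>j<m. exp (- \<beta> * min A (lo n (proj (p n) (\<Theta> j) (fst z)) z))) \<in> borel_measurable (Rvec_borel (p n) \<Otimes>\<^sub>M borel)"
        by (intro borel_measurable_prod measurable_compose[OF _ borel_measurable_exp] borel_measurable_times borel_measurable_min borel_measurable_const lom)
      have prod_eq: "(\<Prod>j<m. exp (- \<beta> * min A (lo n (proj (p n) (\<Theta> j) (fst z)) z))) = (if lab n z = 1 then P 1 \<Theta> n (fst z) else P (- 1) \<Theta> n (fst z))" for z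
        by (simp add: lo_def P_def)
      have pR: "prob_space R" unfolding RZ by (rule prob_space.prob_space_distr[OF prob Z0])
      have sR: "sets R = sets (Rvec_borel (p n))" unfolding R by simp
      have "(\<integral>z. (\<Prod>j<m. exp (- \<beta> * min A (lo n (proj (p n) (\<Theta> j) (fst z)) z))) \<partial>(R \<Otimes>\<^sub>M Pe n)) =
          (\<integral>\<omega>. (if lab n (Z 0 \<omega>, \<epsilon> n 0 \<omega>) = 1 then P 1 \<Theta> n (Z 0 \<omega>) else P (- 1) \<Theta> n (Z 0 \<omega>)) \<partial>M n)"
        unfolding R PeN W(2)[symmetric] by (subst integral_distr[OF W(1) prodm], unfold prod_eq, unfold fst_conv, rule refl)
      also have "\<dots> = (\<integral>x. Jp \<Theta> n x + Jm \<Theta> n x \<partial>R)"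
        unfolding RZ Jp_def Jm_def by (rule label_integral[OF prob Z0 y lb vm hm h01 Pm Pm P1 P1])
      also have "\<dots> = (\<integral>x. Jp \<Theta> n x \<partial>R) + (\<integral>x. Jm \<Theta> n x \<partial>R)"
        by (rule Bochner_Integration.integral_add[OF Jint[OF pR sR]])
      finally show ?thesis
        using Jmeas[of \<Theta> n] unfolding measurable_cong_sets[OF sR refl, symmetric] by (simp add: pairJ)
    qed
    have \<tau>2: "0 < \<tau> / 2" using \<tau> by simp
    have "gf.uniformly_close m (\<lambda>n \<Theta> z. h n (proj (p n) (\<Theta>s n) (fst z)) * (\<Prod>j<m. f 1 (gf.wv n (\<Theta> j) z)))"
      by (rule gf.replica_uniformly_close_weighted[where f = "\<lambda>_. f 1" and w = h and K = "\<bar>K\<bar>"]) (rule fc f1 m h01 hl abs_ge_zero)+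
    then have ev1: "gf.uniformly_close m (\<lambda>n \<Theta> z. Jp \<Theta> n (fst z))" unfolding Pwv Jp_def .
    \<comment> \<open>The complementary weight has the same range and modulus of continuity as
      \<open>h n\<close>.\<close>
    have "gf.uniformly_close m (\<lambda>n \<Theta> z. (1 - h n (proj (p n) (\<Theta>s n) (fst z))) * (\<Prod>j<m. f (- 1) (gf.wv n (\<Theta> j) z)))"
    proof (rule gf.replica_uniformly_close_weighted[where f = "\<lambda>_. f (- 1)" and w = "\<lambda>n v. 1 - h n v" and K = "\<bar>K\<bar>"])
      show "\<bar>(1 - h n v) - (1 - h n v')\<bar> \<le> \<bar>K\<bar> * (1 + norm v + norm v') * norm (v - v')" for n v v'
        using hl[of n v v'] by (simp add: abs_minus_commute)
      show "0 \<le> 1 - h n v" "1 - h n v \<le> 1" for n v using h01[of n v] by auto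
    qed (rule fc f1 m abs_ge_zero)+
    then have ev2: "gf.uniformly_close m (\<lambda>n \<Theta> z. Jm \<Theta> n (fst z))" unfolding Pwv Jm_def .
    show ?thesis
      using ev1[unfolded gf.uniformly_close_def gf.tuples_def gf.Q_def gf.Q'_def, rule_format, OF \<tau>2]
        ev2[unfolded gf.uniformly_close_def gf.tuples_def gf.Q_def gf.Q'_def, rule_format, OF \<tau>2] eventually_ge_at_top[of 1]
    proof eventually_elim
      case (elim n)
      have n0: "0 < n" using elim(3) by simp
      show ?case
      proof (intro allI impI)
        fix \<Theta> :: "nat \<Rightarrow> (nat \<Rightarrow> real) ^ 'k" assume "\<forall>j<m. \<Theta> j \<in> cols_in (C n)"
        then have \<Theta>: "\<Theta> \<in> {\<Theta>. \<forall>j<m. \<Theta> j \<in> cols_in (C n)}" by simp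
        show "\<bar>(\<integral>z. (\<Prod>j<m. exp (- \<beta> * min A (lo n (proj (p n) (\<Theta> j) (fst z)) z))) \<partial>(Px n \<Otimes>\<^sub>M Pe n)) -
         (\<integral>z. (\<Prod>j<m. exp (- \<beta> * min A (lo n (proj (p n) (\<Theta> j) (fst z)) z))) \<partial>(Pg n \<Otimes>\<^sub>M Pe n))\<bar> \<le> \<tau>"
          unfolding repl[OF elim(3) X indep_X labX[OF n0] Px_def] repl[OF elim(3) G indep_G labG[OF n0] Pg_def]
          using elim(1)[rule_format, OF \<Theta>] elim(2)[rule_format, OF \<Theta>] by linarith
      qed
    qed
  qed
  have V: "V lo n \<in> borel_measurable (PiM {..<n} (\<lambda>_. Rvec_borel (p n) \<Otimes>\<^sub>M borel))" for n
    by (rule universality_of_loss(1)[where \<kappa> = \<kappa>0 and ?c2.0 = c2]) (assumption | rule order_refl lo0 lom trunc mom weak)+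
  have U: "(\<lambda>n. \<bar>(\<integral>\<omega>. \<psi> (V lo n (\<lambda>i\<in>{..<n}. (X n i \<omega>, \<epsilon> n i \<omega>))) \<partial>M n) -
            (\<integral>\<omega>. \<psi> (V lo n (\<lambda>i\<in>{..<n}. (G n i \<omega>, \<epsilon> n i \<omega>))) \<partial>M n)\<bar>) \<longlonglongrightarrow> 0" if "bounded_lipschitz \<psi>" for \<psi>
    by (rule universality_of_loss(2)[where \<kappa> = \<kappa>0 and ?c2.0 = c2]) (assumption | rule order_refl lo0 lom trunc mom weak that)+
  have opt_eq: "opt_risk n (p n) L F \<eta> (r n) (C n) (\<Theta>s n) Z (\<epsilon> n) \<omega> =
      (INF \<Theta>\<in>cols_in (C n). (1 / real n) * (\<Sum>i<n. LF (proj (p n) \<Theta> (Z i \<omega>)) (lab n (Z i \<omega>, \<epsilon> n i \<omega>))) + r n \<Theta>)" for n Z \<omega>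
    by (simp add: opt_risk_def min_emp_risk_def emp_risk_def LF_def lab_def)
  obtain Kr where Kr: "0 \<le> Kr" "\<forall>n. \<forall>\<Theta>\<in>cols_in (C n). 0 \<le> r n \<Theta>" "\<forall>n. continuous_on (cols_in (C n)) (r n)"
    "\<forall>n. \<forall>\<Theta>\<in>cols_in (C n). \<forall>\<Theta>'\<in>cols_in (C n). \<bar>r n \<Theta> - r n \<Theta>'\<bar> \<le> Kr * frob_dist (p n) \<Theta> \<Theta>'"
    by (rule penalty_on_cols)
  \<comment> \<open>The risk equals \<open>V lo\<close> at the sample only almost everywhere, and
    the probability space need not be complete; its measurability is therefore proved
    directly.\<close>
  have Rm: "opt_risk n (p n) L F \<eta> (r n) (C n) (\<Theta>s n) Z (\<epsilon> n) \<in> borel_measurable (M n)"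
    if W: "(\<lambda>\<omega>. \<lambda>i\<in>{..<n}. (Z i \<omega>, \<epsilon> n i \<omega>)) \<in> M n \<rightarrow>\<^sub>M PiM {..<n} (\<lambda>_. Rvec_borel (p n) \<Otimes>\<^sub>M borel)" for n Z
    unfolding opt_eq[abs_def]
  proof (rule borel_measurable_INF_cols[OF cols_bounds(1)])
    fix \<omega>
    have "continuous_on (cols_in (C n)) (\<lambda>\<Theta>. LF (proj (p n) \<Theta> x) y)" for x y
      by (rule continuous_on_compose2[OF LFcu continuous_on_proj]) simp
    then show "continuous_on (cols_in (C n)) (\<lambda>\<Theta>. (1 / real n) * (\<Sum>i<n. LF (proj (p n) \<Theta> (Z i \<omega>)) (lab n (Z i \<omega>, \<epsilon> n i \<omega>))) + r n \<Theta>)"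
      by (intro continuous_intros Kr(3)[rule_format])
  next
    fix \<omega> and \<Theta> :: "(nat \<Rightarrow> real) ^ 'k" assume "\<Theta> \<in> cols_in (C n)"
    then show "0 \<le> (1 / real n) * (\<Sum>i<n. LF (proj (p n) \<Theta> (Z i \<omega>)) (lab n (Z i \<omega>, \<epsilon> n i \<omega>))) + r n \<Theta>"
      using Kr(2) LF0 by (intro add_nonneg_nonneg mult_nonneg_nonneg sum_nonneg) auto
  next
    fix \<Theta> :: "(nat \<Rightarrow> real) ^ 'k"
    have "(\<lambda>\<omega>. LF (proj (p n) \<Theta> (Z i \<omega>)) (lab n (Z i \<omega>, \<epsilon> n i \<omega>))) \<in> borel_measurable (M n)" if i: "i \<in> {..<n}" for i
    proof -
      have Wi: "(\<lambda>\<omega>. (Z i \<omega>, \<epsilon> n i \<omega>)) \<in> M n \<rightarrow>\<^sub>M Rvec_borel (p n) \<Otimes>\<^sub>M borel"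
        using measurable_compose[OF W measurable_component_singleton[OF i]] i by simp
      have "(\<lambda>z. (proj (p n) \<Theta> (fst z), lab n z)) \<in> borel_measurable (Rvec_borel (p n) \<Otimes>\<^sub>M borel)"
        by (rule borel_measurable_Pair[OF projm labm])
      from measurable_compose[OF Wi measurable_compose[OF this borel_measurable_continuous_onI[OF LFc]]]
      show ?thesis by simp
    qed
    then show "(\<lambda>\<omega>. (1 / real n) * (\<Sum>i<n. LF (proj (p n) \<Theta> (Z i \<omega>)) (lab n (Z i \<omega>, \<epsilon> n i \<omega>))) + r n \<Theta>) \<in> borel_measurable (M n)"
      by (intro borel_measurable_add borel_measurable_times borel_measurable_const borel_measurable_sum)
  qed
  have Req: "(\<integral>\<omega>. \<psi> (opt_risk n (p n) L F \<eta> (r n) (C n) (\<Theta>s n) Z (\<epsilon> n) \<omega>) \<partial>M n) = (\<integral>\<omega>. \<psi> (V lo n (\<lambda>i\<in>{..<n}. (Z i \<omega>, \<epsilon> n i \<omega>))) \<partial>M n)"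
    if W: "(\<lambda>\<omega>. \<lambda>i\<in>{..<n}. (Z i \<omega>, \<epsilon> n i \<omega>)) \<in> M n \<rightarrow>\<^sub>M PiM {..<n} (\<lambda>_. Rvec_borel (p n) \<Otimes>\<^sub>M borel)"
      and lb: "\<And>i. i < n \<Longrightarrow> binary_label (M n) (p n) (h n) (Z i) (\<lambda>\<omega>. proj (p n) (\<Theta>s n) (Z i \<omega>)) (\<lambda>\<omega>. lab n (Z i \<omega>, \<epsilon> n i \<omega>))"
      and \<psi>: "bounded_lipschitz \<psi>" for n Z \<psi>
  proof (rule integral_cong_AE)
    note \<psi>m = bounded_lipschitz_measurable[OF \<psi>]
    show "(\<lambda>\<omega>. \<psi> (opt_risk n (p n) L F \<eta> (r n) (C n) (\<Theta>s n) Z (\<epsilon> n) \<omega>)) \<in> borel_measurable (M n)"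
      by (rule measurable_compose[OF Rm[OF W] \<psi>m])
    show "(\<lambda>\<omega>. \<psi> (V lo n (\<lambda>i\<in>{..<n}. (Z i \<omega>, \<epsilon> n i \<omega>)))) \<in> borel_measurable (M n)"
      by (rule measurable_compose[OF measurable_compose[OF W V] \<psi>m])
    \<comment> \<open>For fixed \<open>n\<close> the exceptional sets are finitely many, one per
      sample, so one null set covers them all.\<close>
    have "AE \<omega> in M n. \<forall>i\<in>{..<n}. lab n (Z i \<omega>, \<epsilon> n i \<omega>) = 1 \<or> lab n (Z i \<omega>, \<epsilon> n i \<omega>) = - 1"
      by (rule AE_finite_allI) (auto dest: lb[unfolded binary_label_def])
    then show "AE \<omega> in M n. \<psi> (opt_risk n (p n) L F \<eta> (r n) (C n) (\<Theta>s n) Z (\<epsilon> n) \<omega>) = \<psi> (V lo n (\<lambda>i\<in>{..<n}. (Z i \<omega>, \<epsilon> n i \<omega>)))"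
    proof eventually_elim
      case (elim \<omega>)
      have "LF u (lab n (Z i \<omega>, \<epsilon> n i \<omega>)) = lo n u (Z i \<omega>, \<epsilon> n i \<omega>)" if "i \<in> {..<n}" for i u
        using elim[rule_format, OF that] by (auto simp: lo_def)
      then have "(\<Sum>i<n. LF (proj (p n) \<Theta> (Z i \<omega>)) (lab n (Z i \<omega>, \<epsilon> n i \<omega>))) = (\<Sum>i<n. lo n (proj (p n) \<Theta> (Z i \<omega>)) (Z i \<omega>, \<epsilon> n i \<omega>))" for \<Theta>
        by (intro sum.cong refl)
      then show ?case unfolding opt_eq V_pairs by (simp only:)
    qed
  qed
  note WX = iid_pairs_law(1)[OF prob _ X \<epsilon> indep_X] and WG = iid_pairs_law(1)[OF prob _ G \<epsilon> indep_G]
  show "opt_risk n (p n) L F \<eta> (r n) (C n) (\<Theta>s n) (X n) (\<epsilon> n) \<in> borel_measurable (M n)" if "1 \<le> n"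
    by (rule Rm[OF WX[OF that]])
  show "opt_risk n (p n) L F \<eta> (r n) (C n) (\<Theta>s n) (G n) (\<epsilon> n) \<in> borel_measurable (M n)" if "1 \<le> n"
    by (rule Rm[OF WG[OF that]])
  assume \<psi>: "bounded_lipschitz \<psi>"
  have ev: "eventually (\<lambda>n. \<bar>(\<integral>\<omega>. \<psi> (V lo n (\<lambda>i\<in>{..<n}. (X n i \<omega>, \<epsilon> n i \<omega>))) \<partial>M n) -
            (\<integral>\<omega>. \<psi> (V lo n (\<lambda>i\<in>{..<n}. (G n i \<omega>, \<epsilon> n i \<omega>))) \<partial>M n)\<bar> =
       \<bar>(\<integral>\<omega>. \<psi> (opt_risk n (p n) L F \<eta> (r n) (C n) (\<Theta>s n) (X n) (\<epsilon> n) \<omega>) \<partial>M n) -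
            (\<integral>\<omega>. \<psi> (opt_risk n (p n) L F \<eta> (r n) (C n) (\<Theta>s n) (G n) (\<epsilon> n) \<omega>) \<partial>M n)\<bar>) sequentially"
  proof (rule eventually_sequentiallyI[of 1])
    fix n :: nat assume n: "1 \<le> n"
    show "\<bar>(\<integral>\<omega>. \<psi> (V lo n (\<lambda>i\<in>{..<n}. (X n i \<omega>, \<epsilon> n i \<omega>))) \<partial>M n) -
            (\<integral>\<omega>. \<psi> (V lo n (\<lambda>i\<in>{..<n}. (G n i \<omega>, \<epsilon> n i \<omega>))) \<partial>M n)\<bar> =
       \<bar>(\<integral>\<omega>. \<psi> (opt_risk n (p n) L F \<eta> (r n) (C n) (\<Theta>s n) (X n) (\<epsilon> n) \<omega>) \<partial>M n) -
            (\<integral>\<omega>. \<psi> (opt_risk n (p n) L F \<eta> (r n) (C n) (\<Theta>s n) (G n) (\<epsilon> n) \<omega>) \<partial>M n)\<bar>"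
      by (simp only: Req[OF WX[OF n] labX \<psi>] Req[OF WG[OF n] labG \<psi>])
  qed
  show "(\<lambda>n. \<bar>(\<integral>\<omega>. \<psi> (opt_risk n (p n) L F \<eta> (r n) (C n) (\<Theta>s n) (X n) (\<epsilon> n) \<omega>) \<partial>M n) -
            (\<integral>\<omega>. \<psi> (opt_risk n (p n) L F \<eta> (r n) (C n) (\<Theta>s n) (G n) (\<epsilon> n) \<omega>) \<partial>M n)\<bar>) \<longlonglongrightarrow> 0"
    using U[OF \<psi>] tendsto_cong[OF ev] by blast
qed

end

theorem theorem2:
  fixes M :: "nat \<Rightarrow> 'a measure"
    and p :: "nat \<Rightarrow> nat"
    and x g :: "nat \<Rightarrow> 'a \<Rightarrow> nat \<Rightarrow> real"
    and X G :: "nat \<Rightarrow> nat \<Rightarrow> 'a \<Rightarrow> nat \<Rightarrow> real"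
    and \<epsilon> :: "nat \<Rightarrow> nat \<Rightarrow> 'a \<Rightarrow> real"
    and \<mu> :: "nat \<Rightarrow> nat \<Rightarrow> real"
    and \<Sigma> \<Sigma>half :: "nat \<Rightarrow> nat \<Rightarrow> nat \<Rightarrow> real"
    and C S :: "nat \<Rightarrow> (nat \<Rightarrow> real) set"
    and \<Theta>s :: "nat \<Rightarrow> (nat \<Rightarrow> real) ^ 's"
    and r :: "nat \<Rightarrow> (nat \<Rightarrow> real) ^ 'k \<Rightarrow> real"
    and L :: "real \<Rightarrow> real \<Rightarrow> real"
    and F :: "real ^ 'k \<Rightarrow> real"
    and \<eta> :: "(real ^ 's) \<times> real \<Rightarrow> real"
  defines "RX \<equiv> \<lambda>n. opt_risk n (p n) L F \<eta> (r n) (C n) (\<Theta>s n) (X n) (\<epsilon> n)"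
    and "RG \<equiv> \<lambda>n. opt_risk n (p n) L F \<eta> (r n) (C n) (\<Theta>s n) (G n) (\<epsilon> n)"
  assumes prob: "\<And>n. prob_space (M n)"
    and X: "\<And>n. iid_copies (M n) (Rvec_borel (p n)) n (x n) (X n)"
    and G: "\<And>n. iid_copies (M n) (Rvec_borel (p n)) n (g n) (G n)"
    and \<epsilon>: "\<And>n. iid (M n) borel n (\<epsilon> n)"
    and indep_X: "\<And>n. indep_families (M n) n (Rvec_borel (p n)) (X n) borel (\<epsilon> n)"
    and indep_G: "\<And>n. indep_families (M n) n (Rvec_borel (p n)) (G n) borel (\<epsilon> n)"
    and \<Sigma>half: "\<And>n. is_psd_sqrt (p n) (\<Sigma>half n) (\<Sigma> n)"
    and gaussian: "\<And>n. \<mu> n \<in> Rvec (p n) \<and> gaussian_vector (M n) (p n) (\<mu> n) (\<Sigma> n) (g n)"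
    and L_nonneg: "\<And>a b. 0 \<le> L a b"
    and \<eta>_measurable: "\<eta> \<in> borel_measurable borel"
    and regime: "proportional_regime p"
    and constraints: "constraint_sets p C \<Theta>s"
    and pen: "penalty p r"
    and domain: "domain_of_gaussianity M p x g S"
    and subgaussian: "restricted_subgaussian M p x \<mu> \<Sigma>half C \<Theta>s"
    and alternatives: "alternative_I M \<epsilon> (loss_ell L F \<eta>) \<or>
                       alternative_II M p \<eta> \<Theta>s X G \<epsilon> (loss_F L F)"
    and C_sub: "\<And>n. C n \<subseteq> S n"
    and \<Theta>s_in: "\<And>n l. \<Theta>s n $ l \<in> S n"
  shows "(\<forall>\<psi>. bounded_lipschitz \<psi> \<longrightarrow>
            (\<lambda>n. \<bar>(\<integral>\<omega>. \<psi> (RX n \<omega>) \<partial>M n) - (\<integral>\<omega>. \<psi> (RG n \<omega>) \<partial>M n)\<bar>) \<longlonglongrightarrow> 0) \<and>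
         (\<forall>\<rho> \<delta>. 0 < \<delta> \<longrightarrow>
            limsup (\<lambda>n. ereal (measure (M n) {\<omega> \<in> space (M n). RX n \<omega> \<ge> \<rho> + \<delta>}))
              \<le> limsup (\<lambda>n. ereal (measure (M n) {\<omega> \<in> space (M n). RG n \<omega> \<ge> \<rho>})) \<and>
            limsup (\<lambda>n. ereal (measure (M n) {\<omega> \<in> space (M n). RX n \<omega> \<le> \<rho> - \<delta>}))
              \<le> limsup (\<lambda>n. ereal (measure (M n) {\<omega> \<in> space (M n). RG n \<omega> \<le> \<rho>})) \<and>
            liminf (\<lambda>n. ereal (measure (M n) {\<omega> \<in> space (M n). RX n \<omega> \<ge> \<rho> + \<delta>}))
              \<le> liminf (\<lambda>n. ereal (measure (M n) {\<omega> \<in> space (M n). RG n \<omega> \<ge> \<rho>})) \<and>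
            liminf (\<lambda>n. ereal (measure (M n) {\<omega> \<in> space (M n). RX n \<omega> \<le> \<rho> - \<delta>}))
              \<le> liminf (\<lambda>n. ereal (measure (M n) {\<omega> \<in> space (M n). RG n \<omega> \<le> \<rho>}))) \<and>
         (\<forall>\<rho>. converges_in_prob M RX \<rho> \<longleftrightarrow> converges_in_prob M RG \<rho>)"
proof -
  have xm: "x n \<in> M n \<rightarrow>\<^sub>M Rvec_borel (p n)" for n using X[of n] unfolding iid_copies_def by (rule conjunct1)
  have gv: "gaussian_vector (M n) (p n) (\<mu> n) (\<Sigma> n) (g n)" for n using gaussian by (rule conjunct2)
  obtain \<kappa>0 where \<kappa>0: "0 < \<kappa>0" "\<forall>\<kappa>\<ge>\<kappa>0. \<forall>n. \<forall>\<theta>\<in>C n \<union> range (($) (\<Theta>s n)). vnorm (p n) \<theta> \<le> \<kappa> \<and>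
    (\<integral>\<^sup>+\<omega>. ennreal (exp (\<bar>dotp (p n) \<theta> (x n \<omega>)\<bar> / \<kappa>)) \<partial>M n) \<le> 10 \<and>
    (\<integral>\<^sup>+\<omega>. ennreal (exp (\<bar>dotp (p n) \<theta> (g n \<omega>)\<bar> / \<kappa>)) \<partial>M n) \<le> 10"
    by (rule constraint_subexp[OF xm gv \<Sigma>half constraints subgaussian])
  have erm: "erm_models M p x g X G \<epsilon> C S \<Theta>s r \<kappa>0"
    by (rule erm_models.intro[OF prob X G \<epsilon> indep_X indep_G regime constraints pen domain C_sub \<Theta>s_in \<kappa>0])
  have m: "RX n \<in> borel_measurable (M n)" "RG n \<in> borel_measurable (M n)" if "1 \<le> n" for n
    using alternatives that erm_models.universality_alternative_I(1,2)[OF erm]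
      erm_models.universality_alternative_II(1,2)[OF erm \<eta>_measurable]
    unfolding RX_def RG_def by blast+
  have uni: "(\<lambda>n. \<bar>(\<integral>\<omega>. \<psi> (RX n \<omega>) \<partial>M n) - (\<integral>\<omega>. \<psi> (RG n \<omega>) \<partial>M n)\<bar>) \<longlonglongrightarrow> 0" if "bounded_lipschitz \<psi>" for \<psi>
    using alternatives unfolding RX_def RG_def
  proof
    assume "alternative_I M \<epsilon> (loss_ell L F \<eta>)"
    from erm_models.universality_alternative_I(3)[OF erm this that]
    show "(\<lambda>n. \<bar>(\<integral>\<omega>. \<psi> (opt_risk n (p n) L F \<eta> (r n) (C n) (\<Theta>s n) (X n) (\<epsilon> n) \<omega>) \<partial>M n) -
            (\<integral>\<omega>. \<psi> (opt_risk n (p n) L F \<eta> (r n) (C n) (\<Theta>s n) (G n) (\<epsilon> n) \<omega>) \<partial>M n)\<bar>) \<longlonglongrightarrow> 0" .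
  next
    assume "alternative_II M p \<eta> \<Theta>s X G \<epsilon> (loss_F L F)"
    from erm_models.universality_alternative_II(3)[OF erm \<eta>_measurable this that]
    show "(\<lambda>n. \<bar>(\<integral>\<omega>. \<psi> (opt_risk n (p n) L F \<eta> (r n) (C n) (\<Theta>s n) (X n) (\<epsilon> n) \<omega>) \<partial>M n) -
            (\<integral>\<omega>. \<psi> (opt_risk n (p n) L F \<eta> (r n) (C n) (\<Theta>s n) (G n) (\<epsilon> n) \<omega>) \<partial>M n)\<bar>) \<longlonglongrightarrow> 0" .
  qed
  show ?thesis
    by (rule conjI[OF _ universality_consequences[OF prob m uni]]) (use uni in blast)
qed

end
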